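(* The polyhedral cone $PKron_{a,b,ab}$ always contains stable facets, i.e. there always exist faces of codimension one of $PKron_{a,b,ab}$ that are stable faces.
   Context: For a partition $\lambda$ of $n$ let $[\lambda]$ be the corresponding irreducible complex representation (Specht module) of $S_n$. For partitions of the same integer, the Kronecker coefficients $g(\lambda,\mu,\nu)$ are defined by $[\lambda]\otimes[\mu]=\bigoplus_\nu g(\lambda,\mu,\nu)[\nu]$; they are symmetric in the three arguments, and $g(\lambda,\mu,\nu)=0$ unless $|\lambda|=|\mu|=|\nu|$. The length $\ell(\lambda)$ is the number of non zero parts. The triple $(\lambda,\mu,\nu)$ is weakly stable if $g(k\lambda,k\mu,k\nu)=1$ for all integers $k\ge1$. $Kron_{a,b,ab}$ is the semigroup of triples of partitions $(\lambda,\mu,\nu)$ with $\ell(\lambda)\le ab$, $\ell(\mu)\le a$, $\ell(\nu)\le b$ and $g(\lambda,\mu,\nu)\neq0$. $PKron_{a,b,ab}\subset\mathbb R^{ab}\times\mathbb R^{a}\times\mathbb R^{b}$ is the rational polyhedral cone it generates, and $SKron_{a,b,ab}$ is the set of weakly stable triples in $Kron_{a,b,ab}$. The weight lattice is the codimension two sublattice of $\mathbb Z^{ab}\times\mathbb Z^a\times\mathbb Z^b$ defined by $|\lambda|=|\mu|=|\nu|$, where $|\cdot|$ denotes the sum of the entries. A face $F$ of $PKron_{a,b,ab}$ is stable if its intersection with the weight lattice is contained in $SKron_{a,b,ab}$. A facet is a face of codimension one in $PKron_{a,b,ab}$. *)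

theory Defs
  imports
    "HOL-Analysis.Analysis"
    "HOL-Combinatorics.Permutations"
    "HOL-Library.Function_Algebras"
begin

section \<open>Partitions\<close>

definition is_partition :: "nat list \<Rightarrow> bool"
  where "is_partition p \<longleftrightarrow> sorted_wrt (\<ge>) p \<and> 0 \<notin> set p"

definition partitions_of :: "nat \<Rightarrow> nat list set"
  where "partitions_of n = {p. is_partition p \<and> sum_list p = n}"

definition scale_partition :: "nat \<Rightarrow> nat list \<Rightarrow> nat list"
  where "scale_partition k p = map (\<lambda>m. k * m) p"


section \<open>Representations on spaces of complex-valued functions\<close>

text \<open>
  All representations of the symmetric group on \<open>{..<n}\<close> below are complex subspaces of a
  space of functions \<open>'x \<Rightarrow> complex\<close>, on which a permutation \<open>s\<close> acts by
  \<open>f \<mapsto> f \<circ> act s\<close> for a right action \<open>act\<close> of permutations on \<open>'x\<close>.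
\<close>

definition cscale :: "complex \<Rightarrow> ('x \<Rightarrow> complex) \<Rightarrow> ('x \<Rightarrow> complex)"
  where "cscale c f = (\<lambda>x. c * f x)"

global_interpretation cfun: vector_space "cscale :: complex \<Rightarrow> ('x \<Rightarrow> complex) \<Rightarrow> ('x \<Rightarrow> complex)"
  by unfold_locales (simp_all add: cscale_def fun_eq_iff algebra_simps)

definition rep_isomorphic ::
    "nat \<Rightarrow> ((nat \<Rightarrow> nat) \<Rightarrow> 'x \<Rightarrow> 'x) \<Rightarrow> ('x \<Rightarrow> complex) set
         \<Rightarrow> ((nat \<Rightarrow> nat) \<Rightarrow> 'y \<Rightarrow> 'y) \<Rightarrow> ('y \<Rightarrow> complex) set \<Rightarrow> bool"
  where "rep_isomorphic n act V act' W \<longleftrightarrow>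
    (\<exists>\<Phi>. bij_betw \<Phi> V W
       \<and> (\<forall>f\<in>V. \<forall>g\<in>V. \<Phi> (f + g) = \<Phi> f + \<Phi> g)
       \<and> (\<forall>c. \<forall>f\<in>V. \<Phi> (cscale c f) = cscale c (\<Phi> f))
       \<and> (\<forall>s. s permutes {..<n} \<longrightarrow> (\<forall>f\<in>V. \<Phi> (f \<circ> act s) = \<Phi> f \<circ> act' s)))"


section \<open>Specht modules\<close>

definition diagram :: "nat list \<Rightarrow> (nat \<times> nat) set"
  where "diagram p = {(i, j). i < length p \<and> j < p ! i}"

text \<open>
  A tableau of shape \<open>p\<close> sends each entry in \<open>{..<n}\<close>, \<open>n = sum_list p\<close>, to its cell
  (row, column); its tabloid remembers only the row of each entry.
\<close>

definition is_tableau :: "nat list \<Rightarrow> (nat \<Rightarrow> nat \<times> nat) \<Rightarrow> bool"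
  where "is_tableau p t \<longleftrightarrow> bij_betw t {..<sum_list p} (diagram p)"

definition tabloid :: "nat list \<Rightarrow> (nat \<Rightarrow> nat \<times> nat) \<Rightarrow> nat \<Rightarrow> nat"
  where "tabloid p t = restrict (fst \<circ> t) {..<sum_list p}"

definition column_stabilizer :: "nat list \<Rightarrow> (nat \<Rightarrow> nat \<times> nat) \<Rightarrow> (nat \<Rightarrow> nat) set"
  where "column_stabilizer p t =
    {s. s permutes {..<sum_list p} \<and> (\<forall>x<sum_list p. snd (t (s x)) = snd (t x))}"

text \<open>
  Permuting the entries of a tabloid \<open>T\<close> by \<open>s\<close> gives \<open>T \<circ> inv s\<close>, so the polytabloid is the
  alternating sum of the basis vectors \<open>T \<circ> inv s\<close> over the column stabilizer, and the
  induced action on functions of tabloids is \<open>f \<mapsto> (\<lambda>T. f (T \<circ> s))\<close>.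
\<close>

definition polytabloid :: "nat list \<Rightarrow> (nat \<Rightarrow> nat \<times> nat) \<Rightarrow> (nat \<Rightarrow> nat) \<Rightarrow> complex"
  where "polytabloid p t =
    (\<lambda>T. \<Sum>s\<in>column_stabilizer p t. of_int (sign s) * of_bool (T = tabloid p t \<circ> inv s))"

definition specht :: "nat list \<Rightarrow> ((nat \<Rightarrow> nat) \<Rightarrow> complex) set"
  where "specht p = cfun.span {polytabloid p t | t. is_tableau p t}"


section \<open>Kronecker coefficients\<close>

text \<open>
  The tensor product of two spaces of functions, realized as functions of two variables,
  with the diagonal action.
\<close>

definition tensor :: "('x \<Rightarrow> complex) set \<Rightarrow> ('y \<Rightarrow> complex) set \<Rightarrow> ('x \<times> 'y \<Rightarrow> complex) set"
  where "tensor V W = cfun.span {\<lambda>(x, y). f x * h y | f h. f \<in> V \<and> h \<in> W}"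

definition tensor_act :: "(nat \<Rightarrow> nat) \<Rightarrow> (nat \<Rightarrow> nat) \<times> (nat \<Rightarrow> nat) \<Rightarrow> (nat \<Rightarrow> nat) \<times> (nat \<Rightarrow> nat)"
  where "tensor_act s = (\<lambda>(T, U). (T \<circ> s, U \<circ> s))"

text \<open>
  The direct sum, over the partitions \<open>q\<close> of \<open>n\<close>, of \<open>m q\<close> copies of the Specht module of
  \<open>q\<close>: the function \<open>\<lambda>T. f (q, i, T)\<close> is the component of \<open>f\<close> in the \<open>i\<close>-th copy.
\<close>

definition specht_sum :: "nat \<Rightarrow> (nat list \<Rightarrow> nat) \<Rightarrow> (nat list \<times> nat \<times> (nat \<Rightarrow> nat) \<Rightarrow> complex) set"
  where "specht_sum n m =
    {f. \<forall>q i. if q \<in> partitions_of n \<and> i < m q then (\<lambda>T. f (q, i, T)) \<in> specht q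
              else (\<lambda>T. f (q, i, T)) = 0}"

definition sum_act :: "(nat \<Rightarrow> nat) \<Rightarrow> nat list \<times> nat \<times> (nat \<Rightarrow> nat) \<Rightarrow> nat list \<times> nat \<times> (nat \<Rightarrow> nat)"
  where "sum_act s = (\<lambda>(q, i, T). (q, i, T \<circ> s))"

definition tensor_multiplicities :: "nat \<Rightarrow> nat list \<Rightarrow> nat list \<Rightarrow> (nat list \<Rightarrow> nat) \<Rightarrow> bool"
  where "tensor_multiplicities n p q m \<longleftrightarrow>
    (\<forall>r. r \<notin> partitions_of n \<longrightarrow> m r = 0) \<and>
    rep_isomorphic n tensor_act (tensor (specht p) (specht q)) sum_act (specht_sum n m)"

definition kronecker :: "nat list \<Rightarrow> nat list \<Rightarrow> nat list \<Rightarrow> nat"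
  where "kronecker p q r =
    (if sum_list p = sum_list q \<and> sum_list q = sum_list r
     then (THE m. tensor_multiplicities (sum_list p) p q m) r else 0)"


section \<open>The Kronecker semigroup and its cone\<close>

type_synonym triple = "nat list \<times> nat list \<times> nat list"

definition weakly_stable :: "triple \<Rightarrow> bool"
  where "weakly_stable = (\<lambda>(p, q, r).
    \<forall>k\<ge>1. kronecker (scale_partition k p) (scale_partition k q) (scale_partition k r) = 1)"

definition Kron :: "nat \<Rightarrow> nat \<Rightarrow> triple set"
  where "Kron a b = {(p, q, r).
    is_partition p \<and> is_partition q \<and> is_partition r \<and>
    length p \<le> a * b \<and> length q \<le> a \<and> length r \<le> b \<and> kronecker p q r \<noteq> 0}"

definition SKron :: "nat \<Rightarrow> nat \<Rightarrow> triple set"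
  where "SKron a b = {t \<in> Kron a b. weakly_stable t}"

text \<open>
  A partition with at most \<open>CARD('n)\<close> parts is padded with zeros to a vector; the linear order
  of the finite index type \<open>'n\<close> determines the position of each coordinate.
\<close>

definition partition_vec :: "nat list \<Rightarrow> real ^ 'n::{finite,linorder}"
  where "partition_vec p =
    (\<chi> i. let k = card {j. j < i} in if k < length p then real (p ! k) else 0)"

definition triple_vec ::
    "triple \<Rightarrow> (real ^ 'c::{finite,linorder}) \<times> (real ^ 'a::{finite,linorder}) \<times> (real ^ 'b::{finite,linorder})"
  where "triple_vec = (\<lambda>(p, q, r). (partition_vec p, partition_vec q, partition_vec r))"

text \<open>
  In the following definitions the dimensions are \<open>a = CARD('a)\<close>, \<open>b = CARD('b)\<close>, and \<open>'c\<close> is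
  meant to satisfy \<open>CARD('c) = a * b\<close>.
\<close>

definition PKron ::
    "((real ^ 'c::{finite,linorder}) \<times> (real ^ 'a::{finite,linorder}) \<times> (real ^ 'b::{finite,linorder})) set"
  where "PKron = convex_cone hull (triple_vec ` Kron CARD('a) CARD('b))"

definition weight_lattice ::
    "((real ^ 'c::finite) \<times> (real ^ 'a::finite) \<times> (real ^ 'b::finite)) set"
  where "weight_lattice = {(x, y, z).
    (\<forall>i. x $ i \<in> \<int>) \<and> (\<forall>i. y $ i \<in> \<int>) \<and> (\<forall>i. z $ i \<in> \<int>) \<and>
    (\<Sum>i\<in>UNIV. x $ i) = (\<Sum>i\<in>UNIV. y $ i) \<and> (\<Sum>i\<in>UNIV. y $ i) = (\<Sum>i\<in>UNIV. z $ i)}"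

definition stable_face ::
    "((real ^ 'c::{finite,linorder}) \<times> (real ^ 'a::{finite,linorder}) \<times> (real ^ 'b::{finite,linorder})) set \<Rightarrow> bool"
  where "stable_face F \<longleftrightarrow>
    F face_of PKron \<and> F \<inter> weight_lattice \<subseteq> triple_vec ` SKron CARD('a) CARD('b)"

end

theory Submission
  imports Defs
begin

text \<open>
  Fix integers \<open>x 0 > x 1 > \<dots>\<close> and \<open>y 0 > y 1 > \<dots>\<close>, give the cell \<open>(i, j)\<close> of an \<open>a \<times> b\<close> box the
  weight \<open>x i + y j\<close>, and list the cells as \<open>\<kappa> 0, \<kappa> 1, \<dots>\<close> by decreasing weight. If the Kronecker
  coefficient of \<open>(p, q, r)\<close> is not zero, then the boxes of some tableau of shape \<open>p\<close> can be
  filled with cells so that no cell repeats within a column, the first coordinates have content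
  \<open>q\<close> and the second coordinates have content \<open>r\<close> (\<open>kronecker_filling\<close>). A column of length \<open>l\<close>
  weighs at most as much as the \<open>l\<close> heaviest cells, so
  \<open>(\<Sum>i. q i * x i) + (\<Sum>j. r j * y j) \<le> (\<Sum>k. p k * weight (\<kappa> k))\<close> holds on the whole cone, and
  the points with equality form a face \<open>F\<close>.

  On \<open>F\<close> every column of a filling is an initial segment of \<open>\<kappa>\<close>, up to exchanging cells of equal
  weight. Without coincidences of weights \<open>p\<close> would determine \<open>q\<close> and \<open>r\<close>, and \<open>F\<close> would be far
  too small. The weights are therefore chosen with exactly \<open>a + b - 3\<close> pairs of cells of equal
  weight and no three such cells: \<open>x i = - i\<close>, and \<open>- y j\<close> runs through \<open>0, 1, a, 2 a - 1, \<dots>\<close>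
  (\<open>stair\<close>). Each pair contributes one free parameter, namely how the two rows of \<open>p\<close> that
  belong to it are divided between its cells (\<open>splits\<close>). Together with \<open>p\<close> these parameters
  determine \<open>q\<close> and \<open>r\<close>; conversely the parameters are recovered from the margins, uniquely
  (\<open>staircase_unique\<close>) and over the integers (\<open>staircase_solve\<close>). Hence \<open>F\<close> is as large as the
  hyperplane allows and is a facet (\<open>tied_facet\<close>), and every lattice point of \<open>F\<close> is a triple of
  partitions that comes from an integral splitting.

  Such a triple has Kronecker coefficient one (\<open>kronecker_eq_1\<close>). It is at most one because all
  admissible fillings are conjugate by a symmetry that fixes the polytabloid up to a scalar, so
  that an invariant vector is determined by a single number. It is not zero because the extremal
  filling gives a vector invariant under the Young subgroup of \<open>q\<close> in the tensor product of the
  Specht module of \<open>p\<close> with the permutation module of \<open>r\<close>; a constituent that contains an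
  invariant vector dominates \<open>q\<close>, and the weight inequality, being an equality at \<open>(p, q, r)\<close>,
  leaves room for \<open>q\<close> only; the same argument then replaces the permutation module of \<open>r\<close> by the
  Specht module of \<open>r\<close>. Multiples of the triple satisfy the same conditions, so it is weakly
  stable.

  If \<open>a = 1\<close> or \<open>b = 1\<close>, one factor is the trivial representation, a coefficient is nonzero only
  if the two other partitions agree, and the facet on which the last part of \<open>p\<close> vanishes is
  stable (\<open>tie_free_facet\<close>).

  The representation theory of the symmetric group enters through two facts. Every nonzero
  representation is detected by the Young symmetrizer of some tableau (\<open>specht_detects\<close>); this
  is proved by comparing two expressions for the eigenvalue of the sum of all transpositions.
  And the multiplicity of a Specht module is the dimension of the image of its Young symmetrizer
  (\<open>kronecker_dim\<close>).
\<close>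

section \<open>Stabilizers of colourings\<close>

lemma sum_fun_apply: "(\<Sum>i\<in>A. F i) x = (\<Sum>i\<in>A. F i x)"
  by (induction A rule: infinite_finite_induct) (simp_all add: zero_fun_def plus_fun_def)

abbreviation swp :: "nat \<Rightarrow> nat \<Rightarrow> nat \<Rightarrow> nat" where "swp \<equiv> Transposition.transpose"

text \<open>
  A colouring \<open>r\<close> of the entries stands for a set partition, so that Young subgroups need no
  separate notion: rows and columns of a tableau \<open>t\<close> are the colourings \<open>fst \<circ> t\<close> and \<open>snd \<circ> t\<close>,
  and a tabloid is itself a colouring.
\<close>

definition stab :: "nat \<Rightarrow> (nat \<Rightarrow> 'c) \<Rightarrow> (nat \<Rightarrow> nat) set"
  where "stab n r = {s. s permutes {..<n} \<and> (\<forall>x<n. r (s x) = r x)}"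

lemma stab_permutes: "s \<in> stab n r \<Longrightarrow> s permutes {..<n}"
  by (simp add: stab_def)

lemma stab_less: "s \<in> stab n r \<Longrightarrow> x < n \<Longrightarrow> s x < n"
  using permutes_in_image[of s "{..<n}" x] by (simp add: stab_def)

lemma stab_id: "id \<in> stab n r"
  by (simp add: stab_def permutes_id)

lemma stab_comp: "s \<in> stab n r \<Longrightarrow> t \<in> stab n r \<Longrightarrow> s \<circ> t \<in> stab n r"
  using stab_less[of t n r] by (auto simp: stab_def intro: permutes_compose)

lemma permutes_inv_less: "s permutes {..<n} \<Longrightarrow> x < (n::nat) \<Longrightarrow> inv s x < n"
  using permutes_in_image[OF permutes_inv, of s "{..<n}" x] by simp

lemma permutes_less: "s permutes {..<n} \<Longrightarrow> x < (n::nat) \<Longrightarrow> s x < n"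
  using permutes_in_image[of s "{..<n}" x] by simp

lemma stab_inv: "s \<in> stab n r \<Longrightarrow> inv s \<in> stab n r"
proof -
  assume s: "s \<in> stab n r"
  hence p: "s permutes {..<n}" by (simp add: stab_def)
  have "r (inv s x) = r x" if "x < n" for x
  proof -
    have "r (s (inv s x)) = r (inv s x)"
      using s permutes_inv_less[OF p that] by (simp add: stab_def)
    thus ?thesis using permutes_inverses(1)[OF p] by simp
  qed
  thus ?thesis using p by (simp add: stab_def permutes_inv)
qed

lemma finite_stab: "finite (stab n r)"
  by (rule finite_subset[OF _ finite_permutations[of "{..<n}"]]) (auto simp: stab_def)

lemma stab_cong: "(\<And>x y. x < n \<Longrightarrow> y < n \<Longrightarrow> r x = r y \<longleftrightarrow> r' x = r' y) \<Longrightarrow> stab n r = stab n r'"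
  using permutes_less by (fastforce simp: stab_def)

lemma transpose_stab: "x < n \<Longrightarrow> y < n \<Longrightarrow> r x = r y \<Longrightarrow> swp x y \<in> stab n r"
  by (auto simp: stab_def permutes_swap_id Transposition.transpose_def)

lemma stab_bij_left:
  assumes "s \<in> stab n r" shows "bij_betw (\<lambda>u. s \<circ> u) (stab n r) (stab n r)"
proof -
  have p: "s permutes {..<n}" using assms by (rule stab_permutes)
  show ?thesis
    by (rule bij_betw_byWitness[where f' = "\<lambda>u. inv s \<circ> u"])
       (use assms in \<open>auto simp: o_assoc permutes_inv_o[OF p] intro: stab_comp stab_inv\<close>)
qed

lemma stab_bij_right:
  assumes "s \<in> stab n r" shows "bij_betw (\<lambda>u. u \<circ> s) (stab n r) (stab n r)"
proof -
  have p: "s permutes {..<n}" using assms by (rule stab_permutes)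
  show ?thesis
    by (rule bij_betw_byWitness[where f' = "\<lambda>u. u \<circ> inv s"])
       (use assms in \<open>auto simp: comp_assoc permutes_inv_o[OF p] intro: stab_comp stab_inv\<close>)
qed

lemma stab_conj:
  assumes g: "g permutes {..<n}"
  shows "bij_betw (\<lambda>s. inv g \<circ> s \<circ> g) (stab n c) (stab n (c \<circ> g))"
proof (rule bij_betw_byWitness[where f' = "\<lambda>s. g \<circ> s \<circ> inv g"])
  note gi = permutes_inv_o[OF g]
  have gg: "g (inv g x) = x" "inv g (g x) = x" for x
    using permutes_inverses[OF g] by auto
  show "\<forall>s\<in>stab n c. g \<circ> (inv g \<circ> s \<circ> g) \<circ> inv g = s"
    by (auto simp: fun_eq_iff gg)
  show "\<forall>s\<in>stab n (c \<circ> g). inv g \<circ> (g \<circ> s \<circ> inv g) \<circ> g = s"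
    by (auto simp: fun_eq_iff gg)
  show "(\<lambda>s. inv g \<circ> s \<circ> g) ` stab n c \<subseteq> stab n (c \<circ> g)"
    using permutes_less[OF g]
    by (auto simp: stab_def gg intro!: permutes_compose permutes_inv g)
  show "(\<lambda>s. g \<circ> s \<circ> inv g) ` stab n (c \<circ> g) \<subseteq> stab n c"
    using permutes_inv_less[OF g]
    by (auto simp: stab_def gg intro!: permutes_compose permutes_inv g)
qed

section \<open>Right actions and symmetrization\<close>

locale right_action =
  fixes act :: "(nat \<Rightarrow> nat) \<Rightarrow> 'x \<Rightarrow> 'x"
  assumes act_id: "act id = id"
    and act_comp: "act (s \<circ> t) = act t \<circ> act s"
begin

lemma act_act: "act t (act s v) = act (s \<circ> t) v"
  by (simp add: act_comp)

lemma act_inv: "s permutes {..<n} \<Longrightarrow> act s (act (inv s) v) = v" "s permutes {..<n} \<Longrightarrow> act (inv s) (act s v) = v"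
  by (simp_all add: act_act permutes_inv_o act_id)

end

definition submod :: "nat \<Rightarrow> ((nat \<Rightarrow> nat) \<Rightarrow> 'x \<Rightarrow> 'x) \<Rightarrow> ('x \<Rightarrow> complex) set \<Rightarrow> bool"
  where "submod n act W \<longleftrightarrow> cfun.subspace W \<and> (\<forall>s. s permutes {..<n} \<longrightarrow> (\<forall>f\<in>W. f \<circ> act s \<in> W))"

lemma submodD:
  assumes "submod n act W"
  shows "cfun.subspace W" "0 \<in> W" "f \<in> W \<Longrightarrow> g \<in> W \<Longrightarrow> f + g \<in> W" "f \<in> W \<Longrightarrow> cscale c f \<in> W"
    "f \<in> W \<Longrightarrow> g \<in> W \<Longrightarrow> f - g \<in> W"
    "s permutes {..<n} \<Longrightarrow> f \<in> W \<Longrightarrow> f \<circ> act s \<in> W"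
    "(\<And>i. i \<in> I \<Longrightarrow> F i \<in> W) \<Longrightarrow> (\<Sum>i\<in>I. F i) \<in> W"
  using assms unfolding submod_def
  by (auto intro: cfun.subspace_0 cfun.subspace_add cfun.subspace_scale cfun.subspace_diff cfun.subspace_sum)

lemma submod_span:
  assumes "\<And>s f. s permutes {..<n} \<Longrightarrow> f \<in> B \<Longrightarrow> f \<circ> act s \<in> cfun.span B"
  shows "submod n act (cfun.span B)"
  unfolding submod_def
proof (intro conjI allI impI ballI)
  fix s f assume s: "s permutes {..<n}" and f: "f \<in> cfun.span B"
  show "f \<circ> act s \<in> cfun.span B"
    using f
  proof (induction rule: cfun.span_induct)
    show "cfun.subspace {f. f \<circ> act s \<in> cfun.span B}"
    proof (rule cfun.subspaceI)
      have "(0::'a \<Rightarrow> complex) \<circ> act s = 0" by (simp add: fun_eq_iff)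
      thus "0 \<in> {f. f \<circ> act s \<in> cfun.span B}" using cfun.span_zero by simp
      show "f + g \<in> {f. f \<circ> act s \<in> cfun.span B}"
        if "f \<in> {f. f \<circ> act s \<in> cfun.span B}" "g \<in> {f. f \<circ> act s \<in> cfun.span B}" for f g
      proof -
        have "(f + g) \<circ> act s = (f \<circ> act s) + (g \<circ> act s)" by (simp add: fun_eq_iff)
        thus ?thesis using that cfun.span_add by simp
      qed
      show "cscale c f \<in> {f. f \<circ> act s \<in> cfun.span B}" if "f \<in> {f. f \<circ> act s \<in> cfun.span B}" for c f
      proof -
        have "cscale c f \<circ> act s = cscale c (f \<circ> act s)" by (simp add: fun_eq_iff cscale_def)
        thus ?thesis using that cfun.span_scale by simp
      qed
    qed
    show "g \<circ> act s \<in> cfun.span B" if "g \<in> B" for g by (rule assms[OF s that])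
  qed
qed (rule cfun.subspace_span)

text \<open>
  The sum of the translates of \<open>f\<close> under a Young subgroup, weighted by the character \<open>\<epsilon>\<close>: for
  the trivial character and rows, or the sign and columns, the two factors of a Young
  symmetrizer.
\<close>

definition csym :: "nat \<Rightarrow> ((nat \<Rightarrow> nat) \<Rightarrow> 'x \<Rightarrow> 'x) \<Rightarrow> ((nat \<Rightarrow> nat) \<Rightarrow> complex) \<Rightarrow> (nat \<Rightarrow> 'c)
      \<Rightarrow> ('x \<Rightarrow> complex) \<Rightarrow> 'x \<Rightarrow> complex"
  where "csym n act \<epsilon> r f = (\<lambda>v. \<Sum>s\<in>stab n r. \<epsilon> s * f (act s v))"

definition csign :: "(nat \<Rightarrow> nat) \<Rightarrow> complex" where "csign s = of_int (sign s)"
definition triv :: "(nat \<Rightarrow> nat) \<Rightarrow> complex" where "triv s = 1"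

definition character :: "nat \<Rightarrow> ((nat \<Rightarrow> nat) \<Rightarrow> complex) \<Rightarrow> bool"
  where "character n \<epsilon> \<longleftrightarrow> (\<forall>s t. s permutes {..<n} \<longrightarrow> t permutes {..<n} \<longrightarrow> \<epsilon> (s \<circ> t) = \<epsilon> s * \<epsilon> t) \<and> \<epsilon> id = 1"

lemma character_triv: "character n triv"
  by (simp add: character_def triv_def)

lemma character_csign: "character n csign"
proof -
  have "permutation s" if "s permutes {..<n}" for s :: "nat \<Rightarrow> nat"
    using that finite_lessThan permutation_permutes by blast
  thus ?thesis by (simp add: character_def csign_def sign_compose sign_id)
qed

lemma character_comp: "character n \<epsilon> \<Longrightarrow> s permutes {..<n} \<Longrightarrow> t permutes {..<n} \<Longrightarrow> \<epsilon> (s \<circ> t) = \<epsilon> s * \<epsilon> t"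
  by (simp add: character_def)

lemma character_inv: "character n \<epsilon> \<Longrightarrow> s permutes {..<n} \<Longrightarrow> \<epsilon> (inv s) * \<epsilon> s = 1"
  by (metis character_def permutes_inv permutes_inv_o(2))

lemma csym_in:
  assumes "submod n act W" "f \<in> W" shows "csym n act \<epsilon> r f \<in> W"
proof -
  have "csym n act \<epsilon> r f = (\<Sum>s\<in>stab n r. cscale (\<epsilon> s) (f \<circ> act s))"
    by (simp add: csym_def fun_eq_iff sum_fun_apply cscale_def)
  also have "\<dots> \<in> W"
    by (intro submodD(7)[OF assms(1)] submodD(4)[OF assms(1)] submodD(6)[OF assms(1)] assms(2)) (simp add: stab_permutes)
  finally show ?thesis .
qed

lemma csym_add: "csym n act \<epsilon> r (f + g) = csym n act \<epsilon> r f + csym n act \<epsilon> r g"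
  by (simp add: csym_def fun_eq_iff algebra_simps sum.distrib)

lemma csym_scale: "csym n act \<epsilon> r (cscale c f) = cscale c (csym n act \<epsilon> r f)"
  by (simp add: csym_def fun_eq_iff algebra_simps cscale_def sum_distrib_left)

lemma csym_sum: "csym n act \<epsilon> r (\<Sum>i\<in>I. F i) = (\<Sum>i\<in>I. csym n act \<epsilon> r (F i))"
proof -
  have "csym n act \<epsilon> r (\<Sum>i\<in>I. F i) v = (\<Sum>i\<in>I. csym n act \<epsilon> r (F i)) v" for v
    unfolding csym_def sum_fun_apply sum_distrib_left by (rule sum.swap)
  thus ?thesis by blast
qed

lemma csym_0: "csym n act \<epsilon> r 0 = 0"
  by (simp add: csym_def fun_eq_iff)

lemma csym_cong: "(\<And>x y. x < n \<Longrightarrow> y < n \<Longrightarrow> r x = r y \<longleftrightarrow> r' x = r' y) \<Longrightarrow> csym n act \<epsilon> r f = csym n act \<epsilon> r' f"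
  using stab_cong[of n r r'] by (simp add: csym_def)

context right_action
begin

lemma csym_act_left:
  assumes "character n \<epsilon>" "s \<in> stab n r"
  shows "csym n act \<epsilon> r (f \<circ> act s) = cscale (\<epsilon> (inv s)) (csym n act \<epsilon> r f)"
proof
  fix v
  have p: "s permutes {..<n}" using assms(2) by (rule stab_permutes)
  have "csym n act \<epsilon> r f v = (\<Sum>u\<in>stab n r. \<epsilon> (u \<circ> s) * f (act (u \<circ> s) v))"
    unfolding csym_def by (rule sum.reindex_bij_betw[OF stab_bij_right[OF assms(2)], symmetric])
  also have "\<dots> = (\<Sum>u\<in>stab n r. \<epsilon> s * (\<epsilon> u * f (act s (act u v))))"
    by (rule sum.cong) (auto simp: act_act stab_permutes character_comp[OF assms(1) _ p])
  finally have "csym n act \<epsilon> r f v = \<epsilon> s * csym n act \<epsilon> r (f \<circ> act s) v"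
    by (simp add: csym_def sum_distrib_left)
  thus "csym n act \<epsilon> r (f \<circ> act s) v = cscale (\<epsilon> (inv s)) (csym n act \<epsilon> r f) v"
    using character_inv[OF assms(1) p] by (simp add: cscale_def mult.assoc[symmetric])
qed

lemma csym_act_right:
  assumes "character n \<epsilon>" "s \<in> stab n r"
  shows "csym n act \<epsilon> r f \<circ> act s = cscale (\<epsilon> (inv s)) (csym n act \<epsilon> r f)"
proof
  fix v
  have p: "s permutes {..<n}" using assms(2) by (rule stab_permutes)
  have "csym n act \<epsilon> r f v = (\<Sum>u\<in>stab n r. \<epsilon> (s \<circ> u) * f (act (s \<circ> u) v))"
    unfolding csym_def by (rule sum.reindex_bij_betw[OF stab_bij_left[OF assms(2)], symmetric])
  also have "\<dots> = (\<Sum>u\<in>stab n r. \<epsilon> s * (\<epsilon> u * f (act u (act s v))))"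
    by (rule sum.cong) (auto simp: act_act stab_permutes character_comp[OF assms(1) p])
  finally have "csym n act \<epsilon> r f v = \<epsilon> s * (csym n act \<epsilon> r f \<circ> act s) v"
    by (simp add: csym_def sum_distrib_left)
  thus "(csym n act \<epsilon> r f \<circ> act s) v = cscale (\<epsilon> (inv s)) (csym n act \<epsilon> r f) v"
    using character_inv[OF assms(1) p] by (simp add: cscale_def mult.assoc[symmetric])
qed

lemma csym_conj:
  assumes e: "character n \<epsilon>" and g: "g permutes {..<n}"
  shows "csym n act \<epsilon> c (f \<circ> act g) = csym n act \<epsilon> (c \<circ> g) f \<circ> act g"
proof
  fix v
  have "(csym n act \<epsilon> (c \<circ> g) f \<circ> act g) v = (\<Sum>s\<in>stab n c. \<epsilon> (inv g \<circ> s \<circ> g) * f (act (inv g \<circ> s \<circ> g) (act g v)))"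
    unfolding csym_def o_def[of _ "act g"]
    by (rule sum.reindex_bij_betw[OF stab_conj[OF g], symmetric])
  also have "\<dots> = (\<Sum>s\<in>stab n c. \<epsilon> s * f (act g (act s v)))"
  proof (rule sum.cong[OF refl])
    fix s assume "s \<in> stab n c"
    hence s: "s permutes {..<n}" by (rule stab_permutes)
    have "\<epsilon> (inv g \<circ> s \<circ> g) = \<epsilon> (inv g) * \<epsilon> s * \<epsilon> g"
      using s g permutes_inv[OF g] by (simp add: character_comp[OF e] permutes_compose)
    hence 1: "\<epsilon> (inv g \<circ> s \<circ> g) = \<epsilon> s"
      using character_inv[OF e g] by (simp add: mult.commute mult.left_commute)
    have "g \<circ> (inv g \<circ> s \<circ> g) = s \<circ> g"
      by (simp add: o_assoc permutes_inv_o[OF g])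
    thus "\<epsilon> (inv g \<circ> s \<circ> g) * f (act (inv g \<circ> s \<circ> g) (act g v)) = \<epsilon> s * f (act g (act s v))"
      unfolding 1 by (simp add: act_act)
  qed
  finally show "csym n act \<epsilon> c (f \<circ> act g) v = (csym n act \<epsilon> (c \<circ> g) f \<circ> act g) v"
    by (simp add: csym_def)
qed

lemma csym_fixed:
  assumes "character n \<epsilon>" "\<And>s. s \<in> stab n r \<Longrightarrow> f \<circ> act s = cscale (\<epsilon> (inv s)) f"
  shows "csym n act \<epsilon> r f = cscale (of_nat (card (stab n r))) f"
proof
  fix v
  have "csym n act \<epsilon> r f v = (\<Sum>s\<in>stab n r. f v)"
    unfolding csym_def
  proof (rule sum.cong[OF refl])
    fix s assume s: "s \<in> stab n r"
    have "f (act s v) = \<epsilon> (inv s) * f v"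
      using fun_cong[OF assms(2)[OF s], of v] by (simp add: cscale_def)
    moreover have "\<epsilon> (inv s) * \<epsilon> s = 1" using character_inv[OF assms(1) stab_permutes[OF s]] .
    ultimately show "\<epsilon> s * f (act s v) = f v" by (simp add: mult.assoc[symmetric] mult.commute)
  qed
  thus "csym n act \<epsilon> r f v = cscale (of_nat (card (stab n r))) f v" by (simp add: cscale_def)
qed

text \<open>
  Garnir's vanishing argument: a transposition in the group contributes a factor \<open>-1\<close>, while it
  fixes \<open>f\<close>.
\<close>

lemma asym_zero:
  assumes "x < n" "y < n" "x \<noteq> y" "c x = c y" "f \<circ> act (swp x y) = f"
  shows "csym n act csign c f = 0"
proof -
  have t: "swp x y \<in> stab n c" by (rule transpose_stab) (use assms in auto)
  have "csym n act csign c f = cscale (csign (inv (swp x y))) (csym n act csign c f)"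
    using csym_act_left[OF character_csign t, of f] assms(5) by simp
  also have "csign (inv (swp x y)) = -1"
    by (simp add: csign_def sign_swap_id assms(3))
  finally have "csym n act csign c f v = - csym n act csign c f v" for v
    by (metis cscale_def mult_minus1)
  thus ?thesis by (auto simp: fun_eq_iff)
qed

end


section \<open>The sum of all transpositions\<close>

definition block :: "nat \<Rightarrow> (nat \<Rightarrow> nat) \<Rightarrow> nat \<Rightarrow> nat set"
  where "block n r i = {x. x < n \<and> r x = i}"

text \<open>
  The number of ordered pairs of entries of equal colour. It strictly increases when an entry
  moves to a block at least as large as its own and so serves as a numerical substitute for the
  dominance order, for which maximal colourings are chosen.
\<close>

definition square_sum :: "nat \<Rightarrow> (nat \<Rightarrow> nat) \<Rightarrow> nat"
  where "square_sum n r = (\<Sum>i\<in>r ` {..<n}. card (block n r i) * card (block n r i))"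

definition min_sum :: "nat \<Rightarrow> (nat \<Rightarrow> nat) \<Rightarrow> nat"
  where "min_sum n r = (\<Sum>i\<in>r ` {..<n}. \<Sum>j\<in>r ` {..<n}. min (card (block n r i)) (card (block n r j)))"

lemma finite_block [simp]: "finite (block n r i)"
  by (simp add: block_def)

lemma sum_blocks: "(\<Sum>x<n. h x) = (\<Sum>i\<in>r ` {..<n}. \<Sum>x\<in>block n r i. h x)"
  unfolding block_def using sum.image_gen[of "{..<n}" h r] by (simp add: lessThan_def)

lemma square_sum_eq_card: "square_sum n r = card {(u, w). u < n \<and> w < n \<and> r u = r w}"
proof -
  have "{(u, w). u < n \<and> w < n \<and> r u = r w} = (\<Union>i\<in>r ` {..<n}. block n r i \<times> block n r i)"
    by (auto simp: block_def)
  also have "card \<dots> = square_sum n r"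
    unfolding square_sum_def by (subst card_UN_disjoint) (auto simp: block_def card_cartesian_product)
  finally show ?thesis by simp
qed

lemma square_sum_remove:
  assumes "y < n"
  shows "square_sum n r = card {(u, w). u < n \<and> w < n \<and> u \<noteq> y \<and> w \<noteq> y \<and> r u = r w}
      + 2 * card {x. x < n \<and> x \<noteq> y \<and> r x = r y} + 1"
proof -
  let ?A = "{(u, w). u < n \<and> w < n \<and> u \<noteq> y \<and> w \<noteq> y \<and> r u = r w}"
  let ?B = "{x. x < n \<and> x \<noteq> y \<and> r x = r y}"
  have eq: "{(u, w). u < n \<and> w < n \<and> r u = r w} = ?A \<union> ((?B \<times> {y}) \<union> ({y} \<times> ?B) \<union> {(y, y)})"
    using assms by auto
  have fA: "finite ?A" by (rule finite_subset[of _ "{..<n} \<times> {..<n}"]) auto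
  have fB: "finite ?B" by simp
  have "card ((?B \<times> {y}) \<union> ({y} \<times> ?B) \<union> {(y, y)}) = 2 * card ?B + 1"
  proof -
    have "card ((?B \<times> {y}) \<union> ({y} \<times> ?B)) = card (?B \<times> {y}) + card ({y} \<times> ?B)"
      by (rule card_Un_disjoint) (use fB in auto)
    also have "\<dots> = 2 * card ?B" by (simp add: card_cartesian_product)
    finally have 1: "card ((?B \<times> {y}) \<union> ({y} \<times> ?B)) = 2 * card ?B" .
    show ?thesis by (subst card_Un_disjoint) (use fB 1 in auto)
  qed
  moreover have "card (?A \<union> ((?B \<times> {y}) \<union> ({y} \<times> ?B) \<union> {(y, y)})) = card ?A + card ((?B \<times> {y}) \<union> ({y} \<times> ?B) \<union> {(y, y)})"
    by (rule card_Un_disjoint) (use fA fB in auto)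
  ultimately show ?thesis unfolding square_sum_eq_card eq by simp
qed

lemma square_sum_raise:
  assumes y: "y < n" and ne: "i \<noteq> r y" and le: "card (block n r (r y)) \<le> card (block n r i)"
  shows "square_sum n r < square_sum n (r(y := i))"
proof -
  have 1: "{x. x < n \<and> x \<noteq> y \<and> (r(y := i)) x = (r(y := i)) y} = block n r i"
    using ne by (auto simp: block_def)
  have 2: "block n r (r y) = insert y {x. x < n \<and> x \<noteq> y \<and> r x = r y}"
    using y by (auto simp: block_def)
  hence "card (block n r (r y)) = Suc (card {x. x < n \<and> x \<noteq> y \<and> r x = r y})" by simp
  moreover have "{(u, w). u < n \<and> w < n \<and> u \<noteq> y \<and> w \<noteq> y \<and> (r(y := i)) u = (r(y := i)) w}
      = {(u, w). u < n \<and> w < n \<and> u \<noteq> y \<and> w \<noteq> y \<and> r u = r w}" by auto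
  ultimately show ?thesis using le unfolding square_sum_remove[OF y] 1 by simp
qed

lemma square_sum_le: "square_sum n r \<le> n * n"
proof -
  have "square_sum n r \<le> card ({..<n} \<times> {..<n})"
    unfolding square_sum_eq_card by (rule card_mono) auto
  thus ?thesis by (simp add: card_cartesian_product)
qed

text \<open>
  Twice the action of the sum of all transpositions. It commutes with the group and hence acts
  by one scalar on everything generated by an eigenvector.
\<close>

definition casimir :: "nat \<Rightarrow> ((nat \<Rightarrow> nat) \<Rightarrow> 'x \<Rightarrow> 'x) \<Rightarrow> ('x \<Rightarrow> complex) \<Rightarrow> 'x \<Rightarrow> complex"
  where "casimir n act f = (\<lambda>v. \<Sum>x<n. \<Sum>y\<in>{..<n} - {x}. f (act (swp x y) v))"

lemma casimir_add: "casimir n act (f + g) = casimir n act f + casimir n act g"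
  by (simp add: casimir_def fun_eq_iff sum.distrib)

lemma casimir_scale: "casimir n act (cscale c f) = cscale c (casimir n act f)"
  by (simp add: casimir_def fun_eq_iff cscale_def sum_distrib_left)

lemma swp_conj: 
  assumes "g permutes {..<n}" shows "swp x y \<circ> g = g \<circ> swp (inv g x) (inv g y)"
  using permutes_inverses[OF assms] permutes_bij[OF assms]
  by (auto simp: fun_eq_iff Transposition.transpose_def)

context right_action
begin

lemma casimir_act:
  assumes g: "g permutes {..<n}"
  shows "casimir n act (f \<circ> act g) = casimir n act f \<circ> act g"
proof
  fix v
  note gi = permutes_inv[OF g]
  have bij: "bij_betw (inv g) {..<n} {..<n}" using gi by (rule permutes_imp_bij)
  have bij2: "bij_betw (inv g) ({..<n} - {x}) ({..<n} - {inv g x})" if "x < n" for x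
  proof (rule bij_betw_DiffI[OF bij])
    show "bij_betw (inv g) {x} {inv g x}" by simp
  qed (use that permutes_inv_less[OF g] in auto)
  have "casimir n act (f \<circ> act g) v = (\<Sum>x<n. \<Sum>y\<in>{..<n} - {x}. f (act (swp (inv g x) (inv g y)) (act g v)))"
    by (simp add: casimir_def act_act swp_conj[OF g])
  also have "\<dots> = (\<Sum>x<n. \<Sum>y\<in>{..<n} - {inv g x}. f (act (swp (inv g x) y) (act g v)))"
    by (intro sum.cong refl sum.reindex_bij_betw bij2) simp
  also have "\<dots> = (\<Sum>x<n. \<Sum>y\<in>{..<n} - {x}. f (act (swp x y) (act g v)))"
    by (rule sum.reindex_bij_betw[OF bij, where g = "\<lambda>x. \<Sum>y\<in>{..<n} - {x}. f (act (swp x y) (act g v))"])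
  finally show "casimir n act (f \<circ> act g) v = (casimir n act f \<circ> act g) v" by (simp add: casimir_def)
qed

text \<open>
  Let \<open>f\<close> transform by \<open>\<epsilon>\<close> under the Young subgroup of \<open>r\<close>, and suppose that symmetrization over
  any colouring with larger \<open>square_sum\<close> annihilates \<open>W\<close>. Enlarging the block \<open>i\<close> by the entry
  \<open>y\<close> gives such a colouring, and the transpositions \<open>(x y)\<close> with \<open>x\<close> in the block, together
  with the identity, represent the cosets that have to be summed; so this sum vanishes.
\<close>

lemma maximal_relation:
  assumes e: "character n \<epsilon>" and sw: "\<And>x y. x < n \<Longrightarrow> y < n \<Longrightarrow> x \<noteq> y \<Longrightarrow> \<epsilon> (swp x y) = e" and ee: "e * e = 1"
    and W: "submod n act W" and f: "f \<in> W" and inv: "\<And>s. s \<in> stab n r \<Longrightarrow> f \<circ> act s = cscale (\<epsilon> (inv s)) f"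
    and max: "\<And>r' f'. square_sum n r < square_sum n r' \<Longrightarrow> f' \<in> W \<Longrightarrow> csym n act \<epsilon> r' f' = 0"
    and y: "y < n" and ne: "i \<noteq> r y" and le: "card (block n r (r y)) \<le> card (block n r i)"
  shows "(\<Sum>x\<in>block n r i. f (act (swp x y) v)) = - e * f v"
proof -
  define r' where "r' = r(y := i)"
  define g where "g = (\<Sum>x\<in>block n r' i. cscale (\<epsilon> (swp x y)) (f \<circ> act (swp x y)))"
  have perm: "swp x y permutes {..<n}" if "x < n" for x
    using that y by (intro permutes_swap_id) auto
  have clsr': "block n r' i = insert y (block n r i)" and yn: "y \<notin> block n r i"
    using ne y by (auto simp: block_def r'_def)
  have gW: "g \<in> W"
    unfolding g_def by (intro submodD[OF W] f perm) (auto simp: block_def)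
  have sq: "\<epsilon> (swp x y) * \<epsilon> (swp x y) = 1" if "x < n" for x
    using sw[OF that y] ee e by (cases "x = y") (auto simp: character_def transpose_same)
  have ginv: "g \<circ> act s = cscale (\<epsilon> (inv s)) g" if s: "s \<in> stab n r'" for s
  proof
    fix v
    note sp = stab_permutes[OF s]
    have scls: "bij_betw s (block n r' i) (block n r' i)"
    proof (rule bij_betw_byWitness[where f' = "inv s"])
      show "s ` block n r' i \<subseteq> block n r' i" using s stab_less[OF s] by (auto simp: block_def stab_def)
      show "inv s ` block n r' i \<subseteq> block n r' i" using stab_inv[OF s] stab_less[OF stab_inv[OF s]] by (auto simp: block_def stab_def)
    qed (use permutes_inverses[OF sp] in auto)
    have "(g \<circ> act s) v = (\<Sum>x\<in>block n r' i. \<epsilon> (swp x y) * f (act (s \<circ> swp x y) v))"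
      by (simp add: g_def sum_fun_apply cscale_def act_act)
    also have "\<dots> = (\<Sum>x\<in>block n r' i. \<epsilon> (inv s) * (\<epsilon> (swp (s x) y) * f (act (swp (s x) y) v)))"
    proof (rule sum.cong[OF refl])
      fix x assume x: "x \<in> block n r' i"
      hence xn: "x < n" by (simp add: block_def)
      have sxn: "s x < n" using stab_less[OF s xn] .
      define s1 where "s1 = swp (s x) y \<circ> s \<circ> swp x y"
      have a: "swp x y \<in> stab n r'" using x y by (intro transpose_stab) (auto simp: block_def r'_def)
      have b: "swp (s x) y \<in> stab n r'" using x y s sxn by (intro transpose_stab) (auto simp: block_def r'_def stab_def)
      have s1: "s1 \<in> stab n r'" unfolding s1_def by (intro stab_comp a b s)
      have "s1 y = y" by (simp add: s1_def)
      have s1r: "s1 \<in> stab n r"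
      proof -
        have "r (s1 u) = r u" if u: "u < n" for u
        proof (cases "u = y")
          case False
          have "s1 u \<noteq> y" using \<open>s1 y = y\<close> False permutes_inj[OF stab_permutes[OF s1]] by (metis injD)
          thus ?thesis using s1 u False by (auto simp: stab_def r'_def)
        qed (simp add: \<open>s1 y = y\<close>)
        thus ?thesis using s1 by (simp add: stab_def)
      qed
      have c1: "s \<circ> swp x y = swp (s x) y \<circ> s1"
        by (simp add: s1_def o_assoc)
      have i1: "inv s1 = swp x y \<circ> (inv s \<circ> swp (s x) y)"
      proof (rule inv_unique_comp)
        have ss: "s (inv s u) = u" "inv s (s u) = u" for u using permutes_inverses[OF sp] by auto
        show "s1 \<circ> (swp x y \<circ> (inv s \<circ> swp (s x) y)) = id" by (auto simp: s1_def fun_eq_iff ss)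
        show "swp x y \<circ> (inv s \<circ> swp (s x) y) \<circ> s1 = id" by (auto simp: s1_def fun_eq_iff ss)
      qed
      have e1: "\<epsilon> (inv s1) = \<epsilon> (swp x y) * (\<epsilon> (inv s) * \<epsilon> (swp (s x) y))"
        unfolding i1 using perm[OF xn] perm[OF sxn] permutes_inv[OF sp]
        by (simp add: character_comp[OF e] permutes_compose)
      have "f (act (s \<circ> swp x y) v) = f (act s1 (act (swp (s x) y) v))"
        unfolding c1 by (simp add: act_act)
      also have "\<dots> = \<epsilon> (inv s1) * f (act (swp (s x) y) v)"
        using fun_cong[OF inv[OF s1r], of "act (swp (s x) y) v"] by (simp add: cscale_def)
      finally have "\<epsilon> (swp x y) * f (act (s \<circ> swp x y) v) = (\<epsilon> (swp x y) * \<epsilon> (swp x y)) * \<epsilon> (inv s) * \<epsilon> (swp (s x) y) * f (act (swp (s x) y) v)"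
        unfolding e1 by (simp add: mult_ac)
      thus "\<epsilon> (swp x y) * f (act (s \<circ> swp x y) v) = \<epsilon> (inv s) * (\<epsilon> (swp (s x) y) * f (act (swp (s x) y) v))"
        unfolding sq[OF xn] by simp
    qed
    also have "\<dots> = \<epsilon> (inv s) * (\<Sum>x\<in>block n r' i. (\<epsilon> (swp x y) * f (act (swp x y) v)))"
      unfolding sum_distrib_left[symmetric]
      by (subst sum.reindex_bij_betw[OF scls, where g = "\<lambda>x. \<epsilon> (swp x y) * f (act (swp x y) v)"]) simp
    finally show "(g \<circ> act s) v = cscale (\<epsilon> (inv s)) g v"
      by (simp add: g_def sum_fun_apply cscale_def)
  qed
  have "csym n act \<epsilon> r' g = 0"
    by (rule max) (use square_sum_raise[of y n i r, OF y ne le] gW in \<open>simp_all add: r'_def\<close>)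
  hence "cscale (of_nat (card (stab n r'))) g v = 0"
    using csym_fixed[OF e, of r' g] ginv by (metis zero_fun_apply)
  hence "g v = 0"
    using finite_stab[of n r'] stab_id[of n r'] by (auto simp: cscale_def card_eq_0_iff)
  moreover have "g v = f v + e * (\<Sum>x\<in>block n r i. f (act (swp x y) v))"
  proof -
    have "g v = (\<Sum>x\<in>insert y (block n r i). \<epsilon> (swp x y) * f (act (swp x y) v))"
      by (simp add: g_def sum_fun_apply cscale_def clsr')
    also have "\<dots> = \<epsilon> id * f (act id v) + (\<Sum>x\<in>block n r i. \<epsilon> (swp x y) * f (act (swp x y) v))"
      using yn by (simp add: transpose_same id_def)
    also have "(\<Sum>x\<in>block n r i. \<epsilon> (swp x y) * f (act (swp x y) v)) = (\<Sum>x\<in>block n r i. e * f (act (swp x y) v))"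
      using y ne by (intro sum.cong refl arg_cong2[where f = "(*)"] sw) (auto simp: block_def)
    also have "\<epsilon> id = 1" using e by (simp add: character_def)
    finally show ?thesis unfolding act_id by (simp add: sum_distrib_left)
  qed
  ultimately have "e * (\<Sum>x\<in>block n r i. f (act (swp x y) v)) = - f v" by (simp add: add_eq_0_iff)
  hence "(e * e) * (\<Sum>x\<in>block n r i. f (act (swp x y) v)) = - e * f v" by (simp add: mult.assoc)
  thus ?thesis using ee by simp
qed

text \<open>
  Ordered pairs within a block contribute \<open>\<epsilon>\<close> of a transposition each; pairs across two blocks
  are summed by \<open>maximal_relation\<close>, moving an entry of the smaller block to the larger one,
  which leaves minus the size of the smaller block.
\<close>

lemma maximal_casimir:
  assumes e: "character n \<epsilon>" and sw: "\<And>x y. x < n \<Longrightarrow> y < n \<Longrightarrow> x \<noteq> y \<Longrightarrow> \<epsilon> (swp x y) = e" and ee: "e * e = 1"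
    and W: "submod n act W" and f: "f \<in> W" and inv: "\<And>s. s \<in> stab n r \<Longrightarrow> f \<circ> act s = cscale (\<epsilon> (inv s)) f"
    and max: "\<And>r' f'. square_sum n r < square_sum n r' \<Longrightarrow> f' \<in> W \<Longrightarrow> csym n act \<epsilon> r' f' = 0"
  shows "casimir n act f = cscale (e * (of_nat (square_sum n r) - of_nat (min_sum n r))) f"
proof
  fix v
  let ?I = "r ` {..<n}"
  let ?c = "\<lambda>i. card (block n r i)"
  have perm: "swp x y permutes {..<n}" if "x < n" "y < n" for x y
    using that by (intro permutes_swap_id) auto
  have off1: "(\<Sum>x\<in>block n r i. \<Sum>y\<in>block n r j. f (act (swp x y) v)) = - e * of_nat (min (?c i) (?c j)) * f v"
    if ij: "i \<noteq> j" "?c j \<le> ?c i" for i j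
  proof -
    have "(\<Sum>x\<in>block n r i. \<Sum>y\<in>block n r j. f (act (swp x y) v)) = (\<Sum>y\<in>block n r j. \<Sum>x\<in>block n r i. f (act (swp x y) v))"
      by (rule sum.swap)
    also have "\<dots> = (\<Sum>y\<in>block n r j. - e * f v)"
      by (intro sum.cong refl maximal_relation[OF e sw ee W f inv max]) (use ij in \<open>auto simp: block_def\<close>)
    also have "\<dots> = - e * of_nat (min (?c i) (?c j)) * f v"
      using ij by (simp add: min_absorb2)
    finally show ?thesis .
  qed
  have off: "(\<Sum>x\<in>block n r i. \<Sum>y\<in>block n r j. f (act (swp x y) v)) = - e * of_nat (min (?c i) (?c j)) * f v"
    if ij: "i \<noteq> j" for i j
  proof (cases "?c j \<le> ?c i")
    case False
    have "(\<Sum>x\<in>block n r i. \<Sum>y\<in>block n r j. f (act (swp x y) v)) = (\<Sum>y\<in>block n r j. \<Sum>x\<in>block n r i. f (act (swp y x) v))"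
      by (subst sum.swap) (simp add: transpose_commute)
    thus ?thesis using off1[of j i] ij False by (simp add: min.commute)
  qed (use off1 ij in blast)
  have diag: "(\<Sum>x\<in>block n r i. \<Sum>y\<in>block n r i - {x}. f (act (swp x y) v)) = e * of_nat (?c i * ?c i) * f v - e * of_nat (?c i) * f v"
    for i
  proof -
    have "(\<Sum>x\<in>block n r i. \<Sum>y\<in>block n r i - {x}. f (act (swp x y) v)) = (\<Sum>x\<in>block n r i. \<Sum>y\<in>block n r i - {x}. e * f v)"
    proof (intro sum.cong refl)
      fix x y assume xy: "x \<in> block n r i" "y \<in> block n r i - {x}"
      have s: "swp x y \<in> stab n r" using xy by (intro transpose_stab) (auto simp: block_def)
      have "inv (swp x y) = swp x y" by simp
      hence "\<epsilon> (inv (swp x y)) = e" using xy sw[of x y] by (auto simp: block_def)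
      thus "f (act (swp x y) v) = e * f v" using fun_cong[OF inv[OF s], of v] by (simp add: cscale_def)
    qed
    also have "\<dots> = (\<Sum>x\<in>block n r i. (of_nat (?c i) - 1) * (e * f v))"
    proof (rule sum.cong[OF refl])
      fix x assume x: "x \<in> block n r i"
      have "card (block n r i - {x}) = ?c i - 1" using x by simp
      moreover have "?c i \<ge> 1" using x by (metis card_0_eq empty_iff finite_block not_less_eq_eq le_zero_eq One_nat_def)
      ultimately show "(\<Sum>y\<in>block n r i - {x}. e * f v) = (of_nat (?c i) - 1) * (e * f v)" by (simp add: of_nat_diff)
    qed
    finally show ?thesis by (simp add: algebra_simps)
  qed
  have split: "(\<Sum>x\<in>block n r i. \<Sum>y\<in>block n r j - {x}. f (act (swp x y) v))
      = - e * of_nat (min (?c i) (?c j)) * f v + (if i = j then e * of_nat (?c i * ?c i) * f v else 0)" for i j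
  proof (cases "i = j")
    case False
    have "block n r j - {x} = block n r j" if "x \<in> block n r i" for x using that False by (auto simp: block_def)
    thus ?thesis using off[OF False] False by simp
  qed (simp add: diag)
  have "casimir n act f v = (\<Sum>i\<in>?I. \<Sum>x\<in>block n r i. \<Sum>y\<in>{..<n} - {x}. f (act (swp x y) v))"
    unfolding casimir_def by (rule sum_blocks)
  also have "\<dots> = (\<Sum>i\<in>?I. \<Sum>x\<in>block n r i. \<Sum>j\<in>?I. \<Sum>y\<in>block n r j - {x}. f (act (swp x y) v))"
  proof (rule sum.cong[OF refl], rule sum.cong[OF refl])
    fix i x assume "x \<in> block n r i"
    have eq1: "(\<Sum>y\<in>{..<n} - {x}. f (act (swp x y) v)) = (\<Sum>y<n. if y \<in> {..<n} - {x} then f (act (swp x y) v) else 0)"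
      by (simp add: sum.If_cases set_diff_eq Int_def)
    have eq2: "(\<Sum>y<n. if y \<in> {..<n} - {x} then f (act (swp x y) v) else 0) = (\<Sum>j\<in>?I. \<Sum>y\<in>block n r j. if y \<in> {..<n} - {x} then f (act (swp x y) v) else 0)"
      by (rule sum_blocks)
    have eq3: "\<dots> = (\<Sum>j\<in>?I. \<Sum>y\<in>block n r j - {x}. f (act (swp x y) v))"
      by (intro sum.cong refl sum.mono_neutral_cong_right) (auto simp: block_def)
    show "(\<Sum>y\<in>{..<n} - {x}. f (act (swp x y) v)) = (\<Sum>j\<in>?I. \<Sum>y\<in>block n r j - {x}. f (act (swp x y) v))"
      using eq1 eq2 eq3 by (rule trans[OF _ trans])
  qed
  also have "\<dots> = (\<Sum>i\<in>?I. \<Sum>j\<in>?I. \<Sum>x\<in>block n r i. \<Sum>y\<in>block n r j - {x}. f (act (swp x y) v))"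
    by (intro sum.cong refl sum.swap)
  also have "\<dots> = (\<Sum>i\<in>?I. \<Sum>j\<in>?I. - e * of_nat (min (?c i) (?c j)) * f v + (if i = j then e * of_nat (?c i * ?c i) * f v else 0))"
    unfolding split ..
  also have "\<dots> = (\<Sum>i\<in>?I. \<Sum>j\<in>?I. - e * of_nat (min (?c i) (?c j)) * f v) + (\<Sum>i\<in>?I. e * of_nat (?c i * ?c i) * f v)"
    unfolding sum.distrib by simp
  also have "\<dots> = cscale (e * (of_nat (square_sum n r) - of_nat (min_sum n r))) f v"
    by (simp add: cscale_def square_sum_def min_sum_def algebra_simps sum_distrib_left sum_distrib_right sum_negf)
  finally show "casimir n act f v = cscale (e * (of_nat (square_sum n r) - of_nat (min_sum n r))) f v" .
qed

end


lemma antitone_enumeration: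
  fixes f :: "'a \<Rightarrow> 'b::linorder"
  assumes "finite A"
  shows "\<exists>e. bij_betw e {..<card A} A \<and> (\<forall>i j. i \<le> j \<longrightarrow> j < card A \<longrightarrow> f (e j) \<le> f (e i))"
  using assms
proof (induction "card A" arbitrary: A)
  case 0
  thus ?case by (intro exI[of _ undefined]) (auto simp: bij_betw_def)
next
  case (Suc k)
  hence ne: "A \<noteq> {}" by auto
  obtain a where a: "a \<in> A" "\<And>x. x \<in> A \<Longrightarrow> f a \<le> f x"
    using arg_min_if_finite[OF Suc.prems ne, of f] by (metis linorder_not_less)
  have k: "k = card (A - {a})" using Suc.hyps(2) a Suc.prems by simp
  obtain e where e: "bij_betw e {..<k} (A - {a})" "\<And>i j. i \<le> j \<Longrightarrow> j < k \<Longrightarrow> f (e j) \<le> f (e i)"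
    using Suc.hyps(1)[OF k] Suc.prems k by auto
  have eA: "e i \<in> A" if "i < k" for i using bij_betwE[OF e(1)] that by auto
  have "bij_betw (e(k := a)) (insert k {..<k}) (insert a (A - {a}))"
  proof -
    have "bij_betw (e(k := a)) {..<k} (A - {a})"
      using e(1) by (subst bij_betw_cong[where g = e]) auto
    moreover have "bij_betw (e(k := a)) {k} {a}" by simp
    ultimately have "bij_betw (e(k := a)) ({..<k} \<union> {k}) ((A - {a}) \<union> {a})"
      by (rule bij_betw_combine) simp
    thus ?thesis by simp
  qed
  hence "bij_betw (e(k := a)) {..<Suc k} A"
    using a(1) by (simp add: lessThan_Suc insert_absorb)
  thus ?case using e(2) a(2) eA Suc.hyps(2)
    by (intro exI[of _ "e(k := a)"]) (auto simp: less_Suc_eq)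
qed

text \<open>
  When \<open>r\<close> and \<open>c\<close> together separate the entries, a pair of entries with equal \<open>r\<close> is determined
  by its two \<open>c\<close>-blocks and the common value of \<open>r\<close>.
\<close>

lemma card_shared:
  assumes inj: "inj_on (\<lambda>x. (r x, c x)) {..<n}"
  shows "square_sum n r = (\<Sum>j\<in>c ` {..<n}. \<Sum>j'\<in>c ` {..<n}. card (r ` block n c j \<inter> r ` block n c j'))"
    and "card (r ` block n c j) = card (block n c j)"
proof -
  let ?J = "c ` {..<n}"
  let ?D = "\<lambda>j j'. {(u, w). u \<in> block n c j \<and> w \<in> block n c j' \<and> r u = r w}"
  have fin: "finite (?D j j')" for j j' by (rule finite_subset[of _ "{..<n} \<times> {..<n}"]) (auto simp: block_def)
  have inj': "u = w" if "u < n" "w < n" "r u = r w" "c u = c w" for u w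
    using inj that by (auto dest: inj_onD)
  have D: "card (?D j j') = card (r ` block n c j \<inter> r ` block n c j')" for j j'
  proof (rule bij_betw_same_card[of "\<lambda>(u, w). r u"], rule bij_betw_imageI)
    show "inj_on (\<lambda>(u, w). r u) (?D j j')"
    proof (rule inj_onI)
      fix a b assume ab: "a \<in> ?D j j'" "b \<in> ?D j j'" "(\<lambda>(u, w). r u) a = (\<lambda>(u, w). r u) b"
      have "fst a = fst b" by (rule inj') (use ab in \<open>auto simp: block_def\<close>)
      moreover have "snd a = snd b" by (rule inj') (use ab in \<open>auto simp: block_def\<close>)
      ultimately show "a = b" by (rule prod_eqI)
    qed
    show "(\<lambda>(u, w). r u) ` ?D j j' = r ` block n c j \<inter> r ` block n c j'"
    proof
      show "r ` block n c j \<inter> r ` block n c j' \<subseteq> (\<lambda>(u, w). r u) ` ?D j j'"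
      proof
        fix i assume "i \<in> r ` block n c j \<inter> r ` block n c j'"
        then obtain u w where "u \<in> block n c j" "w \<in> block n c j'" "i = r u" "r u = r w" by auto
        thus "i \<in> (\<lambda>(u, w). r u) ` ?D j j'" by (intro image_eqI[of _ _ "(u, w)"]) auto
      qed
    qed auto
  qed
  have "{(u, w). u < n \<and> w < n \<and> r u = r w} = (\<Union>(j, j')\<in>?J \<times> ?J. ?D j j')"
    by (auto simp: block_def)
  hence "square_sum n r = card (\<Union>jj\<in>?J \<times> ?J. ?D (fst jj) (snd jj))" by (simp add: square_sum_eq_card split_beta)
  also have "\<dots> = (\<Sum>jj\<in>?J \<times> ?J. card (?D (fst jj) (snd jj)))"
  proof (rule card_UN_disjoint)
    show "\<forall>jj\<in>?J \<times> ?J. finite (?D (fst jj) (snd jj))" using fin by blast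
    show "\<forall>i\<in>?J \<times> ?J. \<forall>j\<in>?J \<times> ?J. i \<noteq> j \<longrightarrow> ?D (fst i) (snd i) \<inter> ?D (fst j) (snd j) = {}"
      by (auto simp: block_def prod_eq_iff)
  qed simp
  also have "\<dots> = (\<Sum>(j, j')\<in>?J \<times> ?J. card (?D j j'))" by (simp add: split_beta)
  also have "\<dots> = (\<Sum>j\<in>?J. \<Sum>j'\<in>?J. card (r ` block n c j \<inter> r ` block n c j'))"
    by (simp add: D sum.cartesian_product)
  finally show "square_sum n r = (\<Sum>j\<in>?J. \<Sum>j'\<in>?J. card (r ` block n c j \<inter> r ` block n c j'))" .
  show "card (r ` block n c j) = card (block n c j)"
    by (rule card_image, rule inj_onI, rule inj') (auto simp: block_def)
qed

text \<open>
  Two columns share at most as many rows as the shorter of them has. Equality throughout means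
  that the row sets of the columns are nested.
\<close>

lemma square_sum_le_min_sum:
  assumes inj: "inj_on (\<lambda>x. (r x, c x)) {..<n}"
  shows "square_sum n r \<le> min_sum n c"
    and "square_sum n r = min_sum n c \<Longrightarrow> j \<in> c ` {..<n} \<Longrightarrow> j' \<in> c ` {..<n} \<Longrightarrow> card (block n c j) \<le> card (block n c j')
          \<Longrightarrow> r ` block n c j \<subseteq> r ` block n c j'"
proof -
  let ?J = "c ` {..<n}"
  have le: "card (r ` block n c j \<inter> r ` block n c j') \<le> min (card (block n c j)) (card (block n c j'))" for j j'
    unfolding card_shared(2)[OF inj, symmetric] by (auto intro: card_mono)
  show "square_sum n r \<le> min_sum n c"
    unfolding card_shared(1)[OF inj] min_sum_def by (intro sum_mono le)
  assume eq: "square_sum n r = min_sum n c" and j: "j \<in> ?J" "j' \<in> ?J" and c: "card (block n c j) \<le> card (block n c j')"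
  have "(\<Sum>j'\<in>?J. card (r ` block n c j \<inter> r ` block n c j')) = (\<Sum>j'\<in>?J. min (card (block n c j)) (card (block n c j')))"
    by (rule sum_mono_inv[OF eq[unfolded card_shared(1)[OF inj] min_sum_def]]) (use le j in \<open>auto intro: sum_mono\<close>)
  from sum_mono_inv[OF this, of j'] have "card (r ` block n c j \<inter> r ` block n c j') = card (r ` block n c j)"
    using le j c by (auto simp: card_shared(2)[OF inj])
  thus "r ` block n c j \<subseteq> r ` block n c j'"
    by (metis card_subset_eq finite_block finite_imageI inf.orderI inf_le1)
qed

lemma finite_diagram: "finite (diagram p)"
proof -
  have "diagram p = (SIGMA i:{..<length p}. {..<p ! i})" by (auto simp: diagram_def)
  thus ?thesis by simp
qed

lemma card_diagram: "card (diagram p) = sum_list p"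
proof -
  have "diagram p = (SIGMA i:{..<length p}. {..<p ! i})" by (auto simp: diagram_def)
  thus ?thesis by (simp add: sum_list_sum_nth atLeast0LessThan)
qed

text \<open>
  Nested columns, sorted by length, form a Young diagram.
\<close>

lemma nested_tableau:
  assumes inj: "inj_on (\<lambda>x. (r x, c x)) {..<n}" and eq: "square_sum n r = min_sum n c"
  shows "\<exists>p t. p \<in> partitions_of n \<and> is_tableau p t
      \<and> (\<forall>x<n. \<forall>y<n. fst (t x) = fst (t y) \<longleftrightarrow> r x = r y)
      \<and> (\<forall>x<n. \<forall>y<n. snd (t x) = snd (t y) \<longleftrightarrow> c x = c y)"
proof -
  let ?I = "r ` {..<n}" and ?J = "c ` {..<n}"
  obtain er where er: "bij_betw er {..<card ?I} ?I"
      "\<And>i j. i \<le> j \<Longrightarrow> j < card ?I \<Longrightarrow> card (block n r (er j)) \<le> card (block n r (er i))"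
    using antitone_enumeration[of ?I "\<lambda>i. card (block n r i)"] by auto
  obtain ec where ec: "bij_betw ec {..<card ?J} ?J"
      "\<And>i j. i \<le> j \<Longrightarrow> j < card ?J \<Longrightarrow> card (block n c (ec j)) \<le> card (block n c (ec i))"
    using antitone_enumeration[of ?J "\<lambda>i. card (block n c i)"] by auto
  define rr where "rr = inv_into {..<card ?I} er"
  define cc where "cc = inv_into {..<card ?J} ec"
  have rr: "er (rr (r x)) = r x" "rr (r x) < card ?I" if "x < n" for x
    using bij_betw_inv_into_right[OF er(1), of "r x"] bij_betwE[OF bij_betw_inv_into[OF er(1)]] that
    by (auto simp: rr_def)
  have cc: "ec (cc (c x)) = c x" "cc (c x) < card ?J" if "x < n" for x
    using bij_betw_inv_into_right[OF ec(1), of "c x"] bij_betwE[OF bij_betw_inv_into[OF ec(1)]] that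
    by (auto simp: cc_def)
  define p where "p = map (\<lambda>i. card (block n r (er i))) [0..<card ?I]"
  define t where "t = (\<lambda>x. (rr (r x), cc (c x)))"
  have lp: "length p = card ?I" by (simp add: p_def)
  have "sorted_wrt (\<ge>) p"
    unfolding p_def sorted_wrt_iff_nth_less using er(2) by auto
  moreover have "0 \<notin> set p"
  proof
    assume "0 \<in> set p"
    then obtain i where i: "i < card ?I" "block n r (er i) = {}" by (auto simp: p_def)
    have "er i \<in> ?I" using bij_betwE[OF er(1)] i(1) by auto
    thus False using i(2) by (auto simp: block_def)
  qed
  ultimately have part: "is_partition p" by (simp add: is_partition_def)
  have "sum_list p = (\<Sum>i<card ?I. card (block n r (er i)))"
    by (simp add: p_def sum_list_sum_nth atLeast0LessThan)
  also have "\<dots> = (\<Sum>i\<in>?I. card (block n r i))"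
    by (rule sum.reindex_bij_betw[OF er(1)])
  also have "\<dots> = (\<Sum>x<n. 1)"
    by (subst sum_blocks[where r = r]) simp
  finally have sum: "sum_list p = n" by simp
  have tD: "t x \<in> diagram p" if x: "x < n" for x
  proof -
    have sub: "ec ` {..cc (c x)} \<subseteq> c ` block n r (r x)"
    proof
      fix j' assume "j' \<in> ec ` {..cc (c x)}"
      then obtain k where k: "k \<le> cc (c x)" "j' = ec k" by auto
      have j': "j' \<in> ?J" using bij_betwE[OF ec(1)] k cc(2)[OF x] by auto
      have "card (block n c (c x)) \<le> card (block n c j')"
        using ec(2)[OF k(1) cc(2)[OF x]] cc(1)[OF x] k(2) by simp
      hence "r ` block n c (c x) \<subseteq> r ` block n c j'"
        using square_sum_le_min_sum(2)[OF inj eq, of "c x" j'] x j' by auto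
      moreover have "r x \<in> r ` block n c (c x)" using x by (auto simp: block_def)
      ultimately show "j' \<in> c ` block n r (r x)" by (auto simp: block_def)
    qed
    have "inj_on ec {..cc (c x)}"
      by (rule inj_on_subset[OF bij_betw_imp_inj_on[OF ec(1)]]) (use cc(2)[OF x] in auto)
    hence "Suc (cc (c x)) = card (ec ` {..cc (c x)})" by (simp add: card_image)
    also have "\<dots> \<le> card (c ` block n r (r x))" by (rule card_mono[OF _ sub]) simp
    also have "\<dots> \<le> card (block n r (r x))" by (rule card_image_le) simp
    finally show ?thesis
      using rr[OF x] by (simp add: t_def diagram_def lp) (simp add: p_def)
  qed
  have iff1: "rr (r x) = rr (r y) \<longleftrightarrow> r x = r y" if "x < n" "y < n" for x y using rr(1) that by metis
  have iff2: "cc (c x) = cc (c y) \<longleftrightarrow> c x = c y" if "x < n" "y < n" for x y using cc(1) that by metis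
  have injt: "inj_on t {..<n}"
    by (rule inj_onI) (use iff1 iff2 inj in \<open>auto simp: t_def dest: inj_onD\<close>)
  have "t ` {..<n} = diagram p"
    by (rule card_subset_eq) (use tD injt sum in \<open>auto simp: finite_diagram card_diagram card_image\<close>)
  hence "is_tableau p t" using injt sum by (simp add: is_tableau_def bij_betw_def)
  thus ?thesis using part sum iff1 iff2
    by (intro exI[of _ p] exI[of _ t]) (auto simp: t_def partitions_of_def)
qed

context right_action
begin

lemma casimir_span:
  assumes eig: "casimir n act f = cscale c f" and g: "g \<in> cfun.span ((\<lambda>s. f \<circ> act s) ` {s. s permutes {..<n}})"
  shows "casimir n act g = cscale c g"
proof -
  have "casimir n act g = cscale c g"
    using g
  proof (induction rule: cfun.span_induct)
    show "cfun.subspace {g. casimir n act g = cscale c g}"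
    proof (rule cfun.subspaceI)
      show "0 \<in> {g. casimir n act g = cscale c g}" by (simp add: casimir_def cscale_def fun_eq_iff)
      show "x + y \<in> {g. casimir n act g = cscale c g}" if "x \<in> {g. casimir n act g = cscale c g}" "y \<in> {g. casimir n act g = cscale c g}" for x y
        using that by (simp add: casimir_add cfun.scale_right_distrib)
      show "cscale d x \<in> {g. casimir n act g = cscale c g}" if "x \<in> {g. casimir n act g = cscale c g}" for d x
        using that by (simp add: casimir_scale cfun.scale_left_commute)
    qed
    show "casimir n act x = cscale c x" if "x \<in> (\<lambda>s. f \<circ> act s) ` {s. s permutes {..<n}}" for x
      using that casimir_act[of _ n f] eig by (auto simp: cscale_def fun_eq_iff)
  qed
  thus ?thesis .
qed

lemma submod_span_orbit: "submod n act (cfun.span ((\<lambda>s. f \<circ> act s) ` {s. s permutes {..<n}}))"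
proof (rule submod_span)
  fix s x assume s: "s permutes {..<n}" and "x \<in> (\<lambda>s. f \<circ> act s) ` {s. s permutes {..<n}}"
  then obtain u where u: "u permutes {..<n}" "x = f \<circ> act u" by blast
  have "x \<circ> act s = f \<circ> act (s \<circ> u)" by (simp add: u(2) act_comp comp_assoc)
  thus "x \<circ> act s \<in> cfun.span ((\<lambda>s. f \<circ> act s) ` {s. s permutes {..<n}})"
    using permutes_compose[OF u(1) s] by (auto intro: cfun.span_base)
qed

lemma exists_max_sym:
  assumes e: "character n \<epsilon>" and W: "submod n act W" and f: "f \<in> W" "f \<noteq> 0"
  obtains r f' where "f' \<in> W" "csym n act \<epsilon> r f' \<noteq> 0"
      "\<And>r' f'. square_sum n r < square_sum n r' \<Longrightarrow> f' \<in> W \<Longrightarrow> csym n act \<epsilon> r' f' = 0"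
proof -
  let ?P = "\<lambda>k. \<exists>r f'. square_sum n r = k \<and> f' \<in> W \<and> csym n act \<epsilon> r f' \<noteq> 0"
  have st: "stab n (\<lambda>x. x) = {id}"
  proof -
    have "s = id" if "s \<in> stab n (\<lambda>x. x)" for s
    proof
      fix x show "s x = id x"
        using that by (cases "x < n") (auto simp: stab_def permutes_def)
    qed
    thus ?thesis using stab_id by auto
  qed
  have "csym n act \<epsilon> (\<lambda>x. x) f = f"
    using e by (simp add: csym_def st act_id character_def)
  hence "?P (square_sum n (\<lambda>x. x))" using f by auto
  hence ne: "Collect ?P \<noteq> {}" by blast
  have "Collect ?P \<subseteq> {..n * n}" using square_sum_le by auto
  hence fin: "finite (Collect ?P)" by (rule finite_subset) simp
  have "Max (Collect ?P) \<in> Collect ?P" using fin ne by (rule Max_in)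
  then obtain r f' where rf: "square_sum n r = Max (Collect ?P)" "f' \<in> W" "csym n act \<epsilon> r f' \<noteq> 0" by auto
  have max: "csym n act \<epsilon> r' g = 0" if "square_sum n r < square_sum n r'" "g \<in> W" for r' g
  proof (rule ccontr)
    assume "csym n act \<epsilon> r' g \<noteq> 0"
    hence "square_sum n r' \<in> Collect ?P" using that(2) by auto
    hence "square_sum n r' \<le> square_sum n r" unfolding rf(1) by (rule Max_ge[OF fin])
    thus False using that(1) by simp
  qed
  show thesis by (rule that[OF rf(2,3) max])
qed

text \<open>
  Take \<open>r\<close> with \<open>square_sum\<close> maximal among the colourings whose symmetrization does not
  annihilate \<open>W\<close>, \<open>v\<close> a symmetrized vector, and \<open>c\<close> maximal for antisymmetrization on the
  representation generated by \<open>v\<close>. The sum of all transpositions acts there by one scalar, which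
  is \<open>square_sum r - min_sum r\<close> by the first choice and \<open>min_sum c - square_sum c\<close> by the
  second. As \<open>square_sum r \<le> min_sum c\<close> and \<open>square_sum c \<le> min_sum r\<close>, both are equalities, and
  \<open>r\<close> and \<open>c\<close> are the rows and columns of a tableau.
\<close>

theorem specht_detects:
  assumes W: "submod n act W" and f0: "f0 \<in> W" "f0 \<noteq> 0"
  shows "\<exists>p t f. p \<in> partitions_of n \<and> is_tableau p t \<and> f \<in> W
      \<and> csym n act csign (snd \<circ> t) (csym n act triv (fst \<circ> t) f) \<noteq> 0"
proof -
  obtain r f1 where r: "f1 \<in> W" "csym n act triv r f1 \<noteq> 0"
      "\<And>r' f'. square_sum n r < square_sum n r' \<Longrightarrow> f' \<in> W \<Longrightarrow> csym n act triv r' f' = 0"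
    using exists_max_sym[OF character_triv W f0] by (metis (no_types, lifting))
  define v where "v = csym n act triv r f1"
  have vW: "v \<in> W" unfolding v_def by (rule csym_in[OF W r(1)])
  have "casimir n act v = cscale (1 * (of_nat (square_sum n r) - of_nat (min_sum n r))) v"
    by (rule maximal_casimir[OF character_triv _ _ W vW]) (auto simp: triv_def v_def csym_act_right[OF character_triv] r(3))
  hence casv: "casimir n act v = cscale (of_nat (square_sum n r) - of_nat (min_sum n r)) v" by simp
  define X where "X = cfun.span ((\<lambda>s. v \<circ> act s) ` {s. s permutes {..<n}})"
  have XG: "submod n act X" unfolding X_def by (rule submod_span_orbit)
  have XW: "X \<subseteq> W" unfolding X_def
    by (rule cfun.span_minimal) (use submodD(1,6)[OF W] vW in auto)
  have vX: "v \<in> X" unfolding X_def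
    by (rule cfun.span_base) (auto intro!: image_eqI[of _ _ id] simp: act_id permutes_id)
  obtain c f2 where c: "f2 \<in> X" "csym n act csign c f2 \<noteq> 0"
      "\<And>r' f'. square_sum n c < square_sum n r' \<Longrightarrow> f' \<in> X \<Longrightarrow> csym n act csign r' f' = 0"
    using exists_max_sym[OF character_csign XG vX] r(2)[folded v_def] by (metis (no_types, lifting))
  define w where "w = csym n act csign c f2"
  have wX: "w \<in> X" unfolding w_def by (rule csym_in[OF XG c(1)])
  have "casimir n act w = cscale (-1 * (of_nat (square_sum n c) - of_nat (min_sum n c))) w"
    by (rule maximal_casimir[OF character_csign _ _ XG wX])
       (auto simp: csign_def sign_swap_id w_def csym_act_right[OF character_csign] c(3))
  moreover have "casimir n act w = cscale (of_nat (square_sum n r) - of_nat (min_sum n r)) w"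
    by (rule casimir_span[OF casv wX[unfolded X_def]])
  ultimately have "cscale (of_nat (square_sum n r) - of_nat (min_sum n r)) w = cscale (-1 * (of_nat (square_sum n c) - of_nat (min_sum n c))) w"
    by simp
  moreover have "w \<noteq> 0" using c(2) by (simp add: w_def)
  ultimately have "of_nat (square_sum n r) - of_nat (min_sum n r) = (-1 * (of_nat (square_sum n c) - of_nat (min_sum n c)) :: complex)"
    by (simp only: cfun.scale_cancel_right) simp
  hence "(of_nat (square_sum n r + square_sum n c) :: complex) = of_nat (min_sum n r + min_sum n c)"
    by (simp add: algebra_simps)
  hence sums: "square_sum n r + square_sum n c = min_sum n r + min_sum n c" using of_nat_eq_iff by blast
  \<comment> \<open>The antisymmetrization is nonzero on some translate of \<open>v\<close>; moving the translation into the
    colouring gives \<open>c'\<close>.\<close>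
  have "\<exists>g. g permutes {..<n} \<and> csym n act csign c (v \<circ> act g) \<noteq> 0"
  proof (rule ccontr)
    assume neg: "\<not> ?thesis"
    have "csym n act csign c f2 = 0"
      using c(1)[unfolded X_def]
    proof (induction rule: cfun.span_induct)
      show "cfun.subspace {f. csym n act csign c f = 0}"
        by (rule cfun.subspaceI) (auto simp: csym_0 csym_add csym_scale)
      show "csym n act csign c f = 0" if "f \<in> (\<lambda>s. v \<circ> act s) ` {s. s permutes {..<n}}" for f
        using neg that by blast
    qed
    thus False using c(2) by simp
  qed
  then obtain g where g: "g permutes {..<n}" "csym n act csign c (v \<circ> act g) \<noteq> 0" by auto
  define c' where "c' = c \<circ> g"
  have ne: "csym n act csign c' v \<noteq> 0"
  proof
    assume "csym n act csign c' v = 0"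
    hence "csym n act csign c (v \<circ> act g) = 0 \<circ> act g"
      using csym_conj[OF character_csign g(1), of c v] by (simp add: c'_def)
    thus False using g(2) by (simp add: fun_eq_iff)
  qed
  have bij: "bij_betw g {..<n} {..<n}" using g(1) by (rule permutes_imp_bij)
  have im: "c' ` {..<n} = c ` {..<n}"
    using permutes_image[OF g(1)] by (metis c'_def image_comp)
  have "card (block n c' i) = card (block n c i)" for i
  proof (rule bij_betw_same_card[of g], rule bij_betw_imageI)
    show "inj_on g (block n c' i)" using permutes_inj[OF g(1)] by (rule inj_on_subset) simp
    show "g ` block n c' i = block n c i"
    proof
      show "block n c i \<subseteq> g ` block n c' i"
      proof
        fix x assume "x \<in> block n c i"
        hence "inv g x \<in> block n c' i" "x = g (inv g x)"
          using permutes_inverses[OF g(1)] permutes_inv_less[OF g(1)] by (auto simp: block_def c'_def)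
        thus "x \<in> g ` block n c' i" by blast
      qed
    qed (use permutes_less[OF g(1)] in \<open>auto simp: block_def c'_def\<close>)
  qed
  hence same: "square_sum n c' = square_sum n c" "min_sum n c' = min_sum n c"
    by (simp_all add: square_sum_def min_sum_def im)
  have inj: "inj_on (\<lambda>x. (r x, c' x)) {..<n}"
  proof (rule inj_onI, rule ccontr)
    fix x y assume xy: "x \<in> {..<n}" "y \<in> {..<n}" "(r x, c' x) = (r y, c' y)" "x \<noteq> y"
    have "swp x y \<in> stab n r" using xy by (intro transpose_stab) auto
    hence "v \<circ> act (swp x y) = v"
      unfolding v_def csym_act_right[OF character_triv \<open>swp x y \<in> stab n r\<close>] by (simp add: triv_def)
    hence "csym n act csign c' v = 0" using asym_zero[of x n y c' v] xy by auto
    thus False using ne by simp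
  qed
  have inj': "inj_on (\<lambda>x. (c' x, r x)) {..<n}" using inj by (auto simp: inj_on_def)
  have "square_sum n r = min_sum n c'"
    using square_sum_le_min_sum(1)[OF inj] square_sum_le_min_sum(1)[OF inj'] sums same by linarith
  from nested_tableau[OF inj this] obtain p t where pt: "p \<in> partitions_of n" "is_tableau p t"
      "\<And>x y. x < n \<Longrightarrow> y < n \<Longrightarrow> fst (t x) = fst (t y) \<longleftrightarrow> r x = r y"
      "\<And>x y. x < n \<Longrightarrow> y < n \<Longrightarrow> snd (t x) = snd (t y) \<longleftrightarrow> c' x = c' y" by blast
  have "csym n act triv (fst \<circ> t) f1 = v" unfolding v_def by (rule csym_cong) (simp add: pt(3))
  moreover have "csym n act csign (snd \<circ> t) v = csym n act csign c' v" by (rule csym_cong) (simp add: pt(4))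
  ultimately show ?thesis using pt(1,2) r(1) ne by metis
qed

end


section \<open>Columns and fillings of a tableau\<close>

definition rowlen :: "nat list \<Rightarrow> nat \<Rightarrow> nat"
  where "rowlen p k = (if k < length p then p ! k else 0)"

lemma rowlen_antimono: "is_partition p \<Longrightarrow> i \<le> j \<Longrightarrow> rowlen p j \<le> rowlen p i"
  by (cases "i = j") (auto simp: rowlen_def is_partition_def sorted_wrt_iff_nth_less)

lemma rowlen_pos: "is_partition p \<Longrightarrow> 0 < rowlen p i \<longleftrightarrow> i < length p"
  by (auto simp: rowlen_def is_partition_def in_set_conv_nth)

lemma partition_eqI:
  assumes p: "is_partition p" and q: "is_partition q" and eq: "rowlen p = rowlen q"
  shows "p = q"
proof -
  have "i < length p \<longleftrightarrow> i < length q" for i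
    using rowlen_pos[OF p, of i] rowlen_pos[OF q, of i] eq by simp
  hence len: "length p = length q" by (metis linorder_neqE_nat order_less_irrefl)
  show ?thesis
  proof (rule nth_equalityI[OF len])
    fix i assume "i < length p"
    thus "p ! i = q ! i" using fun_cong[OF eq, of i] len by (simp add: rowlen_def)
  qed
qed

lemma partitions_ofD: "q \<in> partitions_of n \<Longrightarrow> is_partition q" "q \<in> partitions_of n \<Longrightarrow> sum_list q = n"
  by (simp_all add: partitions_of_def)

lemma diagram_rowlen: "(i, j) \<in> diagram p \<longleftrightarrow> j < rowlen p i"
  by (auto simp: diagram_def rowlen_def)

lemma sum_rowlen: "length p \<le> N \<Longrightarrow> (\<Sum>i<N. rowlen p i) = sum_list p"
proof -
  assume "length p \<le> N"
  hence "(\<Sum>i<N. rowlen p i) = (\<Sum>i<length p. rowlen p i)"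
    by (intro sum.mono_neutral_right) (auto simp: rowlen_def)
  thus ?thesis by (simp add: rowlen_def sum_list_sum_nth atLeast0LessThan)
qed

definition collen :: "nat list \<Rightarrow> nat \<Rightarrow> nat"
  where "collen p j = card {i. j < rowlen p i}"

lemma finite_rows: "finite {i. j < rowlen p i}"
  by (rule finite_subset[of _ "{..<length p}"]) (auto simp: rowlen_def split: if_splits)

lemma less_collen:
  assumes "is_partition p" shows "i < collen p j \<longleftrightarrow> j < rowlen p i"
proof -
  have "{i. j < rowlen p i} = {..<collen p j}"
  proof (rule card_subset_eq[symmetric])
    have dc: "i' \<in> {i. j < rowlen p i}" if "i \<in> {i. j < rowlen p i}" "i' \<le> i" for i i'
      using that rowlen_antimono[OF assms, of i' i] by auto
    show "{..<collen p j} \<subseteq> {i. j < rowlen p i}"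
    proof
      fix k assume k: "k \<in> {..<collen p j}"
      show "k \<in> {i. j < rowlen p i}"
      proof (rule ccontr)
        assume "k \<notin> {i. j < rowlen p i}"
        hence "{i. j < rowlen p i} \<subseteq> {..<k}" using dc by (metis lessThan_iff linorder_not_less subsetI)
        hence "collen p j \<le> k" unfolding collen_def using card_mono[of "{..<k}"] by fastforce
        thus False using k by simp
      qed
    qed
    show "card {..<collen p j} = card {i. j < rowlen p i}" by (simp add: collen_def)
  qed (rule finite_rows)
  thus ?thesis by auto
qed

definition col :: "nat list \<Rightarrow> (nat \<Rightarrow> nat \<times> nat) \<Rightarrow> nat \<Rightarrow> nat set"
  where "col p t j = {x. x < sum_list p \<and> snd (t x) = j}"

lemma finite_col [simp]: "finite (col p t j)" by (simp add: col_def)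

lemma tableau_cell: "is_tableau p t \<Longrightarrow> x < sum_list p \<Longrightarrow> snd (t x) < rowlen p (fst (t x))"
  by (metis bij_betwE diagram_rowlen is_tableau_def lessThan_iff prod.collapse)

lemma tableau_inj: "is_tableau p t \<Longrightarrow> x < sum_list p \<Longrightarrow> y < sum_list p \<Longrightarrow> t x = t y \<Longrightarrow> x = y"
  by (auto simp: is_tableau_def bij_betw_def dest: inj_onD)

lemma tableau_eqI: "is_tableau p t \<Longrightarrow> fst (t x) = fst (t y) \<Longrightarrow> snd (t x) = snd (t y)
    \<Longrightarrow> x < sum_list p \<Longrightarrow> y < sum_list p \<Longrightarrow> x = y"
  by (rule tableau_inj[of p t]) (auto intro: prod_eqI)

lemma tableau_surj: "is_tableau p t \<Longrightarrow> j < rowlen p i \<Longrightarrow> \<exists>x<sum_list p. t x = (i, j)"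
  by (metis (no_types, lifting) bij_betw_def diagram_rowlen imageE is_tableau_def lessThan_iff)

lemma col_rows:
  assumes "is_partition p" "is_tableau p t"
  shows "bij_betw (\<lambda>x. fst (t x)) (col p t j) {..<collen p j}"
proof (rule bij_betw_imageI)
  show "inj_on (\<lambda>x. fst (t x)) (col p t j)"
    by (rule inj_onI, rule tableau_eqI[OF assms(2)]) (auto simp: col_def)
  show "(\<lambda>x. fst (t x)) ` col p t j = {..<collen p j}"
  proof
    show "{..<collen p j} \<subseteq> (\<lambda>x. fst (t x)) ` col p t j"
    proof
      fix i assume "i \<in> {..<collen p j}"
      hence "j < rowlen p i" by (simp add: less_collen[OF assms(1)])
      from tableau_surj[OF assms(2) this] show "i \<in> (\<lambda>x. fst (t x)) ` col p t j"
        by (force simp: col_def)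
    qed
  qed (use tableau_cell[OF assms(2)] in \<open>auto simp: col_def less_collen[OF assms(1)]\<close>)
qed

lemma sum_cols: "(\<Sum>x<sum_list p. h x) = (\<Sum>j\<in>(\<lambda>x. snd (t x)) ` {..<sum_list p}. \<Sum>x\<in>col p t j. h x)"
  unfolding col_def using sum.image_gen[of "{..<sum_list p}" h "\<lambda>x. snd (t x)"] by (simp add: lessThan_def)

lemma card_col: "is_partition p \<Longrightarrow> is_tableau p t \<Longrightarrow> card (col p t j) = collen p j"
  using bij_betw_same_card[OF col_rows] by simp

text \<open>
  Measure everything against the threshold \<open>\<theta>\<close>, the weight of the \<open>l\<close>-th heaviest element: \<open>A\<close>
  loses the elements above \<open>\<theta>\<close> that it misses and those below \<open>\<theta>\<close> that it contains.
\<close>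

lemma top_sum:
  fixes z :: "'g \<Rightarrow> int"
  assumes k: "bij_betw \<kappa> {..<N} \<Gamma>" and anti: "\<forall>i j. i \<le> j \<longrightarrow> j < N \<longrightarrow> z (\<kappa> j) \<le> z (\<kappa> i)"
    and A: "A \<subseteq> \<Gamma>" "card A = l"
  shows "(\<Sum>g\<in>A. z g) \<le> (\<Sum>k<l. z (\<kappa> k))"
    and "(\<Sum>g\<in>A. z g) = (\<Sum>k<l. z (\<kappa> k)) \<Longrightarrow> 0 < l
      \<Longrightarrow> (\<forall>g\<in>\<Gamma>. z (\<kappa> (l - 1)) < z g \<longrightarrow> g \<in> A) \<and> (\<forall>g\<in>A. z (\<kappa> (l - 1)) \<le> z g)"
proof -
  have fG: "finite \<Gamma>" using bij_betw_finite[OF k] by simp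
  have fA: "finite A" using A(1) fG by (rule finite_subset)
  have lN: "l \<le> N" using card_mono[OF fG A(1)] A(2) bij_betw_same_card[OF k] by simp
  have main: "(\<Sum>g\<in>A. z g) \<le> (\<Sum>k<l. z (\<kappa> k)) \<and> ((\<Sum>g\<in>A. z g) = (\<Sum>k<l. z (\<kappa> k))
      \<longrightarrow> (\<forall>g\<in>\<Gamma>. z (\<kappa> (l - 1)) < z g \<longrightarrow> g \<in> A) \<and> (\<forall>g\<in>A. z (\<kappa> (l - 1)) \<le> z g))" if l: "0 < l"
  proof -
    define \<theta> where "\<theta> = z (\<kappa> (l - 1))"
    let ?B = "{g\<in>\<Gamma>. \<theta> < z g}"
    have inj: "inj_on \<kappa> {..<l}" using bij_betw_imp_inj_on[OF k] by (rule inj_on_subset) (use lN in auto)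
    have B: "?B \<subseteq> \<kappa> ` {..<l}"
    proof
      fix g assume g: "g \<in> ?B"
      then obtain i where i: "i < N" "g = \<kappa> i" using bij_betw_imp_surj_on[OF k] by auto
      have "i < l"
      proof (rule ccontr)
        assume "\<not> i < l"
        hence "z (\<kappa> i) \<le> \<theta>" unfolding \<theta>_def using i l by (intro anti[rule_format]) auto
        thus False using g i by simp
      qed
      thus "g \<in> \<kappa> ` {..<l}" using i by auto
    qed
    have ge: "\<theta> \<le> z (\<kappa> i)" if "i < l" for i
      unfolding \<theta>_def by (rule anti[rule_format]) (use that lN in auto)
    have kG: "\<kappa> ` {..<l} \<subseteq> \<Gamma>" using bij_betwE[OF k] lN by auto
    have 1: "(\<Sum>k<l. z (\<kappa> k) - \<theta>) = (\<Sum>g\<in>?B. z g - \<theta>)"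
    proof -
      have "(\<Sum>k<l. z (\<kappa> k) - \<theta>) = (\<Sum>g\<in>\<kappa> ` {..<l}. z g - \<theta>)"
        by (simp add: sum.reindex[OF inj])
      also have "\<dots> = (\<Sum>g\<in>?B. z g - \<theta>)"
        by (rule sum.mono_neutral_right) (use B ge kG in \<open>fastforce+\<close>)
      finally show ?thesis .
    qed
    have 2: "(\<Sum>g\<in>A. z g - \<theta>) = (\<Sum>g\<in>A \<inter> ?B. z g - \<theta>) + (\<Sum>g\<in>A - ?B. z g - \<theta>)"
      using fA by (simp add: sum.Int_Diff)
    have 3: "(\<Sum>g\<in>?B. z g - \<theta>) = (\<Sum>g\<in>A \<inter> ?B. z g - \<theta>) + (\<Sum>g\<in>?B - A. z g - \<theta>)"
      using fG sum.Int_Diff[of ?B "\<lambda>g. z g - \<theta>" A] by (simp add: Int_commute)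
    have 4: "(\<Sum>g\<in>A - ?B. z g - \<theta>) \<le> 0" by (rule sum_nonpos) (use A(1) in auto)
    have 5: "(\<Sum>g\<in>?B - A. z g - \<theta>) \<ge> 0" by (rule sum_nonneg) auto
    have diff: "(\<Sum>k<l. z (\<kappa> k)) - (\<Sum>g\<in>A. z g) = (\<Sum>g\<in>?B - A. z g - \<theta>) - (\<Sum>g\<in>A - ?B. z g - \<theta>)"
    proof -
      have "(\<Sum>k<l. z (\<kappa> k) - \<theta>) - (\<Sum>g\<in>A. z g - \<theta>) = (\<Sum>k<l. z (\<kappa> k)) - (\<Sum>g\<in>A. z g)"
        using A(2) by (simp add: sum_subtractf)
      thus ?thesis using 1 2 3 by linarith
    qed
    have "(\<forall>g\<in>\<Gamma>. \<theta> < z g \<longrightarrow> g \<in> A) \<and> (\<forall>g\<in>A. \<theta> \<le> z g)" if "(\<Sum>g\<in>A. z g) = (\<Sum>k<l. z (\<kappa> k))"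
    proof
      have 6: "(\<Sum>g\<in>?B - A. z g - \<theta>) = 0" "(\<Sum>g\<in>A - ?B. z g - \<theta>) = 0" using diff 4 5 that by linarith+
      have "z g - \<theta> = 0" if "g \<in> ?B - A" for g
        using sum_nonneg_0[OF _ _ 6(1), of g] fG that by auto
      thus "\<forall>g\<in>\<Gamma>. \<theta> < z g \<longrightarrow> g \<in> A" by fastforce
      have 7: "(\<Sum>g\<in>A - ?B. \<theta> - z g) = 0" using 6(2) by (simp add: sum_subtractf)
      have "\<theta> - z g = 0" if "g \<in> A - ?B" for g
      proof (rule sum_nonneg_0[of "A - ?B" "\<lambda>g. \<theta> - z g"])
        show "0 \<le> \<theta> - z i" if "i \<in> A - ?B" for i using that A(1) by auto
      qed (use fA that 7 in auto)
      hence "\<theta> \<le> z g" if "g \<in> A" for g using that A(1) by (cases "\<theta> < z g") fastforce+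
      thus "\<forall>g\<in>A. \<theta> \<le> z g" by blast
    qed
    thus ?thesis using diff 4 5 unfolding \<theta>_def by linarith
  qed
  show "(\<Sum>g\<in>A. z g) \<le> (\<Sum>k<l. z (\<kappa> k))"
    using main A fA by (cases "l = 0") auto
  show "(\<Sum>g\<in>A. z g) = (\<Sum>k<l. z (\<kappa> k)) \<Longrightarrow> 0 < l
      \<Longrightarrow> (\<forall>g\<in>\<Gamma>. z (\<kappa> (l - 1)) < z g \<longrightarrow> g \<in> A) \<and> (\<forall>g\<in>A. z (\<kappa> (l - 1)) \<le> z g)"
    using main by blast
qed

text \<open>
  Fillings \<open>w\<close> of a tableau without repetition in a column: those that survive
  antisymmetrization over the columns.
\<close>

definition column_inj :: "nat list \<Rightarrow> (nat \<Rightarrow> nat \<times> nat) \<Rightarrow> (nat \<Rightarrow> 'g) \<Rightarrow> bool"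
  where "column_inj p t w \<longleftrightarrow> (\<forall>x<sum_list p. \<forall>y<sum_list p. snd (t x) = snd (t y) \<longrightarrow> w x = w y \<longrightarrow> x = y)"

lemma column_inj_inj_on: "column_inj p t w \<Longrightarrow> inj_on w (col p t j)"
  by (rule inj_onI) (auto simp: column_inj_def col_def)

text \<open>
  The bound of \<open>top_sum\<close>, summed over the columns. Equality of the totals is equality in each
  column.
\<close>

lemma filling_bound:
  fixes z :: "'g \<Rightarrow> int"
  assumes p: "is_partition p" and t: "is_tableau p t"
    and k: "bij_betw \<kappa> {..<N} \<Gamma>" and anti: "\<forall>i j. i \<le> j \<longrightarrow> j < N \<longrightarrow> z (\<kappa> j) \<le> z (\<kappa> i)"
    and w: "\<forall>x<sum_list p. w x \<in> \<Gamma>" and inj: "column_inj p t w"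
  shows "length p \<le> N"
    and "(\<Sum>x<sum_list p. z (w x)) \<le> (\<Sum>x<sum_list p. z (\<kappa> (fst (t x))))"
    and "(\<Sum>x<sum_list p. z (w x)) = (\<Sum>x<sum_list p. z (\<kappa> (fst (t x)))) \<Longrightarrow> 0 < collen p j
      \<Longrightarrow> (\<forall>g\<in>\<Gamma>. z (\<kappa> (collen p j - 1)) < z g \<longrightarrow> g \<in> w ` col p t j)
        \<and> (\<forall>g\<in>w ` col p t j. z (\<kappa> (collen p j - 1)) \<le> z g)"
proof -
  let ?J = "(\<lambda>x. snd (t x)) ` {..<sum_list p}"
  have fG: "finite \<Gamma>" using bij_betw_finite[OF k] by simp
  have cA: "card (w ` col p t j) = collen p j" for j
    using card_image[OF column_inj_inj_on[OF inj]] card_col[OF p t] by simp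
  have AG: "w ` col p t j \<subseteq> \<Gamma>" for j using w by (auto simp: col_def)
  show "length p \<le> N"
  proof -
    have "length p = collen p 0"
      unfolding collen_def rowlen_pos[OF p] by simp
    also have "\<dots> \<le> card \<Gamma>" unfolding cA[symmetric] by (rule card_mono[OF fG AG])
    finally show ?thesis using bij_betw_same_card[OF k] by simp
  qed
  have L: "(\<Sum>x\<in>col p t j. z (w x)) = (\<Sum>g\<in>w ` col p t j. z g)" for j
    by (simp add: sum.reindex[OF column_inj_inj_on[OF inj]])
  have R: "(\<Sum>x\<in>col p t j. z (\<kappa> (fst (t x)))) = (\<Sum>k<collen p j. z (\<kappa> k))" for j
    using sum.reindex_bij_betw[OF col_rows[OF p t], of "\<lambda>k. z (\<kappa> k)"] .
  have le: "(\<Sum>x\<in>col p t j. z (w x)) \<le> (\<Sum>x\<in>col p t j. z (\<kappa> (fst (t x))))" for j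
    unfolding L R by (rule top_sum(1)[where z = z, OF k anti AG cA])
  show "(\<Sum>x<sum_list p. z (w x)) \<le> (\<Sum>x<sum_list p. z (\<kappa> (fst (t x))))"
    unfolding sum_cols[of _ p t] by (rule sum_mono[OF le])
  assume eq: "(\<Sum>x<sum_list p. z (w x)) = (\<Sum>x<sum_list p. z (\<kappa> (fst (t x))))" and pos: "0 < collen p j"
  have jJ: "j \<in> ?J"
  proof -
    have "col p t j \<noteq> {}" using pos card_col[OF p t, of j] by auto
    thus ?thesis by (auto simp: col_def)
  qed
  have "(\<Sum>x\<in>col p t j. z (w x)) = (\<Sum>x\<in>col p t j. z (\<kappa> (fst (t x))))"
    by (rule sum_mono_inv[OF eq[unfolded sum_cols[of _ p t]] le jJ]) simp
  thus "(\<forall>g\<in>\<Gamma>. z (\<kappa> (collen p j - 1)) < z g \<longrightarrow> g \<in> w ` col p t j)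
        \<and> (\<forall>g\<in>w ` col p t j. z (\<kappa> (collen p j - 1)) \<le> z g)"
    unfolding L R using top_sum(2)[where z = z, OF k anti AG cA _ pos] by blast
qed

text \<open>
  The special case of entries \<open>{..<a}\<close> with strictly decreasing weights: the shape dominates the
  content, and equality of one weighted sum already forces each column to be an initial segment.
\<close>

lemma content_dominated:
  fixes xw :: "nat \<Rightarrow> int"
  assumes p: "is_partition p" and t: "is_tableau p t"
    and anti: "\<forall>i j. i < j \<longrightarrow> j < a \<longrightarrow> xw j < xw i"
    and U: "\<forall>x<sum_list p. U x < a" and inj: "column_inj p t U"
  shows "length p \<le> a"
    and "(\<Sum>x<sum_list p. xw (U x)) \<le> (\<Sum>x<sum_list p. xw (fst (t x)))"
    and "(\<Sum>x<sum_list p. xw (U x)) = (\<Sum>x<sum_list p. xw (fst (t x))) \<Longrightarrow> U ` col p t j = {..<collen p j}"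
    and "(\<Sum>x<sum_list p. xw (U x)) = (\<Sum>x<sum_list p. xw (fst (t x))) \<Longrightarrow> card {x. x < sum_list p \<and> U x = i} = rowlen p i"
proof -
  have k: "bij_betw (\<lambda>i. i) {..<a} {..<a}" by (simp add: bij_betw_def)
  have anti': "\<forall>i j. i \<le> j \<longrightarrow> j < a \<longrightarrow> xw j \<le> xw i"
    using anti by (metis order_le_less order_less_imp_le)
  have U': "\<forall>x<sum_list p. U x \<in> {..<a}" using U by simp
  note fb = filling_bound[where z = xw, OF p t k anti' U' inj]
  show len: "length p \<le> a" by (rule fb(1))
  show "(\<Sum>x<sum_list p. xw (U x)) \<le> (\<Sum>x<sum_list p. xw (fst (t x)))" by (rule fb(2))
  have img: "U ` col p t j = {..<collen p j}" if eq: "(\<Sum>x<sum_list p. xw (U x)) = (\<Sum>x<sum_list p. xw (fst (t x)))" for j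
  proof (cases "0 < collen p j")
    case True
    have cl: "collen p j \<le> a"
    proof -
      have "{..<collen p j} \<subseteq> {..<length p}"
        using less_collen[OF p] rowlen_pos[OF p] by (metis gr_zeroI lessThan_iff not_less0 subsetI)
      thus ?thesis using len by simp
    qed
    have "U ` col p t j \<subseteq> {..<collen p j}"
    proof
      fix g assume g: "g \<in> U ` col p t j"
      hence "xw (collen p j - 1) \<le> xw g" "g < a" using fb(3)[OF eq True] U by (auto simp: col_def)
      hence "\<not> collen p j - 1 < g" using anti by (meson linorder_not_le)
      thus "g \<in> {..<collen p j}" using True by auto
    qed
    moreover have "card (U ` col p t j) = collen p j"
      using card_image[OF column_inj_inj_on[OF inj]] card_col[OF p t] by simp
    ultimately show ?thesis by (intro card_subset_eq) auto
  next
    case False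
    hence "col p t j = {}" using card_col[OF p t, of j] by (metis card_0_eq finite_col gr0I)
    thus ?thesis using False by simp
  qed
  assume eq: "(\<Sum>x<sum_list p. xw (U x)) = (\<Sum>x<sum_list p. xw (fst (t x)))"
  show "U ` col p t j = {..<collen p j}" by (rule img[OF eq])
  have "bij_betw (\<lambda>x. snd (t x)) {x. x < sum_list p \<and> U x = i} {..<rowlen p i}"
  proof (rule bij_betw_imageI)
    show "inj_on (\<lambda>x. snd (t x)) {x. x < sum_list p \<and> U x = i}"
      by (rule inj_onI) (use inj in \<open>auto simp: column_inj_def\<close>)
    show "(\<lambda>x. snd (t x)) ` {x. x < sum_list p \<and> U x = i} = {..<rowlen p i}"
    proof (intro equalityI subsetI)
      fix j assume "j \<in> (\<lambda>x. snd (t x)) ` {x. x < sum_list p \<and> U x = i}"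
      hence "i \<in> U ` col p t j" by (auto simp: col_def)
      thus "j \<in> {..<rowlen p i}" using img[OF eq] less_collen[OF p] by auto
    next
      fix j assume "j \<in> {..<rowlen p i}"
      hence "i \<in> U ` col p t j" using img[OF eq] less_collen[OF p] by auto
      thus "j \<in> (\<lambda>x. snd (t x)) ` {x. x < sum_list p \<and> U x = i}" by (auto simp: col_def)
    qed
  qed
  thus "card {x. x < sum_list p \<and> U x = i} = rowlen p i" using bij_betw_same_card by fastforce
qed

lemma content_sum:
  fixes U :: "nat \<Rightarrow> nat"
  assumes "\<And>x. x < n \<Longrightarrow> U x < a"
  shows "(\<Sum>x<n. h (U x)) = (\<Sum>i<a. of_nat (card {x. x < n \<and> U x = i}) * (h i :: 'r::semiring_1))"
proof -
  have "(\<Sum>x<n. h (U x)) = (\<Sum>x<n. \<Sum>i<a. if U x = i then h i else 0)"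
    using assms by (intro sum.cong refl) (subst sum.delta', auto)
  also have "\<dots> = (\<Sum>i<a. \<Sum>x<n. if U x = i then h i else 0)" by (rule sum.swap)
  also have "\<dots> = (\<Sum>i<a. of_nat (card {x. x < n \<and> U x = i}) * h i)"
    by (intro sum.cong refl) (simp add: sum.If_cases Int_def)
  finally show ?thesis .
qed

lemma row_content:
  assumes "is_tableau p t" shows "card {x. x < sum_list p \<and> fst (t x) = i} = rowlen p i"
proof -
  have "bij_betw (\<lambda>x. snd (t x)) {x. x < sum_list p \<and> fst (t x) = i} {..<rowlen p i}"
  proof (rule bij_betw_imageI)
    show "inj_on (\<lambda>x. snd (t x)) {x. x < sum_list p \<and> fst (t x) = i}"
      by (rule inj_onI, rule tableau_eqI[OF assms]) auto
    show "(\<lambda>x. snd (t x)) ` {x. x < sum_list p \<and> fst (t x) = i} = {..<rowlen p i}"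
    proof
      show "{..<rowlen p i} \<subseteq> (\<lambda>x. snd (t x)) ` {x. x < sum_list p \<and> fst (t x) = i}"
        using tableau_surj[OF assms] by force
    qed (use tableau_cell[OF assms] in auto)
  qed
  thus ?thesis using bij_betw_same_card by fastforce
qed

lemma row_less: "is_tableau p t \<Longrightarrow> x < sum_list p \<Longrightarrow> fst (t x) < length p"
  using tableau_cell[of p t x] by (auto simp: rowlen_def split: if_splits)

lemma row_sum:
  assumes "is_tableau p t" "length p \<le> N"
  shows "(\<Sum>x<sum_list p. h (fst (t x))) = (\<Sum>i<N. of_nat (rowlen p i) * (h i :: 'r::semiring_1))"
proof -
  have "fst (t x) < N" if "x < sum_list p" for x using row_less[OF assms(1) that] assms(2) by simp
  from content_sum[of "sum_list p" "\<lambda>x. fst (t x)" N h, OF this] show ?thesis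
    by (simp add: row_content[OF assms(1)])
qed

lemma same_image_permutes:
  assumes "inj_on \<phi> {..<n::nat}" "inj_on \<psi> {..<n}" "\<phi> ` {..<n} = \<psi> ` {..<n}"
  shows "\<exists>s. s permutes {..<n} \<and> (\<forall>x<n. \<phi> (s x) = \<psi> x)"
proof -
  have "image_mset \<psi> (mset_set {..<n}) = image_mset \<phi> (mset_set {..<n})"
    using assms by (simp add: image_mset_mset_set)
  from image_mset_eq_implies_permutes[OF finite_lessThan this] obtain s
    where "s permutes {..<n}" "\<forall>x\<in>{..<n}. \<psi> x = \<phi> (s x)" by blast
  thus ?thesis by (intro exI[of _ s]) auto
qed

lemma content_permutes:
  assumes "\<And>i. card {x. x < (n::nat) \<and> \<phi> x = i} = card {x. x < n \<and> \<psi> x = i}"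
  shows "\<exists>s. s permutes {..<n} \<and> (\<forall>x<n. \<phi> (s x) = \<psi> x)"
proof -
  have "image_mset \<psi> (mset_set {..<n}) = image_mset \<phi> (mset_set {..<n})"
  proof (rule multiset_eqI)
    fix i
    have "count (image_mset h (mset_set {..<n})) i = card {x. x < n \<and> h x = i}" for h :: "nat \<Rightarrow> 'a"
      by (simp add: count_image_mset vimage_def Int_def conj_commute)
    thus "count (image_mset \<psi> (mset_set {..<n})) i = count (image_mset \<phi> (mset_set {..<n})) i"
      using assms by simp
  qed
  from image_mset_eq_implies_permutes[OF finite_lessThan this] obtain s
    where "s permutes {..<n}" "\<forall>x\<in>{..<n}. \<psi> x = \<phi> (s x)" by blast
  thus ?thesis by (intro exI[of _ s]) auto
qed

section \<open>Tabloids\<close>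

definition nact :: "(nat \<Rightarrow> nat) \<Rightarrow> (nat \<Rightarrow> nat) \<Rightarrow> nat \<Rightarrow> nat"
  where "nact s = (\<lambda>T. T \<circ> s)"

global_interpretation nact: right_action nact
  by unfold_locales (auto simp: nact_def fun_eq_iff)

definition tabs :: "nat list \<Rightarrow> (nat \<Rightarrow> nat) set"
  where "tabs p = {tabloid p t | t. is_tableau p t}"

lemma ext_comp: "s permutes {..<n} \<Longrightarrow> T \<in> extensional {..<n} \<Longrightarrow> T \<circ> s \<in> extensional {..<n::nat}"
  by (auto simp: extensional_def permutes_def)

lemma tableau_comp: "is_tableau p t \<Longrightarrow> g permutes {..<sum_list p} \<Longrightarrow> is_tableau p (t \<circ> g)"
  unfolding is_tableau_def by (rule bij_betw_trans[OF permutes_imp_bij])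

lemma tabloid_comp: "g permutes {..<sum_list p} \<Longrightarrow> tabloid p (t \<circ> g) = tabloid p t \<circ> g"
  using permutes_in_image[of g "{..<sum_list p}"] by (auto simp: tabloid_def fun_eq_iff restrict_def)

lemma tableau_exists: "\<exists>t. is_tableau p t"
  unfolding is_tableau_def using finite_same_card_bij[of "{..<sum_list p}" "diagram p"]
  by (simp add: finite_diagram card_diagram)

lemma tableau_rel:
  assumes "is_tableau p t" "is_tableau p t'"
  shows "\<exists>g. g permutes {..<sum_list p} \<and> (\<forall>x<sum_list p. t' x = t (g x))"
  using same_image_permutes[of t "sum_list p" t'] assms unfolding is_tableau_def bij_betw_def by metis

lemma tabs_content:
  assumes "T \<in> tabs p"
  shows "T \<in> extensional {..<sum_list p}" "card {x. x < sum_list p \<and> T x = i} = rowlen p i"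
proof -
  obtain t where t: "is_tableau p t" "T = tabloid p t" using assms by (auto simp: tabs_def)
  show "T \<in> extensional {..<sum_list p}" by (simp add: t(2) tabloid_def)
  have "{x. x < sum_list p \<and> T x = i} = {x. x < sum_list p \<and> fst (t x) = i}"
    by (auto simp: t(2) tabloid_def)
  thus "card {x. x < sum_list p \<and> T x = i} = rowlen p i" using row_content[OF t(1)] by simp
qed

lemma tabs_less: "T \<in> tabs p \<Longrightarrow> x < sum_list p \<Longrightarrow> T x < length p"
  by (auto simp: tabs_def tabloid_def row_less)

text \<open>
  This allows tabloids to be constructed by counting.
\<close>

lemma tabs_iff: "T \<in> tabs p \<longleftrightarrow> T \<in> extensional {..<sum_list p} \<and> (\<forall>i. card {x. x < sum_list p \<and> T x = i} = rowlen p i)"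
proof
  assume T: "T \<in> extensional {..<sum_list p} \<and> (\<forall>i. card {x. x < sum_list p \<and> T x = i} = rowlen p i)"
  obtain t where t: "is_tableau p t" using tableau_exists by blast
  obtain s where s: "s permutes {..<sum_list p}" "\<And>x. x < sum_list p \<Longrightarrow> fst (t (s x)) = T x"
    using content_permutes[of "sum_list p" "\<lambda>x. fst (t x)" T] T row_content[OF t] by auto
  have "T = tabloid p (t \<circ> s)"
    using T s(2) by (auto simp: tabloid_def fun_eq_iff restrict_def extensional_def)
  thus "T \<in> tabs p" using tableau_comp[OF t s(1)] by (auto simp: tabs_def)
qed (use tabs_content in blast)

lemma tabs_comp: "T \<in> tabs p \<Longrightarrow> s permutes {..<sum_list p} \<Longrightarrow> T \<circ> s \<in> tabs p"
  unfolding tabs_def using tabloid_comp tableau_comp by (smt (verit) mem_Collect_eq)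

lemma finite_tabs: "finite (tabs p)"
proof (rule finite_subset)
  show "tabs p \<subseteq> {..<sum_list p} \<rightarrow>\<^sub>E {..<length p}"
    using tabs_content(1) tabs_less by (auto simp: PiE_def)
qed (simp add: finite_PiE)

lemma tabs_bij:
  assumes s: "s permutes {..<sum_list p}" shows "bij_betw (\<lambda>T. T \<circ> s) (tabs p) (tabs p)"
  by (rule bij_betw_byWitness[where f' = "\<lambda>T. T \<circ> inv s"])
     (use tabs_comp s permutes_inv[OF s] in \<open>auto simp: comp_assoc permutes_inv_o[OF s]\<close>)


section \<open>Specht modules\<close>

definition delta :: "'x \<Rightarrow> 'x \<Rightarrow> complex"
  where "delta T = (\<lambda>T'. of_bool (T' = T))"

abbreviation ncsym where "ncsym n \<equiv> csym n nact"

definition supp_on :: "'x set \<Rightarrow> ('x \<Rightarrow> complex) set"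
  where "supp_on X = {f. \<forall>x. x \<notin> X \<longrightarrow> f x = 0}"

lemma supp_on_subspace: "cfun.subspace (supp_on X)"
  by (rule cfun.subspaceI) (auto simp: supp_on_def cscale_def)

lemma delta_nact: "s permutes {..<n} \<Longrightarrow> delta T \<circ> nact s = delta (T \<circ> inv s)"
proof -
  assume s: "s permutes {..<n}"
  have "T' \<circ> s = T \<longleftrightarrow> T' = T \<circ> inv s" for T'
    using permutes_inv_o[OF s] by (metis comp_assoc comp_id)
  thus ?thesis by (simp add: delta_def nact_def fun_eq_iff)
qed

lemma column_stab: "column_stabilizer p t = stab (sum_list p) (snd \<circ> t)"
  by (simp add: column_stabilizer_def stab_def)

text \<open>
  The polytabloid is the antisymmetrization of its tabloid, so that everything known about
  \<open>csym\<close> applies to it.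
\<close>

lemma polytabloid_csym: "polytabloid p t = ncsym (sum_list p) csign (snd \<circ> t) (delta (tabloid p t))"
proof
  fix T
  have "T \<circ> s = tabloid p t \<longleftrightarrow> T = tabloid p t \<circ> inv s" if "s \<in> stab (sum_list p) (snd \<circ> t)" for s
    using permutes_inv_o[OF stab_permutes[OF that]] by (metis comp_assoc comp_id)
  thus "polytabloid p t T = ncsym (sum_list p) csign (snd \<circ> t) (delta (tabloid p t)) T"
    unfolding polytabloid_def csym_def column_stab
    by (intro sum.cong) (auto simp: csign_def delta_def nact_def)
qed

lemma polytabloid_cong:
  assumes "\<And>x. x < sum_list p \<Longrightarrow> t x = t' x" shows "polytabloid p t = polytabloid p t'"
proof -
  have "tabloid p t = tabloid p t'" using assms by (auto simp: tabloid_def fun_eq_iff restrict_def)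
  moreover have "ncsym (sum_list p) csign (snd \<circ> t) f = ncsym (sum_list p) csign (snd \<circ> t') f" for f
    by (rule csym_cong) (simp add: assms)
  ultimately show ?thesis by (simp add: polytabloid_csym)
qed

lemma polytabloid_comp:
  assumes g: "g permutes {..<sum_list p}"
  shows "polytabloid p (t \<circ> g) = polytabloid p t \<circ> nact (inv g)"
proof -
  have "delta (tabloid p t \<circ> g) = delta (tabloid p t) \<circ> nact (inv g)"
    using delta_nact[OF permutes_inv[OF g]] permutes_inv_inv[OF g] by simp
  moreover have "snd \<circ> (t \<circ> g) \<circ> inv g = snd \<circ> t"
    by (simp add: comp_assoc permutes_inv_o[OF g])
  ultimately show ?thesis
    unfolding polytabloid_csym tabloid_comp[OF g]
    using nact.csym_conj[OF character_csign permutes_inv[OF g], of "snd \<circ> (t \<circ> g)" "delta (tabloid p t)"]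
    by simp
qed

lemma tabloid_in: "is_tableau p t \<Longrightarrow> tabloid p t \<in> tabs p"
  by (auto simp: tabs_def)

lemma submod_supp: "submod (sum_list p) nact (supp_on (tabs p))"
  unfolding submod_def
proof (intro conjI allI impI ballI supp_on_subspace)
  fix s f assume s: "s permutes {..<sum_list p}" and f: "f \<in> supp_on (tabs p)"
  have "T \<in> tabs p" if "T \<circ> s \<in> tabs p" for T
  proof -
    have "T = T \<circ> s \<circ> inv s" by (simp add: comp_assoc permutes_inv_o[OF s])
    thus ?thesis using tabs_comp[OF that permutes_inv[OF s]] by simp
  qed
  thus "f \<circ> nact s \<in> supp_on (tabs p)" using f by (auto simp: supp_on_def nact_def)
qed

lemma delta_supp: "T \<in> X \<Longrightarrow> delta T \<in> supp_on X"
  by (auto simp: supp_on_def delta_def)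

lemma polytabloid_supp: "is_tableau p t \<Longrightarrow> polytabloid p t \<in> supp_on (tabs p)"
  unfolding polytabloid_csym by (intro csym_in[OF submod_supp] delta_supp tabloid_in)

lemma specht_supp: "specht p \<subseteq> supp_on (tabs p)"
  unfolding specht_def by (rule cfun.span_minimal) (auto simp: polytabloid_supp supp_on_subspace)

lemma polytabloid_specht: "is_tableau p t \<Longrightarrow> polytabloid p t \<in> specht p"
  unfolding specht_def by (rule cfun.span_base) auto

lemma submod_specht: "submod (sum_list p) nact (specht p)"
  unfolding specht_def
proof (rule submod_span)
  fix s x assume s: "s permutes {..<sum_list p}" and "x \<in> {polytabloid p t |t. is_tableau p t}"
  then obtain t where t: "is_tableau p t" "x = polytabloid p t" by blast
  have "x \<circ> nact s = polytabloid p (t \<circ> inv s)"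
    using polytabloid_comp[OF permutes_inv[OF s], of t] permutes_inv_inv[OF s] t(2) by simp
  thus "x \<circ> nact s \<in> cfun.span {polytabloid p t |t. is_tableau p t}"
    using tableau_comp[OF t(1) permutes_inv[OF s]] by (auto intro: cfun.span_base)
qed

text \<open>
  If two entries of a column of \<open>t\<close> lie in one row of \<open>T\<close>, the result is zero. Otherwise \<open>T\<close> is
  a filling of \<open>t\<close> with the content of its own shape, so equality holds in \<open>content_dominated\<close>,
  and \<open>T\<close> is a column permutation of the tabloid of \<open>t\<close>.
\<close>

lemma asym_tabloid:
  assumes p: "is_partition p" and t: "is_tableau p t" and T: "T \<in> tabs p"
  shows "\<exists>k. ncsym (sum_list p) csign (snd \<circ> t) (delta T) = cscale k (polytabloid p t)"
proof (cases "column_inj p t T")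
  case False
  then obtain x y where xy: "x < sum_list p" "y < sum_list p" "snd (t x) = snd (t y)" "T x = T y" "x \<noteq> y"
    by (auto simp: column_inj_def)
  have "delta T \<circ> nact (swp x y) = delta T"
  proof -
    have sw: "swp x y permutes {..<sum_list p}" using xy by (intro permutes_swap_id) auto
    have "T \<circ> swp x y = T" using xy(4) by (auto simp: fun_eq_iff Transposition.transpose_def)
    thus ?thesis using delta_nact[OF sw, of T] by simp
  qed
  hence "ncsym (sum_list p) csign (snd \<circ> t) (delta T) = 0"
    using xy by (intro nact.asym_zero[of x _ y]) auto
  thus ?thesis by (intro exI[of _ 0]) (simp add: cscale_def fun_eq_iff)
next
  case True
  let ?n = "sum_list p" and ?xw = "\<lambda>k. - int k"
  have lt: "\<forall>x<?n. T x < length p" using tabs_less[OF T] by blast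
  have anti: "\<forall>i j. i < j \<longrightarrow> j < length p \<longrightarrow> ?xw j < ?xw i" by simp
  have eq: "(\<Sum>x<?n. ?xw (T x)) = (\<Sum>x<?n. ?xw (fst (t x)))"
  proof -
    have "(\<Sum>x<?n. ?xw (T x)) = (\<Sum>i<length p. of_nat (rowlen p i) * ?xw i)"
      using content_sum[of ?n T "length p" ?xw] lt by (simp add: tabs_content(2)[OF T])
    thus ?thesis using row_sum[OF t order.refl, of ?xw] by simp
  qed
  note img = content_dominated(3)[OF p t anti lt True eq]
  have "\<exists>s. s permutes {..<?n} \<and> (\<forall>x<?n. (snd (t (s x)), T (s x)) = (snd (t x), fst (t x)))"
  proof (rule same_image_permutes[of "\<lambda>x. (snd (t x), T x)" _ "\<lambda>x. (snd (t x), fst (t x))"])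
    show "inj_on (\<lambda>x. (snd (t x), T x)) {..<?n}"
      by (rule inj_onI) (use True in \<open>auto simp: column_inj_def\<close>)
    show "inj_on (\<lambda>x. (snd (t x), fst (t x))) {..<?n}"
      by (rule inj_onI, rule tableau_eqI[OF t]) auto
    have 1: "(\<lambda>x. (snd (t x), U x)) ` {..<?n} = (SIGMA j:UNIV. U ` col p t j)" for U :: "nat \<Rightarrow> nat"
      by (auto simp: col_def)
    have "(\<lambda>x. fst (t x)) ` col p t j = {..<collen p j}" for j
      using col_rows[OF p t] by (simp add: bij_betw_def)
    thus "(\<lambda>x. (snd (t x), T x)) ` {..<?n} = (\<lambda>x. (snd (t x), fst (t x))) ` {..<?n}"
      unfolding 1 using img by simp
  qed
  then obtain s where s: "s permutes {..<?n}" "\<And>x. x < ?n \<Longrightarrow> snd (t (s x)) = snd (t x)" "\<And>x. x < ?n \<Longrightarrow> T (s x) = fst (t x)"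
    by blast
  have st: "s \<in> stab ?n (snd \<circ> t)" using s by (simp add: stab_def)
  have "T \<circ> s = tabloid p t"
    using s(3) ext_comp[OF s(1) tabs_content(1)[OF T]] by (auto simp: tabloid_def fun_eq_iff extensional_def)
  hence "T = tabloid p t \<circ> inv s" using permutes_inv_o[OF s(1)] by (metis comp_assoc comp_id)
  hence "delta T = delta (tabloid p t) \<circ> nact s" using delta_nact[OF s(1)] by simp
  hence "ncsym ?n csign (snd \<circ> t) (delta T) = cscale (csign (inv s)) (polytabloid p t)"
    using nact.csym_act_left[OF character_csign st] by (simp add: polytabloid_csym)
  thus ?thesis by blast
qed

lemma supp_on_expand:
  assumes "finite X" "f \<in> supp_on X" shows "f = (\<Sum>T\<in>X. cscale (f T) (delta T))"
proof
  fix x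
  have "(\<Sum>T\<in>X. cscale (f T) (delta T)) x = (\<Sum>T\<in>X. if T = x then f T else 0)"
    unfolding sum_fun_apply by (rule sum.cong) (auto simp: cscale_def delta_def)
  thus "f x = (\<Sum>T\<in>X. cscale (f T) (delta T)) x"
    using assms by (simp add: supp_on_def)
qed

lemma asym_supp:
  assumes p: "is_partition p" and t: "is_tableau p t" and f: "f \<in> supp_on (tabs p)"
  shows "\<exists>k. ncsym (sum_list p) csign (snd \<circ> t) f = cscale k (polytabloid p t)"
proof -
  obtain k where k: "\<And>T. T \<in> tabs p \<Longrightarrow> ncsym (sum_list p) csign (snd \<circ> t) (delta T) = cscale (k T) (polytabloid p t)"
    using asym_tabloid[OF p t] by metis
  have "ncsym (sum_list p) csign (snd \<circ> t) f = (\<Sum>T\<in>tabs p. cscale (f T) (ncsym (sum_list p) csign (snd \<circ> t) (delta T)))"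
    by (subst supp_on_expand[OF finite_tabs f]) (simp add: csym_sum csym_scale)
  also have "\<dots> = (\<Sum>T\<in>tabs p. cscale (f T * k T) (polytabloid p t))"
    by (rule sum.cong) (simp_all add: k)
  finally show ?thesis by (auto simp: cfun.scale_sum_left[symmetric])
qed

text \<open>
  The bilinear form is invariant, and on real functions it is positive definite; the
  polytabloids are real.
\<close>

definition pairing :: "nat list \<Rightarrow> ((nat \<Rightarrow> nat) \<Rightarrow> complex) \<Rightarrow> ((nat \<Rightarrow> nat) \<Rightarrow> complex) \<Rightarrow> complex"
  where "pairing p f h = (\<Sum>T\<in>tabs p. f T * h T)"

lemma pairing_nact:
  assumes "s permutes {..<sum_list p}"
  shows "pairing p (f \<circ> nact s) (h \<circ> nact s) = pairing p f h"
  unfolding pairing_def nact_def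
  using sum.reindex_bij_betw[OF tabs_bij[OF assms], of "\<lambda>T. f T * h T"] by simp

lemma pairing_nact_left:
  assumes "s permutes {..<sum_list p}"
  shows "pairing p (f \<circ> nact s) h = pairing p f (h \<circ> nact (inv s))"
proof -
  have "h = h \<circ> nact (inv s) \<circ> nact s"
    by (rule ext) (simp only: o_apply nact.act_inv[OF assms])
  thus ?thesis using pairing_nact[OF assms, of f "h \<circ> nact (inv s)"] by simp
qed

lemma pairing_csym:
  assumes e: "character (sum_list p) \<epsilon>" "\<And>s. s permutes {..<sum_list p} \<Longrightarrow> \<epsilon> (inv s) = \<epsilon> s"
  shows "pairing p (ncsym (sum_list p) \<epsilon> r f) h = pairing p f (ncsym (sum_list p) \<epsilon> r h)"
proof -
  let ?S = "stab (sum_list p) r"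
  have "pairing p (ncsym (sum_list p) \<epsilon> r f) h = (\<Sum>s\<in>?S. \<epsilon> s * pairing p (f \<circ> nact s) h)"
    unfolding pairing_def csym_def sum_distrib_left sum_distrib_right
    by (subst sum.swap) (simp add: mult_ac)
  also have "\<dots> = (\<Sum>s\<in>?S. \<epsilon> (inv s) * pairing p f (h \<circ> nact (inv s)))"
    by (intro sum.cong refl) (simp add: e(2) pairing_nact_left stab_permutes)
  also have "\<dots> = (\<Sum>s\<in>?S. \<epsilon> s * pairing p f (h \<circ> nact s))"
  proof (rule sum.reindex_bij_betw[where g = "\<lambda>s. \<epsilon> s * pairing p f (h \<circ> nact s)"])
    show "bij_betw inv ?S ?S"
      by (rule bij_betw_byWitness[where f' = inv]) (auto simp: stab_inv permutes_inv_inv[OF stab_permutes])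
  qed
  also have "\<dots> = pairing p f (ncsym (sum_list p) \<epsilon> r h)"
    unfolding pairing_def csym_def sum_distrib_left sum_distrib_right
    by (subst sum.swap) (simp add: mult_ac)
  finally show ?thesis .
qed

lemma csign_inv: "s permutes {..<n} \<Longrightarrow> csign (inv s) = csign s"
  using permutation_permutes[of s] finite_lessThan[of n] by (auto simp: csign_def sign_inverse)

lemmas pairing_sgn = pairing_csym[OF character_csign csign_inv]
lemma pairing_triv: "pairing p (ncsym (sum_list p) triv r f) h = pairing p f (ncsym (sum_list p) triv r h)"
  by (rule pairing_csym[OF character_triv]) (simp add: triv_def)

lemma stab_row_col:
  assumes t: "is_tableau p t" and s: "s \<in> stab (sum_list p) (fst \<circ> t)" "s \<in> stab (sum_list p) (snd \<circ> t)"
  shows "s = id"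
proof
  fix x show "s x = id x"
  proof (cases "x < sum_list p")
    case True
    have "s x = x" by (rule tableau_eqI[OF t]) (use s True stab_less[OF s(1)] in \<open>auto simp: stab_def\<close>)
    thus ?thesis by simp
  next
    case False
    thus ?thesis using stab_permutes[OF s(1)] by (auto simp: permutes_def)
  qed
qed

lemma tabloid_eq_iff:
  assumes s: "s permutes {..<sum_list p}"
  shows "tabloid p t \<circ> s = tabloid p t \<longleftrightarrow> s \<in> stab (sum_list p) (fst \<circ> t)"
  using s permutes_less[OF s] ext_comp[OF s, of "tabloid p t"]
  by (auto simp: stab_def tabloid_def fun_eq_iff restrict_def extensional_def permutes_def)

lemma polytabloid_self: assumes t: "is_tableau p t" shows "polytabloid p t (tabloid p t) = 1"
proof -
  let ?S = "stab (sum_list p) (snd \<circ> t)"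
  have "polytabloid p t (tabloid p t) = (\<Sum>s\<in>?S. if s = id then 1 else 0)"
    unfolding polytabloid_csym csym_def
  proof (rule sum.cong[OF refl])
    fix s assume s: "s \<in> ?S"
    show "csign s * delta (tabloid p t) (nact s (tabloid p t)) = (if s = id then 1 else 0)"
    proof (cases "s = id")
      case False
      hence "s \<notin> stab (sum_list p) (fst \<circ> t)" using stab_row_col[OF t _ s] by blast
      thus ?thesis using False tabloid_eq_iff[OF stab_permutes[OF s]] by (simp add: delta_def nact_def)
    qed (simp add: delta_def nact_def csign_def)
  qed
  thus ?thesis by (simp only: sum.delta[OF finite_stab] stab_id if_True)
qed

lemma polytabloid_cnj: "cnj (polytabloid p t T) = polytabloid p t T"
proof -
  have "cnj (of_bool P) = of_bool P" for P by (cases P) auto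
  thus ?thesis by (simp add: polytabloid_def)
qed

lemma specht_cnj: assumes "f \<in> specht p" shows "(\<lambda>T. cnj (f T)) \<in> specht p"
  using assms unfolding specht_def
proof (induction rule: cfun.span_induct)
  let ?S = "cfun.span {polytabloid p t |t. is_tableau p t}"
  show "cfun.subspace {f. (\<lambda>T. cnj (f T)) \<in> ?S}"
  proof (rule cfun.subspaceI)
    have "(\<lambda>T. cnj ((0::(nat \<Rightarrow> nat) \<Rightarrow> complex) T)) = 0" by (simp add: fun_eq_iff)
    thus "0 \<in> {f. (\<lambda>T. cnj (f T)) \<in> ?S}" using cfun.span_zero by simp
    show "x + y \<in> {f. (\<lambda>T. cnj (f T)) \<in> ?S}" if "x \<in> {f. (\<lambda>T. cnj (f T)) \<in> ?S}" "y \<in> {f. (\<lambda>T. cnj (f T)) \<in> ?S}" for x y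
    proof -
      have "(\<lambda>T. cnj ((x + y) T)) = (\<lambda>T. cnj (x T)) + (\<lambda>T. cnj (y T))" by (simp add: fun_eq_iff)
      thus ?thesis using that cfun.span_add by simp
    qed
    show "cscale d x \<in> {f. (\<lambda>T. cnj (f T)) \<in> ?S}" if "x \<in> {f. (\<lambda>T. cnj (f T)) \<in> ?S}" for d x
    proof -
      have "(\<lambda>T. cnj (cscale d x T)) = cscale (cnj d) (\<lambda>T. cnj (x T))" by (simp add: fun_eq_iff cscale_def)
      thus ?thesis using that cfun.span_scale by simp
    qed
  qed
  show "(\<lambda>T. cnj (x T)) \<in> ?S" if "x \<in> {polytabloid p t |t. is_tableau p t}" for x
    using that cfun.span_base[OF that] by (auto simp: polytabloid_cnj)
qed

text \<open>
  The Specht module is closed under complex conjugation, so a vector orthogonal to it and in it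
  has norm zero.
\<close>

lemma specht_nonorthogonal:
  assumes u: "u \<in> specht p" "u \<noteq> 0"
  obtains t where "is_tableau p t" "pairing p u (polytabloid p t) \<noteq> 0"
proof (rule ccontr)
  assume neg: "\<not> thesis"
  have z: "pairing p u h = 0" if "h \<in> specht p" for h
    using that unfolding specht_def
  proof (induction rule: cfun.span_induct)
    show "cfun.subspace {h. pairing p u h = 0}"
      by (rule cfun.subspaceI)
         (auto simp: pairing_def cscale_def algebra_simps sum.distrib sum_distrib_left[symmetric])
    show "pairing p u x = 0" if "x \<in> {polytabloid p t |t. is_tableau p t}" for x
      using that neg \<open>\<And>t. is_tableau p t \<Longrightarrow> pairing p u (polytabloid p t) \<noteq> 0 \<Longrightarrow> thesis\<close> by blast
  qed
  have "(\<Sum>T\<in>tabs p. u T * cnj (u T)) = 0" using z[OF specht_cnj[OF u(1)]] by (simp add: pairing_def)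
  hence "of_real (\<Sum>T\<in>tabs p. (cmod (u T))\<^sup>2) = (0::complex)"
    by (simp add: complex_norm_square del: of_real_power)
  hence "(\<Sum>T\<in>tabs p. (cmod (u T))\<^sup>2) = 0" using of_real_eq_0_iff by blast
  hence "u T = 0" if "T \<in> tabs p" for T
    using that finite_tabs[of p] by (subst (asm) sum_nonneg_eq_0_iff) auto
  hence "u = 0" using u(1) specht_supp by (fastforce simp: supp_on_def)
  thus False using u(2) by simp
qed

lemma specht_asym_nonzero:
  assumes u: "u \<in> specht p" "u \<noteq> 0"
  obtains t where "is_tableau p t" "ncsym (sum_list p) csign (snd \<circ> t) u \<noteq> 0"
proof -
  obtain t where t: "is_tableau p t" "pairing p u (polytabloid p t) \<noteq> 0" by (rule specht_nonorthogonal[OF u])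
  have "pairing p u (polytabloid p t) = pairing p (ncsym (sum_list p) csign (snd \<circ> t) u) (delta (tabloid p t))"
    unfolding polytabloid_csym by (rule pairing_sgn[symmetric])
  hence "ncsym (sum_list p) csign (snd \<circ> t) u \<noteq> 0" using t(2) by (auto simp: pairing_def)
  thus thesis using that t(1) by blast
qed

lemma (in right_action) asym_column_inj:
  assumes "csym (sum_list p) act csign (snd \<circ> t) u \<noteq> 0" "\<And>s. s \<in> stab (sum_list p) w \<Longrightarrow> u \<circ> act s = u"
  shows "column_inj p t w"
  unfolding column_inj_def
proof (intro allI impI, rule ccontr)
  fix x y assume xy: "x < sum_list p" "y < sum_list p" "snd (t x) = snd (t y)" "w x = w y" "x \<noteq> y"
  have "swp x y \<in> stab (sum_list p) w" using xy by (intro transpose_stab) auto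
  hence "csym (sum_list p) act csign (snd \<circ> t) u = 0" using assms(2) xy by (intro asym_zero[of x _ y]) auto
  thus False using assms(1) by simp
qed

text \<open>
  A nonzero vector of the Specht module survives antisymmetrization over the columns of some
  tableau; by Garnir's argument the colours it is invariant under cannot repeat in a column.
\<close>

lemma specht_invariant_filling:
  assumes u: "u \<in> specht p" "u \<noteq> 0" and inv: "\<And>s. s \<in> stab (sum_list p) w \<Longrightarrow> u \<circ> nact s = u"
  obtains t where "is_tableau p t" "column_inj p t w"
proof -
  obtain t where t: "is_tableau p t" "ncsym (sum_list p) csign (snd \<circ> t) u \<noteq> 0" by (rule specht_asym_nonzero[OF u])
  show thesis using that t(1) nact.asym_column_inj[OF t(2) inv] by blast
qed

text \<open>
  That the result is a multiple of the polytabloid \<open>e\<close> is \<open>asym_supp\<close>. The scalar is nonzero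
  because pairing with the tabloid gives, up to a positive factor, the squared norm of the row
  symmetrization of \<open>e\<close>.
\<close>

lemma polytabloid_eigen:
  assumes p: "is_partition p" and t: "is_tableau p t"
  shows "\<exists>\<alpha>. \<alpha> \<noteq> 0 \<and> ncsym (sum_list p) csign (snd \<circ> t) (ncsym (sum_list p) triv (fst \<circ> t) (polytabloid p t)) = cscale \<alpha> (polytabloid p t)"
proof -
  let ?n = "sum_list p" and ?e = "polytabloid p t" and ?T = "tabloid p t"
  let ?a = "ncsym ?n triv (fst \<circ> t)" and ?b = "ncsym ?n csign (snd \<circ> t)"
  let ?R = "stab ?n (fst \<circ> t)"
  obtain \<alpha> where \<alpha>: "?b (?a ?e) = cscale \<alpha> ?e"
    using asym_supp[OF p t, of "?a ?e"] csym_in[OF submod_supp polytabloid_supp[OF t]] by blast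
  have aT: "?a ?e ?T = of_nat (card ?R)"
  proof -
    have "?a ?e ?T = (\<Sum>s\<in>?R. 1)"
      unfolding csym_def
    proof (rule sum.cong[OF refl])
      fix s assume s: "s \<in> ?R"
      hence "nact s ?T = ?T" using tabloid_eq_iff[OF stab_permutes[OF s]] by (simp add: nact_def)
      thus "triv s * ?e (nact s ?T) = 1" by (simp add: triv_def polytabloid_self[OF t])
    qed
    thus ?thesis by simp
  qed
  have aa: "?a (?a ?e) = cscale (of_nat (card ?R)) (?a ?e)"
    by (rule nact.csym_fixed[OF character_triv nact.csym_act_right[OF character_triv]])
  have "of_nat (card ?R) * \<alpha> * pairing p ?e (delta ?T) = of_nat (card ?R) * pairing p (?b (?a ?e)) (delta ?T)"
    by (simp add: \<alpha> pairing_def cscale_def sum_distrib_left mult_ac)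
  also have "\<dots> = of_nat (card ?R) * pairing p (?a ?e) ?e"
    using pairing_sgn[where p = p and r = "snd \<circ> t" and f = "?a ?e" and h = "delta ?T"] by (simp add: polytabloid_csym[symmetric])
  also have "\<dots> = pairing p (?a (?a ?e)) ?e"
    by (simp add: aa pairing_def cscale_def sum_distrib_left mult_ac)
  also have "\<dots> = pairing p (?a ?e) (?a ?e)" by (rule pairing_triv)
  also have "\<dots> = (\<Sum>T\<in>tabs p. of_real ((cmod (?a ?e T))\<^sup>2))"
    unfolding pairing_def
  proof (rule sum.cong[OF refl])
    fix T
    have "cnj (?a ?e T) = ?a ?e T" by (simp add: csym_def triv_def polytabloid_cnj)
    thus "?a ?e T * ?a ?e T = of_real ((cmod (?a ?e T))\<^sup>2)" using complex_norm_square[of "?a ?e T"] by simp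
  qed
  also have "\<dots> = of_real (\<Sum>T\<in>tabs p. (cmod (?a ?e T))\<^sup>2)" by simp
  finally have main: "of_nat (card ?R) * \<alpha> * pairing p ?e (delta ?T) = of_real (\<Sum>T\<in>tabs p. (cmod (?a ?e T))\<^sup>2)" .
  have "card ?R > 0" using stab_id[of ?n "fst \<circ> t"] finite_stab[of ?n "fst \<circ> t"] by (auto simp: card_gt_0_iff)
  hence "?a ?e ?T \<noteq> 0" using aT by simp
  hence "(\<Sum>T\<in>tabs p. (cmod (?a ?e T))\<^sup>2) > 0"
    by (intro sum_pos2[OF finite_tabs tabloid_in[OF t]]) auto
  hence "\<alpha> \<noteq> 0" using main by (metis mult_zero_left mult_zero_right of_real_eq_0_iff order_less_irrefl)
  thus ?thesis using \<alpha> by blast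
qed

text \<open>
  A filling without repetition in columns makes the shape \<open>p\<close> dominate the content \<open>q\<close>; if, in
  addition, some strictly decreasing weighting does not rank \<open>p\<close> above \<open>q\<close>, the two agree.
\<close>

lemma dominating_content_eq:
  fixes xw :: "nat \<Rightarrow> int"
  assumes p: "p \<in> partitions_of n" and q: "q \<in> partitions_of n"
    and t: "is_tableau p t" "column_inj p t U" and U: "U \<in> tabs q"
    and anti: "\<forall>i j. i < j \<longrightarrow> j < a \<longrightarrow> xw j < xw i" and len: "length q \<le> a"
    and le: "(\<Sum>i<a. int (rowlen p i) * xw i) \<le> (\<Sum>i<a. int (rowlen q i) * xw i)"
  shows "p = q"
proof -
  note P = partitions_ofD[OF p] and Q = partitions_ofD[OF q]
  have Ua: "\<forall>i<sum_list p. U i < a" using tabs_less[OF U] len P(2) Q(2) by fastforce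
  note cd = content_dominated[OF P(1) t(1) anti Ua t(2)]
  have 1: "(\<Sum>i<sum_list p. xw (U i)) = (\<Sum>i<a. int (rowlen q i) * xw i)"
    using content_sum[of n U a xw] Ua tabs_content(2)[OF U] P(2) Q(2) by simp
  have 2: "(\<Sum>i<sum_list p. xw (fst (t i))) = (\<Sum>i<a. int (rowlen p i) * xw i)"
    using row_sum[OF t(1) cd(1), of xw] by simp
  have "(\<Sum>i<sum_list p. xw (U i)) = (\<Sum>i<sum_list p. xw (fst (t i)))" using cd(2) le 1 2 by simp
  from cd(4)[OF this] have "rowlen p = rowlen q" using tabs_content(2)[OF U] P(2) Q(2) by auto
  thus ?thesis by (rule partition_eqI[OF P(1) Q(1)])
qed

lemma dominance_antisym:
  assumes p: "p \<in> partitions_of n" and q: "q \<in> partitions_of n"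
    and t: "is_tableau p t" "U \<in> tabs q" "column_inj p t U" and t': "is_tableau q t'" "T \<in> tabs p" "column_inj q t' T"
  shows "p = q"
proof -
  define a where "a = max (length p) (length q)"
  let ?s = "\<lambda>p. \<Sum>i<a. int (rowlen p i) * - int i"
  have anti: "\<forall>i j. i < j \<longrightarrow> j < a \<longrightarrow> - int j < - int i" by simp
  have len: "length p \<le> a" "length q \<le> a" by (simp_all add: a_def)
  consider "?s p \<le> ?s q" | "?s q \<le> ?s p" by linarith
  thus ?thesis
  proof cases
    case 1
    show ?thesis by (rule dominating_content_eq[OF p q t(1,3,2) anti len(2) 1])
  next
    case 2
    show ?thesis by (rule dominating_content_eq[OF q p t'(1,3,2) anti len(1) 2, symmetric])
  qed
qed

text \<open>
  A surviving vector yields fillings without repetition in columns both ways: of \<open>q\<close> by the rows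
  of \<open>t\<close>, and of \<open>t\<close> by a tabloid of shape \<open>q\<close>. So \<open>p\<close> and \<open>q\<close> dominate each other.
\<close>

lemma young_kills:
  assumes p: "is_partition p" and t: "is_tableau p t" and q: "is_partition q" and n: "sum_list q = sum_list p" and ne: "q \<noteq> p"
    and f: "f \<in> specht q"
  shows "ncsym (sum_list p) csign (snd \<circ> t) (ncsym (sum_list p) triv (fst \<circ> t) f) = 0"
proof (rule ccontr)
  let ?n = "sum_list p"
  let ?a = "ncsym ?n triv (fst \<circ> t)" and ?b = "ncsym ?n csign (snd \<circ> t)"
  assume nz: "?b (?a f) \<noteq> 0"
  have u: "?a f \<in> specht q" using csym_in[OF submod_specht[of q] f] n by simp
  have unz: "?a f \<noteq> 0" using nz by (auto simp: csym_0)
  have uinv: "?a f \<circ> nact s = ?a f" if "s \<in> stab (sum_list q) (fst \<circ> t)" for s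
    using nact.csym_act_right[OF character_triv, of s ?n "fst \<circ> t" f] that n by (simp add: triv_def)
  obtain t' where t': "is_tableau q t'" "column_inj q t' (fst \<circ> t)"
    by (rule specht_invariant_filling[OF u unz uinv])
  have "\<exists>T\<in>tabs q. ?b (delta T) \<noteq> 0"
  proof (rule ccontr)
    assume "\<not> ?thesis"
    hence "?b (\<Sum>T\<in>tabs q. cscale (?a f T) (delta T)) = 0"
      by (simp add: csym_sum csym_scale)
    moreover have "(\<Sum>T\<in>tabs q. cscale (?a f T) (delta T)) = ?a f"
      by (rule supp_on_expand[OF finite_tabs subsetD[OF specht_supp u], symmetric])
    ultimately show False using nz by simp
  qed
  then obtain T where T: "T \<in> tabs q" "?b (delta T) \<noteq> 0" by blast
  have Ti: "column_inj p t T"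
  proof (rule nact.asym_column_inj[OF T(2)])
    fix s assume s: "s \<in> stab ?n T"
    hence sp: "inv s permutes {..<sum_list q}" using stab_permutes permutes_inv n by metis
    have "T \<circ> inv s = T"
    proof
      fix x show "(T \<circ> inv s) x = T x"
        using stab_inv[OF s] ext_comp[OF sp tabs_content(1)[OF T(1)]] tabs_content(1)[OF T(1)] n
        by (cases "x < ?n") (auto simp: stab_def extensional_def)
    qed
    thus "delta T \<circ> nact s = delta T" using delta_nact[OF stab_permutes[OF s]] by simp
  qed
  have "column_inj q t' (tabloid p t)" using t'(2) n by (simp add: column_inj_def tabloid_def)
  hence "p = q"
    using dominance_antisym[of p ?n q t T t' "tabloid p t"] p q n t T(1) Ti t'(1) tabloid_in[OF t]
    by (simp add: partitions_of_def)
  thus False using ne by simp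
qed


section \<open>Linear maps between spaces of functions\<close>

global_interpretation cpair: vector_space_pair "cscale :: complex \<Rightarrow> ('x \<Rightarrow> complex) \<Rightarrow> _" "cscale :: complex \<Rightarrow> ('y \<Rightarrow> complex) \<Rightarrow> _"
  by unfold_locales

lemma linear_cscale_iff:
  "Vector_Spaces.linear cscale cscale f \<longleftrightarrow> (\<forall>x y. f (x + y) = f x + f y) \<and> (\<forall>c x. f (cscale c x) = cscale c (f x))"
  by (simp add: Vector_Spaces.linear_iff cfun.vector_space_axioms)

lemma supp_on_span: "finite X \<Longrightarrow> supp_on X \<subseteq> cfun.span (delta ` X)"
  using supp_on_expand by (metis (no_types, lifting) cfun.span_base cfun.span_scale cfun.span_sum image_eqI subsetI)

text \<open>
  \<open>\<Phi>\<close> is additive and homogeneous only on \<open>V\<close>, as in the definition of isomorphic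
  representations; it is therefore replaced by a globally linear map that agrees with it on \<open>V\<close>.
\<close>

lemma dim_iso_image:
  assumes V: "cfun.subspace V" and fin: "finite B0" "V \<subseteq> cfun.span B0"
    and add: "\<And>f g. f \<in> V \<Longrightarrow> g \<in> V \<Longrightarrow> \<Phi> (f + g) = \<Phi> f + \<Phi> g"
    and sc: "\<And>c f. f \<in> V \<Longrightarrow> \<Phi> (cscale c f) = cscale c (\<Phi> f)" and inj: "inj_on \<Phi> V"
  shows "cfun.dim (\<Phi> ` V) = cfun.dim V"
proof -
  obtain B where B: "B \<subseteq> V" "cfun.independent B" "V \<subseteq> cfun.span B" "card B = cfun.dim V"
    by (rule cfun.basis_exists)
  obtain g where g: "Vector_Spaces.linear cscale cscale g" "\<And>x. x \<in> B \<Longrightarrow> g x = \<Phi> x"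
    using cpair.linear_independent_extend[OF B(2), of \<Phi>] by blast
  interpret g: Vector_Spaces.linear cscale cscale g by fact
  have spV: "cfun.span B = V" using B(1,3) V by (metis cfun.span_minimal subset_antisym)
  have eq: "x \<in> V \<and> g x = \<Phi> x" if "x \<in> cfun.span B" for x
    using that
  proof (induction rule: cfun.span_induct)
    have z: "\<Phi> 0 = 0" using sc[of 0 0] cfun.subspace_0[OF V] by (metis cfun.scale_zero_left)
    show "cfun.subspace {x. x \<in> V \<and> g x = \<Phi> x}"
      using cfun.subspace_0[OF V] cfun.subspace_add[OF V] cfun.subspace_scale[OF V] g.zero
      by (intro cfun.subspaceI) (auto simp: add sc g.add g.scale z)
  qed (use B(1) g(2) in auto)
  have gV: "g ` V = \<Phi> ` V" using eq spV by (metis (no_types, lifting) image_cong)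
  have "inj_on g (cfun.span B)" using inj eq spV by (metis (no_types, lifting) inj_on_cong)
  hence ind: "cfun.independent (g ` B)" by (rule g.independent_inj_on_image[OF B(2)])
  have "inj_on g B" using \<open>inj_on g (cfun.span B)\<close> by (rule inj_on_subset) (rule cfun.span_superset)
  hence "card (g ` B) = cfun.dim V" using B(4) by (simp add: card_image)
  moreover have "g ` V = cfun.span (g ` B)" using spV g.span_image by metis
  ultimately show ?thesis using cfun.dim_span_eq_card_independent[OF ind] gV by simp
qed

lemma right_action_sum: "right_action sum_act"
  by unfold_locales (auto simp: sum_act_def fun_eq_iff)
lemma right_action_tensor: "right_action tensor_act"
  by unfold_locales (auto simp: tensor_act_def fun_eq_iff)

global_interpretation sact: right_action sum_act by (rule right_action_sum)
global_interpretation tact: right_action tensor_act by (rule right_action_tensor)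

abbreviation Sn where "Sn n \<equiv> stab n (\<lambda>_. ())"

lemma Sn_iff: "s \<in> Sn n \<longleftrightarrow> s permutes {..<n}" by (simp add: stab_def)

section \<open>Invariant complements\<close>

text \<open>
  Maschke's theorem: averaging a projection onto \<open>V\<close> over the group gives an equivariant
  projection, whose kernel is the complement.
\<close>

lemma (in right_action) averaging:
  assumes W: "submod n act W" and V: "submod n act V" "V \<subseteq> W" "V \<noteq> W"
  shows "\<exists>U. submod n act U \<and> U \<subseteq> W \<and> U \<noteq> {0} \<and> U \<inter> V = {0}"
proof -
  have "Vector_Spaces.linear cscale cscale (\<lambda>x::'x \<Rightarrow> complex. x)" by (simp add: linear_cscale_iff)
  from cpair.linear_exists_left_inverse_on[OF this submodD(1)[OF V(1)] inj_on_id2]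
  obtain P where P: "\<And>x. P x \<in> V" "Vector_Spaces.linear cscale cscale P" "\<And>v. v \<in> V \<Longrightarrow> P v = v"
    by blast
  have Padd: "P (f + g) = P f + P g" and Psc: "P (cscale c f) = cscale c (P f)" for f g c
    using P(2) by (simp_all add: linear_cscale_iff)
  define Q where "Q f = (\<Sum>s\<in>Sn n. P (f \<circ> act s) \<circ> act (inv s))" for f
  have Qadd: "Q (f + g) = Q f + Q g" for f g
  proof -
    have "(f + g) \<circ> act s = (f \<circ> act s) + (g \<circ> act s)" for s by (simp add: fun_eq_iff)
    moreover have "(f' + g') \<circ> act s = (f' \<circ> act s) + (g' \<circ> act s)" for f' g' :: "'x \<Rightarrow> complex" and s by (simp add: fun_eq_iff)
    ultimately show ?thesis by (simp add: Q_def Padd sum.distrib)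
  qed
  have Qsc: "Q (cscale c f) = cscale c (Q f)" for f c
  proof -
    have 1: "cscale c f \<circ> h = cscale c (f \<circ> h)" for f :: "'x \<Rightarrow> complex" and h :: "'x \<Rightarrow> 'x" by (simp add: fun_eq_iff cscale_def)
    show ?thesis by (simp add: Q_def 1 Psc cfun.scale_sum_right)
  qed
  have QV: "Q f \<in> V" for f
    unfolding Q_def by (intro submodD(7)[OF V(1)] submodD(6)[OF V(1)] P(1)) (simp add: Sn_iff permutes_inv)
  define N where "N = (of_nat (card (Sn n)) :: complex)"
  have N: "N \<noteq> 0" unfolding N_def using stab_id[of n "\<lambda>_. ()"] finite_stab[of n "\<lambda>_. ()"] by (auto simp: card_eq_0_iff)
  have Qid: "Q f = cscale N f" if "f \<in> V" for f
  proof -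
    have "Q f = (\<Sum>s\<in>Sn n. f)"
      unfolding Q_def
    proof (rule sum.cong[OF refl])
      fix s assume "s \<in> Sn n"
      hence s: "s permutes {..<n}" by (simp add: Sn_iff)
      show "P (f \<circ> act s) \<circ> act (inv s) = f"
        using P(3)[OF submodD(6)[OF V(1) s that]] act_inv[OF s] by (simp add: fun_eq_iff)
    qed
    thus ?thesis by (simp add: N_def cscale_def fun_eq_iff sum_fun_apply)
  qed
  have Qact: "Q (f \<circ> act u) = Q f \<circ> act u" if u: "u permutes {..<n}" for u f
  proof
    fix x
    have uS: "u \<in> Sn n" using u by (simp add: Sn_iff)
    have "Q (f \<circ> act u) x = (\<Sum>s\<in>Sn n. P (f \<circ> act (s \<circ> u)) (act (inv (s \<circ> u)) (act u x)))"
      unfolding Q_def sum_fun_apply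
    proof (rule sum.cong[OF refl])
      fix s assume "s \<in> Sn n"
      hence s: "s permutes {..<n}" by (simp add: Sn_iff)
      have "u \<circ> inv (s \<circ> u) = inv s"
        using permutes_inv_o[OF u] by (simp add: o_inv_distrib[OF permutes_bij[OF s] permutes_bij[OF u]] o_assoc)
      thus "(P (f \<circ> act u \<circ> act s) \<circ> act (inv s)) x = P (f \<circ> act (s \<circ> u)) (act (inv (s \<circ> u)) (act u x))"
        by (simp add: act_act act_comp comp_assoc)
    qed
    also have "\<dots> = (\<Sum>s\<in>Sn n. P (f \<circ> act s) (act (inv s) (act u x)))"
      by (rule sum.reindex_bij_betw[OF stab_bij_right[OF uS], where g = "\<lambda>s. P (f \<circ> act s) (act (inv s) (act u x))"])
    finally show "Q (f \<circ> act u) x = (Q f \<circ> act u) x" by (simp add: Q_def sum_fun_apply)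
  qed
  define U where "U = {w \<in> W. Q w = 0}"
  have Q0: "Q 0 = 0" using Qsc[of 0 0] by (metis cfun.scale_zero_left)
  have "submod n act U"
    unfolding submod_def U_def using submodD[OF W] Q0
    by (auto intro!: cfun.subspaceI simp: Qadd Qsc Qact)
  moreover have "U \<subseteq> W" by (auto simp: U_def)
  moreover have "U \<noteq> {0}"
  proof
    assume U0: "U = {0}"
    obtain w where w: "w \<in> W" "w \<notin> V" using V by blast
    define u where "u = cscale N w - Q w"
    have "Q (cscale N w) = Q (u + Q w)" by (simp add: u_def)
    hence "cscale N (Q w) = Q u + cscale N (Q w)" unfolding Qadd Qsc Qid[OF QV] .
    hence "Q u = 0" by simp
    moreover have "u \<in> W" unfolding u_def using w QV V(2) by (intro submodD[OF W]) auto
    ultimately have "u = 0" using U0 by (auto simp: U_def)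
    hence "cscale N w = Q w" by (simp add: u_def)
    hence "w = cscale (inverse N) (Q w)" using N by (metis cfun.scale_one cfun.scale_scale left_inverse)
    thus False using w(2) submodD(4)[OF V(1) QV] by metis
  qed
  moreover have "U \<inter> V = {0}"
  proof -
    have "f = 0" if "f \<in> U" "f \<in> V" for f
      using that Qid[of f] N by (auto simp: U_def)
    thus ?thesis using submodD(2)[OF V(1)] submodD(2)[OF \<open>submod n act U\<close>] by blast
  qed
  ultimately show ?thesis by blast
qed

section \<open>Young symmetrizers\<close>

definition ctab :: "nat list \<Rightarrow> nat \<Rightarrow> nat \<times> nat"
  where "ctab q = (SOME t. is_tableau q t)"

lemma ctab: "is_tableau q (ctab q)"
  unfolding ctab_def using tableau_exists by (rule someI_ex)

definition young :: "nat \<Rightarrow> ((nat \<Rightarrow> nat) \<Rightarrow> 'x \<Rightarrow> 'x) \<Rightarrow> nat list \<Rightarrow> ('x \<Rightarrow> complex) \<Rightarrow> 'x \<Rightarrow> complex"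
  where "young n act q f = csym n act csign (snd \<circ> ctab q) (csym n act triv (fst \<circ> ctab q) f)"

lemma young_add: "young n act q (f + g) = young n act q f + young n act q g"
  by (simp add: young_def csym_add)
lemma young_scale: "young n act q (cscale c f) = cscale c (young n act q f)"
  by (simp add: young_def csym_scale)
lemma young_in: "submod n act W \<Longrightarrow> f \<in> W \<Longrightarrow> young n act q f \<in> W"
  by (simp add: young_def csym_in)
lemma young_0: "young n act q 0 = 0"
  by (simp add: young_def csym_0)

lemma young_subspace: "cfun.subspace W \<Longrightarrow> cfun.subspace (young n act q ` W)"
proof -
  assume W: "cfun.subspace W"
  have "Vector_Spaces.linear cscale cscale (young n act q)" by (simp add: linear_cscale_iff young_add young_scale)
  then interpret l: Vector_Spaces.linear cscale cscale "young n act q" .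
  show ?thesis by (rule l.subspace_image[OF W])
qed

text \<open>
  Any tableau of the shape is a translate of the chosen one, and the symmetrizers are conjugate
  accordingly.
\<close>

lemma (in right_action) young_detects:
  assumes W: "submod n act W" and nz: "W \<noteq> {0}"
  shows "\<exists>q f. q \<in> partitions_of n \<and> f \<in> W \<and> young n act q f \<noteq> 0"
proof -
  obtain f0 where f0: "f0 \<in> W" "f0 \<noteq> 0" using nz submodD(2)[OF W] by blast
  obtain q t f where f: "q \<in> partitions_of n" "is_tableau q t" "f \<in> W"
      "csym n act csign (snd \<circ> t) (csym n act triv (fst \<circ> t) f) \<noteq> 0"
    using specht_detects[OF W f0] by blast
  obtain g where g: "g permutes {..<n}" "\<And>x. x < n \<Longrightarrow> t x = ctab q (g x)"
    using tableau_rel[OF ctab f(2)] partitions_ofD(2)[OF f(1)] by auto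
  have 1: "csym n act \<epsilon> (fst \<circ> t) h = csym n act \<epsilon> (fst \<circ> ctab q \<circ> g) h"
       "csym n act \<epsilon> (snd \<circ> t) h = csym n act \<epsilon> (snd \<circ> ctab q \<circ> g) h" for \<epsilon> h
    by (rule csym_cong; simp add: g(2))+
  have "young n act q (f \<circ> act g) = csym n act csign (snd \<circ> t) (csym n act triv (fst \<circ> t) f) \<circ> act g"
    unfolding young_def csym_conj[OF character_triv g(1)] csym_conj[OF character_csign g(1)] 1 ..
  moreover have "h \<noteq> 0 \<Longrightarrow> h \<circ> act g \<noteq> 0" for h :: "'x \<Rightarrow> complex"
    using act_inv(1)[OF g(1)] by (metis comp_apply zero_fun_apply ext)
  ultimately have "young n act q (f \<circ> act g) \<noteq> 0" using f(4) by metis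
  thus ?thesis using f(1) submodD(6)[OF W g(1) f(3)] by blast
qed

text \<open>
  The homomorphism from functions of tabloids of shape \<open>q\<close> that sends the tabloid of the chosen
  tableau to the row symmetrization of \<open>v\<close>.
\<close>

definition orbit_hom :: "((nat \<Rightarrow> nat) \<Rightarrow> 'x \<Rightarrow> 'x) \<Rightarrow> nat list \<Rightarrow> ('x \<Rightarrow> complex) \<Rightarrow> ((nat \<Rightarrow> nat) \<Rightarrow> complex) \<Rightarrow> 'x \<Rightarrow> complex"
  where "orbit_hom act q v h = (\<lambda>x. \<Sum>g\<in>Sn (sum_list q). h (tabloid q (ctab q) \<circ> inv g) * v (act g x))"

lemma orbit_hom_add: "orbit_hom act q v (h + h') = orbit_hom act q v h + orbit_hom act q v h'"
  by (simp add: orbit_hom_def fun_eq_iff algebra_simps sum.distrib)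
lemma orbit_hom_scale: "orbit_hom act q v (cscale c h) = cscale c (orbit_hom act q v h)"
  by (simp add: orbit_hom_def fun_eq_iff algebra_simps cscale_def sum_distrib_left)
lemma orbit_hom_in: assumes "submod (sum_list q) act W" "v \<in> W" shows "orbit_hom act q v h \<in> W"
proof -
  have "orbit_hom act q v h = (\<Sum>g\<in>Sn (sum_list q). cscale (h (tabloid q (ctab q) \<circ> inv g)) (v \<circ> act g))"
    by (simp add: orbit_hom_def fun_eq_iff sum_fun_apply cscale_def)
  also have "\<dots> \<in> W"
    by (intro submodD(7)[OF assms(1)] submodD(4)[OF assms(1)] submodD(6)[OF assms(1)] assms(2)) (simp add: Sn_iff)
  finally show ?thesis .
qed

lemma (in right_action) orbit_hom_act:
  assumes s: "s permutes {..<sum_list q}"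
  shows "orbit_hom act q v (h \<circ> nact s) = orbit_hom act q v h \<circ> act s"
proof
  fix x
  have sS: "s \<in> Sn (sum_list q)" using s by (simp add: Sn_iff)
  have "orbit_hom act q v (h \<circ> nact s) x
      = (\<Sum>g\<in>Sn (sum_list q). (h \<circ> nact s) (tabloid q (ctab q) \<circ> inv (s \<circ> g)) * v (act (s \<circ> g) x))"
    unfolding orbit_hom_def
    by (rule sum.reindex_bij_betw[OF stab_bij_left[OF sS], symmetric])
  also have "\<dots> = (\<Sum>g\<in>Sn (sum_list q). h (tabloid q (ctab q) \<circ> inv g) * v (act g (act s x)))"
  proof (rule sum.cong[OF refl])
    fix g assume "g \<in> Sn (sum_list q)"
    hence g: "g permutes {..<sum_list q}" by (simp add: Sn_iff)
    have "inv (s \<circ> g) \<circ> s = inv g"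
      using permutes_inv_o[OF s] by (simp add: o_inv_distrib[OF permutes_bij[OF s] permutes_bij[OF g]] comp_assoc)
    thus "(h \<circ> nact s) (tabloid q (ctab q) \<circ> inv (s \<circ> g)) * v (act (s \<circ> g) x)
        = h (tabloid q (ctab q) \<circ> inv g) * v (act g (act s x))"
      by (simp add: nact_def act_act comp_assoc)
  qed
  finally show "orbit_hom act q v (h \<circ> nact s) x = (orbit_hom act q v h \<circ> act s) x"
    by (simp add: orbit_hom_def)
qed

lemma csym_as_sum: "csym n act \<epsilon> r f = (\<Sum>s\<in>stab n r. cscale (\<epsilon> s) (f \<circ> act s))"
  by (simp add: csym_def fun_eq_iff sum_fun_apply cscale_def)

lemma orbit_hom_sum: "orbit_hom act q v (\<Sum>i\<in>I. F i) = (\<Sum>i\<in>I. orbit_hom act q v (F i))"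
proof (induction I rule: infinite_finite_induct)
  case empty show ?case by (simp add: orbit_hom_def fun_eq_iff)
next
  case (infinite A) thus ?case by (simp add: orbit_hom_def fun_eq_iff)
next
  case (insert x A)
  show ?case unfolding sum.insert[OF insert.hyps] orbit_hom_add insert.IH ..
qed

lemma (in right_action) orbit_hom_csym:
  "orbit_hom act q v (csym (sum_list q) nact \<epsilon> r h) = csym (sum_list q) act \<epsilon> r (orbit_hom act q v h)"
  unfolding csym_as_sum orbit_hom_sum orbit_hom_scale
  by (intro sum.cong refl arg_cong[where f = "cscale _"] orbit_hom_act) (simp add: stab_permutes)

text \<open>
  So every nonzero value of the Young symmetrizer spans, together with its translates, an image
  of the Specht module.
\<close>

lemma (in right_action) orbit_hom_polytabloid:
  "orbit_hom act q v (polytabloid q (ctab q)) = young (sum_list q) act q v"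
proof -
  let ?n = "sum_list q" and ?T = "tabloid q (ctab q)"
  have "orbit_hom act q v (delta ?T) = csym ?n act triv (fst \<circ> ctab q) v"
  proof
    fix x
    have "orbit_hom act q v (delta ?T) x = (\<Sum>g\<in>Sn ?n. if g \<in> stab ?n (fst \<circ> ctab q) then v (act g x) else 0)"
      unfolding orbit_hom_def
    proof (rule sum.cong[OF refl])
      fix g assume "g \<in> Sn ?n"
      hence g: "g permutes {..<?n}" by (simp add: Sn_iff)
      have "?T \<circ> inv g = ?T \<longleftrightarrow> g \<in> stab ?n (fst \<circ> ctab q)"
        using tabloid_eq_iff[OF permutes_inv[OF g]] stab_inv[of g] stab_inv[of "inv g"] permutes_inv_inv[OF g] by metis
      thus "delta ?T (?T \<circ> inv g) * v (act g x) = (if g \<in> stab ?n (fst \<circ> ctab q) then v (act g x) else 0)"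
        by (simp add: delta_def)
    qed
    also have "\<dots> = csym ?n act triv (fst \<circ> ctab q) v x"
    proof -
      have "Sn ?n \<inter> stab ?n (fst \<circ> ctab q) = stab ?n (fst \<circ> ctab q)" by (auto simp: stab_def)
      thus ?thesis by (simp add: csym_def triv_def sum.If_cases[OF finite_stab])
    qed
    finally show "orbit_hom act q v (delta ?T) x = csym ?n act triv (fst \<circ> ctab q) v x" .
  qed
  thus ?thesis by (simp add: polytabloid_csym orbit_hom_csym young_def)
qed

lemma finite_partitions_of: "finite (partitions_of n)"
proof (rule finite_subset)
  show "partitions_of n \<subseteq> {xs. set xs \<subseteq> {..n} \<and> length xs \<le> n}"
  proof
    fix q assume q: "q \<in> partitions_of n"
    have "set q \<subseteq> {..n}" using member_le_sum_list[of _ q] partitions_ofD(2)[OF q] by auto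
    moreover have "length q \<le> sum_list q"
    proof -
      have "0 \<notin> set q" using partitions_ofD(1)[OF q] by (simp add: is_partition_def)
      thus ?thesis
      proof (induction q)
        case (Cons a q)
        hence "a > 0" "length q \<le> sum_list q" by auto
        thus ?case by simp
      qed simp
    qed
    ultimately show "q \<in> {xs. set xs \<subseteq> {..n} \<and> length xs \<le> n}" using partitions_ofD(2)[OF q] by simp
  qed
qed (rule finite_lists_length_le, simp)


section \<open>Decomposition into Specht modules\<close>

lemma specht_sum_slice:
  assumes "f \<in> specht_sum n m"
  shows "q \<in> partitions_of n \<Longrightarrow> i < m q \<Longrightarrow> (\<lambda>T. f (q, i, T)) \<in> specht q"
    and "\<not> (q \<in> partitions_of n \<and> i < m q) \<Longrightarrow> f (q, i, T) = 0"
  using assms unfolding specht_sum_def mem_Collect_eq by (metis, metis zero_fun_apply)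

lemma specht_sumI:
  assumes "\<And>q i. q \<in> partitions_of n \<Longrightarrow> i < m q \<Longrightarrow> (\<lambda>T. f (q, i, T)) \<in> specht q"
    and "\<And>q i T. \<not> (q \<in> partitions_of n \<and> i < m q) \<Longrightarrow> f (q, i, T) = 0"
  shows "f \<in> specht_sum n m"
  unfolding specht_sum_def mem_Collect_eq using assms by (metis (no_types, lifting) ext zero_fun_apply)

lemma subspace_specht: "cfun.subspace (specht q)"
  unfolding specht_def by (rule cfun.subspace_span)

lemma submod_specht': "q \<in> partitions_of n \<Longrightarrow> submod n nact (specht q)"
  using submod_specht[of q] partitions_ofD(2) by simp

lemma submod_specht_sum: "submod n sum_act (specht_sum n m)"
  unfolding submod_def
proof (intro conjI allI impI ballI cfun.subspaceI)
  show "0 \<in> specht_sum n m"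
    using cfun.subspace_0[OF subspace_specht] by (intro specht_sumI) (simp_all add: zero_fun_def)
  show "f + g \<in> specht_sum n m" if f: "f \<in> specht_sum n m" and g: "g \<in> specht_sum n m" for f g
  proof (rule specht_sumI)
    fix q i assume qi: "q \<in> partitions_of n" "i < m q"
    have "(\<lambda>T. (f + g) (q, i, T)) = (\<lambda>T. f (q, i, T)) + (\<lambda>T. g (q, i, T))" by (simp add: fun_eq_iff)
    thus "(\<lambda>T. (f + g) (q, i, T)) \<in> specht q"
      using cfun.subspace_add[OF subspace_specht specht_sum_slice(1)[OF f qi] specht_sum_slice(1)[OF g qi]] by simp
  qed (use specht_sum_slice(2)[OF f] specht_sum_slice(2)[OF g] in simp)
  show "cscale c f \<in> specht_sum n m" if f: "f \<in> specht_sum n m" for c f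
  proof (rule specht_sumI)
    fix q i assume qi: "q \<in> partitions_of n" "i < m q"
    have "(\<lambda>T. cscale c f (q, i, T)) = cscale c (\<lambda>T. f (q, i, T))" by (simp add: fun_eq_iff cscale_def)
    thus "(\<lambda>T. cscale c f (q, i, T)) \<in> specht q"
      using cfun.subspace_scale[OF subspace_specht specht_sum_slice(1)[OF f qi]] by simp
  qed (use specht_sum_slice(2)[OF f] in \<open>simp add: cscale_def\<close>)
  fix s f assume s: "s permutes {..<n}" and f: "f \<in> specht_sum n m"
  show "f \<circ> sum_act s \<in> specht_sum n m"
  proof (rule specht_sumI)
    fix q i assume qi: "q \<in> partitions_of n" "i < m q"
    have "(\<lambda>T. (f \<circ> sum_act s) (q, i, T)) = (\<lambda>T. f (q, i, T)) \<circ> nact s" by (simp add: fun_eq_iff sum_act_def nact_def)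
    thus "(\<lambda>T. (f \<circ> sum_act s) (q, i, T)) \<in> specht q"
      using submodD(6)[OF submod_specht'[OF qi(1)] s specht_sum_slice(1)[OF f qi]] by simp
  qed (use specht_sum_slice(2)[OF f] in \<open>simp add: sum_act_def\<close>)
qed

lemma csym_slice: "(\<lambda>T. csym n sum_act \<epsilon> r f (q, i, T)) = ncsym n \<epsilon> r (\<lambda>T. f (q, i, T))"
  by (simp add: csym_def sum_act_def nact_def)

lemma young_slice: "(\<lambda>T. young n sum_act q' f (q, i, T)) = young n nact q' (\<lambda>T. f (q, i, T))"
  by (simp add: young_def csym_slice)

lemma young_specht_other:
  "q \<in> partitions_of n \<Longrightarrow> q' \<in> partitions_of n \<Longrightarrow> q' \<noteq> q \<Longrightarrow> h \<in> specht q \<Longrightarrow> young n nact q' h = 0"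
  unfolding young_def using young_kills[OF _ ctab, of q' q h] by (simp add: partitions_of_def)

lemma young_specht_same:
  assumes "q \<in> partitions_of n" "h \<in> specht q"
  shows "\<exists>k. young n nact q h = cscale k (polytabloid q (ctab q))"
proof -
  have p: "is_partition q" "sum_list q = n" using partitions_ofD[OF assms(1)] by auto
  have "ncsym n triv (fst \<circ> ctab q) h \<in> supp_on (tabs q)"
    using csym_in[OF submod_specht'[OF assms(1)] assms(2)] specht_supp by blast
  from asym_supp[OF p(1) ctab this] show ?thesis by (simp add: young_def p(2))
qed

lemma young_polytabloid:
  assumes "q \<in> partitions_of n"
  shows "\<exists>\<alpha>. \<alpha> \<noteq> 0 \<and> young n nact q (polytabloid q (ctab q)) = cscale \<alpha> (polytabloid q (ctab q))"
  using polytabloid_eigen[OF _ ctab, of q] partitions_ofD[OF assms] by (simp add: young_def)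

lemma young_specht_sum:
  assumes f: "f \<in> specht_sum n m" and q: "q \<in> partitions_of n"
  shows "\<exists>k. \<forall>q' i T. young n sum_act q f (q', i, T) = (if q' = q \<and> i < m q then k i * polytabloid q (ctab q) T else 0)"
proof -
  have "\<exists>k. \<forall>T. young n sum_act q f (q, i, T) = k * polytabloid q (ctab q) T" if i: "i < m q" for i
    using young_specht_same[OF q specht_sum_slice(1)[OF f q i]] fun_cong[OF young_slice[of n q f q i]]
    by (auto simp: cscale_def)
  then obtain k where k: "\<And>i T. i < m q \<Longrightarrow> young n sum_act q f (q, i, T) = k i * polytabloid q (ctab q) T" by metis
  have "young n sum_act q f (q', i, T) = 0" if ne: "\<not> (q' = q \<and> i < m q)" for q' i T
  proof (cases "q' \<in> partitions_of n \<and> i < m q'")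
    case True
    hence "young n nact q (\<lambda>T. f (q', i, T)) = 0"
      using young_specht_other[of q' n q] specht_sum_slice(1)[OF f] q ne by auto
    thus ?thesis using fun_cong[OF young_slice[of n q f q' i], of T] by simp
  next
    case False
    thus ?thesis by (rule specht_sum_slice(2)[OF young_in[OF submod_specht_sum f]])
  qed
  thus ?thesis using k by (intro exI[of _ k]) auto
qed

lemma polytabloid_ctab_nz: "polytabloid q (ctab q) (tabloid q (ctab q)) = 1"
  by (rule polytabloid_self[OF ctab])

text \<open>
  On each summand of shape \<open>q\<close> the symmetrizer has rank one, with image spanned by the chosen
  polytabloid, and it annihilates the other shapes.
\<close>

lemma dim_young_specht_sum:
  assumes q: "q \<in> partitions_of n"
  shows "cfun.dim (young n sum_act q ` specht_sum n m) = m q"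
proof -
  define E where "E i = (\<lambda>(q', i', T). if q' = q \<and> i' = i then polytabloid q (ctab q) T else 0)" for i :: nat
  have Ein: "E i \<in> specht_sum n m" if "i < m q" for i
  proof (rule specht_sumI)
    fix q' i' assume "q' \<in> partitions_of n" "i' < m q'"
    show "(\<lambda>T. E i (q', i', T)) \<in> specht q'"
    proof (cases "q' = q \<and> i' = i")
      case True thus ?thesis using polytabloid_specht[OF ctab] by (simp add: E_def)
    next
      case False
      hence "(\<lambda>T. E i (q', i', T)) = 0" by (auto simp: E_def fun_eq_iff)
      thus ?thesis using cfun.subspace_0[OF subspace_specht] by simp
    qed
  qed (use that q in \<open>auto simp: E_def\<close>)
  obtain \<alpha> where \<alpha>: "\<alpha> \<noteq> 0" "young n nact q (polytabloid q (ctab q)) = cscale \<alpha> (polytabloid q (ctab q))"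
    using young_polytabloid[OF q] by blast
  have yE: "young n sum_act q (E i) = cscale \<alpha> (E i)" for i
  proof
    fix x :: "nat list \<times> nat \<times> (nat \<Rightarrow> nat)"
    obtain q' i' T where x: "x = (q', i', T)" by (cases x) auto
    have "young n sum_act q (E i) (q', i', T) = young n nact q (\<lambda>T. E i (q', i', T)) T"
      using fun_cong[OF young_slice] .
    also have "\<dots> = cscale \<alpha> (E i) (q', i', T)"
    proof (cases "q' = q \<and> i' = i")
      case True thus ?thesis using fun_cong[OF \<alpha>(2), of T] by (simp add: E_def cscale_def)
    next
      case False
      hence "(\<lambda>T. E i (q', i', T)) = 0" by (auto simp: E_def fun_eq_iff)
      thus ?thesis using False by (simp only: young_0) (auto simp: E_def cscale_def)
    qed
    finally show "young n sum_act q (E i) x = cscale \<alpha> (E i) x" by (simp add: x)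
  qed
  have inj: "inj_on E {..<m q}"
  proof (rule inj_onI)
    fix i j assume "E i = E j"
    from fun_cong[OF this, of "(q, i, tabloid q (ctab q))"] show "i = j"
      by (simp add: E_def polytabloid_ctab_nz split: if_splits)
  qed
  show ?thesis
  proof (rule cfun.dim_unique)
    show "E ` {..<m q} \<subseteq> young n sum_act q ` specht_sum n m"
    proof
      fix f assume "f \<in> E ` {..<m q}"
      then obtain i where i: "i < m q" "f = E i" by auto
      have "f = young n sum_act q (cscale (inverse \<alpha>) (E i))"
        using \<alpha>(1) by (simp add: young_scale yE i(2))
      thus "f \<in> young n sum_act q ` specht_sum n m"
        using submodD(4)[OF submod_specht_sum Ein[OF i(1)]] by blast
    qed
    show "young n sum_act q ` specht_sum n m \<subseteq> cfun.span (E ` {..<m q})"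
    proof
      fix h assume "h \<in> young n sum_act q ` specht_sum n m"
      then obtain f where f: "f \<in> specht_sum n m" "h = young n sum_act q f" by auto
      obtain k where k: "\<And>q' i T. h (q', i, T) = (if q' = q \<and> i < m q then k i * polytabloid q (ctab q) T else 0)"
        using young_specht_sum[OF f(1) q] f(2) by auto
      have "h = (\<Sum>i<m q. cscale (k i) (E i))"
      proof
        fix x :: "nat list \<times> nat \<times> (nat \<Rightarrow> nat)"
    obtain q' i' T where x: "x = (q', i', T)" by (cases x) auto
        have "(\<Sum>i<m q. cscale (k i) (E i)) x = (\<Sum>i<m q. if i' = i then (if q' = q then k i * polytabloid q (ctab q) T else 0) else 0)"
          unfolding sum_fun_apply by (rule sum.cong) (auto simp: x E_def cscale_def)
        thus "h x = (\<Sum>i<m q. cscale (k i) (E i)) x" using k by (simp add: x)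
      qed
      thus "h \<in> cfun.span (E ` {..<m q})"
        by (simp only:) (intro cfun.span_sum cfun.span_scale cfun.span_base imageI)
    qed
    show "cfun.independent (E ` {..<m q})"
    proof (rule cfun.independent_if_scalars_zero)
      fix c x assume z: "(\<Sum>x\<in>E ` {..<m q}. cscale (c x) x) = 0" and x: "x \<in> E ` {..<m q}"
      then obtain j where j: "j < m q" "x = E j" by auto
      have "(\<Sum>i<m q. cscale (c (E i)) (E i)) = 0" using z by (simp add: sum.reindex[OF inj])
      hence "0 = (\<Sum>i<m q. cscale (c (E i)) (E i)) (q, j, tabloid q (ctab q))" by simp
      also have "\<dots> = (\<Sum>i<m q. if j = i then c (E i) else 0)"
        unfolding sum_fun_apply by (rule sum.cong) (auto simp: E_def cscale_def polytabloid_ctab_nz)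
      also have "\<dots> = c (E j)" using j(1) by simp
      finally show "c x = 0" using j(2) by simp
    qed simp
    show "card (E ` {..<m q}) = m q" by (simp add: card_image[OF inj])
  qed
qed

definition mult_of :: "nat \<Rightarrow> ((nat \<Rightarrow> nat) \<Rightarrow> 'x \<Rightarrow> 'x) \<Rightarrow> ('x \<Rightarrow> complex) set \<Rightarrow> nat list \<Rightarrow> nat"
  where "mult_of n act W q = (if q \<in> partitions_of n then cfun.dim (young n act q ` W) else 0)"

text \<open>
  Send a basis of the image of each Young symmetrizer to \<open>W\<close> through \<open>orbit_hom\<close>. The kernel is
  zero because a Young symmetrizer would detect it; the image is everything because otherwise a
  symmetrizer would detect a complement of it, while all images of symmetrizers have been
  covered.
\<close>

theorem (in right_action) specht_decomposition:
  assumes W: "submod n act W" and fin: "finite B" "W \<subseteq> cfun.span B"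
  shows "rep_isomorphic n act W sum_act (specht_sum n (mult_of n act W))"
proof -
  define m where "m = mult_of n act W"
  have sub: "young n act q ` W \<subseteq> W" for q using young_in[OF W] by blast
  have "\<exists>v. (\<forall>i<m q. v i \<in> W) \<and> inj_on (\<lambda>i. young n act q (v i)) {..<m q}
      \<and> cfun.independent ((\<lambda>i. young n act q (v i)) ` {..<m q}) \<and> young n act q ` W \<subseteq> cfun.span ((\<lambda>i. young n act q (v i)) ` {..<m q})"
    if q: "q \<in> partitions_of n" for q
  proof -
    obtain C where C: "C \<subseteq> young n act q ` W" "cfun.independent C" "young n act q ` W \<subseteq> cfun.span C" "card C = cfun.dim (young n act q ` W)"
      by (rule cfun.basis_exists)
    have "finite C" using cfun.independent_span_bound[OF fin(1) C(2)] C(1) sub fin(2) by blast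
    then obtain e where e: "bij_betw e {..<m q} C"
      using finite_same_card_bij[of "{..<m q}" C] C(4) q by (auto simp: m_def mult_of_def)
    have "\<exists>v. v \<in> W \<and> young n act q v = e i" if "i < m q" for i
      using bij_betwE[OF e] that C(1) by (metis (no_types, lifting) imageE lessThan_iff subsetD)
    then obtain v where v: "\<And>i. i < m q \<Longrightarrow> v i \<in> W" "\<And>i. i < m q \<Longrightarrow> young n act q (v i) = e i" by metis
    have im: "(\<lambda>i. young n act q (v i)) ` {..<m q} = C"
      using bij_betw_imp_surj_on[OF e] v(2) by (metis (no_types, lifting) image_cong lessThan_iff)
    moreover have "inj_on (\<lambda>i. young n act q (v i)) {..<m q}"
      using bij_betw_imp_inj_on[OF e] v(2) by (metis (no_types, lifting) inj_on_cong lessThan_iff)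
    ultimately show ?thesis using v(1) C by (intro exI[of _ v]) auto
  qed
  then obtain v where v: "\<And>q i. q \<in> partitions_of n \<Longrightarrow> i < m q \<Longrightarrow> v q i \<in> W"
      "\<And>q. q \<in> partitions_of n \<Longrightarrow> inj_on (\<lambda>i. young n act q (v q i)) {..<m q}"
      "\<And>q. q \<in> partitions_of n \<Longrightarrow> cfun.independent ((\<lambda>i. young n act q (v q i)) ` {..<m q})"
      "\<And>q. q \<in> partitions_of n \<Longrightarrow> young n act q ` W \<subseteq> cfun.span ((\<lambda>i. young n act q (v q i)) ` {..<m q})"
    by metis
  let ?S = "specht_sum n m"
  define \<Psi> where "\<Psi> f = (\<Sum>q\<in>partitions_of n. \<Sum>i<m q. orbit_hom act q (v q i) (\<lambda>T. f (q, i, T)))" for f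
  have add: "\<Psi> (f + g) = \<Psi> f + \<Psi> g" for f g
  proof -
    have "(\<lambda>T. (f + g) (q, i, T)) = (\<lambda>T. f (q, i, T)) + (\<lambda>T. g (q, i, T))" for q i by (simp add: fun_eq_iff)
    thus ?thesis unfolding \<Psi>_def by (simp only: orbit_hom_add sum.distrib)
  qed
  have sc: "\<Psi> (cscale c f) = cscale c (\<Psi> f)" for c f
  proof -
    have "(\<lambda>T. cscale c f (q, i, T)) = cscale c (\<lambda>T. f (q, i, T))" for q i by (simp add: fun_eq_iff cscale_def)
    thus ?thesis unfolding \<Psi>_def by (simp only: orbit_hom_scale cfun.scale_sum_right)
  qed
  have act: "\<Psi> (f \<circ> sum_act s) = \<Psi> f \<circ> act s" if s: "s permutes {..<n}" for s f
  proof -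
    have 1: "(\<lambda>T. (f \<circ> sum_act s) (q, i, T)) = (\<lambda>T. f (q, i, T)) \<circ> nact s" for q i
      by (simp add: fun_eq_iff sum_act_def nact_def)
    have 2: "orbit_hom act q w (h \<circ> nact s) = orbit_hom act q w h \<circ> act s" if "q \<in> partitions_of n" for q w h
      using orbit_hom_act[of s q] s partitions_ofD(2)[OF that] by simp
    show ?thesis unfolding \<Psi>_def 1 by (rule ext) (simp add: 2 sum_fun_apply)
  qed
  have inW: "\<Psi> f \<in> W" for f
    unfolding \<Psi>_def
    by (intro submodD(7)[OF W] orbit_hom_in) (use W v(1) partitions_ofD(2) in auto)
  have \<Psi>0: "\<Psi> 0 = 0" using sc[of 0 0] by (metis cfun.scale_zero_left)
  \<comment> \<open>\<open>\<Psi>\<close> maps the copies of the chosen polytabloid to the chosen basis.\<close>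
  have \<Psi>E: "\<Psi> h = (\<Sum>i<m q. cscale (k i) (young n act q (v q i)))"
    if q: "q \<in> partitions_of n" and h: "\<And>q' i T. h (q', i, T) = (if q' = q \<and> i < m q then k i * polytabloid q (ctab q) T else 0)"
    for q h k
  proof -
    have "\<Psi> h = (\<Sum>q'\<in>partitions_of n. if q' = q then (\<Sum>i<m q. cscale (k i) (young n act q (v q i))) else 0)"
      unfolding \<Psi>_def
    proof (rule sum.cong[OF refl])
      fix q' assume "q' \<in> partitions_of n"
      show "(\<Sum>i<m q'. orbit_hom act q' (v q' i) (\<lambda>T. h (q', i, T)))
          = (if q' = q then (\<Sum>i<m q. cscale (k i) (young n act q (v q i))) else 0)"
      proof (cases "q' = q")
        case True
        have "(\<Sum>i<m q. orbit_hom act q (v q i) (\<lambda>T. h (q, i, T))) = (\<Sum>i<m q. cscale (k i) (young n act q (v q i)))"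
        proof (rule sum.cong[OF refl])
          fix i assume "i \<in> {..<m q}"
          hence "(\<lambda>T. h (q, i, T)) = cscale (k i) (polytabloid q (ctab q))" by (simp add: h fun_eq_iff cscale_def)
          thus "orbit_hom act q (v q i) (\<lambda>T. h (q, i, T)) = cscale (k i) (young n act q (v q i))"
            using orbit_hom_polytabloid[of q] partitions_ofD(2)[OF q] by (simp add: orbit_hom_scale)
        qed
        thus ?thesis using True by simp
      next
        case False
        have "orbit_hom act q' w (\<lambda>T. h (q', i, T)) = 0" for w i
          using False by (simp add: h orbit_hom_def fun_eq_iff)
        thus ?thesis using False by simp
      qed
    qed
    also have "\<dots> = (\<Sum>i<m q. cscale (k i) (young n act q (v q i)))"
      using q by (subst sum.delta[OF finite_partitions_of]) simp
    finally show ?thesis .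
  qed
  have inj: "inj_on \<Psi> ?S"
  proof -
    define K where "K = {f \<in> ?S. \<Psi> f = 0}"
    have KG: "submod n sum_act K"
      unfolding submod_def K_def using submodD[OF submod_specht_sum[of n m]] \<Psi>0
      by (auto intro!: cfun.subspaceI simp: add sc act)
    have "K = {0}"
    proof (rule ccontr)
      assume "K \<noteq> {0}"
      then obtain q f where f: "q \<in> partitions_of n" "f \<in> K" "young n sum_act q f \<noteq> 0"
        using sact.young_detects[OF KG] by blast
      obtain k where k: "\<And>q' i T. young n sum_act q f (q', i, T) = (if q' = q \<and> i < m q then k i * polytabloid q (ctab q) T else 0)"
        using young_specht_sum[of f n m q] f by (auto simp: K_def)
      have "\<Psi> (young n sum_act q f) = 0" using young_in[OF KG f(2)] by (simp add: K_def)
      hence z: "(\<Sum>i<m q. cscale (k i) (young n act q (v q i))) = 0" using \<Psi>E[OF f(1) k] by simp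
      let ?y = "\<lambda>i. young n act q (v q i)"
      have ki: "k i = 0" if i: "i < m q" for i
      proof (rule ccontr)
        assume ne: "k i \<noteq> 0"
        define c where "c x = k (inv_into {..<m q} ?y x)" for x
        have cy: "c (?y j) = k j" if "j < m q" for j
          unfolding c_def using inv_into_f_f[OF v(2)[OF f(1)], of j] that by simp
        have "(\<Sum>x\<in>?y ` {..<m q}. cscale (c x) x) = (\<Sum>j<m q. cscale (k j) (?y j))"
          by (simp add: sum.reindex[OF v(2)[OF f(1)]] cy)
        hence "cfun.dependent (?y ` {..<m q})"
          unfolding cfun.dependent_explicit using z ne i cy
          by (intro exI[of _ "?y ` {..<m q}"] exI[of _ c] conjI) auto
        thus False using v(3)[OF f(1)] by simp
      qed
      have "young n sum_act q f = 0"
      proof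
        fix x show "young n sum_act q f x = 0 x" by (cases x) (simp add: k ki)
      qed
      thus False using f(3) by simp
    qed
    show ?thesis
    proof (rule inj_onI)
      fix f g assume fg: "f \<in> ?S" "g \<in> ?S" "\<Psi> f = \<Psi> g"
      have "\<Psi> f = \<Psi> (f - g) + \<Psi> g" by (simp add: add[symmetric])
      hence "\<Psi> (f - g) = 0" using fg(3) by simp
      hence "f - g \<in> K" using submodD(5)[OF submod_specht_sum fg(1,2)] by (simp add: K_def)
      thus "f = g" using \<open>K = {0}\<close> by simp
    qed
  qed
  have sub: "cfun.subspace (\<Psi> ` ?S)"
  proof -
    have "Vector_Spaces.linear cscale cscale \<Psi>" by (simp add: linear_cscale_iff add sc)
    then interpret l: Vector_Spaces.linear cscale cscale \<Psi> .
    show ?thesis by (rule l.subspace_image[OF submodD(1)[OF submod_specht_sum]])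
  qed
  have yim: "young n act q ` W \<subseteq> \<Psi> ` ?S" if q: "q \<in> partitions_of n" for q
  proof -
    have "young n act q (v q i) \<in> \<Psi> ` ?S" if i: "i < m q" for i
    proof -
      define h where "h = (\<lambda>(q', i', T). if q' = q \<and> i' < m q then of_bool (i' = i) * polytabloid q (ctab q) T else 0)"
      have "h \<in> ?S"
      proof (rule specht_sumI)
        fix q' i' assume "q' \<in> partitions_of n" "i' < m q'"
        show "(\<lambda>T. h (q', i', T)) \<in> specht q'"
        proof (cases "q' = q \<and> i' = i")
          case True thus ?thesis using polytabloid_specht[OF ctab] i by (simp add: h_def)
        next
          case False
          hence "(\<lambda>T. h (q', i', T)) = 0" by (auto simp: h_def fun_eq_iff)
          thus ?thesis using cfun.subspace_0[OF subspace_specht] by simp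
        qed
      qed (use q in \<open>auto simp: h_def\<close>)
      moreover have "\<Psi> h = (\<Sum>j<m q. cscale (of_bool (j = i)) (young n act q (v q j)))"
        by (rule \<Psi>E[OF q]) (simp add: h_def)
      moreover have "\<dots> = (\<Sum>j<m q. if j = i then young n act q (v q j) else 0)"
        by (rule sum.cong) (auto simp: cscale_def fun_eq_iff)
      ultimately have "\<Psi> h = young n act q (v q i)" using i by (simp add: sum.delta)
      thus ?thesis using \<open>h \<in> ?S\<close> by (metis image_eqI)
    qed
    hence "cfun.span ((\<lambda>i. young n act q (v q i)) ` {..<m q}) \<subseteq> \<Psi> ` ?S"
      by (intro cfun.span_minimal[OF _ sub]) auto
    thus ?thesis using v(4)[OF q] by blast
  qed
  have surj: "\<Psi> ` ?S = W"
  proof (rule ccontr)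
    assume ne: "\<Psi> ` ?S \<noteq> W"
    have VG: "submod n act (\<Psi> ` ?S)"
      unfolding submod_def
    proof (intro conjI allI impI ballI sub)
      fix s x assume s: "s permutes {..<n}" and "x \<in> \<Psi> ` ?S"
      then obtain f where f: "f \<in> ?S" "x = \<Psi> f" by blast
      have "x \<circ> act s = \<Psi> (f \<circ> sum_act s)" by (simp add: f(2) act[OF s])
      thus "x \<circ> act s \<in> \<Psi> ` ?S" using submodD(6)[OF submod_specht_sum s f(1)] by (rule image_eqI)
    qed
    obtain U where U: "submod n act U" "U \<subseteq> W" "U \<noteq> {0}" "U \<inter> \<Psi> ` ?S = {0}"
      using averaging[OF W VG _ ne] inW by auto
    obtain q f where f: "q \<in> partitions_of n" "f \<in> U" "young n act q f \<noteq> 0"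
      using young_detects[OF U(1,3)] by blast
    have "young n act q f \<in> \<Psi> ` ?S" using yim[OF f(1)] f(2) U(2) by blast
    thus False using young_in[OF U(1) f(2)] U(4) f(3) by blast
  qed
  define \<Phi> where "\<Phi> = inv_into ?S \<Psi>"
  have bij: "bij_betw \<Psi> ?S W" using inj surj by (simp add: bij_betw_def)
  have \<Phi>S: "\<Phi> f \<in> ?S" "\<Psi> (\<Phi> f) = f" if "f \<in> W" for f
    using that surj by (auto simp: \<Phi>_def inv_into_into f_inv_into_f)
  have \<Phi>I: "\<Phi> (\<Psi> g) = g" if "g \<in> ?S" for g using inv_into_f_f[OF inj that] by (simp add: \<Phi>_def)
  show ?thesis
    unfolding rep_isomorphic_def m_def[symmetric]
  proof (intro exI[of _ \<Phi>] conjI ballI allI impI)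
    show "bij_betw \<Phi> W ?S" unfolding \<Phi>_def by (rule bij_betw_inv_into[OF bij])
    show "\<Phi> (f + g) = \<Phi> f + \<Phi> g" if "f \<in> W" "g \<in> W" for f g
      using \<Phi>I[OF submodD(3)[OF submod_specht_sum \<Phi>S(1)[OF that(1)] \<Phi>S(1)[OF that(2)]]] \<Phi>S(2) that by (simp add: add)
    show "\<Phi> (cscale c f) = cscale c (\<Phi> f)" if "f \<in> W" for c f
      using \<Phi>I[OF submodD(4)[OF submod_specht_sum \<Phi>S(1)[OF that]], of c] \<Phi>S(2) that by (simp add: sc)
    show "\<Phi> (f \<circ> act s) = \<Phi> f \<circ> sum_act s" if "s permutes {..<n}" "f \<in> W" for s f
      using \<Phi>I[OF submodD(6)[OF submod_specht_sum that(1) \<Phi>S(1)[OF that(2)]]] \<Phi>S(2) that by (simp add: act)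
  qed
qed


section \<open>Kronecker coefficients as dimensions\<close>

lemma (in right_action) rep_isomorphic_young:
  assumes W: "submod n act W" 
    and add: "\<forall>f\<in>W. \<forall>g\<in>W. \<Phi> (f + g) = \<Phi> f + \<Phi> g"
    and sc: "\<forall>c. \<forall>f\<in>W. \<Phi> (cscale c f) = cscale c (\<Phi> f)"
    and act: "\<forall>s. s permutes {..<n} \<longrightarrow> (\<forall>f\<in>W. \<Phi> (f \<circ> act s) = \<Phi> f \<circ> act' s)" and f: "f \<in> W"
  shows "\<Phi> (young n act q f) = young n act' q (\<Phi> f)"
proof -
  have z: "\<Phi> 0 = 0" using sc submodD(2)[OF W] by (metis cfun.scale_zero_left)
  have sum: "\<Phi> (\<Sum>i\<in>I. F i) = (\<Sum>i\<in>I. \<Phi> (F i))" if "\<forall>i\<in>I. F i \<in> W" for I F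
    using that
  proof (induction I rule: infinite_finite_induct)
    case (insert x A)
    hence "F x \<in> W" "(\<Sum>i\<in>A. F i) \<in> W" "\<Phi> (\<Sum>i\<in>A. F i) = (\<Sum>i\<in>A. \<Phi> (F i))"
      using submodD(7)[OF W, of A F] by auto
    thus ?case unfolding sum.insert[OF insert.hyps] using add by metis
  qed (use z in auto)
  have cs: "\<Phi> (csym n act \<epsilon> r f) = csym n act' \<epsilon> r (\<Phi> f)" if f: "f \<in> W"
    for \<epsilon> f and r :: "nat \<Rightarrow> nat"
  proof -
    have "\<Phi> (csym n act \<epsilon> r f) = (\<Sum>s\<in>stab n r. \<Phi> (cscale (\<epsilon> s) (f \<circ> act s)))"
      unfolding csym_as_sum
      by (rule sum) (use f in \<open>auto intro!: submodD(4)[OF W] submodD(6)[OF W] stab_permutes\<close>)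
    also have "\<dots> = (\<Sum>s\<in>stab n r. cscale (\<epsilon> s) (\<Phi> f \<circ> act' s))"
      using sc act f submodD(6)[OF W _ f] by (intro sum.cong refl) (simp add: stab_permutes)
    finally show ?thesis by (simp add: csym_as_sum)
  qed
  show ?thesis unfolding young_def cs[OF csym_in[OF W f]] cs[OF f] ..
qed

text \<open>
  Isomorphisms commute with symmetrizers, so the multiplicities in any decomposition are the
  same.
\<close>

lemma (in right_action) rep_isomorphic_mult:
  assumes W: "submod n act W" and fin: "finite B" "W \<subseteq> cfun.span B"
    and iso: "rep_isomorphic n act W sum_act (specht_sum n m)" and q: "q \<in> partitions_of n"
  shows "m q = cfun.dim (young n act q ` W)"
proof -
  obtain \<Phi> where \<Phi>: "bij_betw \<Phi> W (specht_sum n m)"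
      "\<forall>f\<in>W. \<forall>g\<in>W. \<Phi> (f + g) = \<Phi> f + \<Phi> g" "\<forall>c. \<forall>f\<in>W. \<Phi> (cscale c f) = cscale c (\<Phi> f)"
      "\<forall>s. s permutes {..<n} \<longrightarrow> (\<forall>f\<in>W. \<Phi> (f \<circ> act s) = \<Phi> f \<circ> sum_act s)"
    using iso unfolding rep_isomorphic_def by blast
  have sub: "young n act q ` W \<subseteq> W" using young_in[OF W] by blast
  have "\<Phi> ` (young n act q ` W) = (\<lambda>f. young n sum_act q (\<Phi> f)) ` W"
    using rep_isomorphic_young[OF W \<Phi>(2-4)] by (simp add: image_image)
  also have "\<dots> = young n sum_act q ` specht_sum n m"
    using bij_betw_imp_surj_on[OF \<Phi>(1)] by (metis image_image)
  finally have "cfun.dim (\<Phi> ` (young n act q ` W)) = m q"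
    using dim_young_specht_sum[OF q] by simp
  moreover have "cfun.dim (\<Phi> ` (young n act q ` W)) = cfun.dim (young n act q ` W)"
  proof (rule dim_iso_image[OF young_subspace[OF submodD(1)[OF W]] fin(1)])
    show "inj_on \<Phi> (young n act q ` W)" using bij_betw_imp_inj_on[OF \<Phi>(1)] sub by (rule inj_on_subset)
    show "young n act q ` W \<subseteq> cfun.span B" using sub fin(2) by blast
  qed (use \<Phi> sub in blast)+
  ultimately show ?thesis by simp
qed

text \<open>
  Transport the invariant vector to the direct sum of Specht modules and take a nonzero
  component.
\<close>

lemma (in right_action) invariant_constituent:
  assumes W: "submod n act W" and fin: "finite B" "W \<subseteq> cfun.span B"
    and f: "f \<in> W" "f \<noteq> 0" and inv: "\<And>s. s \<in> stab n r \<Longrightarrow> f \<circ> act s = f"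
  obtains q u f' where "q \<in> partitions_of n" "u \<in> specht q" "u \<noteq> 0"
      "\<And>s. s \<in> stab n r \<Longrightarrow> u \<circ> nact s = u" "f' \<in> W" "young n act q f' \<noteq> 0"
proof -
  let ?m = "mult_of n act W"
  obtain \<Phi> where \<Phi>: "bij_betw \<Phi> W (specht_sum n ?m)"
      "\<forall>f\<in>W. \<forall>g\<in>W. \<Phi> (f + g) = \<Phi> f + \<Phi> g" "\<forall>c. \<forall>f\<in>W. \<Phi> (cscale c f) = cscale c (\<Phi> f)"
      "\<forall>s. s permutes {..<n} \<longrightarrow> (\<forall>f\<in>W. \<Phi> (f \<circ> act s) = \<Phi> f \<circ> sum_act s)"
    using specht_decomposition[OF W fin] unfolding rep_isomorphic_def by blast
  have z: "\<Phi> 0 = 0" using \<Phi>(3) submodD(2)[OF W] by (metis cfun.scale_zero_left)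
  have nz: "\<Phi> f \<noteq> 0"
    using bij_betw_imp_inj_on[OF \<Phi>(1)] z f submodD(2)[OF W] by (metis inj_onD)
  have S: "\<Phi> f \<in> specht_sum n ?m" using bij_betwE[OF \<Phi>(1)] f(1) by blast
  obtain q i T where qiT: "\<Phi> f (q, i, T) \<noteq> 0" using nz by (auto simp: fun_eq_iff)
  hence qi: "q \<in> partitions_of n" "i < ?m q" using specht_sum_slice(2)[OF S] by blast+
  define u where "u = (\<lambda>T. \<Phi> f (q, i, T))"
  have 1: "u \<in> specht q" unfolding u_def by (rule specht_sum_slice(1)[OF S qi])
  have 2: "u \<noteq> 0" using qiT by (auto simp: u_def fun_eq_iff)
  have 3: "u \<circ> nact s = u" if s: "s \<in> stab n r" for s
  proof -
    have "\<Phi> f \<circ> sum_act s = \<Phi> f" using \<Phi>(4) stab_permutes[OF s] f(1) inv[OF s] by metis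
    hence "\<Phi> f (sum_act s (q, i, T)) = \<Phi> f (q, i, T)" for T by (metis comp_apply)
    thus ?thesis by (simp add: u_def fun_eq_iff sum_act_def nact_def)
  qed
  have "\<exists>f'\<in>W. young n act q f' \<noteq> 0"
  proof (rule ccontr)
    assume "\<not> ?thesis"
    hence "young n act q ` W \<subseteq> cfun.span {}" by auto
    hence "cfun.dim (young n act q ` W) \<le> 0" using cfun.dim_le_card[of _ "{}"] by simp
    thus False using qi by (simp add: mult_of_def)
  qed
  thus thesis using that qi(1) 1 2 3 by blast
qed

lemma submod_tensor:
  assumes V: "submod n nact V" and W: "submod n nact W"
  shows "submod n tensor_act (tensor V W)"
  unfolding tensor_def
proof (rule submod_span)
  fix s x assume s: "s permutes {..<n}" and "x \<in> {\<lambda>(x, y). f x * h y |f h. f \<in> V \<and> h \<in> W}"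
  then obtain f h where fh: "x = (\<lambda>(x, y). f x * h y)" "f \<in> V" "h \<in> W" by blast
  have "x \<circ> tensor_act s = (\<lambda>(x, y). (f \<circ> nact s) x * (h \<circ> nact s) y)"
    by (auto simp: fh(1) tensor_act_def nact_def fun_eq_iff)
  moreover have "\<dots> \<in> cfun.span {\<lambda>(x, y). f x * h y |f h. f \<in> V \<and> h \<in> W}"
    using submodD(6)[OF V s fh(2)] submodD(6)[OF W s fh(3)] by (intro cfun.span_base) blast
  ultimately show "x \<circ> tensor_act s \<in> cfun.span {\<lambda>(x, y). f x * h y |f h. f \<in> V \<and> h \<in> W}" by simp
qed

text \<open>
  Fixing one variable turns tensors into vectors of a factor, which lets statements about Specht
  modules apply to tensor products.
\<close>

lemma tensor_slices:
  assumes f: "f \<in> tensor V W" and V: "cfun.subspace V" and W: "cfun.subspace W"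
  shows "(\<lambda>x. f (x, y)) \<in> V" "(\<lambda>y. f (x, y)) \<in> W"
proof -
  have "(\<forall>y. (\<lambda>x. f (x, y)) \<in> V) \<and> (\<forall>x. (\<lambda>y. f (x, y)) \<in> W)"
    using f unfolding tensor_def
  proof (induction rule: cfun.span_induct)
    let ?X = "{f. (\<forall>y. (\<lambda>x. f (x, y)) \<in> V) \<and> (\<forall>x. (\<lambda>y. f (x, y)) \<in> W)}"
    show "cfun.subspace ?X"
    proof (rule cfun.subspaceI)
      show "0 \<in> ?X" using cfun.subspace_0[OF V] cfun.subspace_0[OF W] by (simp add: zero_fun_def)
      show "f + g \<in> ?X" if "f \<in> ?X" "g \<in> ?X" for f g
      proof -
        have "(\<lambda>x. (f + g) (x, y)) = (\<lambda>x. f (x, y)) + (\<lambda>x. g (x, y))" for y by (simp add: fun_eq_iff)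
        moreover have "(\<lambda>y. (f + g) (x, y)) = (\<lambda>y. f (x, y)) + (\<lambda>y. g (x, y))" for x by (simp add: fun_eq_iff)
        ultimately show ?thesis using that cfun.subspace_add[OF V] cfun.subspace_add[OF W] by simp
      qed
      show "cscale c f \<in> ?X" if "f \<in> ?X" for c f
      proof -
        have "(\<lambda>x. cscale c f (x, y)) = cscale c (\<lambda>x. f (x, y))" for y by (simp add: cscale_def)
        moreover have "(\<lambda>y. cscale c f (x, y)) = cscale c (\<lambda>y. f (x, y))" for x by (simp add: cscale_def)
        ultimately show ?thesis using that cfun.subspace_scale[OF V] cfun.subspace_scale[OF W] by simp
      qed
    qed
    fix g assume "g \<in> {\<lambda>(x, y). f x * h y |f h. f \<in> V \<and> h \<in> W}"
    then obtain f h where fh: "g = (\<lambda>(x, y). f x * h y)" "f \<in> V" "h \<in> W" by blast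
    have "(\<lambda>x. g (x, y)) = cscale (h y) f" "(\<lambda>y. g (x, y)) = cscale (f x) h" for x y
      by (simp_all add: fh(1) cscale_def fun_eq_iff)
    thus "(\<forall>y. (\<lambda>x. g (x, y)) \<in> V) \<and> (\<forall>x. (\<lambda>y. g (x, y)) \<in> W)"
      using cfun.subspace_scale[OF V fh(2)] cfun.subspace_scale[OF W fh(3)] by simp
  qed
  thus "(\<lambda>x. f (x, y)) \<in> V" "(\<lambda>y. f (x, y)) \<in> W" by blast+
qed

lemma tensor_specht_supp: "tensor (specht p) (specht q) \<subseteq> supp_on (tabs p \<times> tabs q)"
proof
  fix f assume f: "f \<in> tensor (specht p) (specht q)"
  note sl = tensor_slices[OF f subspace_specht subspace_specht]
  show "f \<in> supp_on (tabs p \<times> tabs q)"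
    using sl specht_supp[of p] specht_supp[of q] unfolding supp_on_def by fastforce
qed

lemma tensor_specht_fin:
  "finite (delta ` (tabs p \<times> tabs q))" "tensor (specht p) (specht q) \<subseteq> cfun.span (delta ` (tabs p \<times> tabs q))"
  using finite_tabs tensor_specht_supp supp_on_span[of "tabs p \<times> tabs q"] by blast+

lemma submod_tensor_specht:
  "p \<in> partitions_of n \<Longrightarrow> q \<in> partitions_of n \<Longrightarrow> submod n tensor_act (tensor (specht p) (specht q))"
  by (intro submod_tensor submod_specht')

theorem kronecker_dim:
  assumes "p \<in> partitions_of n" "q \<in> partitions_of n" "r \<in> partitions_of n"
  shows "kronecker p q r = cfun.dim (young n tensor_act r ` tensor (specht p) (specht q))"
proof -
  let ?W = "tensor (specht p) (specht q)"
  note W = submod_tensor_specht[OF assms(1,2)]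
  have "(THE m. tensor_multiplicities n p q m) = mult_of n tensor_act ?W"
  proof (rule the_equality)
    show "tensor_multiplicities n p q (mult_of n tensor_act ?W)"
      using tact.specht_decomposition[OF W tensor_specht_fin]
      by (simp add: tensor_multiplicities_def mult_of_def)
    fix m assume m: "tensor_multiplicities n p q m"
    show "m = mult_of n tensor_act ?W"
    proof
      fix q'
      show "m q' = mult_of n tensor_act ?W q'"
        using m tact.rep_isomorphic_mult[OF W tensor_specht_fin, of m q']
        by (auto simp: tensor_multiplicities_def mult_of_def)
    qed
  qed
  thus ?thesis using assms partitions_ofD(2)[OF assms(1)] partitions_ofD(2)[OF assms(2)] partitions_ofD(2)[OF assms(3)]
    by (simp add: kronecker_def mult_of_def)
qed


section \<open>Matrix coefficients of Specht modules\<close>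

lemma dim_eq_1I:
  assumes Y: "cfun.subspace Y" and f0: "f0 \<in> Y" "f0 \<noteq> 0"
    and dep: "\<And>f g. f \<in> Y \<Longrightarrow> g \<in> Y \<Longrightarrow> \<exists>c d. (c \<noteq> 0 \<or> d \<noteq> 0) \<and> cscale c f + cscale d g = 0"
  shows "cfun.dim Y = 1"
proof (rule cfun.dim_unique[of "{f0}"])
  show "Y \<subseteq> cfun.span {f0}"
  proof
    fix g assume g: "g \<in> Y"
    obtain c d where cd: "c \<noteq> 0 \<or> d \<noteq> 0" "cscale c f0 + cscale d g = 0" using dep[OF f0(1) g] by blast
    have d: "d \<noteq> 0"
    proof
      assume "d = 0"
      hence "cscale c f0 = 0" using cd(2) by simp
      thus False using cd(1) f0(2) \<open>d = 0\<close> by simp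
    qed
    have "cscale d g = cscale (- c) f0" using cd(2) by (simp add: eq_neg_iff_add_eq_0 add.commute)
    hence "g = cscale (inverse d) (cscale (- c) f0)" using d by (metis cfun.scale_one cfun.scale_scale left_inverse)
    also have "\<dots> \<in> cfun.span {f0}" by (intro cfun.span_scale cfun.span_base) simp
    finally show "g \<in> cfun.span {f0}" .
  qed
  show "cfun.independent {f0}" using f0(2) by simp
qed (use f0 in auto)

lemma ext_stab: "U \<in> extensional {..<n} \<Longrightarrow> s permutes {..<n} \<Longrightarrow> U \<circ> s = U \<longleftrightarrow> s \<in> stab n U"
proof -
  assume U: "U \<in> extensional {..<n}" and s: "s permutes {..<n}"
  have "(U \<circ> s) x = U x" if "\<not> x < n" for x using s that by (simp add: permutes_def)
  thus ?thesis using s by (auto simp: stab_def fun_eq_iff)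
qed

lemma tabs_ext: "U \<in> tabs q \<Longrightarrow> q \<in> partitions_of n \<Longrightarrow> U \<in> extensional {..<n}"
  using tabs_content(1)[of U q] partitions_ofD(2)[of q n] by simp

lemma pairing_polytabloid: "pairing p u (polytabloid p t) = pairing p (ncsym (sum_list p) csign (snd \<circ> t) u) (delta (tabloid p t))"
  unfolding polytabloid_csym by (rule pairing_sgn[symmetric])

text \<open>
  The sum transforms under the column stabilizer like the polytabloid \<open>e\<close>, hence is a multiple
  of it by \<open>asym_supp\<close>; its pairing with \<open>e\<close> is the sum of the squares of the matrix
  coefficients, one of which is the squared norm of \<open>e\<close>.
\<close>

lemma matrix_coefficient_sum:
  assumes p: "is_partition p" and t: "is_tableau p t"
  shows "\<exists>c. c \<noteq> 0 \<and> (\<Sum>g\<in>Sn (sum_list p). cscale (pairing p (polytabloid p t \<circ> nact g) (polytabloid p t)) (polytabloid p t \<circ> nact g))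
      = cscale c (polytabloid p t)"
proof -
  let ?n = "sum_list p" and ?e = "polytabloid p t" and ?c = "snd \<circ> t"
  define cg where "cg g = pairing p (?e \<circ> nact g) ?e" for g
  define X where "X = (\<Sum>g\<in>Sn ?n. cscale (cg g) (?e \<circ> nact g))"
  have eS: "?e \<circ> nact s = cscale (csign (inv s)) ?e" if "s \<in> stab ?n ?c" for s
    unfolding polytabloid_csym by (rule nact.csym_act_right[OF character_csign that])
  have Xs: "X \<circ> nact s = cscale (csign (inv s)) X" if s: "s \<in> stab ?n ?c" for s
  proof
    fix T
    have sp: "s permutes {..<?n}" using s by (rule stab_permutes)
    have iS: "inv s \<in> Sn ?n" using sp by (simp add: Sn_iff permutes_inv)
    have sS: "s \<in> Sn ?n" using sp by (simp add: Sn_iff)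
    have cgs: "cg (inv s \<circ> g) = csign (inv s) * cg g" for g
    proof -
      have "cg (inv s \<circ> g) = pairing p (?e \<circ> nact g \<circ> nact (inv s)) ?e"
        by (simp add: cg_def nact.act_comp comp_assoc)
      also have "\<dots> = pairing p (?e \<circ> nact g) (?e \<circ> nact s)"
        using pairing_nact_left[OF permutes_inv[OF sp]] permutes_inv_inv[OF sp] by simp
      also have "\<dots> = csign (inv s) * cg g"
        unfolding eS[OF s] by (simp add: cg_def pairing_def cscale_def sum_distrib_left mult_ac)
      finally show ?thesis .
    qed
    have "(X \<circ> nact s) T = (\<Sum>g\<in>Sn ?n. cg g * ?e (nact (s \<circ> g) T))"
      by (simp add: X_def sum_fun_apply cscale_def nact.act_act)
    also have "\<dots> = (\<Sum>g\<in>Sn ?n. csign (inv s) * (cg (s \<circ> g) * ?e (nact (s \<circ> g) T)))"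
    proof (rule sum.cong[OF refl])
      fix g :: "nat \<Rightarrow> nat"
      have "inv s \<circ> (s \<circ> g) = g" by (simp add: o_assoc permutes_inv_o[OF sp])
      hence "cg g = csign (inv s) * cg (s \<circ> g)" using cgs[of "s \<circ> g"] by simp
      thus "cg g * ?e (nact (s \<circ> g) T) = csign (inv s) * (cg (s \<circ> g) * ?e (nact (s \<circ> g) T))" by simp
    qed
    also have "\<dots> = (\<Sum>g\<in>Sn ?n. csign (inv s) * (cg g * ?e (nact g T)))"
      by (rule sum.reindex_bij_betw[OF stab_bij_left[OF sS], where g = "\<lambda>g. csign (inv s) * (cg g * ?e (nact g T))"])
    finally show "(X \<circ> nact s) T = cscale (csign (inv s)) X T"
      by (simp add: X_def sum_fun_apply cscale_def sum_distrib_left)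
  qed
  have "X \<in> supp_on (tabs p)"
    unfolding X_def
    by (intro submodD(7)[OF submod_supp] submodD(4)[OF submod_supp] submodD(6)[OF submod_supp] polytabloid_supp t) (simp add: Sn_iff)
  from asym_supp[OF p t this] obtain k where k: "ncsym ?n csign ?c X = cscale k ?e" by blast
  have fx: "ncsym ?n csign ?c X = cscale (of_nat (card (stab ?n ?c))) X"
    by (rule nact.csym_fixed[OF character_csign Xs])
  have nz: "(of_nat (card (stab ?n ?c)) :: complex) \<noteq> 0"
    using stab_id[of ?n ?c] finite_stab[of ?n ?c] by (auto simp: card_eq_0_iff)
  define c where "c = inverse (of_nat (card (stab ?n ?c))) * k"
  have Xc: "X = cscale c ?e"
    using k fx nz unfolding c_def by (metis cfun.scale_one cfun.scale_scale left_inverse)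
  have real: "cnj (?e T) = ?e T" for T by (rule polytabloid_cnj)
  have cgr: "cnj (cg g) = cg g" for g by (simp add: cg_def pairing_def real)
  have "pairing p X ?e = (\<Sum>g\<in>Sn ?n. cg g * cg g)"
    unfolding X_def pairing_def sum_fun_apply sum_distrib_right
    by (subst sum.swap) (simp add: cg_def pairing_def cscale_def sum_distrib_left mult_ac)
  also have "\<dots> = (\<Sum>g\<in>Sn ?n. of_real ((cmod (cg g))\<^sup>2))"
    by (rule sum.cong[OF refl]) (use complex_norm_square cgr in simp)
  also have "\<dots> = of_real (\<Sum>g\<in>Sn ?n. (cmod (cg g))\<^sup>2)" by simp
  finally have main: "pairing p X ?e = of_real (\<Sum>g\<in>Sn ?n. (cmod (cg g))\<^sup>2)" .
  have "cg id \<noteq> 0"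
  proof -
    have "cg id = (\<Sum>T\<in>tabs p. of_real ((cmod (?e T))\<^sup>2))"
      unfolding cg_def pairing_def nact.act_id comp_id
      by (rule sum.cong[OF refl]) (use complex_norm_square real in simp)
    also have "\<dots> = of_real (\<Sum>T\<in>tabs p. (cmod (?e T))\<^sup>2)" by simp
    finally have *: "cg id = of_real (\<Sum>T\<in>tabs p. (cmod (?e T))\<^sup>2)" .
    have "(\<Sum>T\<in>tabs p. (cmod (?e T))\<^sup>2) > 0"
      by (rule sum_pos2[OF finite_tabs tabloid_in[OF t]]) (auto simp: polytabloid_self[OF t])
    thus ?thesis unfolding * by (simp del: of_real_sum)
  qed
  hence "(\<Sum>g\<in>Sn ?n. (cmod (cg g))\<^sup>2) > 0"
    by (intro sum_pos2[OF finite_stab stab_id]) auto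
  hence "pairing p X ?e \<noteq> 0" unfolding main by (simp del: of_real_sum)
  hence "c \<noteq> 0" unfolding Xc by (auto simp: pairing_def cscale_def)
  thus ?thesis using Xc unfolding X_def cg_def by blast
qed

text \<open>
  This passes from an occurrence of the Specht module of \<open>q\<close> in a representation to a nonzero
  invariant in the tensor product with that Specht module. If all these sums vanished, so would
  the combination of translates of the symmetrized vector with the coefficients of
  \<open>matrix_coefficient_sum\<close>, which is a nonzero multiple of that vector.
\<close>

lemma (in right_action) transfer:
  assumes q: "q \<in> partitions_of n" and f: "young n act q v \<noteq> 0"
  shows "\<exists>x U. (\<Sum>g\<in>Sn n. young n act q v (act g x) * polytabloid q (ctab q) (U \<circ> g)) \<noteq> 0"
proof (rule ccontr)
  let ?e = "polytabloid q (ctab q)" and ?f = "young n act q v"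
  assume neg: "\<not> ?thesis"
  have p: "is_partition q" "sum_list q = n" using partitions_ofD[OF q] by auto
  define cg where "cg g = pairing q (?e \<circ> nact g) ?e" for g
  obtain c where c: "c \<noteq> 0" "(\<Sum>g\<in>Sn n. cscale (cg g) (?e \<circ> nact g)) = cscale c ?e"
    using matrix_coefficient_sum[OF p(1) ctab] by (auto simp: p(2) cg_def)
  have fe: "?f = orbit_hom act q v ?e" using orbit_hom_polytabloid[of q v] p(2) by simp
  have "cscale c ?f = orbit_hom act q v (\<Sum>g\<in>Sn n. cscale (cg g) (?e \<circ> nact g))"
    unfolding c(2) orbit_hom_scale fe ..
  also have "\<dots> = (\<Sum>g\<in>Sn n. cscale (cg g) (?f \<circ> act g))"
    unfolding orbit_hom_sum orbit_hom_scale fe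
    by (intro sum.cong refl arg_cong[where f = "cscale _"] orbit_hom_act) (simp add: Sn_iff p(2))
  also have "\<dots> = 0"
  proof
    fix x
    have "(\<Sum>g\<in>Sn n. cscale (cg g) (?f \<circ> act g)) x = (\<Sum>g\<in>Sn n. \<Sum>U\<in>tabs q. ?e U * (?f (act g x) * ?e (U \<circ> g)))"
      by (simp add: sum_fun_apply cscale_def cg_def pairing_def nact_def sum_distrib_left sum_distrib_right mult_ac)
    also have "\<dots> = (\<Sum>U\<in>tabs q. ?e U * (\<Sum>g\<in>Sn n. ?f (act g x) * ?e (U \<circ> g)))"
      unfolding sum_distrib_left by (rule sum.swap)
    also have "\<dots> = 0" using neg by simp
    finally show "(\<Sum>g\<in>Sn n. cscale (cg g) (?f \<circ> act g)) x = 0 x" by simp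
  qed
  finally have "cscale c ?f = 0" .
  thus False using c(1) f by simp
qed

section \<open>Kronecker coefficients and fillings\<close>

lemma young_nonzero_sym:
  assumes W: "submod n act W" and act: "right_action act" and f: "f \<in> W" "young n act r f \<noteq> 0"
  obtains v where "v \<in> W" "v \<noteq> 0" "\<And>s. s \<in> stab n (fst \<circ> ctab r) \<Longrightarrow> v \<circ> act s = v"
proof -
  interpret right_action act by (rule act)
  let ?v = "csym n act triv (fst \<circ> ctab r) f"
  show thesis
  proof (rule that[of ?v])
    show "?v \<in> W" by (rule csym_in[OF W f(1)])
    show "?v \<noteq> 0" using f(2) by (auto simp: young_def csym_0)
    show "?v \<circ> act s = ?v" if "s \<in> stab n (fst \<circ> ctab r)" for s
      using csym_act_right[OF character_triv that] by (simp add: triv_def)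
  qed
qed

lemma slice_invariant:
  assumes inv: "\<And>s. s \<in> stab n R \<Longrightarrow> v \<circ> tensor_act s = v" and U: "U \<in> extensional {..<n}"
    and s: "s \<in> stab n (\<lambda>x. (U x, R x))"
  shows "(\<lambda>T. v (T, U)) \<circ> nact s = (\<lambda>T. v (T, U))"
proof
  fix T
  have sU: "s \<in> stab n U" and sR: "s \<in> stab n R" using s by (auto simp: stab_def)
  have "U \<circ> s = U" using ext_stab[OF U stab_permutes[OF s]] sU by simp
  thus "((\<lambda>T. v (T, U)) \<circ> nact s) T = v (T, U)"
    using fun_cong[OF inv[OF sR], of "(T, U)"] by (simp add: nact_def tensor_act_def)
qed

text \<open>
  Fix the second variable at some \<open>U\<close>: the slice is invariant under permutations that preserve
  both \<open>U\<close> and \<open>R\<close>, so the pairs \<open>(U x, R x)\<close> cannot repeat in a column.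
\<close>

lemma slice_filling:
  assumes p: "p \<in> partitions_of n" and W: "cfun.subspace W" "W \<subseteq> supp_on (tabs q)" and q: "q \<in> partitions_of n"
    and v: "v \<in> tensor (specht p) W" "v \<noteq> 0" and inv: "\<And>s. s \<in> stab n R \<Longrightarrow> v \<circ> tensor_act s = v"
  obtains U t where "U \<in> tabs q" "is_tableau p t" "column_inj p t (\<lambda>x. (U x, R x))"
proof -
  note sl = tensor_slices[OF v(1) subspace_specht W(1)]
  obtain T U where TU: "v (T, U) \<noteq> 0" using v(2) by (auto simp: fun_eq_iff)
  have U: "U \<in> tabs q" using sl(2)[of T] W(2) TU by (auto simp: supp_on_def)
  have nz: "(\<lambda>T. v (T, U)) \<noteq> 0" using TU by (auto simp: fun_eq_iff)
  have iv: "(\<lambda>T. v (T, U)) \<circ> nact s = (\<lambda>T. v (T, U))" if "s \<in> stab (sum_list p) (\<lambda>x. (U x, R x))" for s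
    by (rule slice_invariant[where n = n and R = R]) (use inv tabs_ext[OF U q] that partitions_ofD(2)[OF p] in auto)
  show thesis
    by (rule specht_invariant_filling[OF sl(1) nz, where w = "\<lambda>x. (U x, R x)"]) (use iv that U in auto)
qed

lemma kronecker_nonzero_iff:
  assumes "p \<in> partitions_of n" "q \<in> partitions_of n" "r \<in> partitions_of n"
  shows "kronecker p q r \<noteq> 0 \<longleftrightarrow> (\<exists>f\<in>tensor (specht p) (specht q). young n tensor_act r f \<noteq> 0)"
proof
  let ?Y = "young n tensor_act r ` tensor (specht p) (specht q)"
  note W = submod_tensor_specht[OF assms(1,2)]
  { assume "kronecker p q r \<noteq> 0"
    hence "cfun.dim ?Y \<noteq> 0" using kronecker_dim[OF assms] by simp
    moreover have "cfun.dim ?Y = 0" if "\<forall>f\<in>tensor (specht p) (specht q). young n tensor_act r f = 0"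
    proof -
      have "?Y \<subseteq> cfun.span {}" using that by auto
      thus ?thesis using cfun.dim_le_card[of ?Y "{}"] by simp
    qed
    ultimately show "\<exists>f\<in>tensor (specht p) (specht q). young n tensor_act r f \<noteq> 0" by metis }
  assume "\<exists>f\<in>tensor (specht p) (specht q). young n tensor_act r f \<noteq> 0"
  then obtain f where f: "f \<in> tensor (specht p) (specht q)" "young n tensor_act r f \<noteq> 0" by blast
  obtain B where B: "B \<subseteq> ?Y" "cfun.independent B" "?Y \<subseteq> cfun.span B" "card B = cfun.dim ?Y"
    by (rule cfun.basis_exists)
  have "B \<subseteq> tensor (specht p) (specht q)" using B(1) young_in[OF W] by blast
  hence "B \<subseteq> cfun.span (delta ` (tabs p \<times> tabs q))" using tensor_specht_fin(2) by blast
  hence "finite B" using cfun.independent_span_bound[OF tensor_specht_fin(1) B(2)] by blast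
  moreover have "B \<noteq> {}"
  proof
    assume "B = {}"
    hence "young n tensor_act r f = 0" using B(3) f(1) by auto
    thus False using f(2) by simp
  qed
  ultimately show "kronecker p q r \<noteq> 0" using B(4) kronecker_dim[OF assms] by auto
qed

text \<open>
  Row symmetrization gives a vector invariant under the row stabilizer of the chosen tableau of
  shape \<open>r\<close>, to which \<open>slice_filling\<close> applies.
\<close>

lemma kronecker_filling:
  assumes p: "p \<in> partitions_of n" and q: "q \<in> partitions_of n" and r: "r \<in> partitions_of n" and nz: "kronecker p q r \<noteq> 0"
  obtains U t where "U \<in> tabs q" "is_tableau p t" "column_inj p t (\<lambda>x. (U x, fst (ctab r x)))"
proof -
  obtain f where f: "f \<in> tensor (specht p) (specht q)" "young n tensor_act r f \<noteq> 0"
    using nz kronecker_nonzero_iff[OF p q r] by blast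
  obtain v where v: "v \<in> tensor (specht p) (specht q)" "v \<noteq> 0" "\<And>s. s \<in> stab n (fst \<circ> ctab r) \<Longrightarrow> v \<circ> tensor_act s = v"
    using young_nonzero_sym[OF submod_tensor_specht[OF p q] right_action_tensor f] by metis
  obtain U t where Ut: "U \<in> tabs q" "is_tableau p t" "column_inj p t (\<lambda>x. (U x, (fst \<circ> ctab r) x))"
    by (rule slice_filling[OF p subspace_specht specht_supp q v])
  from Ut(3) have "column_inj p t (\<lambda>x. (U x, fst (ctab r x)))" by simp
  with that Ut(1,2) show thesis by blast
qed

lemma length_le_1_row: "length r \<le> 1 \<Longrightarrow> is_tableau r t \<Longrightarrow> x < sum_list r \<Longrightarrow> fst (t x) = 0"
  using row_less[of r t x] by linarith

text \<open>
  With the trivial third factor the invariant vector is fixed by all permutations; slicing in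
  either variable shows that \<open>p\<close> and \<open>q\<close> dominate each other.
\<close>

lemma kronecker_trivial_right:
  assumes p: "p \<in> partitions_of n" and q: "q \<in> partitions_of n" and r: "r \<in> partitions_of n"
    and nz: "kronecker p q r \<noteq> 0" and len: "length r \<le> 1"
  shows "p = q"
proof -
  note W = submod_tensor_specht[OF p q]
  obtain f where f: "f \<in> tensor (specht p) (specht q)" "young n tensor_act r f \<noteq> 0"
    using nz kronecker_nonzero_iff[OF p q r] by blast
  obtain v where v: "v \<in> tensor (specht p) (specht q)" "v \<noteq> 0" "\<And>s. s \<in> stab n (fst \<circ> ctab r) \<Longrightarrow> v \<circ> tensor_act s = v"
    using young_nonzero_sym[OF W right_action_tensor f] by metis
  have "s \<in> stab n (fst \<circ> ctab r)" if "s permutes {..<n}" for s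
    using that length_le_1_row[OF len ctab] partitions_ofD(2)[OF r] permutes_less[OF that] by (simp add: stab_def)
  hence inv: "v (T \<circ> s, U \<circ> s) = v (T, U)" if "s permutes {..<n}" for s T U
    using fun_cong[OF v(3), of s "(T, U)"] that by (simp add: tensor_act_def)
  note sl = tensor_slices[OF v(1) subspace_specht subspace_specht]
  obtain T U where TU: "v (T, U) \<noteq> 0" using v(2) by (auto simp: fun_eq_iff)
  have U: "U \<in> tabs q" using sl(2)[of T] specht_supp[of q] TU by (auto simp: supp_on_def)
  have T: "T \<in> tabs p" using sl(1)[of U] specht_supp[of p] TU by (auto simp: supp_on_def)
  have nz1: "(\<lambda>T. v (T, U)) \<noteq> 0" and nz2: "(\<lambda>U. v (T, U)) \<noteq> 0" using TU by (auto simp: fun_eq_iff)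
  have iv1: "(\<lambda>T. v (T, U)) \<circ> nact s = (\<lambda>T. v (T, U))" if "s \<in> stab (sum_list p) U" for s
  proof -
    have s: "s permutes {..<n}" "U \<circ> s = U"
      using that partitions_ofD(2)[OF p] stab_permutes[OF that] ext_stab[OF tabs_ext[OF U q]] by auto
    show ?thesis using inv[OF s(1), of _ U] s(2) by (simp add: nact_def fun_eq_iff)
  qed
  have iv2: "(\<lambda>U. v (T, U)) \<circ> nact s = (\<lambda>U. v (T, U))" if "s \<in> stab (sum_list q) T" for s
  proof -
    have s: "s permutes {..<n}" "T \<circ> s = T"
      using that partitions_ofD(2)[OF q] stab_permutes[OF that] ext_stab[OF tabs_ext[OF T p]] by auto
    show ?thesis using inv[OF s(1), of T] s(2) by (simp add: nact_def fun_eq_iff)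
  qed
  obtain t where t: "is_tableau p t" "column_inj p t U"
    by (rule specht_invariant_filling[OF sl(1) nz1 iv1])
  obtain t' where t': "is_tableau q t'" "column_inj q t' T"
    by (rule specht_invariant_filling[OF sl(2) nz2 iv2])
  show ?thesis by (rule dominance_antisym[OF p q t(1) U t(2) t'(1) T t'(2)])
qed

lemma tabs_trivial:
  assumes "length q \<le> 1" "T \<in> tabs q" shows "T = (\<lambda>x. if x < sum_list q then 0 else undefined)"
  using tabs_less[OF assms(2)] tabs_content(1)[OF assms(2)] assms(1) by (fastforce simp: extensional_def)

lemma tabs_trivial_comp:
  assumes "length q \<le> 1" "T \<in> tabs q" "s permutes {..<sum_list q}" shows "T \<circ> s = T"
  using tabs_trivial[OF assms(1) tabs_comp[OF assms(2,3)]] tabs_trivial[OF assms(1,2)] by simp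

text \<open>
  With the trivial second factor the tensor product is the Specht module of \<open>p\<close>, on which the
  symmetrizer of any other shape vanishes.
\<close>

lemma kronecker_trivial_middle:
  assumes p: "p \<in> partitions_of n" and q: "q \<in> partitions_of n" and r: "r \<in> partitions_of n"
    and nz: "kronecker p q r \<noteq> 0" and len: "length q \<le> 1"
  shows "p = r"
proof (rule ccontr)
  assume ne: "p \<noteq> r"
  obtain f where f: "f \<in> tensor (specht p) (specht q)" "young n tensor_act r f \<noteq> 0"
    using nz kronecker_nonzero_iff[OF p q r] by blast
  have yf: "young n tensor_act r f \<in> tensor (specht p) (specht q)" by (rule young_in[OF submod_tensor_specht[OF p q] f(1)])
  obtain T U where TU: "young n tensor_act r f (T, U) \<noteq> 0" using f(2) by (auto simp: fun_eq_iff)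
  have U: "U \<in> tabs q" using yf tensor_specht_supp TU by (fastforce simp: supp_on_def)
  have Us: "U \<circ> s = U" if "s permutes {..<n}" for s
    using tabs_trivial_comp[OF len U] that partitions_ofD(2)[OF q] by simp
  have cs: "(\<lambda>T. csym n tensor_act \<epsilon> c h (T, U)) = ncsym n \<epsilon> c (\<lambda>T. h (T, U))" for \<epsilon> h and c :: "nat \<Rightarrow> nat"
    unfolding csym_def by (intro ext sum.cong refl) (simp add: tensor_act_def nact_def Us stab_permutes)
  have "(\<lambda>T. young n tensor_act r f (T, U)) = young n nact r (\<lambda>T. f (T, U))"
    unfolding young_def cs ..
  also have "\<dots> = 0"
    by (rule young_specht_other[OF p r]) (use ne tensor_slices(1)[OF f(1) subspace_specht subspace_specht] in auto)
  finally show False using TU by (auto simp: fun_eq_iff)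
qed

lemma kronecker_trivial_left:
  assumes p: "p \<in> partitions_of n" and q: "q \<in> partitions_of n" and len: "length p \<le> 1"
  shows "kronecker p q q \<noteq> 0"
proof -
  let ?e = "polytabloid p (ctab p)" and ?e' = "polytabloid q (ctab q)"
  let ?f = "\<lambda>(T, U). ?e T * ?e' U"
  have es: "?e (T \<circ> s) = ?e T" if s: "s permutes {..<n}" for s T
  proof (cases "T \<in> tabs p")
    case True
    thus ?thesis using tabs_trivial_comp[OF len True] s partitions_ofD(2)[OF p] by simp
  next
    case False
    have "T \<circ> s \<notin> tabs p"
    proof
      assume "T \<circ> s \<in> tabs p"
      from tabs_comp[OF this, of "inv s"] have "T \<circ> s \<circ> inv s \<in> tabs p"
        using permutes_inv[OF s] partitions_ofD(2)[OF p] by simp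
      thus False using False by (simp add: comp_assoc permutes_inv_o[OF s])
    qed
    thus ?thesis using False polytabloid_supp[OF ctab, of p] by (simp add: supp_on_def)
  qed
  have cs: "csym n tensor_act \<epsilon> c (\<lambda>(T, U). ?e T * h U) = (\<lambda>(T, U). ?e T * ncsym n \<epsilon> c h U)" for \<epsilon> h and c :: "nat \<Rightarrow> nat"
    unfolding csym_def by (auto simp: tensor_act_def nact_def es stab_permutes sum_distrib_left fun_eq_iff intro!: sum.cong)
  have y: "young n tensor_act q ?f = (\<lambda>(T, U). ?e T * young n nact q ?e' U)"
    unfolding young_def cs ..
  obtain \<alpha> where \<alpha>: "\<alpha> \<noteq> 0" "young n nact q ?e' = cscale \<alpha> ?e'" using young_polytabloid[OF q] by blast
  have "young n tensor_act q ?f (tabloid p (ctab p), tabloid q (ctab q)) = \<alpha>"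
    unfolding y \<alpha>(2) by (simp add: cscale_def polytabloid_ctab_nz)
  hence "young n tensor_act q ?f \<noteq> 0" using \<alpha>(1) by (metis zero_fun_apply)
  moreover have "?f \<in> tensor (specht p) (specht q)"
    unfolding tensor_def by (rule cfun.span_base) (use polytabloid_specht[OF ctab] in blast)
  ultimately show ?thesis using kronecker_nonzero_iff[OF p q q] by blast
qed


section \<open>Maximal fillings\<close>

definition wt :: "(nat \<Rightarrow> int) \<Rightarrow> (nat \<Rightarrow> int) \<Rightarrow> nat \<times> nat \<Rightarrow> int"
  where "wt x y g = x (fst g) + y (snd g)"

definition tie :: "nat \<Rightarrow> ('g \<Rightarrow> int) \<Rightarrow> (nat \<Rightarrow> 'g) \<Rightarrow> nat \<Rightarrow> bool"
  where "tie N z \<kappa> k \<longleftrightarrow> Suc k < N \<and> z (\<kappa> k) = z (\<kappa> (Suc k))"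

lemma content_perm:
  assumes s: "s permutes {..<n::nat}"
  shows "card {x. x < n \<and> h (s x) = i} = card {x. x < n \<and> h x = i}"
proof (rule bij_betw_same_card[of s], rule bij_betw_imageI)
  show "inj_on s {x. x < n \<and> h (s x) = i}" using permutes_inj[OF s] by (rule inj_on_subset) simp
  show "s ` {x. x < n \<and> h (s x) = i} = {x. x < n \<and> h x = i}"
  proof
    show "{x. x < n \<and> h x = i} \<subseteq> s ` {x. x < n \<and> h (s x) = i}"
    proof
      fix x assume "x \<in> {x. x < n \<and> h x = i}"
      hence "inv s x \<in> {x. x < n \<and> h (s x) = i}" "x = s (inv s x)"
        using permutes_inverses[OF s] permutes_inv_less[OF s] by auto
      thus "x \<in> s ` {x. x < n \<and> h (s x) = i}" by blast
    qed
  qed (use permutes_less[OF s] in auto)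
qed

definition filling :: "nat list \<Rightarrow> nat list \<Rightarrow> nat list \<Rightarrow> (nat \<Rightarrow> nat \<times> nat) \<Rightarrow> (nat \<Rightarrow> nat \<times> nat) \<Rightarrow> bool"
  where "filling p q r t w \<longleftrightarrow> column_inj p t w
    \<and> (\<forall>i. card {x. x < sum_list p \<and> fst (w x) = i} = rowlen q i)
    \<and> (\<forall>j. card {x. x < sum_list p \<and> snd (w x) = j} = rowlen r j)"

text \<open>
  The list \<open>\<kappa>\<close> orders the cells by decreasing weight, and at most two cells share a weight.
\<close>

locale pair_config =
  fixes a b :: nat and x y :: "nat \<Rightarrow> int" and \<kappa> :: "nat \<Rightarrow> nat \<times> nat"
  assumes kap_bij: "bij_betw \<kappa> {..<a * b} ({..<a} \<times> {..<b})"
    and kap_anti: "\<forall>i j. i \<le> j \<longrightarrow> j < a * b \<longrightarrow> wt x y (\<kappa> j) \<le> wt x y (\<kappa> i)"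
    and no_triple: "Suc (Suc k) < a * b \<Longrightarrow> wt x y (\<kappa> (Suc (Suc k))) < wt x y (\<kappa> k)"
    and x_anti: "\<forall>i j. i < j \<longrightarrow> j < a \<longrightarrow> x j < x i"
    and y_anti: "\<forall>i j. i < j \<longrightarrow> j < b \<longrightarrow> y j < y i"
begin

abbreviation "z \<equiv> wt x y"
abbreviation "P \<equiv> tie (a * b) z \<kappa>"

text \<open>
  How the entries of the rows \<open>l k\<close> of a partition are distributed over the cells in a filling
  of maximal weight: \<open>d k\<close> entries carry the cell \<open>\<kappa> k\<close>. A cell without a partner fills its row;
  two tied cells share the two rows, and each of them occurs in every column that meets both
  rows.
\<close>

definition splits :: "(nat \<Rightarrow> 'r::linordered_idom) \<Rightarrow> (nat \<Rightarrow> 'r) \<Rightarrow> bool"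
  where "splits l d \<longleftrightarrow> (\<forall>k<a * b. \<not> P k \<longrightarrow> (\<forall>k'. k = Suc k' \<longrightarrow> \<not> P k') \<longrightarrow> d k = l k)
    \<and> (\<forall>k. P k \<longrightarrow> d k + d (Suc k) = l k + l (Suc k) \<and> l (Suc k) \<le> d k \<and> d k \<le> l k)"

text \<open>
  The differences of two splittings of the same partition.
\<close>

definition balanced :: "(nat \<Rightarrow> 'r::comm_monoid_add) \<Rightarrow> bool"
  where "balanced \<delta> \<longleftrightarrow> (\<forall>k<a * b. \<not> P k \<longrightarrow> (\<forall>k'. k = Suc k' \<longrightarrow> \<not> P k') \<longrightarrow> \<delta> k = 0)
    \<and> (\<forall>k. P k \<longrightarrow> \<delta> k + \<delta> (Suc k) = 0)"

definition rowsum :: "(nat \<Rightarrow> 'r::comm_monoid_add) \<Rightarrow> nat \<Rightarrow> 'r"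
  where "rowsum d i = (\<Sum>k | k < a * b \<and> fst (\<kappa> k) = i. d k)"

definition colsum :: "(nat \<Rightarrow> 'r::comm_monoid_add) \<Rightarrow> nat \<Rightarrow> 'r"
  where "colsum d j = (\<Sum>k | k < a * b \<and> snd (\<kappa> k) = j. d k)"

lemma rowsum_of_int: "rowsum (\<lambda>k. real_of_int (d k)) i = real_of_int (rowsum d i)"
  and colsum_of_int: "colsum (\<lambda>k. real_of_int (d k)) i = real_of_int (colsum d i)"
  and rowsum_real: "rowsum (\<lambda>k. real (e k)) i = real (rowsum e i)"
  and colsum_real: "colsum (\<lambda>k. real (e k)) i = real (colsum e i)"
  and rowsum_int: "rowsum (\<lambda>k. int (e k)) i = int (rowsum e i)"
  and colsum_int: "colsum (\<lambda>k. int (e k)) i = int (colsum e i)"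
  by (simp_all add: rowsum_def colsum_def)

lemma splits_of_int_iff:
  "splits (\<lambda>k. real_of_int (l k)) (\<lambda>k. real_of_int (d k)) \<longleftrightarrow> splits l d"
  unfolding splits_def by (simp flip: of_int_add)

lemmas splits_of_int = splits_of_int_iff[THEN iffD2]

lemma P_less: "P k \<Longrightarrow> Suc k < a * b"
  by (simp add: tie_def)

lemma P_Suc: "P k \<Longrightarrow> \<not> P (Suc k)"
  using no_triple[of k] by (auto simp: tie_def)

lemma kap_inj: "i < a * b \<Longrightarrow> j < a * b \<Longrightarrow> \<kappa> i = \<kappa> j \<longleftrightarrow> i = j"
  using bij_betw_imp_inj_on[OF kap_bij] by (auto dest: inj_onD)

lemma kap_range: "k < a * b \<Longrightarrow> fst (\<kappa> k) < a" "k < a * b \<Longrightarrow> snd (\<kappa> k) < b"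
  using bij_betwE[OF kap_bij] by (auto simp: mem_Times_iff)

lemma z_eq_cases:
  assumes "i < a * b" "j < a * b" "z (\<kappa> i) = z (\<kappa> j)" "i \<le> j"
  shows "i = j \<or> (j = Suc i \<and> P i)"
proof (rule ccontr)
  assume neg: "\<not> ?thesis"
  hence "j \<noteq> i" "j \<noteq> Suc i" using assms by (auto simp: tie_def)
  hence "Suc (Suc i) \<le> j" using assms(4) by simp
  hence "z (\<kappa> j) \<le> z (\<kappa> (Suc (Suc i)))" using kap_anti assms(2) by blast
  moreover have "z (\<kappa> (Suc (Suc i))) < z (\<kappa> i)" using no_triple[of i] \<open>Suc (Suc i) \<le> j\<close> assms(2) by simp
  ultimately show False using assms(3) by simp
qed

lemma filling_range:
  assumes "filling p q r t w" "length q \<le> a" "length r \<le> b" "i < sum_list p"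
  shows "w i \<in> {..<a} \<times> {..<b}"
proof -
  have f: "finite {x. x < sum_list p \<and> Q x}" for Q by simp
  have "i \<in> {x. x < sum_list p \<and> fst (w x) = fst (w i)}" using assms(4) by simp
  hence "card {x. x < sum_list p \<and> fst (w x) = fst (w i)} \<noteq> 0" by (subst card_0_eq[OF f]) blast
  hence "rowlen q (fst (w i)) \<noteq> 0" using assms(1) unfolding filling_def by metis
  hence 1: "fst (w i) < a" using assms(2) by (auto simp: rowlen_def split: if_splits)
  have "i \<in> {x. x < sum_list p \<and> snd (w x) = snd (w i)}" using assms(4) by simp
  hence "card {x. x < sum_list p \<and> snd (w x) = snd (w i)} \<noteq> 0" by (subst card_0_eq[OF f]) blast
  hence "rowlen r (snd (w i)) \<noteq> 0" using assms(1) unfolding filling_def by metis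
  hence "snd (w i) < b" using assms(3) by (auto simp: rowlen_def split: if_splits)
  thus ?thesis using 1 by (cases "w i") auto
qed

definition margin_weight :: "nat list \<Rightarrow> nat list \<Rightarrow> int"
  where "margin_weight q r = (\<Sum>i<a. int (rowlen q i) * x i) + (\<Sum>j<b. int (rowlen r j) * y j)"
definition top_weight :: "nat list \<Rightarrow> int"
  where "top_weight p = (\<Sum>k<a * b. int (rowlen p k) * z (\<kappa> k))"

lemma filling_weight:
  assumes "filling p q r t w" "length q \<le> a" "length r \<le> b"
  shows "(\<Sum>i<sum_list p. z (w i)) = margin_weight q r"
proof -
  have rg: "fst (w i) < a \<and> snd (w i) < b" if "i < sum_list p" for i using filling_range[OF assms that] by auto
  have "(\<Sum>i<sum_list p. z (w i)) = (\<Sum>i<sum_list p. x (fst (w i))) + (\<Sum>i<sum_list p. y (snd (w i)))"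
    by (simp add: wt_def sum.distrib)
  also have "(\<Sum>i<sum_list p. x (fst (w i))) = (\<Sum>i<a. int (rowlen q i) * x i)"
    using content_sum[of "sum_list p" "\<lambda>i. fst (w i)" a x] rg assms(1) by (simp add: filling_def)
  also have "(\<Sum>i<sum_list p. y (snd (w i))) = (\<Sum>i<b. int (rowlen r i) * y i)"
    using content_sum[of "sum_list p" "\<lambda>i. snd (w i)" b y] rg assms(1) by (simp add: filling_def)
  finally show ?thesis by (simp add: margin_weight_def)
qed

definition dcount :: "nat list \<Rightarrow> (nat \<Rightarrow> nat \<times> nat) \<Rightarrow> nat \<Rightarrow> nat"
  where "dcount p w k = card {i. i < sum_list p \<and> w i = \<kappa> k}"
definition dset :: "nat list \<Rightarrow> (nat \<Rightarrow> nat \<times> nat) \<Rightarrow> (nat \<Rightarrow> nat \<times> nat) \<Rightarrow> nat \<Rightarrow> nat set"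
  where "dset p t w k = {j. \<kappa> k \<in> w ` col p t j}"
text \<open>
  A formula, in terms of the \<open>dcount\<close> only, for the number of columns with set of cells \<open>S\<close> in a
  filling of maximal weight; \<open>card_colcount\<close> shows that it is correct.
\<close>

definition colcount :: "nat list \<Rightarrow> (nat \<Rightarrow> nat \<times> nat) \<Rightarrow> (nat \<times> nat) set \<Rightarrow> nat"
  where "colcount p w S = (let l = card S in if l = 0 then 0 else if S = \<kappa> ` {..<l} then
      (if P (l - 1) then dcount p w (l - 1) - rowlen p l else rowlen p (l - 1) - rowlen p l)
     else if P (l - 1) \<and> S = insert (\<kappa> l) (\<kappa> ` {..<l - 1}) then dcount p w l - rowlen p l else 0)"

lemma content_margin:
  fixes h :: "nat \<times> nat \<Rightarrow> nat" and w :: "nat \<Rightarrow> nat \<times> nat"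
  assumes w: "\<forall>s<m. w s \<in> {..<a} \<times> {..<b}"
  shows "card {s. s < m \<and> h (w s) = i} = (\<Sum>k | k < a * b \<and> h (\<kappa> k) = i. card {s. s < m \<and> w s = \<kappa> k})"
proof -
  have e: "{s. s < m \<and> h (w s) = i} = (\<Union>k\<in>{k. k < a * b \<and> h (\<kappa> k) = i}. {s. s < m \<and> w s = \<kappa> k})"
  proof (intro equalityI subsetI)
    fix s assume s: "s \<in> {s. s < m \<and> h (w s) = i}"
    then obtain k where "k < a * b" "w s = \<kappa> k"
      using w bij_betw_imp_surj_on[OF kap_bij] by (metis (no_types, lifting) imageE lessThan_iff mem_Collect_eq)
    thus "s \<in> (\<Union>k\<in>{k. k < a * b \<and> h (\<kappa> k) = i}. {s. s < m \<and> w s = \<kappa> k})" using s by auto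
  qed auto
  show ?thesis
    unfolding e
  proof (rule card_UN_disjoint)
    show "\<forall>k\<in>{k. k < a * b \<and> h (\<kappa> k) = i}. \<forall>k'\<in>{k. k < a * b \<and> h (\<kappa> k) = i}. k \<noteq> k' \<longrightarrow>
        {s. s < m \<and> w s = \<kappa> k} \<inter> {s. s < m \<and> w s = \<kappa> k'} = {}"
    proof (intro ballI impI)
      fix k k' assume "k \<in> {k. k < a * b \<and> h (\<kappa> k) = i}" "k' \<in> {k. k < a * b \<and> h (\<kappa> k) = i}" "k \<noteq> k'"
      hence "\<kappa> k \<noteq> \<kappa> k'" using kap_inj[of k k'] by simp
      thus "{s. s < m \<and> w s = \<kappa> k} \<inter> {s. s < m \<and> w s = \<kappa> k'} = {}" by auto
    qed
  qed simp_all
qed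

context
  fixes p q r t w
  assumes p: "is_partition p" and t: "is_tableau p t" and w: "filling p q r t w"
    and lq: "length q \<le> a" and lr: "length r \<le> b"
begin

lemma filling_inj: "column_inj p t w" using w by (simp add: filling_def)

lemma w_in: "\<forall>i<sum_list p. w i \<in> {..<a} \<times> {..<b}" using filling_range[OF w lq lr] by blast

lemma filling_length: "length p \<le> a * b"
  by (rule filling_bound(1)[where z = z, OF p t kap_bij kap_anti w_in filling_inj])

lemma top_weight_rows: "(\<Sum>i<sum_list p. z (\<kappa> (fst (t i)))) = top_weight p"
  using row_sum[OF t filling_length, of "\<lambda>k. z (\<kappa> k)"] by (simp add: top_weight_def)

lemma filling_weight_le: "margin_weight q r \<le> top_weight p"
  using filling_bound(2)[where z = z, OF p t kap_bij kap_anti w_in filling_inj]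
  by (simp add: filling_weight[OF w lq lr] top_weight_rows)

context
  assumes eq: "margin_weight q r = top_weight p"
begin

lemma collen_le: "collen p j \<le> a * b"
proof -
  have "collen p j \<le> card {..<length p}"
    unfolding collen_def by (rule card_mono) (auto simp: rowlen_def split: if_splits)
  thus ?thesis using filling_length by simp
qed

lemma card_colset: "card (w ` col p t j) = collen p j"
  using card_image[OF column_inj_inj_on[OF filling_inj]] card_col[OF p t] by simp

text \<open>
  The equality case of \<open>top_sum\<close>: the column contains all cells heavier than its threshold and
  none lighter, which leaves a choice only if the threshold is shared with a cell outside.
\<close>

lemma colset_cases:
  assumes pos: "0 < collen p j"
  shows "w ` col p t j = \<kappa> ` {..<collen p j}
    \<or> (P (collen p j - 1) \<and> w ` col p t j = insert (\<kappa> (collen p j)) (\<kappa> ` {..<collen p j - 1}))"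
proof -
  let ?A = "w ` col p t j"
  define l where "l = collen p j"
  have lpos: "0 < l" and lN: "l \<le> a * b" using pos collen_le by (auto simp: l_def)
  have eq': "(\<Sum>i<sum_list p. z (w i)) = (\<Sum>i<sum_list p. z (\<kappa> (fst (t i))))"
    using eq by (simp add: filling_weight[OF w lq lr] top_weight_rows)
  have fb: "(\<forall>g\<in>{..<a} \<times> {..<b}. z (\<kappa> (l - 1)) < z g \<longrightarrow> g \<in> ?A) \<and> (\<forall>g\<in>?A. z (\<kappa> (l - 1)) \<le> z g)"
    using filling_bound(3)[where z = z, OF p t kap_bij kap_anti w_in filling_inj eq' pos] by (simp add: l_def)
  have cA: "card ?A = l" using card_colset by (simp add: l_def)
  have fA: "finite ?A" by simp
  have kinj: "inj_on \<kappa> {..<l}" using bij_betw_imp_inj_on[OF kap_bij] by (rule inj_on_subset) (use lN in auto)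
  have "?A = \<kappa> ` {..<l} \<or> (P (l - 1) \<and> ?A = insert (\<kappa> l) (\<kappa> ` {..<l - 1}))"
  proof (cases "?A \<subseteq> \<kappa> ` {..<l}")
    case True
    hence "?A = \<kappa> ` {..<l}" by (rule card_subset_eq[rotated]) (simp_all add: cA card_image[OF kinj])
    thus ?thesis by blast
  next
    case False
    then obtain g where g: "g \<in> ?A" "g \<notin> \<kappa> ` {..<l}" by blast
    have "g \<in> {..<a} \<times> {..<b}" using g(1) w_in by (auto simp: col_def)
    then obtain k where k: "k < a * b" "g = \<kappa> k" using bij_betw_imp_surj_on[OF kap_bij] by (metis imageE lessThan_iff)
    have kl: "l \<le> k" using g(2) k by (meson image_eqI lessThan_iff linorder_not_le)
    have "z (\<kappa> (l - 1)) \<le> z g" using fb g(1) by blast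
    hence "z (\<kappa> (l - 1)) \<le> z (\<kappa> k)" by (simp add: k(2))
    moreover have "z (\<kappa> k) \<le> z (\<kappa> (l - 1))" using kap_anti kl k(1) by auto
    ultimately have zs: "z (\<kappa> (l - 1)) = z (\<kappa> k)" by simp
    have "l - 1 = k \<or> (k = Suc (l - 1) \<and> P (l - 1))" by (rule z_eq_cases) (use zs kl k lN lpos in auto)
    hence kl2: "k = l" "P (l - 1)" using kl lpos by auto
    have sub: "insert (\<kappa> l) (\<kappa> ` {..<l - 1}) \<subseteq> ?A"
    proof -
      have "\<kappa> i \<in> ?A" if i: "i < l - 1" for i
      proof -
        have "z (\<kappa> (l - 1)) \<noteq> z (\<kappa> i)"
        proof
          assume "z (\<kappa> (l - 1)) = z (\<kappa> i)"
          hence "i = l \<or> (l = Suc i \<and> P i)" using z_eq_cases[of i l] zs kl2(1) k(1) i by auto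
          thus False using i by auto
        qed
        moreover have "z (\<kappa> (l - 1)) \<le> z (\<kappa> i)" using kap_anti i lN by auto
        moreover have "\<kappa> i \<in> {..<a} \<times> {..<b}" using bij_betwE[OF kap_bij] i lN by auto
        ultimately have "z (\<kappa> (l - 1)) < z (\<kappa> i) \<and> \<kappa> i \<in> {..<a} \<times> {..<b}" by simp
        thus ?thesis using conjunct1[OF fb, THEN bspec, of "\<kappa> i"] by simp
      qed
      thus ?thesis using g(1) k(2) kl2(1) by auto
    qed
    have "card (insert (\<kappa> l) (\<kappa> ` {..<l - 1})) = l"
    proof -
      have "\<kappa> l \<notin> \<kappa> ` {..<l - 1}"
      proof
        assume "\<kappa> l \<in> \<kappa> ` {..<l - 1}"
        then obtain i where "i < l - 1" "\<kappa> l = \<kappa> i" by auto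
        thus False using kap_inj[of l i] kl2(1) k(1) by auto
      qed
      moreover have "card (\<kappa> ` {..<l - 1}) = l - 1"
        using card_image[OF inj_on_subset[OF kinj, of "{..<l - 1}"]] by auto
      ultimately show ?thesis using lpos by simp
    qed
    hence "insert (\<kappa> l) (\<kappa> ` {..<l - 1}) = ?A" by (intro card_subset_eq[OF fA sub]) (simp add: cA)
    thus ?thesis using kl2(2) by blast
  qed
  thus ?thesis by (simp add: l_def)
qed

lemma colset_empty: "collen p j = 0 \<Longrightarrow> w ` col p t j = {}"
  using card_colset[of j] by simp

lemma kap_mem: "k < a * b \<Longrightarrow> l \<le> a * b \<Longrightarrow> \<kappa> k \<in> \<kappa> ` {..<l} \<longleftrightarrow> k < l"
  using kap_inj by (metis (no_types, lifting) image_iff lessThan_iff order_less_le_trans)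

lemma mem_single:
  assumes k: "k < a * b" "\<not> P k" "\<forall>k'. k = Suc k' \<longrightarrow> \<not> P k'"
  shows "\<kappa> k \<in> w ` col p t j \<longleftrightarrow> k < collen p j"
proof (cases "collen p j = 0")
  case False
  let ?l = "collen p j"
  from False have "0 < ?l" by simp
  from colset_cases[OF this] show ?thesis
  proof
    assume "w ` col p t j = \<kappa> ` {..<?l}"
    thus ?thesis using kap_mem[OF k(1) collen_le] by simp
  next
    assume A: "P (?l - 1) \<and> w ` col p t j = insert (\<kappa> ?l) (\<kappa> ` {..<?l - 1})"
    have lN: "?l < a * b" using P_less[of "?l - 1"] A False by simp
    have "k \<noteq> ?l - 1" "k \<noteq> ?l" using A k False by auto
    moreover have "\<kappa> k \<in> w ` col p t j \<longleftrightarrow> k = ?l \<or> k < ?l - 1"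
      using A kap_mem[OF k(1), of "?l - 1"] kap_inj[OF k(1) lN] lN by auto
    ultimately show ?thesis by auto
  qed
qed (simp add: colset_empty)

text \<open>
  Tied cells are exchangeable, so the length of a column determines only how many of the two it
  contains.
\<close>

lemma mem_pair:
  assumes k: "P k"
  shows "\<kappa> k \<in> w ` col p t j \<or> \<kappa> (Suc k) \<in> w ` col p t j \<longleftrightarrow> k < collen p j"
    and "\<kappa> k \<in> w ` col p t j \<and> \<kappa> (Suc k) \<in> w ` col p t j \<longleftrightarrow> Suc k < collen p j"
proof -
  let ?l = "collen p j" and ?A = "w ` col p t j"
  have kN: "k < a * b" "Suc k < a * b" using P_less[OF k] by auto
  have "(\<kappa> k \<in> ?A \<or> \<kappa> (Suc k) \<in> ?A \<longleftrightarrow> k < ?l) \<and> (\<kappa> k \<in> ?A \<and> \<kappa> (Suc k) \<in> ?A \<longleftrightarrow> Suc k < ?l)"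
  proof (cases "?l = 0")
    case False
    hence "0 < ?l" by simp
    from colset_cases[OF this] show ?thesis
    proof
      assume "?A = \<kappa> ` {..<?l}"
      thus ?thesis using kap_mem[OF kN(1) collen_le] kap_mem[OF kN(2) collen_le] by auto
    next
      assume A: "P (?l - 1) \<and> ?A = insert (\<kappa> ?l) (\<kappa> ` {..<?l - 1})"
      have lN: "?l < a * b" using P_less[of "?l - 1"] A False by simp
      have 1: "k \<noteq> ?l" using A k P_Suc[of "?l - 1"] False by auto
      have 2: "Suc k \<noteq> ?l - 1" using A k P_Suc[of k] by auto
      have 3: "\<kappa> k \<in> ?A \<longleftrightarrow> k = ?l \<or> k < ?l - 1"
        using A kap_mem[OF kN(1), of "?l - 1"] kap_inj[OF kN(1) lN] lN by auto
      have 4: "\<kappa> (Suc k) \<in> ?A \<longleftrightarrow> Suc k = ?l \<or> Suc k < ?l - 1"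
        using A kap_mem[OF kN(2), of "?l - 1"] kap_inj[OF kN(2) lN] lN by auto
      show ?thesis using 1 2 3 4 False by auto
    qed
  qed (simp add: colset_empty)
  thus "\<kappa> k \<in> ?A \<or> \<kappa> (Suc k) \<in> ?A \<longleftrightarrow> k < ?l" "\<kappa> k \<in> ?A \<and> \<kappa> (Suc k) \<in> ?A \<longleftrightarrow> Suc k < ?l" by blast+
qed


lemma dcount_dset: "dcount p w k = card (dset p t w k)" and finite_dset: "finite (dset p t w k)"
proof -
  have b: "bij_betw (\<lambda>i. snd (t i)) {i. i < sum_list p \<and> w i = \<kappa> k} (dset p t w k)"
  proof (rule bij_betw_imageI)
    show "inj_on (\<lambda>i. snd (t i)) {i. i < sum_list p \<and> w i = \<kappa> k}"
      by (rule inj_onI) (use filling_inj in \<open>auto simp: column_inj_def\<close>)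
    show "(\<lambda>i. snd (t i)) ` {i. i < sum_list p \<and> w i = \<kappa> k} = dset p t w k"
      by (force simp: dset_def col_def image_iff)
  qed
  show "dcount p w k = card (dset p t w k)" unfolding dcount_def by (rule bij_betw_same_card[OF b])
  show "finite (dset p t w k)" using bij_betw_finite[OF b] by simp
qed

lemma collen_set: "{j. k < collen p j} = {..<rowlen p k}"
  by (auto simp: less_collen[OF p])

lemma dset_single: "k < a * b \<Longrightarrow> \<not> P k \<Longrightarrow> \<forall>k'. k = Suc k' \<longrightarrow> \<not> P k' \<Longrightarrow> dset p t w k = {..<rowlen p k}"
  unfolding dset_def collen_set[symmetric] using mem_single by blast

lemma dset_pair: "P k \<Longrightarrow> dset p t w k \<union> dset p t w (Suc k) = {..<rowlen p k}" "P k \<Longrightarrow> dset p t w k \<inter> dset p t w (Suc k) = {..<rowlen p (Suc k)}"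
  unfolding dset_def collen_set[symmetric] using mem_pair by blast+

lemma filling_splits: "splits (\<lambda>k. int (rowlen p k)) (\<lambda>k. int (dcount p w k))"
  unfolding splits_def
proof (intro conjI allI impI)
  show "int (dcount p w k) = int (rowlen p k)" if "k < a * b" "\<not> P k" "\<forall>k'. k = Suc k' \<longrightarrow> \<not> P k'" for k
    using dset_single[OF that] by (simp add: dcount_dset)
  fix k assume k: "P k"
  have "card (dset p t w k) + card (dset p t w (Suc k)) = rowlen p k + rowlen p (Suc k)"
    using card_Un_Int[OF finite_dset finite_dset, of k "Suc k"] dset_pair[OF k] by simp
  thus "int (dcount p w k) + int (dcount p w (Suc k)) = int (rowlen p k) + int (rowlen p (Suc k))"
    by (simp add: dcount_dset flip: of_nat_add)
  have "card {..<rowlen p (Suc k)} \<le> card (dset p t w k)" using dset_pair(2)[OF k] by (intro card_mono finite_dset) auto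
  thus "int (rowlen p (Suc k)) \<le> int (dcount p w k)" by (simp add: dcount_dset)
  have "card (dset p t w k) \<le> card {..<rowlen p k}" using dset_pair(1)[OF k] by (intro card_mono) auto
  thus "int (dcount p w k) \<le> int (rowlen p k)" by (simp add: dcount_dset)
qed

lemma filling_margins:
  "i < a \<Longrightarrow> rowsum (\<lambda>k. int (dcount p w k)) i = int (rowlen q i)"
  "j < b \<Longrightarrow> colsum (\<lambda>k. int (dcount p w k)) j = int (rowlen r j)"
proof -
  note gen = content_margin[OF w_in, folded dcount_def]
  show "i < a \<Longrightarrow> rowsum (\<lambda>k. int (dcount p w k)) i = int (rowlen q i)"
    using gen[of fst i] w by (simp add: rowsum_def filling_def)
  show "j < b \<Longrightarrow> colsum (\<lambda>k. int (dcount p w k)) j = int (rowlen r j)"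
    using gen[of snd j] w by (simp add: colsum_def filling_def)
qed

lemma card_colcount: "card {j. j < rowlen p 0 \<and> w ` col p t j = S} = colcount p w S"
proof -
  define l where "l = card S"
  let ?J = "{j. j < rowlen p 0 \<and> w ` col p t j = S}"
  have cc: "colcount p w S = (if l = 0 then 0 else if S = \<kappa> ` {..<l} then
      (if P (l - 1) then dcount p w (l - 1) - rowlen p l else rowlen p (l - 1) - rowlen p l)
     else if P (l - 1) \<and> S = insert (\<kappa> l) (\<kappa> ` {..<l - 1}) then dcount p w l - rowlen p l else 0)"
    unfolding colcount_def Let_def l_def ..
  have jl: "collen p j = l" if "w ` col p t j = S" for j using that card_colset[of j] unfolding l_def by simp
  have j0: "0 < collen p j \<longleftrightarrow> j < rowlen p 0" for j by (rule less_collen[OF p])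
  consider "l = 0" | "0 < l" "S = \<kappa> ` {..<l}" "P (l - 1)" | "0 < l" "S = \<kappa> ` {..<l}" "\<not> P (l - 1)"
    | "0 < l" "S \<noteq> \<kappa> ` {..<l}" "P (l - 1)" "S = insert (\<kappa> l) (\<kappa> ` {..<l - 1})"
    | "0 < l" "S \<noteq> \<kappa> ` {..<l}" "\<not> (P (l - 1) \<and> S = insert (\<kappa> l) (\<kappa> ` {..<l - 1}))" by blast
  thus ?thesis
  proof cases
    case 1
    have "?J = {}"
    proof (rule ccontr)
      assume "?J \<noteq> {}"
      then obtain j where j: "j < rowlen p 0" "w ` col p t j = S" by blast
      show False using jl[OF j(2)] j0[of j] j(1) 1 by simp
    qed
    thus ?thesis unfolding cc using 1 by simp
  next
    case 2
    have lN: "l < a * b" using P_less[OF 2(3)] 2(1) by simp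
    have sub: "{..<rowlen p l} \<subseteq> dset p t w (l - 1)" using dset_pair(2)[OF 2(3)] 2(1) by auto
    have "?J = dset p t w (l - 1) - {..<rowlen p l}"
    proof (intro equalityI subsetI)
      fix j assume j: "j \<in> ?J"
      have "\<kappa> (l - 1) \<in> S" using 2 by auto
      thus "j \<in> dset p t w (l - 1) - {..<rowlen p l}" using j jl[of j] less_collen[OF p, of l j] by (auto simp: dset_def)
    next
      fix j assume j: "j \<in> dset p t w (l - 1) - {..<rowlen p l}"
      have 3: "\<not> l < collen p j" using j less_collen[OF p, of l j] by auto
      have "\<kappa> (l - 1) \<in> w ` col p t j" using j by (simp add: dset_def)
      hence "l - 1 < collen p j" using mem_pair(1)[OF 2(3)] by blast
      hence cj: "collen p j = l" using 3 by simp
      have "\<kappa> (l - 1) \<notin> insert (\<kappa> l) (\<kappa> ` {..<l - 1})"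
        using kap_mem[of "l - 1" "l - 1"] kap_inj[of "l - 1" l] lN 2(1) by simp
      hence "w ` col p t j \<noteq> insert (\<kappa> l) (\<kappa> ` {..<l - 1})"
        using \<open>\<kappa> (l - 1) \<in> w ` col p t j\<close> by metis
      hence "w ` col p t j = S" using colset_cases[of j] cj 2 by auto
      thus "j \<in> ?J" using j0[of j] cj 2(1) by auto
    qed
    hence "card ?J = dcount p w (l - 1) - rowlen p l" using sub by (simp add: card_Diff_subset dcount_dset)
    thus ?thesis unfolding cc using 2 by simp
  next
    case 3
    have "?J = {..<rowlen p (l - 1)} - {..<rowlen p l}"
    proof (intro equalityI subsetI)
      fix j assume "j \<in> ?J"
      thus "j \<in> {..<rowlen p (l - 1)} - {..<rowlen p l}"
        using jl[of j] less_collen[OF p, of l j] less_collen[OF p, of "l - 1" j] 3(1) by auto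
    next
      fix j assume "j \<in> {..<rowlen p (l - 1)} - {..<rowlen p l}"
      hence cj: "collen p j = l" using less_collen[OF p, of l j] less_collen[OF p, of "l - 1" j] 3(1) by auto
      hence "w ` col p t j = S" using colset_cases[of j] 3 by auto
      thus "j \<in> ?J" using j0[of j] cj 3(1) by auto
    qed
    hence "card ?J = rowlen p (l - 1) - rowlen p l"
      using rowlen_antimono[OF p, of "l - 1" l] by (simp add: card_Diff_subset)
    thus ?thesis unfolding cc using 3 by simp
  next
    case 4
    have lN: "l < a * b" using P_less[OF 4(3)] 4(1) by simp
    have sub: "{..<rowlen p l} \<subseteq> dset p t w l" using dset_pair(2)[OF 4(3)] 4(1) by auto
    have "?J = dset p t w l - {..<rowlen p l}"
    proof (intro equalityI subsetI)
      fix j assume j: "j \<in> ?J"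
      have "\<kappa> l \<in> S" using 4 by auto
      thus "j \<in> dset p t w l - {..<rowlen p l}" using j jl[of j] less_collen[OF p, of l j] by (auto simp: dset_def)
    next
      fix j assume j: "j \<in> dset p t w l - {..<rowlen p l}"
      have 3: "\<not> l < collen p j" using j less_collen[OF p, of l j] by auto
      have kj: "\<kappa> l \<in> w ` col p t j" using j by (simp add: dset_def)
      hence "l - 1 < collen p j" using mem_pair(1)[OF 4(3), of j] 4(1) by simp
      hence cj: "collen p j = l" using 3 by simp
      have "w ` col p t j \<noteq> \<kappa> ` {..<l}"
        using kj kap_mem[of l l] lN by auto
      hence "w ` col p t j = S" using colset_cases[of j] cj 4 by auto
      thus "j \<in> ?J" using j0[of j] cj 4(1) by auto
    qed
    hence "card ?J = dcount p w l - rowlen p l" using sub by (simp add: card_Diff_subset dcount_dset)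
    thus ?thesis unfolding cc using 4 by simp
  next
    case 5
    have "?J = {}"
    proof (rule ccontr)
      assume "?J \<noteq> {}"
      then obtain j where j: "w ` col p t j = S" by blast
      show False using colset_cases[of j] jl[OF j] j 5 by auto
    qed
    thus ?thesis unfolding cc using 5 by auto
  qed
qed

end

end


text \<open>
  Equal counts give equally many columns with each set of cells. So the columns of one filling
  can be matched with those of the other; the matching permutes columns of equal length, hence
  conjugates the column stabilizer into itself and multiplies the polytabloid by a scalar.
\<close>

lemma two_fillings:
  assumes p: "is_partition p" and t: "is_tableau p t" and w: "filling p q r t w" and w': "filling p q r t w'"
    and lq: "length q \<le> a" and lr: "length r \<le> b" and eq: "margin_weight q r = top_weight p"
    and same: "\<And>k. k < a * b \<Longrightarrow> dcount p w k = dcount p w' k"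
  obtains \<sigma> c where "\<sigma> permutes {..<sum_list p}" "\<And>i. i < sum_list p \<Longrightarrow> w (\<sigma> i) = w' i"
      "polytabloid p t \<circ> nact \<sigma> = cscale c (polytabloid p t)"
proof -
  let ?n = "sum_list p" and ?A = "\<lambda>w j. w ` col p t j"
  have "colcount p w S = colcount p w' S" for S
  proof (cases "card S = 0 \<or> \<not> P (card S - 1)")
    case True
    thus ?thesis by (auto simp: colcount_def Let_def)
  next
    case False
    hence "card S < a * b" "card S - 1 < a * b" using P_less[of "card S - 1"] by auto
    thus ?thesis by (simp only: colcount_def Let_def same)
  qed
  hence "card {j. j < rowlen p 0 \<and> ?A w j = S} = card {j. j < rowlen p 0 \<and> ?A w' j = S}" for S
    using card_colcount[OF p t w lq lr eq, of S] card_colcount[OF p t w' lq lr eq, of S] by simp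
  from content_permutes[OF this] obtain \<pi> where \<pi>: "\<pi> permutes {..<rowlen p 0}" "\<And>j. j < rowlen p 0 \<Longrightarrow> ?A w (\<pi> j) = ?A w' j"
    by blast
  have wi: "column_inj p t w" and wi': "column_inj p t w'" using w w' by (auto simp: filling_def)
  have sn: "snd (t i) < rowlen p 0" if "i < ?n" for i
    using tableau_cell[OF t that] rowlen_antimono[OF p, of 0 "fst (t i)"] by simp
  have "\<exists>s. s permutes {..<?n} \<and> (\<forall>i<?n. (snd (t (s i)), w (s i)) = (\<pi> (snd (t i)), w' i))"
  proof (rule same_image_permutes[of "\<lambda>i. (snd (t i), w i)" _ "\<lambda>i. (\<pi> (snd (t i)), w' i)"])
    show "inj_on (\<lambda>i. (snd (t i), w i)) {..<?n}"
      by (rule inj_onI) (use wi in \<open>auto simp: column_inj_def\<close>)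
    show "inj_on (\<lambda>i. (\<pi> (snd (t i)), w' i)) {..<?n}"
    proof (rule inj_onI)
      fix i j assume ij: "i \<in> {..<?n}" "j \<in> {..<?n}" "(\<pi> (snd (t i)), w' i) = (\<pi> (snd (t j)), w' j)"
      hence "snd (t i) = snd (t j)" using permutes_inj[OF \<pi>(1)] by (auto dest: injD)
      thus "i = j" using wi' ij by (auto simp: column_inj_def)
    qed
    show "(\<lambda>i. (snd (t i), w i)) ` {..<?n} = (\<lambda>i. (\<pi> (snd (t i)), w' i)) ` {..<?n}"
    proof (intro equalityI subsetI)
      fix g assume "g \<in> (\<lambda>i. (snd (t i), w i)) ` {..<?n}"
      then obtain i where i: "i < ?n" "g = (snd (t i), w i)" by auto
      define j where "j = inv \<pi> (snd (t i))"
      have j: "\<pi> j = snd (t i)" "j < rowlen p 0"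
        using permutes_inverses[OF \<pi>(1)] permutes_inv_less[OF \<pi>(1) sn[OF i(1)]] by (auto simp: j_def)
      have "w i \<in> ?A w (\<pi> j)" using i(1) by (auto simp: j(1) col_def)
      hence "w i \<in> ?A w' j" using \<pi>(2)[OF j(2)] by simp
      then obtain i' where i': "i' < ?n" "snd (t i') = j" "w i = w' i'" by (auto simp: col_def)
      show "g \<in> (\<lambda>i. (\<pi> (snd (t i)), w' i)) ` {..<?n}"
        by (rule image_eqI[of _ _ i']) (use i i' j in auto)
    next
      fix g assume "g \<in> (\<lambda>i. (\<pi> (snd (t i)), w' i)) ` {..<?n}"
      then obtain i where i: "i < ?n" "g = (\<pi> (snd (t i)), w' i)" by auto
      have "w' i \<in> ?A w' (snd (t i))" using i(1) by (auto simp: col_def)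
      hence "w' i \<in> ?A w (\<pi> (snd (t i)))" using \<pi>(2)[OF sn[OF i(1)]] by simp
      then obtain i' where i': "i' < ?n" "snd (t i') = \<pi> (snd (t i))" "w' i = w i'" by (auto simp: col_def)
      show "g \<in> (\<lambda>i. (snd (t i), w i)) ` {..<?n}"
        by (rule image_eqI[of _ _ i']) (use i i' in auto)
    qed
  qed
  then obtain \<sigma> where \<sigma>: "\<sigma> permutes {..<?n}" "\<And>i. i < ?n \<Longrightarrow> snd (t (\<sigma> i)) = \<pi> (snd (t i))" "\<And>i. i < ?n \<Longrightarrow> w (\<sigma> i) = w' i"
    by blast
  let ?T = "tabloid p t"
  have "polytabloid p t \<circ> nact \<sigma> = ncsym ?n csign (snd \<circ> t \<circ> \<sigma>) (delta ?T) \<circ> nact \<sigma>"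
    unfolding polytabloid_csym
    by (rule arg_cong[where f = "\<lambda>h. h \<circ> nact \<sigma>"], rule csym_cong)
       (use \<sigma>(2) permutes_inj[OF \<pi>(1)] in \<open>auto dest: injD\<close>)
  also have "\<dots> = ncsym ?n csign (snd \<circ> t) (delta ?T \<circ> nact \<sigma>)"
    by (rule nact.csym_conj[OF character_csign \<sigma>(1), symmetric])
  also have "\<dots> = ncsym ?n csign (snd \<circ> t) (delta (?T \<circ> inv \<sigma>))"
    using delta_nact[OF \<sigma>(1)] by simp
  finally have 1: "polytabloid p t \<circ> nact \<sigma> = ncsym ?n csign (snd \<circ> t) (delta (?T \<circ> inv \<sigma>))" .
  have "?T \<circ> inv \<sigma> \<in> tabs p" using tabs_comp[OF tabloid_in[OF t] permutes_inv[OF \<sigma>(1)]] .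
  from asym_tabloid[OF p t this] show thesis using that[OF \<sigma>(1,3)] 1 by metis
qed

text \<open>
  Weights are additive in the two coordinates.
\<close>

lemma sum_margins:
  fixes d :: "nat \<Rightarrow> 'r::comm_ring_1"
  shows "(\<Sum>i<a. rowsum d i * of_int (x i)) + (\<Sum>j<b. colsum d j * of_int (y j)) = (\<Sum>k<a * b. d k * of_int (z (\<kappa> k)))"
proof -
  have grp: "(\<Sum>i<m. (\<Sum>k | k < a * b \<and> h k = i. d k) * of_int (f i)) = (\<Sum>k<a * b. d k * of_int (f (h k)))"
    if "\<And>k. k < a * b \<Longrightarrow> h k < m" for h :: "nat \<Rightarrow> nat" and m and f :: "nat \<Rightarrow> int"
  proof -
    have "(\<Sum>i<m. (\<Sum>k | k < a * b \<and> h k = i. d k) * of_int (f i)) = (\<Sum>i<m. \<Sum>k | k \<in> {..<a * b} \<and> h k = i. d k * of_int (f (h k)))"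
      by (auto simp: sum_distrib_right intro!: sum.cong)
    also have "\<dots> = (\<Sum>k<a * b. d k * of_int (f (h k)))"
      by (rule sum.group) (use that in auto)
    finally show ?thesis .
  qed
  show ?thesis
    unfolding rowsum_def colsum_def
    using grp[of "\<lambda>k. fst (\<kappa> k)" a x] grp[of "\<lambda>k. snd (\<kappa> k)" b y] kap_range
    by (simp add: wt_def sum.distrib algebra_simps)
qed

lemma pair_sum:
  fixes h :: "nat \<Rightarrow> 'r::comm_monoid_add"
  assumes "\<And>k. k < a * b \<Longrightarrow> \<not> P k \<Longrightarrow> \<forall>k'. k = Suc k' \<longrightarrow> \<not> P k' \<Longrightarrow> h k = 0"
  shows "(\<Sum>k<a * b. h k) = (\<Sum>k | P k. h k + h (Suc k))"
proof -
  have fin: "finite {k. P k}" by (rule finite_subset[of _ "{..<a * b}"]) (auto simp: tie_def)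
  have "(\<Sum>k<a * b. h k) = (\<Sum>k\<in>{k. P k} \<union> Suc ` {k. P k}. h k)"
    by (rule sum.mono_neutral_right) (use assms in \<open>auto simp: tie_def\<close>)
  also have "\<dots> = (\<Sum>k | P k. h k) + (\<Sum>k\<in>Suc ` {k. P k}. h k)"
    by (rule sum.union_disjoint) (use fin P_Suc in auto)
  also have "(\<Sum>k\<in>Suc ` {k. P k}. h k) = (\<Sum>k | P k. h (Suc k))"
    by (simp add: sum.reindex)
  finally show ?thesis by (simp add: sum.distrib)
qed

lemma balanced_sum:
  fixes \<delta> :: "nat \<Rightarrow> 'r::comm_ring_1"
  assumes "balanced \<delta>"
  shows "(\<Sum>k<a * b. \<delta> k * of_int (z (\<kappa> k))) = 0" and "(\<Sum>k<a * b. \<delta> k) = 0"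
proof -
  have gen: "(\<Sum>k<a * b. \<delta> k * f k) = 0" if f: "\<And>k. P k \<Longrightarrow> f k = f (Suc k)" for f
  proof -
    have "(\<Sum>k<a * b. \<delta> k * f k) = (\<Sum>k | P k. \<delta> k * f k + \<delta> (Suc k) * f (Suc k))"
      by (rule pair_sum) (use assms in \<open>auto simp: balanced_def\<close>)
    also have "\<dots> = (\<Sum>k | P k. 0)"
    proof (rule sum.cong[OF refl])
      fix k assume "k \<in> {k. P k}"
      hence k: "P k" by simp
      hence "\<delta> k + \<delta> (Suc k) = 0" using assms by (auto simp: balanced_def)
      thus "\<delta> k * f k + \<delta> (Suc k) * f (Suc k) = 0"
        by (simp add: f[OF k] flip: distrib_right)
    qed
    finally show ?thesis by simp
  qed
  show "(\<Sum>k<a * b. \<delta> k * of_int (z (\<kappa> k))) = 0" by (rule gen) (simp add: tie_def)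
  have "(\<Sum>k<a * b. \<delta> k * 1) = 0" by (rule gen) simp
  thus "(\<Sum>k<a * b. \<delta> k) = 0" by simp
qed

lemma splits_sum:
  fixes l d :: "nat \<Rightarrow> 'r::linordered_idom"
  assumes "splits l d"
  shows "(\<Sum>k<a * b. d k * of_int (z (\<kappa> k))) = (\<Sum>k<a * b. l k * of_int (z (\<kappa> k)))"
    and "(\<Sum>k<a * b. d k) = (\<Sum>k<a * b. l k)"
proof -
  have "balanced (\<lambda>k. d k - l k)"
    unfolding balanced_def
  proof (intro conjI allI impI)
    fix k assume "P k"
    hence "d k + d (Suc k) = l k + l (Suc k)" using assms by (auto simp: splits_def)
    thus "d k - l k + (d (Suc k) - l (Suc k)) = 0" by (simp add: algebra_simps)
  qed (use assms in \<open>auto simp: splits_def\<close>)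
  from balanced_sum[OF this] show "(\<Sum>k<a * b. d k * of_int (z (\<kappa> k))) = (\<Sum>k<a * b. l k * of_int (z (\<kappa> k)))"
    and "(\<Sum>k<a * b. d k) = (\<Sum>k<a * b. l k)"
    by (simp_all add: left_diff_distrib sum_subtractf)
qed

end

text \<open>
  Splittings are determined by their margins; over the reals, since this is applied to
  splittings of arbitrary points of the cone.
\<close>

locale rigid_config = pair_config +
  assumes unique: "\<And>\<delta> :: nat \<Rightarrow> real. \<lbrakk>balanced \<delta>; \<And>i. i < a \<Longrightarrow> rowsum \<delta> i = 0; \<And>j. j < b \<Longrightarrow> colsum \<delta> j = 0\<rbrakk>
      \<Longrightarrow> k < a * b \<Longrightarrow> \<delta> k = 0"
begin

lemma splits_unique:
  fixes d d' :: "nat \<Rightarrow> int"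
  assumes d: "splits l d" "splits l d'" and m: "\<And>i. i < a \<Longrightarrow> rowsum d i = rowsum d' i" "\<And>j. j < b \<Longrightarrow> colsum d j = colsum d' j"
    and k: "k < a * b"
  shows "d k = d' k"
proof -
  have "real_of_int (d k - d' k) = 0"
  proof (rule unique[of "\<lambda>k. real_of_int (d k - d' k)", OF _ _ _ k])
    show "balanced (\<lambda>k. real_of_int (d k - d' k))"
      unfolding balanced_def
    proof (intro conjI allI impI)
      fix k assume "P k"
      hence "d k + d (Suc k) = l k + l (Suc k)" "d' k + d' (Suc k) = l k + l (Suc k)"
        using d by (auto simp: splits_def)
      hence "(d k - d' k) + (d (Suc k) - d' (Suc k)) = 0" by simp
      thus "real_of_int (d k - d' k) + real_of_int (d (Suc k) - d' (Suc k)) = 0"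
        by (simp flip: of_int_add)
    qed (use d in \<open>auto simp: splits_def\<close>)
    show "rowsum (\<lambda>k. real_of_int (d k - d' k)) i = 0" if "i < a" for i
      unfolding rowsum_of_int using m(1)[OF that] by (simp add: rowsum_def sum_subtractf)
    show "colsum (\<lambda>k. real_of_int (d k - d' k)) j = 0" if "j < b" for j
      unfolding colsum_of_int using m(2)[OF that] by (simp add: colsum_def sum_subtractf)
  qed
  thus ?thesis by simp
qed

text \<open>
  Both fillings have the same margins and split the same partition, so they use each cell
  equally often.
\<close>

lemma fillings_conjugate:
  assumes p: "is_partition p" and t: "is_tableau p t" and w: "filling p q r t w" and w': "filling p q r t w'"
    and lq: "length q \<le> a" and lr: "length r \<le> b" and eq: "margin_weight q r = top_weight p"
  obtains \<sigma> c where "\<sigma> permutes {..<sum_list p}" "\<And>i. i < sum_list p \<Longrightarrow> w (\<sigma> i) = w' i"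
      "polytabloid p t \<circ> nact \<sigma> = cscale c (polytabloid p t)"
proof (rule two_fillings[OF p t w w' lq lr eq])
  fix k assume k: "k < a * b"
  have "int (dcount p w k) = int (dcount p w' k)"
    by (rule splits_unique[OF filling_splits[OF p t w lq lr eq] filling_splits[OF p t w' lq lr eq] _ _ k])
       (simp_all add: filling_margins[OF p t w lq lr eq] filling_margins[OF p t w' lq lr eq])
  thus "dcount p w k = dcount p w' k" by simp
qed (use that in blast)

end


section \<open>Kronecker coefficients on the face\<close>

lemma cells_count:
  assumes t: "is_tableau p t"
  shows "card {s. s < sum_list p \<and> fst (t s) = i \<and> snd (t s) \<in> J} = card (J \<inter> {..<rowlen p i})"
proof (rule bij_betw_same_card[of "\<lambda>s. snd (t s)"], rule bij_betw_imageI)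
  show "inj_on (\<lambda>s. snd (t s)) {s. s < sum_list p \<and> fst (t s) = i \<and> snd (t s) \<in> J}"
    by (rule inj_onI, rule tableau_eqI[OF t]) auto
  show "(\<lambda>s. snd (t s)) ` {s. s < sum_list p \<and> fst (t s) = i \<and> snd (t s) \<in> J} = J \<inter> {..<rowlen p i}"
  proof (intro equalityI subsetI)
    fix j assume j: "j \<in> J \<inter> {..<rowlen p i}"
    then obtain s where "s < sum_list p" "t s = (i, j)" using tableau_surj[OF t, of j i] by auto
    thus "j \<in> (\<lambda>s. snd (t s)) ` {s. s < sum_list p \<and> fst (t s) = i \<and> snd (t s) \<in> J}"
      using j by (intro image_eqI[of _ _ s]) auto
  qed (use tableau_cell[OF t] in auto)
qed

lemma row_filling:
  assumes p: "p \<in> partitions_of n" and q: "q \<in> partitions_of n" and r: "r \<in> partitions_of n"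
    and U: "U \<in> tabs q" and inj: "column_inj p t (\<lambda>x. (U x, R x))"
    and R: "\<And>x. x < n \<Longrightarrow> R x = fst (t' x)" and t': "is_tableau r t'"
  shows "filling p q r t (\<lambda>x. (U x, R x))"
proof -
  have n: "sum_list p = n" "sum_list q = n" "sum_list r = n" using partitions_ofD p q r by auto
  have "{x. x < n \<and> R x = j} = {x. x < n \<and> fst (t' x) = j}" for j using R by auto
  thus ?thesis
    using inj tabs_content(2)[OF U] row_content[OF t'] n by (simp add: filling_def)
qed

context rigid_config
begin

context
  fixes p q r :: "nat list" and n :: nat
  assumes p: "p \<in> partitions_of n" and q: "q \<in> partitions_of n" and r: "r \<in> partitions_of n"
    and lq: "length q \<le> a" and lr: "length r \<le> b"
begin

lemma sizes: "sum_list p = n" "sum_list q = n" "sum_list r = n"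
  using partitions_ofD p q r by auto

text \<open>
  All parts are read off the filling provided by \<open>kronecker_filling\<close>.
\<close>

lemma kronecker_nonzero_weight:
  assumes nz: "kronecker p q r \<noteq> 0"
  shows "length p \<le> a * b" "margin_weight q r \<le> top_weight p"
    and "margin_weight q r = top_weight p \<Longrightarrow> \<exists>d::nat \<Rightarrow> nat. splits (\<lambda>k. int (rowlen p k)) (\<lambda>k. int (d k))
      \<and> (\<forall>i<a. rowsum (\<lambda>k. int (d k)) i = int (rowlen q i)) \<and> (\<forall>j<b. colsum (\<lambda>k. int (d k)) j = int (rowlen r j))"
proof -
  obtain U t where Ut: "U \<in> tabs q" "is_tableau p t" "column_inj p t (\<lambda>x. (U x, fst (ctab r x)))"
    by (rule kronecker_filling[OF p q r nz])
  have f: "filling p q r t (\<lambda>x. (U x, fst (ctab r x)))"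
    by (rule row_filling[OF p q r Ut(1,3) _ ctab]) simp
  note P = partitions_ofD(1)[OF p]
  show "length p \<le> a * b" by (rule filling_length[OF P Ut(2) f lq lr])
  show "margin_weight q r \<le> top_weight p" by (rule filling_weight_le[OF P Ut(2) f lq lr])
  assume eq: "margin_weight q r = top_weight p"
  show "\<exists>d::nat \<Rightarrow> nat. splits (\<lambda>k. int (rowlen p k)) (\<lambda>k. int (d k))
      \<and> (\<forall>i<a. rowsum (\<lambda>k. int (d k)) i = int (rowlen q i)) \<and> (\<forall>j<b. colsum (\<lambda>k. int (d k)) j = int (rowlen r j))"
    using filling_splits[OF P Ut(2) f lq lr eq] filling_margins[OF P Ut(2) f lq lr eq] by blast
qed

text \<open>
  The image of the symmetrizer is controlled by the vectors \<open>v\<close> invariant under the row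
  stabilizer of the tableau of shape \<open>r\<close>. Such a vector is determined by the numbers obtained
  from pairing its slices with polytabloids; the nonzero ones are indexed by fillings, and since
  all fillings are conjugate, they are fixed multiples of one of them.
\<close>

lemma kronecker_dependent:
  assumes eq: "margin_weight q r = top_weight p"
    and f: "f1 \<in> young n tensor_act r ` tensor (specht p) (specht q)" "f2 \<in> young n tensor_act r ` tensor (specht p) (specht q)"
  shows "\<exists>c d. (c \<noteq> 0 \<or> d \<noteq> 0) \<and> cscale c f1 + cscale d f2 = 0"
proof -
  let ?W = "tensor (specht p) (specht q)" and ?R = "fst \<circ> ctab r"
  note W = submod_tensor_specht[OF p q]
  note P = partitions_ofD(1)[OF p]
  define A where "A = {v \<in> ?W. \<forall>s\<in>stab n ?R. v \<circ> tensor_act s = v}"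
  define m where "m v t U = pairing p (\<lambda>T. v (T, U)) (polytabloid p t)" for v t and U :: "nat \<Rightarrow> nat"
  have sl: "(\<lambda>T. v (T, U)) \<in> specht p" "(\<lambda>U. v (T, U)) \<in> specht q" if "v \<in> A" for v T U
    using that tensor_slices[of v, OF _ subspace_specht subspace_specht] by (auto simp: A_def)
  \<comment> \<open>The pairing is the antisymmetrization of a slice of \<open>v\<close>, evaluated at a tabloid; so Garnir's
    argument applies.\<close>
  have L1: "U \<in> tabs q \<and> filling p q r t (\<lambda>x. (U x, ?R x))" if v: "v \<in> A" and t: "is_tableau p t" and nz: "m v t U \<noteq> 0" for v t U
  proof -
    obtain T where T: "v (T, U) \<noteq> 0" using nz by (force simp: m_def pairing_def)
    have U: "U \<in> tabs q" using sl(2)[OF v, of T] specht_supp[of q] T by (auto simp: supp_on_def)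
    have "pairing p (ncsym (sum_list p) csign (snd \<circ> t) (\<lambda>T. v (T, U))) (delta (tabloid p t)) \<noteq> 0"
      using nz unfolding m_def pairing_polytabloid .
    hence nz': "ncsym (sum_list p) csign (snd \<circ> t) (\<lambda>T. v (T, U)) \<noteq> 0" by (auto simp: pairing_def)
    have "column_inj p t (\<lambda>x. (U x, ?R x))"
    proof (rule nact.asym_column_inj[OF nz'])
      fix s assume "s \<in> stab (sum_list p) (\<lambda>x. (U x, ?R x))"
      hence s: "s \<in> stab n (\<lambda>x. (U x, ?R x))" unfolding sizes .
      have "v \<circ> tensor_act u = v" if "u \<in> stab n ?R" for u using v that unfolding A_def by blast
      thus "(\<lambda>T. v (T, U)) \<circ> nact s = (\<lambda>T. v (T, U))"
        by (rule slice_invariant[OF _ tabs_ext[OF U q] s])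
    qed
    hence "filling p q r t (\<lambda>x. (U x, ?R x))" by (rule row_filling[OF p q r U _ _ ctab]) simp
    thus ?thesis using U by blast
  qed
  \<comment> \<open>The symmetry of \<open>fillings_conjugate\<close>, composed with the permutation from \<open>t1\<close> to \<open>t2\<close>,
    stabilizes \<open>?R\<close> and therefore fixes \<open>v\<close>.\<close>
  have L2: "\<exists>c. \<forall>v\<in>A. m v t2 U2 = c * m v t1 U1"
    if t1: "is_tableau p t1" and U1: "U1 \<in> tabs q" and f1: "filling p q r t1 (\<lambda>x. (U1 x, ?R x))"
      and t2: "is_tableau p t2" and U2: "U2 \<in> tabs q" and f2: "filling p q r t2 (\<lambda>x. (U2 x, ?R x))" for t1 U1 t2 U2
  proof -
    obtain g where g: "g permutes {..<n}" "\<And>i. i < n \<Longrightarrow> t2 i = t1 (g i)"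
      using tableau_rel[OF t1 t2] sizes by auto
    have ig: "inv g i < n" if "i < n" for i using permutes_inv_less[OF g(1) that] .
    have gg: "g (inv g i) = i" "inv g (g i) = i" for i using permutes_inverses[OF g(1)] by auto
    let ?w2 = "\<lambda>x. (U2 x, ?R x)"
    have f2': "filling p q r t1 (\<lambda>x. ?w2 (inv g x))"
      unfolding filling_def sizes
    proof (intro conjI allI)
      show "column_inj p t1 (\<lambda>x. ?w2 (inv g x))"
        unfolding column_inj_def sizes
      proof (intro allI impI)
        fix i j assume ij: "i < n" "j < n" "snd (t1 i) = snd (t1 j)" "?w2 (inv g i) = ?w2 (inv g j)"
        have "snd (t2 (inv g i)) = snd (t2 (inv g j))" using g(2)[OF ig[OF ij(1)]] g(2)[OF ig[OF ij(2)]] ij(3) gg by simp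
        hence "inv g i = inv g j" using f2 ij(4) ig[OF ij(1)] ig[OF ij(2)] by (auto simp: filling_def column_inj_def sizes)
        thus "i = j" using gg by metis
      qed
      show "card {x. x < n \<and> fst (?w2 (inv g x)) = i} = rowlen q i" for i
        using content_perm[OF permutes_inv[OF g(1)], of "\<lambda>x. fst (?w2 x)" i] f2 by (simp add: filling_def sizes)
      show "card {x. x < n \<and> snd (?w2 (inv g x)) = i} = rowlen r i" for i
        using content_perm[OF permutes_inv[OF g(1)], of "\<lambda>x. snd (?w2 x)" i] f2 by (simp add: filling_def sizes)
    qed
    obtain \<sigma> c where \<sigma>: "\<sigma> permutes {..<n}" "\<And>i. i < n \<Longrightarrow> (U1 (\<sigma> i), ?R (\<sigma> i)) = ?w2 (inv g i)"
        "polytabloid p t1 \<circ> nact \<sigma> = cscale c (polytabloid p t1)"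
      using fillings_conjugate[OF P t1 f1 f2' lq lr eq] sizes by metis
    define s where "s = \<sigma> \<circ> g"
    have s: "s permutes {..<n}" unfolding s_def by (rule permutes_compose[OF g(1) \<sigma>(1)])
    have sw: "U1 (s i) = U2 i" "?R (s i) = ?R i" if "i < n" for i
      using \<sigma>(2)[OF permutes_less[OF g(1) that]] gg by (auto simp: s_def)
    have sR: "s \<in> stab n ?R" using s sw(2) by (simp add: stab_def)
    have U1s: "U1 \<circ> s = U2"
    proof
      fix i show "(U1 \<circ> s) i = U2 i"
        using sw(1)[of i] ext_comp[OF s tabs_ext[OF U1 q]] tabs_ext[OF U2 q] by (cases "i < n") (auto simp: extensional_def)
    qed
    have et2: "polytabloid p t2 (T \<circ> s) = c * polytabloid p t1 T" for T
    proof -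
      have "polytabloid p t2 = polytabloid p (t1 \<circ> g)" by (rule polytabloid_cong) (simp add: g(2) sizes)
      also have "\<dots> = polytabloid p t1 \<circ> nact (inv g)" by (rule polytabloid_comp) (simp add: g(1) sizes)
      finally have "polytabloid p t2 (T \<circ> s) = polytabloid p t1 (T \<circ> \<sigma> \<circ> (g \<circ> inv g))"
        by (simp add: s_def nact_def comp_assoc)
      also have "\<dots> = (polytabloid p t1 \<circ> nact \<sigma>) T" by (simp add: permutes_inv_o[OF g(1)] nact_def)
      finally show ?thesis unfolding \<sigma>(3) by (simp add: cscale_def)
    qed
    have "m v t2 U2 = c * m v t1 U1" if v: "v \<in> A" for v
    proof -
      have vs: "v (T \<circ> s, U2) = v (T, U1)" for T
      proof -
        have "v \<circ> tensor_act s = v" using v sR by (simp add: A_def)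
        from fun_cong[OF this, of "(T, U1)"] show ?thesis by (simp add: tensor_act_def U1s)
      qed
      have "m v t2 U2 = (\<Sum>T\<in>tabs p. v (T \<circ> s, U2) * polytabloid p t2 (T \<circ> s))"
        unfolding m_def pairing_def
        by (rule sum.reindex_bij_betw[OF tabs_bij, symmetric]) (simp add: s sizes)
      thus ?thesis by (simp add: vs et2 m_def pairing_def sum_distrib_left mult_ac)
    qed
    thus ?thesis by blast
  qed
  have L3: "v = 0" if v: "v \<in> A" and z: "\<And>t U. is_tableau p t \<Longrightarrow> m v t U = 0" for v
  proof -
    have "(\<lambda>T. v (T, U)) = 0" for U
    proof (rule ccontr)
      assume "(\<lambda>T. v (T, U)) \<noteq> 0"
      from specht_nonorthogonal[OF sl(1)[OF v] this] obtain t where "is_tableau p t" "pairing p (\<lambda>T. v (T, U)) (polytabloid p t) \<noteq> 0" .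
      thus False using z by (simp add: m_def)
    qed
    thus ?thesis by (auto simp: fun_eq_iff)
  qed
  have dep: "\<exists>c d. (c \<noteq> 0 \<or> d \<noteq> 0) \<and> cscale c v1 + cscale d v2 = 0" if v: "v1 \<in> A" "v2 \<in> A" for v1 v2
  proof (cases "\<forall>t U. is_tableau p t \<longrightarrow> m v1 t U = 0")
    case True
    hence "v1 = 0" using L3[OF v(1)] by blast
    thus ?thesis by (intro exI[of _ 1] exI[of _ 0]) simp
  next
    case False
    then obtain t1 U1 where t1: "is_tableau p t1" "m v1 t1 U1 \<noteq> 0" by blast
    define u where "u = cscale (- m v2 t1 U1) v1 + cscale (m v1 t1 U1) v2"
    have lin: "m u t U = - m v2 t1 U1 * m v1 t U + m v1 t1 U1 * m v2 t U" for t U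
      by (simp add: m_def u_def pairing_def cscale_def algebra_simps sum.distrib sum_distrib_left sum_subtractf)
    have uA: "u \<in> A"
    proof -
      have "u \<in> ?W" unfolding u_def using v by (intro submodD(3,4)[OF W]) (auto simp: A_def)
      moreover have "u \<circ> tensor_act s = u" if "s \<in> stab n ?R" for s
      proof -
        have "v1 \<circ> tensor_act s = v1" "v2 \<circ> tensor_act s = v2" using v that by (auto simp: A_def)
        hence "v1 (tensor_act s x) = v1 x" "v2 (tensor_act s x) = v2 x" for x by (metis comp_apply)+
        thus ?thesis by (simp add: u_def cscale_def fun_eq_iff)
      qed
      ultimately show ?thesis by (simp add: A_def)
    qed
    have "m u t U = 0" if t: "is_tableau p t" for t U
    proof (rule ccontr)
      assume nz: "m u t U \<noteq> 0"
      obtain c where c: "\<And>v. v \<in> A \<Longrightarrow> m v t U = c * m v t1 U1"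
        using L2[OF t1(1) _ _ t] L1[OF v(1) t1] L1[OF uA t nz] by blast
      have "m u t1 U1 = 0" by (simp add: lin)
      thus False using nz c[OF uA] by simp
    qed
    hence "u = 0" by (rule L3[OF uA])
    thus ?thesis using t1(2) unfolding u_def by blast
  qed
  obtain g1 g2 where g: "g1 \<in> ?W" "g2 \<in> ?W" "f1 = young n tensor_act r g1" "f2 = young n tensor_act r g2" using f by blast
  let ?b = "csym n tensor_act csign (snd \<circ> ctab r)" and ?a = "csym n tensor_act triv ?R"
  have inA: "?a g \<in> A" if "g \<in> ?W" for g
    using csym_in[OF W that] tact.csym_act_right[OF character_triv, of _ n ?R g] by (auto simp: A_def triv_def)
  obtain c d where cd: "c \<noteq> 0 \<or> d \<noteq> 0" "cscale c (?a g1) + cscale d (?a g2) = 0"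
    using dep[OF inA[OF g(1)] inA[OF g(2)]] by blast
  have "cscale c f1 + cscale d f2 = ?b (cscale c (?a g1) + cscale d (?a g2))"
    by (simp only: csym_add csym_scale g(3,4) young_def)
  also have "\<dots> = 0" unfolding cd(2) by (rule csym_0)
  finally show ?thesis using cd(1) by blast
qed


text \<open>
  The splitting \<open>d\<close> yields a filling \<open>w\<close> of maximal weight. Symmetrizing the tensor of a
  polytabloid and a tabloid over the Young subgroup of the first coordinates of \<open>w\<close> gives a
  vector \<open>F\<close> that is nonzero because row and column permutations cannot cancel on \<open>w\<close>. The
  weight inequality identifies a constituent of the representation that contains \<open>F\<close> as \<open>q\<close>;
  \<open>transfer\<close> turns it into a vector invariant under the Young subgroup of \<open>r\<close> in the tensor
  product of the two Specht modules, and the same inequality identifies a constituent there as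
  \<open>r\<close>.
\<close>

lemma kronecker_nonzero:
  fixes d :: "nat \<Rightarrow> nat"
  assumes lp: "length p \<le> a * b" and d: "splits (\<lambda>k. int (rowlen p k)) (\<lambda>k. int (d k))"
    and rows: "\<And>i. i < a \<Longrightarrow> rowsum (\<lambda>k. int (d k)) i = int (rowlen q i)"
    and cols: "\<And>j. j < b \<Longrightarrow> colsum (\<lambda>k. int (d k)) j = int (rowlen r j)"
  shows "kronecker p q r \<noteq> 0"
proof -
  note Pp = partitions_ofD(1)[OF p]
  have eq: "margin_weight q r = top_weight p"
    using sum_margins[of "\<lambda>k. int (d k)"] splits_sum(1)[OF d] rows cols by (simp add: top_weight_def margin_weight_def)
  define t where "t = ctab p"
  have t: "is_tableau p t" unfolding t_def by (rule ctab)
  have dP: "rowlen p (Suc k) \<le> d k" "d k \<le> rowlen p k" "d k + d (Suc k) = rowlen p k + rowlen p (Suc k)" if "P k" for k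
  proof -
    have "int (d k) + int (d (Suc k)) = int (rowlen p k) + int (rowlen p (Suc k))
        \<and> int (rowlen p (Suc k)) \<le> int (d k) \<and> int (d k) \<le> int (rowlen p k)"
      using d that by (auto simp: splits_def)
    thus "rowlen p (Suc k) \<le> d k" "d k \<le> rowlen p k" "d k + d (Suc k) = rowlen p k + rowlen p (Suc k)" by linarith+
  qed
  have rowN: "fst (t i) < a * b" if "i < n" for i using row_less[OF t] that lp sizes by fastforce
  \<comment> \<open>Row \<open>k\<close> carries the cell \<open>\<kappa> k\<close>, except that its last boxes carry the tied cell once \<open>d k\<close> is
    used up.\<close>
  define w where "w i = (if P (fst (t i)) \<and> d (fst (t i)) \<le> snd (t i) then \<kappa> (Suc (fst (t i))) else \<kappa> (fst (t i)))" for i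
  have w_in: "\<forall>i<n. w i \<in> {..<a} \<times> {..<b}"
    using rowN P_less bij_betwE[OF kap_bij] by (auto simp: w_def)
  have zw: "z (w i) = z (\<kappa> (fst (t i)))" for i by (auto simp: w_def tie_def)
  have wk: "w i = \<kappa> k \<longleftrightarrow> (fst (t i) = k \<and> \<not> (P k \<and> d k \<le> snd (t i))) \<or> (P (fst (t i)) \<and> Suc (fst (t i)) = k \<and> d (fst (t i)) \<le> snd (t i))"
    if "i < n" "k < a * b" for i k
    using kap_inj[OF rowN[OF that(1)] that(2)] kap_inj[OF P_less that(2), of "fst (t i)"] by (auto simp: w_def)
  have count: "card {i. i < n \<and> w i = \<kappa> k} = d k" if k: "k < a * b" for k
  proof -
    consider "P k" | k' where "\<not> P k" "k = Suc k'" "P k'" | "\<not> P k" "\<forall>k'. k = Suc k' \<longrightarrow> \<not> P k'" by blast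
    thus ?thesis
    proof cases
      case 1
      have "{i. i < n \<and> w i = \<kappa> k} = {i. i < n \<and> fst (t i) = k \<and> snd (t i) \<in> {..<d k}}"
        using wk[OF _ k] 1 P_Suc by auto
      thus ?thesis using cells_count[OF t, of k "{..<d k}"] dP(2)[OF 1] sizes by (simp add: Int_absorb2)
    next
      case 2
      have "{i. i < n \<and> w i = \<kappa> k} = {i. i < n \<and> fst (t i) = k \<and> snd (t i) \<in> UNIV} \<union> {i. i < n \<and> fst (t i) = k' \<and> snd (t i) \<in> {d k'..}}"
        using wk[OF _ k] 2 by auto
      moreover have "card ({i. i < n \<and> fst (t i) = k \<and> snd (t i) \<in> UNIV} \<union> {i. i < n \<and> fst (t i) = k' \<and> snd (t i) \<in> {d k'..}})
          = card {i. i < n \<and> fst (t i) = k \<and> snd (t i) \<in> UNIV} + card {i. i < n \<and> fst (t i) = k' \<and> snd (t i) \<in> {d k'..}}"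
        by (rule card_Un_disjoint) (use 2 in auto)
      moreover have "card {i. i < n \<and> fst (t i) = k \<and> snd (t i) \<in> UNIV} = rowlen p k"
        using cells_count[OF t, of k UNIV] sizes by simp
      moreover have "card {i. i < n \<and> fst (t i) = k' \<and> snd (t i) \<in> {d k'..}} = rowlen p k' - d k'"
      proof -
        have "{d k'..} \<inter> {..<rowlen p k'} = {d k'..<rowlen p k'}" by auto
        thus ?thesis using cells_count[OF t, of k' "{d k'..}"] sizes by simp
      qed
      ultimately show ?thesis using dP[OF 2(3)] 2(2) by simp
    next
      case 3
      have "{i. i < n \<and> w i = \<kappa> k} = {i. i < n \<and> fst (t i) = k \<and> snd (t i) \<in> UNIV}"
        using wk[OF _ k] 3 by auto
      moreover have "int (d k) = int (rowlen p k)" using d 3 k unfolding splits_def by blast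
      ultimately show ?thesis using cells_count[OF t, of k UNIV] sizes by simp
    qed
  qed
  define U where "U = restrict (\<lambda>i. fst (w i)) {..<n}"
  define V where "V = restrict (\<lambda>i. snd (w i)) {..<n}"
  have U: "U \<in> tabs q"
  proof -
    have "card {i. i < n \<and> U i = j} = rowlen q j" for j
    proof -
      have e: "{i. i < n \<and> U i = j} = {i. i < n \<and> fst (w i) = j}" by (auto simp: U_def)
      show ?thesis
      proof (cases "j < a")
        case True
        have "int (card {i. i < n \<and> fst (w i) = j}) = rowsum (\<lambda>k. int (d k)) j"
          unfolding content_margin[OF w_in] rowsum_def of_nat_sum
          by (rule sum.cong) (simp_all add: count)
        thus ?thesis using rows[OF True] e by simp
      next
        case False
        hence "{i. i < n \<and> fst (w i) = j} = {}" using w_in by (auto simp: mem_Times_iff)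
        thus ?thesis using e False lq by (simp add: rowlen_def)
      qed
    qed
    thus ?thesis by (simp add: tabs_iff sizes U_def)
  qed
  have V: "V \<in> tabs r"
  proof -
    have "card {i. i < n \<and> V i = j} = rowlen r j" for j
    proof -
      have e: "{i. i < n \<and> V i = j} = {i. i < n \<and> snd (w i) = j}" by (auto simp: V_def)
      show ?thesis
      proof (cases "j < b")
        case True
        have "int (card {i. i < n \<and> snd (w i) = j}) = colsum (\<lambda>k. int (d k)) j"
          unfolding content_margin[OF w_in] colsum_def of_nat_sum
          by (rule sum.cong) (simp_all add: count)
        thus ?thesis using cols[OF True] e by simp
      next
        case False
        hence "{i. i < n \<and> snd (w i) = j} = {}" using w_in by (auto simp: mem_Times_iff)
        thus ?thesis using e False lr by (simp add: rowlen_def)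
      qed
    qed
    thus ?thesis by (simp add: tabs_iff sizes V_def)
  qed
  \<comment> \<open>A column permutation that changes \<open>w\<close> in the same way as a row permutation is trivial: a box
    could only move between two tied rows, and in the columns that meet both rows the upper one
    carries the earlier cell.\<close>
  have straighten: "s = id"
    if h: "h \<in> stab n (fst \<circ> t)" and s: "s \<in> stab n (snd \<circ> t)" and hs: "\<And>i. i < n \<Longrightarrow> w (h i) = w (s i)" for h s
  proof -
    have hr: "fst (t (h i)) = fst (t i)" if "i < n" for i using h that by (simp add: stab_def)
    have sc: "snd (t (s i)) = snd (t i)" if "i < n" for i using s that by (simp add: stab_def)
    have zs: "z (\<kappa> (fst (t (s i)))) = z (\<kappa> (fst (t i)))" if "i < n" for i
      using hs[OF that] zw[of "s i"] zw[of "h i"] hr[OF that] by simp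
    have down: False if i: "i < n" "fst (t i) = Suc k" "fst (t (s i)) = k" and k: "P k" for i k
    proof -
      have kN: "k < a * b" "Suc k < a * b" using P_less[OF k] by auto
      have "snd (t i) < rowlen p (Suc k)" using tableau_cell[OF t, of i] i sizes by simp
      hence "\<not> d k \<le> snd (t (s i))" using dP(1)[OF k] sc[OF i(1)] by simp
      hence "w (s i) = \<kappa> k" by (simp add: w_def i(3))
      moreover have "w (h i) = \<kappa> (Suc k)" using P_Suc[OF k] hr[OF i(1)] by (simp add: w_def i(2))
      ultimately show False using hs[OF i(1)] kap_inj[OF kN] by simp
    qed
    have "fst (t (s i)) = fst (t i)" if i: "i < n" for i
    proof (rule ccontr)
      assume ne: "fst (t (s i)) \<noteq> fst (t i)"
      have si: "s i < n" by (rule stab_less[OF s i])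
      consider "fst (t (s i)) \<le> fst (t i)" | "fst (t i) \<le> fst (t (s i))" by linarith
      thus False
      proof cases
        case 1
        from z_eq_cases[OF rowN[OF si] rowN[OF i] zs[OF i] 1] ne
        have "fst (t i) = Suc (fst (t (s i)))" "P (fst (t (s i)))" by auto
        thus False using down[OF i] by blast
      next
        case 2
        define k where "k = fst (t i)"
        from z_eq_cases[OF rowN[OF i] rowN[OF si] zs[OF i, symmetric] 2] ne
        have k: "fst (t (s i)) = Suc k" "P k" by (auto simp: k_def)
        define j where "j = inv s i"
        note sp = stab_permutes[OF s]
        have j: "s j = i" "j < n" using permutes_inverses[OF sp] permutes_inv_less[OF sp i] by (auto simp: j_def)
        have zj: "z (\<kappa> (fst (t j))) = z (\<kappa> k)" using zs[OF j(2)] j(1) k_def by simp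
        have "fst (t j) = k \<or> fst (t j) = Suc k"
        proof (cases "fst (t j) \<le> k")
          case True
          from z_eq_cases[OF rowN[OF j(2)] _ zj True] have "fst (t j) = k \<or> (k = Suc (fst (t j)) \<and> P (fst (t j)))"
            using rowN[OF i] k_def by blast
          thus ?thesis using P_Suc k(2) by blast
        next
          case False
          from z_eq_cases[OF _ rowN[OF j(2)] zj[symmetric]] False show ?thesis using rowN[OF i] k_def by auto
        qed
        moreover have "fst (t j) \<noteq> k"
        proof
          assume "fst (t j) = k"
          hence "j = i" using tableau_eqI[OF t, of j i] sc[OF j(2)] j i k_def sizes by simp
          thus False using j(1) ne by simp
        qed
        ultimately have "fst (t j) = Suc k" by blast
        thus False using down[OF j(2) _ _ k(2)] j(1) k_def by simp
      qed
    qed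
    hence "s \<in> stab n (fst \<circ> t)" using stab_permutes[OF s] by (simp add: stab_def)
    thus ?thesis using stab_row_col[OF t] s sizes by simp
  qed
  let ?e = "polytabloid p t" and ?T = "tabloid p t"
  let ?M = "supp_on (tabs r)"
  let ?W = "tensor (specht p) ?M"
  have M: "submod n nact ?M" using submod_supp[of r] sizes by simp
  have W: "submod n tensor_act ?W" by (rule submod_tensor[OF submod_specht'[OF p] M])
  have Wfin: "finite (delta ` (tabs p \<times> tabs r))" "?W \<subseteq> cfun.span (delta ` (tabs p \<times> tabs r))"
  proof -
    have "?W \<subseteq> supp_on (tabs p \<times> tabs r)"
    proof
      fix f assume f: "f \<in> ?W"
      note sl = tensor_slices[OF f subspace_specht supp_on_subspace]
      show "f \<in> supp_on (tabs p \<times> tabs r)" using sl specht_supp[of p] unfolding supp_on_def by fastforce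
    qed
    thus "?W \<subseteq> cfun.span (delta ` (tabs p \<times> tabs r))"
      using supp_on_span[of "tabs p \<times> tabs r"] finite_tabs by blast
  qed (simp add: finite_tabs)
  define F where "F = csym n tensor_act triv U (\<lambda>(T, V'). ?e T * delta V V')"
  have F: "F \<in> ?W"
    unfolding F_def
    by (rule csym_in[OF W], unfold tensor_def, rule cfun.span_base)
       (use polytabloid_specht[OF t] delta_supp[OF V] in blast)
  have "F (?T, V) \<noteq> 0"
  proof -
    \<comment> \<open>Only permutations that preserve \<open>w\<close> and the rows contribute to this value, each of them
      with one.\<close>
    have term1: "?e (?T \<circ> g) * delta V (V \<circ> g) = (if g \<in> stab n V \<inter> stab n (fst \<circ> t) then 1 else 0)" if g: "g \<in> stab n U" for g
    proof (cases "g \<in> stab n V")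
      case False
      hence "V \<circ> g \<noteq> V" using ext_stab[OF tabs_ext[OF V r] stab_permutes[OF g]] by simp
      thus ?thesis using False by (simp add: delta_def)
    next
      case True
      have gw: "w (g i) = w i" if "i < n" for i
        using g True that stab_less[OF g that] by (auto simp: stab_def U_def V_def prod_eq_iff)
      have gp: "g permutes {..<n}" by (rule stab_permutes[OF g])
      have "V \<circ> g = V" using True ext_stab[OF tabs_ext[OF V r] gp] by simp
      hence "?e (?T \<circ> g) * delta V (V \<circ> g) = (\<Sum>s\<in>stab n (snd \<circ> t). csign s * delta ?T (?T \<circ> (g \<circ> s)))"
        by (simp add: polytabloid_csym csym_def sizes nact_def delta_def comp_assoc)
      also have "\<dots> = (\<Sum>s\<in>stab n (snd \<circ> t). if s = id then (if g \<in> stab n (fst \<circ> t) then 1 else 0) else 0)"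
      proof (rule sum.cong[OF refl])
        fix s assume s: "s \<in> stab n (snd \<circ> t)"
        have gs: "g \<circ> s permutes {..<sum_list p}" using permutes_compose[OF stab_permutes[OF s] gp] sizes by simp
        have iff: "?T \<circ> (g \<circ> s) = ?T \<longleftrightarrow> g \<circ> s \<in> stab n (fst \<circ> t)" using tabloid_eq_iff[OF gs] sizes by simp
        have "s = id" if "g \<circ> s \<in> stab n (fst \<circ> t)"
          by (rule straighten[OF that s]) (use gw stab_less[OF s] in simp)
        thus "csign s * delta ?T (?T \<circ> (g \<circ> s)) = (if s = id then (if g \<in> stab n (fst \<circ> t) then 1 else 0) else 0)"
          using iff by (auto simp: delta_def csign_def)
      qed
      also have "\<dots> = (if g \<in> stab n (fst \<circ> t) then 1 else 0)"
        by (simp only: sum.delta[OF finite_stab] stab_id if_True)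
      finally show ?thesis using True by simp
    qed
    have "F (?T, V) = (\<Sum>g\<in>stab n U. if g \<in> stab n V \<inter> stab n (fst \<circ> t) then 1 else 0)"
      unfolding F_def csym_def by (rule sum.cong[OF refl]) (simp add: triv_def tensor_act_def term1)
    also have "\<dots> = of_nat (card (stab n U \<inter> (stab n V \<inter> stab n (fst \<circ> t))))"
      by (simp add: sum.If_cases[OF finite_stab] Int_def)
    also have "\<dots> \<noteq> 0"
    proof -
      have "id \<in> stab n U \<inter> (stab n V \<inter> stab n (fst \<circ> t))" by (simp add: stab_id)
      moreover have "finite (stab n U \<inter> (stab n V \<inter> stab n (fst \<circ> t)))" using finite_stab by blast
      ultimately show ?thesis by (metis card_0_eq empty_iff of_nat_eq_0_iff)
    qed
    finally show ?thesis .
  qed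
  hence Fnz: "F \<noteq> 0" by auto
  have Finv: "F \<circ> tensor_act s = F" if "s \<in> stab n U" for s
    unfolding F_def using tact.csym_act_right[OF character_triv that] by (simp add: triv_def)
  obtain q' u f' where q': "q' \<in> partitions_of n" "u \<in> specht q'" "u \<noteq> 0"
      "\<And>s. s \<in> stab n U \<Longrightarrow> u \<circ> nact s = u" "f' \<in> ?W" "young n tensor_act q' f' \<noteq> 0"
    using tact.invariant_constituent[OF W Wfin F Fnz Finv] by metis
  note Q' = partitions_ofD[OF q'(1)]
  \<comment> \<open>The constituent dominates \<open>q\<close> because of its invariant vector, and the weight inequality for
    its own filling bounds it from above.\<close>
  have q'q: "q' = q"
  proof -
    obtain t' where t': "is_tableau q' t'" "column_inj q' t' U"
      using specht_invariant_filling[OF q'(2,3), of U] q'(4) Q'(2) by metis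
    have Ua: "\<forall>i<sum_list q'. U i < a" using tabs_less[OF U] lq sizes Q'(2) by fastforce
    have lq': "length q' \<le> a" by (rule content_dominated(1)[OF Q'(1) t'(1) x_anti Ua t'(2)])
    obtain v where v: "v \<in> ?W" "v \<noteq> 0" "\<And>s. s \<in> stab n (fst \<circ> ctab q') \<Longrightarrow> v \<circ> tensor_act s = v"
      using young_nonzero_sym[OF W right_action_tensor q'(5,6)] by metis
    obtain V' s where V': "V' \<in> tabs r" "is_tableau p s" "column_inj p s (\<lambda>i. (V' i, (fst \<circ> ctab q') i))"
      by (rule slice_filling[OF p supp_on_subspace order.refl r v])
    have "column_inj p s (\<lambda>i. (fst (ctab q' i), V' i))" using V'(3) by (auto simp: column_inj_def)
    hence "filling p q' r s (\<lambda>i. (fst (ctab q' i), V' i))"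
      using row_content[OF ctab[of q']] tabs_content(2)[OF V'(1)] sizes Q'(2) by (simp add: filling_def)
    from filling_weight_le[OF Pp V'(2) this lq' lr] have "margin_weight q' r \<le> margin_weight q r" using eq by simp
    hence "(\<Sum>i<a. int (rowlen q' i) * x i) \<le> (\<Sum>i<a. int (rowlen q i) * x i)" by (simp add: margin_weight_def)
    thus ?thesis by (rule dominating_content_eq[OF q'(1) q t' U x_anti lq])
  qed
  obtain TV U1 where ne: "(\<Sum>g\<in>Sn n. young n tensor_act q f' (tensor_act g TV) * polytabloid q (ctab q) (U1 \<circ> g)) \<noteq> 0"
    using tact.transfer[OF q q'(6)[unfolded q'q]] by blast
  obtain T1 V1 where TV: "TV = (T1, V1)" by (cases TV)
  define f2 where "f2 = young n tensor_act q f'"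
  have f2W: "f2 \<in> ?W" unfolding f2_def by (rule young_in[OF W q'(5)])
  note sl2 = tensor_slices[OF f2W subspace_specht supp_on_subspace]
  \<comment> \<open>The sum of \<open>transfer\<close>, with the tabloid variable fixed at \<open>V1\<close>: of the invariance under all
    permutations there remains the invariance under the stabilizer of \<open>V1\<close>, a Young subgroup for
    \<open>r\<close>.\<close>
  define G where "G = (\<lambda>(T, U). \<Sum>g\<in>Sn n. f2 (T \<circ> g, V1 \<circ> g) * polytabloid q (ctab q) (U \<circ> g))"
  have GT: "G (T1, U1) \<noteq> 0" using ne by (simp add: G_def f2_def TV tensor_act_def)
  hence Gnz: "G \<noteq> 0" by auto
  have V1: "V1 \<in> tabs r"
  proof (rule ccontr)
    assume n1: "V1 \<notin> tabs r"
    have "f2 (T1 \<circ> g, V1 \<circ> g) = 0" if "g \<in> Sn n" for g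
    proof -
      have g: "g permutes {..<n}" using that by (simp add: Sn_iff)
      have "V1 \<circ> g \<notin> tabs r"
      proof
        assume "V1 \<circ> g \<in> tabs r"
        from tabs_comp[OF this, of "inv g"] have "V1 \<circ> g \<circ> inv g \<in> tabs r" using permutes_inv[OF g] sizes by simp
        thus False using n1 by (simp add: comp_assoc permutes_inv_o[OF g])
      qed
      thus ?thesis using sl2(2)[of "T1 \<circ> g"] by (simp add: supp_on_def)
    qed
    thus False using GT by (simp add: G_def)
  qed
  note W2 = submod_tensor_specht[OF p q]
  have G: "G \<in> tensor (specht p) (specht q)"
  proof -
    have "G = (\<Sum>g\<in>Sn n. (\<lambda>(T, U). ((\<lambda>T. f2 (T, V1 \<circ> g)) \<circ> nact g) T * (polytabloid q (ctab q) \<circ> nact g) U))"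
      by (auto simp: G_def fun_eq_iff sum_fun_apply nact_def)
    also have "\<dots> \<in> tensor (specht p) (specht q)"
    proof (rule submodD(7)[OF W2])
      fix g assume "g \<in> Sn n"
      hence g: "g permutes {..<n}" by (simp add: Sn_iff)
      have "(\<lambda>T. f2 (T, V1 \<circ> g)) \<circ> nact g \<in> specht p" by (rule submodD(6)[OF submod_specht'[OF p] g sl2(1)])
      moreover have "polytabloid q (ctab q) \<circ> nact g \<in> specht q"
        by (rule submodD(6)[OF submod_specht'[OF q] g polytabloid_specht[OF ctab]])
      ultimately show "(\<lambda>(T, U). ((\<lambda>T. f2 (T, V1 \<circ> g)) \<circ> nact g) T * (polytabloid q (ctab q) \<circ> nact g) U) \<in> tensor (specht p) (specht q)"
        unfolding tensor_def by (intro cfun.span_base) blast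
    qed
    finally show ?thesis .
  qed
  have Ginv: "G \<circ> tensor_act s = G" if s: "s \<in> stab n V1" for s
  proof
    fix TU :: "(nat \<Rightarrow> nat) \<times> (nat \<Rightarrow> nat)"
    obtain T U where TU: "TU = (T, U)" by (cases TU)
    have sp: "s permutes {..<n}" by (rule stab_permutes[OF s])
    have sS: "s \<in> Sn n" using sp by (simp add: Sn_iff)
    have V1s: "V1 \<circ> s = V1" using ext_stab[OF tabs_ext[OF V1 r] sp] s by simp
    have "(G \<circ> tensor_act s) TU = (\<Sum>g\<in>Sn n. f2 (T \<circ> (s \<circ> g), V1 \<circ> (s \<circ> g)) * polytabloid q (ctab q) (U \<circ> (s \<circ> g)))"
      by (simp add: G_def TU tensor_act_def comp_assoc[symmetric] V1s)
    also have "\<dots> = G TU"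
      unfolding G_def TU prod.case
      by (rule sum.reindex_bij_betw[OF stab_bij_left[OF sS], where g = "\<lambda>g. f2 (T \<circ> g, V1 \<circ> g) * polytabloid q (ctab q) (U \<circ> g)"])
    finally show "(G \<circ> tensor_act s) TU = G TU" .
  qed
  obtain r' u' f'' where r': "r' \<in> partitions_of n" "u' \<in> specht r'" "u' \<noteq> 0"
      "\<And>s. s \<in> stab n V1 \<Longrightarrow> u' \<circ> nact s = u'" "f'' \<in> tensor (specht p) (specht q)" "young n tensor_act r' f'' \<noteq> 0"
    using tact.invariant_constituent[OF W2 tensor_specht_fin G Gnz Ginv] by metis
  note R' = partitions_ofD[OF r'(1)]
  have "r' = r"
  proof -
    obtain t' where t': "is_tableau r' t'" "column_inj r' t' V1"
      using specht_invariant_filling[OF r'(2,3), of V1] r'(4) R'(2) by metis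
    have Va: "\<forall>i<sum_list r'. V1 i < b" using tabs_less[OF V1] lr sizes R'(2) by fastforce
    have lr': "length r' \<le> b" by (rule content_dominated(1)[OF R'(1) t'(1) y_anti Va t'(2)])
    have "kronecker p q r' \<noteq> 0" using kronecker_nonzero_iff[OF p q r'(1)] r'(5,6) by blast
    from kronecker_filling[OF p q r'(1) this] obtain U' s where
      U': "U' \<in> tabs q" "is_tableau p s" "column_inj p s (\<lambda>i. (U' i, fst (ctab r' i)))" by metis
    have "filling p q r' s (\<lambda>i. (U' i, fst (ctab r' i)))"
      by (rule row_filling[OF p q r'(1) U'(1,3) _ ctab]) simp
    from filling_weight_le[OF Pp U'(2) this lq lr'] have "margin_weight q r' \<le> margin_weight q r" using eq by simp
    hence "(\<Sum>i<b. int (rowlen r' i) * y i) \<le> (\<Sum>i<b. int (rowlen r i) * y i)" by (simp add: margin_weight_def)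
    thus ?thesis by (rule dominating_content_eq[OF r'(1) r t' V1 y_anti lr])
  qed
  thus ?thesis using kronecker_nonzero_iff[OF p q r] r'(5,6) by blast
qed

theorem kronecker_eq_1:
  fixes d :: "nat \<Rightarrow> nat"
  assumes lp: "length p \<le> a * b" and d: "splits (\<lambda>k. int (rowlen p k)) (\<lambda>k. int (d k))"
    and rows: "\<And>i. i < a \<Longrightarrow> rowsum (\<lambda>k. int (d k)) i = int (rowlen q i)"
    and cols: "\<And>j. j < b \<Longrightarrow> colsum (\<lambda>k. int (d k)) j = int (rowlen r j)"
  shows "kronecker p q r = 1"
proof -
  have eq: "margin_weight q r = top_weight p"
    using sum_margins[of "\<lambda>k. int (d k)"] splits_sum(1)[OF d] rows cols by (simp add: top_weight_def margin_weight_def)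
  have nz: "kronecker p q r \<noteq> 0" by (rule kronecker_nonzero[OF assms])
  then obtain f where f: "f \<in> tensor (specht p) (specht q)" "young n tensor_act r f \<noteq> 0"
    using kronecker_nonzero_iff[OF p q r] by blast
  show ?thesis
    unfolding kronecker_dim[OF p q r]
  proof (rule dim_eq_1I)
    show "cfun.subspace (young n tensor_act r ` tensor (specht p) (specht q))"
      by (rule young_subspace[OF submodD(1)[OF submod_tensor_specht[OF p q]]])
    show "young n tensor_act r f \<in> young n tensor_act r ` tensor (specht p) (specht q)" using f(1) by (rule imageI)
  qed (use f(2) kronecker_dependent[OF eq] in auto)
qed

end

end


section \<open>Coordinates\<close>

definition index_of :: "'n::{finite,linorder} \<Rightarrow> nat" where "index_of i = card {j. j < i}"

lemma index_of_strict: "i < j \<Longrightarrow> index_of i < index_of j"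
  unfolding index_of_def by (rule psubset_card_mono) (auto dest: less_trans)

lemma index_of_inj: "inj (index_of :: 'n::{finite,linorder} \<Rightarrow> nat)"
  by (rule injI) (metis less_irrefl neqE index_of_strict)

lemma index_of_bij: "bij_betw (index_of :: 'n::{finite,linorder} \<Rightarrow> nat) UNIV {..<CARD('n)}"
proof (rule bij_betw_imageI)
  show "inj_on (index_of :: 'n \<Rightarrow> nat) UNIV" by (rule index_of_inj)
  have "index_of i < CARD('n)" for i :: 'n
    unfolding index_of_def by (rule psubset_card_mono) auto
  hence "range (index_of :: 'n \<Rightarrow> nat) \<subseteq> {..<CARD('n)}" by auto
  thus "range (index_of :: 'n \<Rightarrow> nat) = {..<CARD('n)}"
    by (rule card_subset_eq[rotated]) (simp_all add: card_image index_of_inj)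
qed

definition vec_of :: "(nat \<Rightarrow> real) \<Rightarrow> real ^ 'n::{finite,linorder}"
  where "vec_of f = (\<chi> i. f (index_of i))"

definition crd :: "real ^ 'n::{finite,linorder} \<Rightarrow> nat \<Rightarrow> real"
  where "crd v k = (if k < CARD('n) then v $ (inv_into UNIV index_of k) else 0)"

lemma crd_index_of: "crd v (index_of i) = v $ i"
proof -
  have "index_of i < CARD('a)" using bij_betwE[OF index_of_bij] by auto
  thus ?thesis by (simp add: crd_def inv_into_f_f[OF index_of_inj])
qed

lemma vec_of_crd: "vec_of (crd v) = v"
  by (simp add: vec_of_def vec_eq_iff crd_index_of)

lemma crd_vec_of: "k < CARD('n) \<Longrightarrow> crd (vec_of f :: real ^ 'n::{finite,linorder}) k = f k"
  using bij_betw_inv_into_right[OF index_of_bij[where 'n = 'n], of k] by (simp add: crd_def vec_of_def)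

lemma crd_add: "crd (u + v) k = crd u k + crd v k"
  and crd_scale: "crd (c *\<^sub>R v) k = c * crd v k"
  and crd_zero: "crd 0 k = 0"
  by (simp_all add: crd_def)

lemma crd_out: "CARD('n) \<le> k \<Longrightarrow> crd (v :: real ^ 'n::{finite,linorder}) k = 0"
  by (simp add: crd_def)

lemma vec_of_cong: "(\<And>k. k < CARD('n) \<Longrightarrow> f k = g k) \<Longrightarrow> vec_of f = (vec_of g :: real ^ 'n::{finite,linorder})"
  using bij_betwE[OF index_of_bij[where 'n = 'n]] by (auto simp: vec_of_def vec_eq_iff)

lemma sum_index_of: "(\<Sum>i\<in>UNIV. h (index_of (i::'n::{finite,linorder}))) = (\<Sum>k<CARD('n). h k)"
  by (rule sum.reindex_bij_betw[OF index_of_bij])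

lemma sum_crd: "(\<Sum>i\<in>UNIV. v $ i) = (\<Sum>k<CARD('n). crd (v :: real ^ 'n::{finite,linorder}) k)"
  using sum_index_of[where 'n = 'n and h = "crd v"] by (simp add: crd_index_of)

lemma inner_vec_of: "vec_of f \<bullet> (v :: real ^ 'n::{finite,linorder}) = (\<Sum>k<CARD('n). f k * crd v k)"
  using sum_index_of[where 'n = 'n and h = "\<lambda>k. f k * crd v k"] by (simp add: inner_vec_def vec_of_def crd_index_of)

lemma partition_vec_of: "partition_vec p = vec_of (\<lambda>k. real (rowlen p k))"
  by (simp add: partition_vec_def vec_of_def index_of_def rowlen_def Let_def vec_eq_iff)

lemma crd_partition_vec: "length p \<le> CARD('n) \<Longrightarrow> crd (partition_vec p :: real ^ 'n::{finite,linorder}) k = real (rowlen p k)"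
  by (cases "k < CARD('n)") (simp_all add: partition_vec_of crd_vec_of crd_out rowlen_def)

lemma vec_of_lin: "vec_of f + vec_of g = vec_of (\<lambda>k. f k + g k)" "c *\<^sub>R vec_of f = vec_of (\<lambda>k. c * f k)"
  "vec_of f - vec_of g = vec_of (\<lambda>k. f k - g k)"
  by (simp_all add: vec_of_def vec_eq_iff)

section \<open>Facets of cones\<close>

text \<open>
  A supporting hyperplane cuts out a face; that one further vector spans everything together
  with it bounds the codimension.
\<close>

lemma facet_of_cone:
  fixes a :: "'v::euclidean_space"
  assumes C: "C = convex_cone hull S" and F: "F = C \<inter> {v. a \<bullet> v = 0}"
    and le: "\<And>s. s \<in> S \<Longrightarrow> a \<bullet> s \<le> 0" and p: "p \<in> C" "a \<bullet> p < 0"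
    and span: "\<And>s. s \<in> S \<Longrightarrow> s \<in> span (insert p F)"
  shows "F facet_of C"
proof -
  have cc: "convex_cone C" unfolding C by (rule convex_cone_convex_cone_hull)
  have conv: "convex C" unfolding C by (rule convex_convex_cone_hull)
  have leC: "a \<bullet> v \<le> 0" if "v \<in> C" for v
  proof -
    have "C \<subseteq> {v. a \<bullet> v \<le> 0}"
      unfolding C by (rule hull_minimal) (use le in \<open>auto intro: convex_cone_halfspace_le\<close>)
    thus ?thesis using that by auto
  qed
  have face: "F face_of C" unfolding F by (rule face_of_Int_supporting_hyperplane_le[OF conv leC])
  have 0: "0 \<in> C" "0 \<in> F" using convex_cone_contains_0[OF cc] by (auto simp: F)
  have "C \<subseteq> span (insert p F)"
    unfolding C by (rule hull_minimal) (use span convex_cone_span in \<open>auto simp: F C\<close>)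
  hence "dim C \<le> dim (insert p F)" using dim_subset[of C "span (insert p F)"] by simp
  also have "\<dots> \<le> dim F + 1" by (simp add: dim_insert)
  finally have "dim C \<le> dim F + 1" .
  hence "aff_dim C \<le> aff_dim F + 1"
    using 0 by (simp add: aff_dim_zero hull_inc)
  moreover have "aff_dim F < aff_dim C"
  proof (rule face_of_aff_dim_lt[OF conv face])
    have "p \<notin> F" using p(2) by (simp add: F)
    thus "F \<noteq> C" using p(1) by blast
  qed
  ultimately have "aff_dim F = aff_dim C - 1" by simp
  thus ?thesis using face 0 unfolding facet_of_def by blast
qed

section \<open>Partitions from functions\<close>

lemma exists_partition:
  fixes f :: "nat \<Rightarrow> nat"
  assumes anti: "\<And>i j. i \<le> j \<Longrightarrow> f j \<le> f i" and out: "\<And>k. N \<le> k \<Longrightarrow> f k = 0"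
  obtains p where "is_partition p" "length p \<le> N" "rowlen p = f"
proof -
  define m where "m = (LEAST k. f k = 0)"
  have m0: "f m = 0" unfolding m_def by (rule LeastI[of _ N]) (simp add: out)
  have mN: "m \<le> N" unfolding m_def by (rule Least_le) (simp add: out)
  have pos: "0 < f k" if "k < m" for k using not_less_Least[of k "\<lambda>k. f k = 0"] that by (simp add: m_def)
  define p where "p = map f [0..<m]"
  have "rowlen p = f"
  proof
    fix k show "rowlen p k = f k"
      using anti[of m k] m0 by (cases "k < m") (auto simp: p_def rowlen_def)
  qed
  moreover have "is_partition p"
  proof -
    have "0 \<notin> set p" unfolding p_def using pos by fastforce
    thus ?thesis using anti by (simp add: is_partition_def p_def sorted_wrt_iff_nth_less)
  qed
  ultimately show thesis using that mN by (simp add: p_def)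
qed

lemma rowlen_scale: "rowlen (scale_partition k p) i = k * rowlen p i"
  by (simp add: rowlen_def scale_partition_def)

lemma scale_partition_partition: "1 \<le> k \<Longrightarrow> is_partition p \<Longrightarrow> is_partition (scale_partition k p)"
  by (auto simp: is_partition_def scale_partition_def sorted_wrt_map intro: sorted_wrt_mono_rel[rotated])

lemma sum_scale: "sum_list (scale_partition k p) = k * sum_list p"
  by (simp add: scale_partition_def sum_list_const_mult)

section \<open>Stable lattice points\<close>

context pair_config
begin

text \<open>
  The entries of a splitting lie between the two rows of their tie, and the rows of a heavier
  cell come before those of a lighter one.
\<close>

lemma splits_level:
  fixes l d :: "nat \<Rightarrow> 'r::linordered_idom"
  assumes s: "splits l d" and anti: "\<And>i j. i \<le> j \<Longrightarrow> l j \<le> l i" and k: "k < a * b" "k' < a * b" and z: "z (\<kappa> k') < z (\<kappa> k)"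
  shows "d k' \<le> d k"
proof -
  have kk: "k < k'" using z kap_anti k(1) by (metis linorder_not_le)
  have lower: "(if P k then l (Suc k) else l k) \<le> d k"
  proof (cases "P k")
    case False
    show ?thesis
    proof (cases "\<exists>k'. k = Suc k' \<and> P k'")
      case True
      then obtain k0 where k0: "k = Suc k0" "P k0" by blast
      have "d k0 + d (Suc k0) = l k0 + l (Suc k0)" "d k0 \<le> l k0" using s k0(2) by (auto simp: splits_def)
      hence "d k = l k + (l k0 - d k0)" by (simp add: k0(1) algebra_simps)
      thus ?thesis using False \<open>d k0 \<le> l k0\<close> by simp
    qed (use s k(1) False in \<open>auto simp: splits_def\<close>)
  qed (use s in \<open>auto simp: splits_def\<close>)
  have upper: "d k' \<le> (if P (k' - 1) then l (k' - 1) else l k')"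
  proof (cases "P (k' - 1)")
    case True
    hence "d (k' - 1) + d k' = l (k' - 1) + l k'" "l k' \<le> d (k' - 1)" using s kk by (auto simp: splits_def)
    hence "d k' = l (k' - 1) + l k' - d (k' - 1)" by (simp add: algebra_simps)
    thus ?thesis using True \<open>l k' \<le> d (k' - 1)\<close> by simp
  next
    case False
    show ?thesis
    proof (cases "P k'")
      case False
      hence "d k' = l k'" using s k(2) \<open>\<not> P (k' - 1)\<close> by (auto simp: splits_def)
      thus ?thesis using \<open>\<not> P (k' - 1)\<close> by simp
    qed (use s False in \<open>auto simp: splits_def\<close>)
  qed
  have "(if P (k' - 1) then l (k' - 1) else l k') \<le> (if P k then l (Suc k) else l k)"
  proof -
    have 1: "P k \<Longrightarrow> Suc k \<noteq> k'" using z by (auto simp: tie_def)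
    show ?thesis using 1 kk by (auto intro!: anti)
  qed
  with lower upper show ?thesis by linarith
qed

lemma splits_nonneg:
  fixes l d :: "nat \<Rightarrow> 'r::linordered_idom"
  assumes s: "splits l d" and anti: "\<And>i j. i \<le> j \<Longrightarrow> l j \<le> l i" and nn: "\<And>k. 0 \<le> l k" and k: "k < a * b"
  shows "0 \<le> d k"
proof (cases "P k")
  case True
  hence "l (Suc k) \<le> d k" using s by (auto simp: splits_def)
  thus ?thesis using nn[of "Suc k"] by simp
next
  case False
  show ?thesis
  proof (cases "\<exists>k'. k = Suc k' \<and> P k'")
    case True
    then obtain k0 where k0: "k = Suc k0" "P k0" by blast
    have "d k0 + d k = l k0 + l k" "d k0 \<le> l k0" using s k0 by (auto simp: splits_def)
    hence "d k = l k0 - d k0 + l k" by (simp add: algebra_simps)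
    thus ?thesis using \<open>d k0 \<le> l k0\<close> nn[of k] by simp
  next
    case no: False
    hence "d k = l k" using s k False by (auto simp: splits_def)
    thus ?thesis using nn by simp
  qed
qed

definition idx :: "nat \<times> nat \<Rightarrow> nat" where "idx = inv_into {..<a * b} \<kappa>"

lemma idx: "i < a \<Longrightarrow> j < b \<Longrightarrow> \<kappa> (idx (i, j)) = (i, j)" "i < a \<Longrightarrow> j < b \<Longrightarrow> idx (i, j) < a * b" "k < a * b \<Longrightarrow> idx (\<kappa> k) = k"
proof -
  show "i < a \<Longrightarrow> j < b \<Longrightarrow> \<kappa> (idx (i, j)) = (i, j)"
    using bij_betw_inv_into_right[OF kap_bij, of "(i, j)"] by (simp add: idx_def)
  show "i < a \<Longrightarrow> j < b \<Longrightarrow> idx (i, j) < a * b"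
    using bij_betwE[OF bij_betw_inv_into[OF kap_bij]] by (auto simp: idx_def)
  show "k < a * b \<Longrightarrow> idx (\<kappa> k) = k"
    using bij_betw_inv_into_left[OF kap_bij] by (simp add: idx_def)
qed

lemma rowsum_idx: "i < a \<Longrightarrow> rowsum d i = (\<Sum>j<b. d (idx (i, j)))"
proof -
  assume i: "i < a"
  have "bij_betw (\<lambda>j. idx (i, j)) {..<b} {k. k < a * b \<and> fst (\<kappa> k) = i}"
    by (rule bij_betw_byWitness[where f' = "\<lambda>k. snd (\<kappa> k)"]) (use i idx kap_range in auto)
  thus ?thesis unfolding rowsum_def by (rule sum.reindex_bij_betw[symmetric])
qed

lemma colsum_idx: "j < b \<Longrightarrow> colsum d j = (\<Sum>i<a. d (idx (i, j)))"
proof -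
  assume j: "j < b"
  have "bij_betw (\<lambda>i. idx (i, j)) {..<a} {k. k < a * b \<and> snd (\<kappa> k) = j}"
    by (rule bij_betw_byWitness[where f' = "\<lambda>k. fst (\<kappa> k)"]) (use j idx kap_range in auto)
  thus ?thesis unfolding colsum_def by (rule sum.reindex_bij_betw[symmetric])
qed

lemma margin_totals: "(\<Sum>i<a. rowsum d i) = (\<Sum>k<a * b. d k)" "(\<Sum>j<b. colsum d j) = (\<Sum>k<a * b. d k)"
proof -
  have "(\<Sum>i<a. rowsum d i) = (\<Sum>i<a. \<Sum>k | k \<in> {..<a * b} \<and> fst (\<kappa> k) = i. d k)"
    by (simp add: rowsum_def)
  also have "\<dots> = (\<Sum>k<a * b. d k)" by (rule sum.group) (use kap_range in auto)
  finally show "(\<Sum>i<a. rowsum d i) = (\<Sum>k<a * b. d k)" .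
  have "(\<Sum>i<b. colsum d i) = (\<Sum>i<b. \<Sum>k | k \<in> {..<a * b} \<and> snd (\<kappa> k) = i. d k)"
    by (simp add: colsum_def)
  also have "\<dots> = (\<Sum>k<a * b. d k)" by (rule sum.group) (use kap_range in auto)
  finally show "(\<Sum>j<b. colsum d j) = (\<Sum>k<a * b. d k)" .
qed

end

context rigid_config
begin

text \<open>
  The margins of a splitting are partitions because, along a row or a column of the box, weights
  decrease strictly and so the counts decrease weakly. Multiplying \<open>p\<close> and \<open>d\<close> by a factor
  preserves the splitting.
\<close>

lemma stable_triple:
  fixes l d :: "nat \<Rightarrow> nat"
  assumes anti: "\<And>i j. i \<le> j \<Longrightarrow> l j \<le> l i" and out: "\<And>k. a * b \<le> k \<Longrightarrow> l k = 0"
    and s: "splits (\<lambda>k. int (l k)) (\<lambda>k. int (d k))"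
  obtains p q r where "(p, q, r) \<in> SKron a b" "rowlen p = l" "\<And>i. i < a \<Longrightarrow> rowlen q i = rowsum d i" "\<And>j. j < b \<Longrightarrow> rowlen r j = colsum d j"
    "length p \<le> a * b" "length q \<le> a" "length r \<le> b"
proof -
  have lev: "d k' \<le> d k" if "k < a * b" "k' < a * b" "z (\<kappa> k') < z (\<kappa> k)" for k k'
    using splits_level[OF s _ that] anti by simp
  obtain p where p: "is_partition p" "length p \<le> a * b" "rowlen p = l"
    using exists_partition[of l "a * b"] anti out by metis
  define f where "f i = (if i < a then rowsum d i else 0)" for i
  have "f j \<le> f i" if "i \<le> j" for i j
  proof (cases "i < j \<and> j < a")
    case True
    have "rowsum d j \<le> rowsum d i"
    proof -
      have "d (idx (j, k)) \<le> d (idx (i, k))" if k: "k < b" for k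
      proof (rule lev)
        show "z (\<kappa> (idx (j, k))) < z (\<kappa> (idx (i, k)))"
          using x_anti True k idx(1) by (simp add: wt_def)
      qed (use idx(2) True k in auto)
      thus ?thesis using True by (auto simp: rowsum_idx intro: sum_mono)
    qed
    thus ?thesis using True by (simp add: f_def)
  qed (use that in \<open>auto simp: f_def\<close>)
  then obtain q where q: "is_partition q" "length q \<le> a" "rowlen q = f"
    using exists_partition[of f a] by (auto simp: f_def)
  define h where "h j = (if j < b then colsum d j else 0)" for j
  have "h j \<le> h i" if "i \<le> j" for i j
  proof (cases "i < j \<and> j < b")
    case True
    have "colsum d j \<le> colsum d i"
    proof -
      have "d (idx (k, j)) \<le> d (idx (k, i))" if k: "k < a" for k
      proof (rule lev)
        show "z (\<kappa> (idx (k, j))) < z (\<kappa> (idx (k, i)))"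
          using y_anti True k idx(1) by (simp add: wt_def)
      qed (use idx(2) True k in auto)
      thus ?thesis using True by (auto simp: colsum_idx intro: sum_mono)
    qed
    thus ?thesis using True by (simp add: h_def)
  qed (use that in \<open>auto simp: h_def\<close>)
  then obtain r where r: "is_partition r" "length r \<le> b" "rowlen r = h"
    using exists_partition[of h b] by (auto simp: h_def)
  define n where "n = sum_list p"
  have sumd: "(\<Sum>k<a * b. d k) = n"
  proof -
    have "int (\<Sum>k<a * b. d k) = int (\<Sum>k<a * b. l k)" using splits_sum(2)[OF s] by simp
    thus ?thesis using sum_rowlen[OF p(2)] p(3) by (simp add: n_def del: of_nat_sum)
  qed
  have "sum_list q = n"
    using sum_rowlen[OF q(2)] margin_totals(1)[of d] sumd by (simp add: q(3) f_def)
  moreover have "sum_list r = n"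
    using sum_rowlen[OF r(2)] margin_totals(2)[of d] sumd by (simp add: r(3) h_def)
  ultimately have sums: "sum_list p = n" "sum_list q = n" "sum_list r = n" by (simp_all add: n_def)
  have one: "kronecker (scale_partition k p) (scale_partition k q) (scale_partition k r) = 1" if k: "1 \<le> k" for k
  proof (rule kronecker_eq_1[where n = "k * n" and d = "\<lambda>i. k * d i"])
    show "scale_partition k p \<in> partitions_of (k * n)" "scale_partition k q \<in> partitions_of (k * n)" "scale_partition k r \<in> partitions_of (k * n)"
      using scale_partition_partition[OF k] p(1) q(1) r(1) sums by (auto simp: partitions_of_def sum_scale)
    show "length (scale_partition k q) \<le> a" "length (scale_partition k r) \<le> b" "length (scale_partition k p) \<le> a * b"
      using p q r by (simp_all add: scale_partition_def)
    show "splits (\<lambda>i. int (rowlen (scale_partition k p) i)) (\<lambda>i. int (k * d i))"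
      using s by (auto simp: splits_def rowlen_scale p(3) mult_left_mono simp flip: distrib_left)
    show "rowsum (\<lambda>i. int (k * d i)) i = int (rowlen (scale_partition k q) i)" if "i < a" for i
      using that by (simp add: rowlen_scale q(3) f_def rowsum_def sum_distrib_left)
    show "colsum (\<lambda>i. int (k * d i)) i = int (rowlen (scale_partition k r) i)" if "i < b" for i
      using that by (simp add: rowlen_scale r(3) h_def colsum_def sum_distrib_left)
  qed
  have id1: "scale_partition 1 s = s" for s by (simp add: scale_partition_def)
  have "kronecker p q r \<noteq> 0" using one[of 1] unfolding id1 by simp
  hence "(p, q, r) \<in> SKron a b"
    using p q r one by (simp add: SKron_def Kron_def weakly_stable_def)
  thus thesis using that p q r by (simp add: f_def h_def)
qed

end


section \<open>Stable facets\<close>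

lemma facet_stableI:
  fixes F :: "((real ^ 'c::{finite,linorder}) \<times> (real ^ 'a::{finite,linorder}) \<times> (real ^ 'b::{finite,linorder})) set"
  assumes "F facet_of PKron" "F \<inter> weight_lattice \<subseteq> triple_vec ` SKron CARD('a) CARD('b)"
  shows "F facet_of PKron \<and> stable_face F"
  using assms by (simp add: stable_face_def facet_of_imp_face_of)

lemma int_function:
  fixes f :: "nat \<Rightarrow> real"
  assumes "\<And>k. f k \<in> \<int>" shows "\<exists>g. \<forall>k. f k = real_of_int (g k)"
proof -
  have "f k = real_of_int \<lfloor>f k\<rfloor>" for k using assms[of k] by (metis Ints_cases floor_of_int)
  thus ?thesis by (intro exI[of _ "\<lambda>k. \<lfloor>f k\<rfloor>"]) simp
qed

lemma crd_Ints: "(\<And>i. v $ i \<in> \<int>) \<Longrightarrow> crd v k \<in> \<int>"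
  by (simp add: crd_def)

context pair_config
begin

lemma rowsum_lin:
  fixes d d' :: "nat \<Rightarrow> 'r::comm_ring_1"
  shows "rowsum (\<lambda>k. d k + d' k) i = rowsum d i + rowsum d' i" and "rowsum (\<lambda>k. c * d k) i = c * rowsum d i"
    "colsum (\<lambda>k. d k + d' k) i = colsum d i + colsum d' i" "colsum (\<lambda>k. c * d k) i = c * colsum d i"
    "rowsum (\<lambda>k. d k - d' k) i = rowsum d i - rowsum d' i" "colsum (\<lambda>k. d k - d' k) i = colsum d i - colsum d' i"
  by (simp_all add: rowsum_def colsum_def sum.distrib sum_distrib_left sum_subtractf)

lemma rowsum_cong: "(\<And>k. k < a * b \<Longrightarrow> d k = d' k) \<Longrightarrow> rowsum d i = rowsum d' i"
  and colsum_cong: "(\<And>k. k < a * b \<Longrightarrow> d k = d' k) \<Longrightarrow> colsum d i = colsum d' i"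
  by (simp_all add: rowsum_def colsum_def)

lemma splits_cong:
  assumes "\<And>k. k < a * b \<Longrightarrow> l k = l' k" "\<And>k. k < a * b \<Longrightarrow> d k = d' k"
  shows "splits l d \<longleftrightarrow> splits l' d'"
  using assms P_less by (auto simp: splits_def Suc_lessD)

end

context rigid_config
begin

lemma stable_vec:
  fixes l d :: "nat \<Rightarrow> nat"
  assumes cards: "CARD('c::{finite,linorder}) = a * b" "CARD('a::{finite,linorder}) = a" "CARD('b::{finite,linorder}) = b"
    and anti: "\<And>i j. i \<le> j \<Longrightarrow> l j \<le> l i" and out: "\<And>k. a * b \<le> k \<Longrightarrow> l k = 0"
    and s: "splits (\<lambda>k. int (l k)) (\<lambda>k. int (d k))"
  shows "(vec_of (\<lambda>k. real (l k)) :: real ^ 'c::{finite,linorder}, vec_of (\<lambda>i. real (rowsum d i)) :: real ^ 'a::{finite,linorder},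
      vec_of (\<lambda>j. real (colsum d j)) :: real ^ 'b::{finite,linorder})
    \<in> triple_vec ` SKron a b"
proof -
  obtain p q r where pqr: "(p, q, r) \<in> SKron a b" "rowlen p = l" "\<And>i. i < a \<Longrightarrow> rowlen q i = rowsum d i" "\<And>j. j < b \<Longrightarrow> rowlen r j = colsum d j"
    using stable_triple[OF anti out s] by metis
  have "triple_vec (p, q, r) = (vec_of (\<lambda>k. real (l k)) :: real ^ 'c::{finite,linorder}, vec_of (\<lambda>i. real (rowsum d i)) :: real ^ 'a::{finite,linorder}, vec_of (\<lambda>j. real (colsum d j)) :: real ^ 'b::{finite,linorder})"
    unfolding triple_vec_def by (auto simp: partition_vec_of pqr cards intro!: vec_of_cong)
  thus ?thesis using pqr(1) by (metis image_eqI)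
qed

end

lemma Kron_in_PKron: "t \<in> Kron CARD('a) CARD('b)
    \<Longrightarrow> triple_vec t \<in> (PKron :: ((real ^ 'c::{finite,linorder}) \<times> (real ^ 'a::{finite,linorder}) \<times> (real ^ 'b::{finite,linorder})) set)"
  unfolding PKron_def by (rule hull_inc) simp

lemma SKron_in_PKron: "v \<in> triple_vec ` SKron CARD('a) CARD('b)
    \<Longrightarrow> v \<in> (PKron :: ((real ^ 'c::{finite,linorder}) \<times> (real ^ 'a::{finite,linorder}) \<times> (real ^ 'b::{finite,linorder})) set)"
  using Kron_in_PKron by (auto simp: SKron_def)

lemma KronD:
  assumes "(p, q, r) \<in> Kron a b"
  shows "is_partition p" "is_partition q" "is_partition r" "length p \<le> a * b" "length q \<le> a" "length r \<le> b"
    "kronecker p q r \<noteq> 0" "p \<in> partitions_of (sum_list p)" "q \<in> partitions_of (sum_list p)" "r \<in> partitions_of (sum_list p)"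
proof -
  show a: "is_partition p" "is_partition q" "is_partition r" "length p \<le> a * b" "length q \<le> a" "length r \<le> b" "kronecker p q r \<noteq> 0"
    using assms by (auto simp: Kron_def)
  have "sum_list p = sum_list q \<and> sum_list q = sum_list r" using a(7) by (auto simp: kronecker_def split: if_splits)
  thus "p \<in> partitions_of (sum_list p)" "q \<in> partitions_of (sum_list p)" "r \<in> partitions_of (sum_list p)"
    using a by (auto simp: partitions_of_def)
qed

context rigid_config
begin

text \<open>
  The facet on which the last part of \<open>p\<close> vanishes. By hypothesis every point of the cone is
  determined by its first component, and every weakly decreasing first component occurs.
\<close>

theorem tie_free_facet:
  assumes cards: "CARD('c::{finite,linorder}) = a * b" "CARD('a::{finite,linorder}) = a" "CARD('b::{finite,linorder}) = b"
    and free: "\<And>k. \<not> P k"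
    and margins: "\<And>p q r. (p, q, r) \<in> Kron a b \<Longrightarrow> (\<forall>i<a. rowlen q i = rowsum (rowlen p) i) \<and> (\<forall>j<b. rowlen r j = colsum (rowlen p) j)"
  shows "\<exists>F :: ((real ^ 'c::{finite,linorder}) \<times> (real ^ 'a::{finite,linorder}) \<times> (real ^ 'b::{finite,linorder})) set. F facet_of PKron \<and> stable_face F"
proof -
  let ?C = "PKron :: ((real ^ 'c::{finite,linorder}) \<times> (real ^ 'a::{finite,linorder}) \<times> (real ^ 'b::{finite,linorder})) set"
  let ?N = "a * b"
  have N: "0 < ?N" using cards(1) by (metis zero_less_card_finite)
  have sp: "splits l l" for l :: "nat \<Rightarrow> 'r::linordered_idom" using free by (simp add: splits_def)
  define V where "V l = (vec_of (\<lambda>k. real (l k)) :: real ^ 'c::{finite,linorder}, vec_of (\<lambda>i. real (rowsum l i)) :: real ^ 'a::{finite,linorder}, vec_of (\<lambda>j. real (colsum l j)) :: real ^ 'b::{finite,linorder})"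
    for l :: "nat \<Rightarrow> nat"
  have V: "V l \<in> triple_vec ` SKron a b" if "\<And>i j. i \<le> j \<Longrightarrow> l j \<le> l i" "\<And>k. ?N \<le> k \<Longrightarrow> l k = 0" for l
    unfolding V_def by (rule stable_vec[OF cards that sp])
  have VC: "V l \<in> ?C" if "\<And>i j. i \<le> j \<Longrightarrow> l j \<le> l i" "\<And>k. ?N \<le> k \<Longrightarrow> l k = 0" for l
    by (rule SKron_in_PKron) (use V[OF that] cards in simp)
  define h where "h = (vec_of (\<lambda>k. if k = ?N - 1 then -1 else 0) :: real ^ 'c::{finite,linorder}, 0 :: real ^ 'a::{finite,linorder}, 0 :: real ^ 'b::{finite,linorder})"
  have h: "h \<bullet> (u, v, w) = - crd u (?N - 1)" for u v w
  proof -
    have "h \<bullet> (u, v, w) = (\<Sum>k<?N. if k = ?N - 1 then - crd u k else 0)"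
      by (simp add: h_def inner_vec_of cards if_distrib[of "\<lambda>s. s * _"] cong: if_cong)
    also have "\<dots> = - crd u (?N - 1)" using N by simp
    finally show ?thesis .
  qed
  have hV: "h \<bullet> V l = - real (l (?N - 1))" for l
    unfolding V_def h using N by (simp add: crd_vec_of cards)
  define F where "F = ?C \<inter> {v. h \<bullet> v = 0}"
  define l0 where "l0 k = (if k < ?N then 1 else 0 :: nat)" for k
  have l0: "V l0 \<in> ?C" by (rule VC) (auto simp: l0_def)
  \<comment> \<open>A convex cone that contains the generators, so that its defining conditions carry over to
    all points of the cone.\<close>
  define Q where "Q = {(u :: real ^ 'c::{finite,linorder}, v :: real ^ 'a::{finite,linorder}, w :: real ^ 'b::{finite,linorder}). (\<forall>i j. i \<le> j \<longrightarrow> crd u j \<le> crd u i) \<and> (\<forall>k. 0 \<le> crd u k)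
      \<and> (\<forall>i<a. crd v i = rowsum (crd u) i) \<and> (\<forall>j<b. crd w j = colsum (crd u) j)}"
  have QC: "?C \<subseteq> Q"
    unfolding PKron_def
  proof (rule hull_minimal)
    show "triple_vec ` Kron CARD('a) CARD('b) \<subseteq> Q"
    proof
      fix s :: "(real ^ 'c::{finite,linorder}) \<times> (real ^ 'a::{finite,linorder}) \<times> (real ^ 'b::{finite,linorder})" assume "s \<in> triple_vec ` Kron CARD('a) CARD('b)"
      then obtain p q r where k: "(p, q, r) \<in> Kron a b" "s = triple_vec (p, q, r)" using cards by auto
      note K = KronD[OF k(1)]
      have "crd (partition_vec p :: real ^ 'c::{finite,linorder}) = (\<lambda>k. real (rowlen p k))" using K(4) cards by (auto simp: crd_partition_vec)
      moreover have "crd (partition_vec q :: real ^ 'a::{finite,linorder}) = (\<lambda>k. real (rowlen q k))" using K(5) cards by (auto simp: crd_partition_vec)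
      moreover have "crd (partition_vec r :: real ^ 'b::{finite,linorder}) = (\<lambda>k. real (rowlen r k))" using K(6) cards by (auto simp: crd_partition_vec)
      ultimately show "s \<in> Q"
        using margins[OF k(1)] rowlen_antimono[OF K(1)] by (simp add: k(2) triple_vec_def Q_def rowsum_real colsum_real)
    qed
    show "convex_cone Q"
      unfolding convex_cone_iff
    proof (intro conjI ballI allI impI)
      show "0 \<in> Q" by (simp add: Q_def zero_prod_def crd_zero rowsum_def colsum_def)
      show "s + s' \<in> Q" if "s \<in> Q" "s' \<in> Q" for s s'
        using that by (cases s; cases s') (simp add: Q_def crd_add[abs_def] rowsum_lin crd_add add_mono)
      show "c *\<^sub>R s \<in> Q" if "s \<in> Q" "0 \<le> c" for s c
        using that by (cases s) (simp add: Q_def crd_scale[abs_def] rowsum_lin crd_scale mult_left_mono)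
    qed
  qed
  have "F facet_of ?C"
  proof (rule facet_of_cone[OF PKron_def F_def])
    have "triple_vec ` Kron CARD('a) CARD('b) \<subseteq> ?C" unfolding PKron_def by (rule hull_subset)
    thus "h \<bullet> s \<le> 0" if "s \<in> triple_vec ` Kron CARD('a) CARD('b)" for s
    proof -
      have "s \<in> Q" using that QC \<open>triple_vec ` Kron CARD('a) CARD('b) \<subseteq> ?C\<close> by blast
      thus ?thesis by (cases s) (auto simp: h Q_def)
    qed
    show "V l0 \<in> ?C" by (rule l0)
    show "h \<bullet> V l0 < 0" using N by (simp add: hV l0_def)
    fix s :: "(real ^ 'c::{finite,linorder}) \<times> (real ^ 'a::{finite,linorder}) \<times> (real ^ 'b::{finite,linorder})" assume "s \<in> triple_vec ` Kron CARD('a) CARD('b)"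
    then obtain p q r where k: "(p, q, r) \<in> Kron a b" "s = triple_vec (p, q, r)" using cards by auto
    note K = KronD[OF k(1)]
    define c where "c = rowlen p (?N - 1)"
    define l where "l k = (if k < ?N then rowlen p k - c else 0)" for k
    have ge: "c \<le> rowlen p k" if "k < ?N" for k
      unfolding c_def by (rule rowlen_antimono[OF K(1)]) (use that in simp)
    have "V l \<in> F"
    proof -
      have "V l \<in> ?C" by (rule VC) (use rowlen_antimono[OF K(1)] in \<open>auto simp: l_def diff_le_mono\<close>)
      moreover have "h \<bullet> V l = 0" by (simp add: hV l_def c_def)
      ultimately show ?thesis by (simp add: F_def)
    qed
    have pk: "rowlen p k = l k + c * l0 k" if "k < ?N" for k
      using that ge[OF that] by (simp add: l_def l0_def)
    have row: "rowsum (rowlen p) i = rowsum l i + c * rowsum l0 i" for i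
      using rowsum_cong[of "rowlen p" "\<lambda>k. l k + c * l0 k", OF pk]
      by (simp add: rowsum_def sum.distrib sum_distrib_left)
    have colm: "colsum (rowlen p) i = colsum l i + c * colsum l0 i" for i
      using colsum_cong[of "rowlen p" "\<lambda>k. l k + c * l0 k", OF pk]
      by (simp add: colsum_def sum.distrib sum_distrib_left)
    have "s = V l + real c *\<^sub>R V l0"
      unfolding k(2) triple_vec_def V_def
      using margins[OF k(1)]
      by (auto simp: partition_vec_of vec_of_lin cards row colm pk intro!: vec_of_cong)
    thus "s \<in> span (insert (V l0) F)"
      using \<open>V l \<in> F\<close> by (simp only:) (intro span_add span_scale span_base insertI1 insertI2)
  qed
  moreover have "F \<inter> weight_lattice \<subseteq> triple_vec ` SKron CARD('a) CARD('b)"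
  proof
    fix s assume s: "s \<in> F \<inter> weight_lattice"
    obtain u v w where uvw: "s = (u, v, w)" by (cases s)
    have Q: "(u, v, w) \<in> Q" using s QC uvw by (auto simp: F_def)
    have "crd u k \<in> \<int>" for k using s by (intro crd_Ints) (auto simp: weight_lattice_def uvw)
    then obtain g where g: "\<And>k. crd u k = real_of_int (g k)" using int_function[of "crd u"] by auto
    define l where "l k = nat (g k)" for k
    have l: "crd u k = real (l k)" for k
    proof -
      have "0 \<le> crd u k" using Q by (auto simp: Q_def)
      thus ?thesis using g[of k] by (simp add: l_def)
    qed
    have l': "crd u = (\<lambda>k. real (l k))" using l by blast
    have "s = V l"
    proof -
      have "u = vec_of (\<lambda>k. real (l k))" using vec_of_crd[of u] l' by simp
      moreover have "v = vec_of (\<lambda>i. real (rowsum l i))"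
      proof -
        have "vec_of (crd v) = (vec_of (\<lambda>i. real (rowsum l i)) :: real ^ 'a::{finite,linorder})"
          by (rule vec_of_cong) (use Q in \<open>simp add: Q_def l' rowsum_real cards\<close>)
        thus ?thesis by (simp add: vec_of_crd)
      qed
      moreover have "w = vec_of (\<lambda>i. real (colsum l i))"
      proof -
        have "vec_of (crd w) = (vec_of (\<lambda>i. real (colsum l i)) :: real ^ 'b::{finite,linorder})"
          by (rule vec_of_cong) (use Q in \<open>simp add: Q_def l' colsum_real cards\<close>)
        thus ?thesis by (simp add: vec_of_crd)
      qed
      ultimately show ?thesis by (simp add: uvw V_def)
    qed
    moreover have "V l \<in> triple_vec ` SKron a b"
    proof (rule V)
      show "l j \<le> l i" if "i \<le> j" for i j using Q that by (auto simp: Q_def l')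
      show "l k = 0" if "?N \<le> k" for k using crd_out[of k u] l[of k] that cards by simp
    qed
    ultimately show "s \<in> triple_vec ` SKron CARD('a) CARD('b)" using cards by simp
  qed
  ultimately show ?thesis using facet_stableI by blast
qed

end


text \<open>
  The condition \<open>solve\<close> makes the face as large as the hyperplane: it provides an integral
  splitting for every integral point of the hyperplane.
\<close>

locale facet_config = rigid_config +
  assumes two: "2 \<le> a" "2 \<le> b"
    and solve: "\<lbrakk>(\<Sum>i<a. m i) = 0; (\<Sum>j<b. m' j) = 0; (\<Sum>i<a. m i * x i) + (\<Sum>j<b. m' j * y j) = 0\<rbrakk>
      \<Longrightarrow> \<exists>\<delta> :: nat \<Rightarrow> int. balanced \<delta> \<and> (\<forall>i<a. rowsum \<delta> i = m i) \<and> (\<forall>j<b. colsum \<delta> j = m' j)"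
begin

text \<open>
  The solution \<open>D\<close> may violate the inequalities of a splitting.  On the face they hold by
  uniqueness, and for the span of the face \<open>stable_shift\<close> restores them.
\<close>

lemma lift_margins:
  fixes L M M' :: "nat \<Rightarrow> int"
  assumes "(\<Sum>i<a. M i) = (\<Sum>k<a * b. L k)" "(\<Sum>j<b. M' j) = (\<Sum>k<a * b. L k)"
    and "(\<Sum>i<a. M i * x i) + (\<Sum>j<b. M' j * y j) = (\<Sum>k<a * b. L k * z (\<kappa> k))"
  shows "\<exists>D. balanced (\<lambda>k. D k - L k) \<and> (\<forall>i<a. rowsum D i = M i) \<and> (\<forall>j<b. colsum D j = M' j)"
proof -
  have "\<exists>\<delta> :: nat \<Rightarrow> int. balanced \<delta> \<and> (\<forall>i<a. rowsum \<delta> i = M i - rowsum L i) \<and> (\<forall>j<b. colsum \<delta> j = M' j - colsum L j)"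
  proof (rule solve)
    show "(\<Sum>i<a. M i - rowsum L i) = 0" "(\<Sum>j<b. M' j - colsum L j) = 0"
      using assms(1,2) by (simp_all add: sum_subtractf margin_totals)
    have "(\<Sum>i<a. rowsum L i * x i) + (\<Sum>j<b. colsum L j * y j) = (\<Sum>k<a * b. L k * z (\<kappa> k))"
      using sum_margins[of L] by simp
    thus "(\<Sum>i<a. (M i - rowsum L i) * x i) + (\<Sum>j<b. (M' j - colsum L j) * y j) = 0"
      using assms(3) by (simp add: left_diff_distrib sum_subtractf)
  qed
  then obtain \<delta> :: "nat \<Rightarrow> int" where \<delta>: "balanced \<delta>" "\<And>i. i < a \<Longrightarrow> rowsum \<delta> i = M i - rowsum L i"
    "\<And>j. j < b \<Longrightarrow> colsum \<delta> j = M' j - colsum L j" by blast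
  show ?thesis
    by (rule exI[of _ "\<lambda>k. L k + \<delta> k"]) (simp add: \<delta> rowsum_lin)
qed

text \<open>
  A partition and a splitting of it with slack in all inequalities: consecutive rows differ by
  \<open>4\<close>, and the split deviates from the rows by \<open>1\<close> only.
\<close>

definition steep :: "nat \<Rightarrow> int" where "steep k = (if k < a * b then 4 * (int (a * b) - int k) else 0)"
definition steep_split :: "nat \<Rightarrow> int"
  where "steep_split k = (if P k then steep k - 1 else if 0 < k \<and> P (k - 1) then steep k + 1 else steep k)"

lemma steep_split_bound: "\<bar>steep_split k - steep k\<bar> \<le> 1"
  by (simp add: steep_split_def)

text \<open>
  Adding a large multiple of the steep partition makes any integral point of the hyperplane
  admissible. The slack grows by at least \<open>K\<close>, and \<open>K\<close> exceeds twice the sum of all absolute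
  values involved.
\<close>

lemma stable_shift:
  fixes L D :: "nat \<Rightarrow> int"
  assumes bal: "balanced (\<lambda>k. D k - L k)" and out: "\<And>k. a * b \<le> k \<Longrightarrow> L k = 0"
    and K: "K = 2 * (\<Sum>k<a * b. \<bar>L k\<bar> + \<bar>D k\<bar>) + 1"
    and l: "l = (\<lambda>k. nat (L k + K * steep k))" and d: "d = (\<lambda>k. nat (D k + K * steep_split k))"
  shows "\<And>k. int (l k) = L k + K * steep k" "\<And>k. k < a * b \<Longrightarrow> int (d k) = D k + K * steep_split k"
    "\<And>i j. i \<le> j \<Longrightarrow> l j \<le> l i" "\<And>k. a * b \<le> k \<Longrightarrow> l k = 0" "splits (\<lambda>k. int (l k)) (\<lambda>k. int (d k))"
proof -
  define B where "B = (\<Sum>k<a * b. \<bar>L k\<bar> + \<bar>D k\<bar>)"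
  have B0: "0 \<le> B" unfolding B_def by (intro sum_nonneg) simp
  have KB: "K = 2 * B + 1" by (simp add: K B_def)
  have bd: "\<bar>L k\<bar> + \<bar>D k\<bar> \<le> B" if "k < a * b" for k
    unfolding B_def by (rule member_le_sum) (use that in auto)
  have bL: "\<bar>L k\<bar> \<le> B" for k using bd[of k] out[of k] B0 by (cases "k < a * b") auto
  have st: "steep k = steep (Suc k) + 4" if "k < a * b" for k
  proof (cases "Suc k < a * b")
    case False
    hence "int (a * b) = int k + 1" using that by linarith
    thus ?thesis using False that by (simp add: steep_def del: of_nat_mult)
  qed (use that in \<open>simp add: steep_def\<close>)
  have st4: "4 \<le> steep k" if "k < a * b" for k
  proof -
    have "int k + 1 \<le> int (a * b)" using that by linarith
    thus ?thesis using that by (simp add: steep_def del: of_nat_mult)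
  qed
  have Kst: "4 * K \<le> K * steep k" if "k < a * b" for k
    using mult_left_mono[OF st4[OF that], of K] KB B0 by (simp add: mult.commute)
  show lk: "int (l k) = L k + K * steep k" for k
  proof (cases "k < a * b")
    case True
    thus ?thesis using Kst[OF True] bL[of k] KB B0 by (simp add: l)
  qed (simp add: l out steep_def)
  have dst: "K * (steep k - 1) \<le> K * steep_split k" for k
    by (rule mult_left_mono) (use steep_split_bound[of k] KB B0 in linarith)+
  show dk: "int (d k) = D k + K * steep_split k" if k: "k < a * b" for k
  proof -
    have "3 * K \<le> K * steep_split k" using dst[of k] Kst[OF k] by (simp add: right_diff_distrib)
    thus ?thesis using bd[OF k] KB B0 by (simp add: d)
  qed
  show "l k = 0" if "a * b \<le> k" for k using that by (simp add: l out steep_def)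
  have step: "l (Suc k) \<le> l k" for k
  proof (cases "k < a * b")
    case True
    have "K * steep k = K * steep (Suc k) + 4 * K" by (simp add: st[OF True] distrib_left)
    hence "int (l (Suc k)) \<le> int (l k)" unfolding lk using bL[of k] bL[of "Suc k"] KB B0 by linarith
    thus ?thesis by simp
  qed (simp add: l out steep_def)
  show "l j \<le> l i" if "i \<le> j" for i j
    by (rule lift_Suc_antimono_le[of l, OF step that])
  show "splits (\<lambda>k. int (l k)) (\<lambda>k. int (d k))"
    unfolding splits_def
  proof (intro conjI allI impI)
    fix k assume k: "k < a * b" "\<not> P k" "\<forall>k'. k = Suc k' \<longrightarrow> \<not> P k'"
    have "D k = L k" using bal k by (auto simp: balanced_def)
    moreover have "steep_split k = steep k" using k by (cases k) (auto simp: steep_split_def)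
    ultimately show "int (d k) = int (l k)" by (simp add: lk dk[OF k(1)])
  next
    fix k assume k: "P k"
    have kN: "k < a * b" "Suc k < a * b" using P_less[OF k] by auto
    have "(D k - L k) + (D (Suc k) - L (Suc k)) = 0" using bal k by (simp add: balanced_def)
    hence DL: "D k + D (Suc k) = L k + L (Suc k)" by simp
    have s: "steep_split k = steep k - 1" "steep_split (Suc k) = steep (Suc k) + 1"
      using k P_Suc[OF k] by (simp_all add: steep_split_def)
    show "int (d k) + int (d (Suc k)) = int (l k) + int (l (Suc k))"
      using DL by (simp add: lk dk kN s algebra_simps)
    have "K * steep k = K * steep (Suc k) + 4 * K" by (simp add: st[OF kN(1)] distrib_left)
    thus "int (l (Suc k)) \<le> int (d k)"
      unfolding lk dk[OF kN(1)] s using bL[of "Suc k"] bd[OF kN(1)] KB B0 by (simp add: right_diff_distrib)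
    show "int (d k) \<le> int (l k)"
      unfolding lk dk[OF kN(1)] s using bd[OF kN(1)] KB B0 by (simp add: right_diff_distrib)
  qed
qed

text \<open>
  Lattice points of the face: a real splitting exists by passing to the cone, an integral one by
  \<open>lift_margins\<close>, and they agree by uniqueness; so the integral one satisfies the inequalities
  of a splitting and \<open>stable_triple\<close> applies. Codimension one: the triple \<open>((2), (1,1), (1,1))\<close>
  is off the hyperplane, and every generator becomes, after scaling and subtracting a multiple
  of that triple, an integral point of the hyperplane, which is a difference of points of the
  face by \<open>stable_shift\<close>.
\<close>

theorem tied_facet:
  assumes cards: "CARD('c::{finite,linorder}) = a * b" "CARD('a::{finite,linorder}) = a" "CARD('b::{finite,linorder}) = b"
  shows "\<exists>F :: ((real ^ 'c::{finite,linorder}) \<times> (real ^ 'a::{finite,linorder}) \<times> (real ^ 'b::{finite,linorder})) set. F facet_of PKron \<and> stable_face F"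
proof -
  let ?C = "PKron :: ((real ^ 'c::{finite,linorder}) \<times> (real ^ 'a::{finite,linorder}) \<times> (real ^ 'b::{finite,linorder})) set"
  let ?N = "a * b"
  define V where "V l m m' = (vec_of l :: real ^ 'c::{finite,linorder}, vec_of m :: real ^ 'a::{finite,linorder}, vec_of m' :: real ^ 'b::{finite,linorder})"
    for l m m'
  define H where "H l m m' = (\<Sum>i<a. m i * real_of_int (x i)) + (\<Sum>j<b. m' j * real_of_int (y j)) - (\<Sum>k<?N. l k * real_of_int (z (\<kappa> k)))"
    for l m m'
  define h where "h = V (\<lambda>k. - real_of_int (z (\<kappa> k))) (\<lambda>i. real_of_int (x i)) (\<lambda>j. real_of_int (y j))"
  have h: "h \<bullet> (u, v, w) = H (crd u) (crd v) (crd w)" for u v w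
    by (simp add: h_def V_def H_def inner_vec_of cards sum_negf mult.commute)
  have Hcong: "H l m m' = H l' n n'" if "\<And>k. k < ?N \<Longrightarrow> l k = l' k" "\<And>i. i < a \<Longrightarrow> m i = n i" "\<And>j. j < b \<Longrightarrow> m' j = n' j" for l m m' l' n n'
    using that by (simp add: H_def)
  have hV: "h \<bullet> V l m m' = H l m m'" for l m m'
    unfolding V_def h by (rule Hcong) (simp_all add: crd_vec_of cards)
  define F where "F = ?C \<inter> {v. h \<bullet> v = 0}"
  have stable: "V (\<lambda>k. real (l k)) (\<lambda>i. real (rowsum d i)) (\<lambda>j. real (colsum d j)) \<in> triple_vec ` SKron a b"
    if "\<And>i j. i \<le> j \<Longrightarrow> l j \<le> l i" "\<And>k. ?N \<le> k \<Longrightarrow> l k = 0" "splits (\<lambda>k. int (l k)) (\<lambda>k. int (d k))" for l d :: "nat \<Rightarrow> nat"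
    unfolding V_def by (rule stable_vec[OF cards that])
  have inF: "V (\<lambda>k. real (l k)) (\<lambda>i. real (rowsum d i)) (\<lambda>j. real (colsum d j)) \<in> F"
    if ld: "\<And>i j. i \<le> j \<Longrightarrow> l j \<le> l i" "\<And>k. ?N \<le> k \<Longrightarrow> l k = 0" "splits (\<lambda>k. int (l k)) (\<lambda>k. int (d k))" for l d :: "nat \<Rightarrow> nat"
  proof -
    have "V (\<lambda>k. real (l k)) (\<lambda>i. real (rowsum d i)) (\<lambda>j. real (colsum d j)) \<in> ?C"
      by (rule SKron_in_PKron) (use stable[OF ld] cards in simp)
    moreover have "H (\<lambda>k. real (l k)) (\<lambda>i. real (rowsum d i)) (\<lambda>j. real (colsum d j)) = 0"
    proof -
      have "(\<Sum>i<a. int (rowsum d i) * x i) + (\<Sum>j<b. int (colsum d j) * y j) = (\<Sum>k<?N. int (l k) * z (\<kappa> k))"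
        using sum_margins[of "\<lambda>k. int (d k)"] splits_sum(1)[OF ld(3)] by (simp add: rowsum_int colsum_int)
      hence "real_of_int ((\<Sum>i<a. int (rowsum d i) * x i) + (\<Sum>j<b. int (colsum d j) * y j)) = real_of_int (\<Sum>k<?N. int (l k) * z (\<kappa> k))"
        by (rule arg_cong)
      thus ?thesis by (simp add: H_def)
    qed
    ultimately show ?thesis by (simp add: F_def hV)
  qed
  have Htriple: "H (\<lambda>k. real (rowlen p k)) (\<lambda>i. real (rowlen q i)) (\<lambda>j. real (rowlen r j)) = real_of_int (margin_weight q r - top_weight p)" for p q r
    by (simp add: H_def top_weight_def margin_weight_def)
  have triple: "triple_vec (p, q, r) = V (\<lambda>k. real (rowlen p k)) (\<lambda>i. real (rowlen q i)) (\<lambda>j. real (rowlen r j))" for p q r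
    by (simp add: triple_vec_def V_def partition_vec_of)
  \<comment> \<open>The inequality and the existence of a splitting in the case of equality are closed under
    positive combinations, so they pass from the generators to the cone.\<close>
  define Q where "Q = {(u :: real ^ 'c::{finite,linorder}, v :: real ^ 'a::{finite,linorder}, w :: real ^ 'b::{finite,linorder}).
      (\<forall>i j. i \<le> j \<longrightarrow> crd u j \<le> crd u i) \<and> (\<forall>k. 0 \<le> crd u k) \<and> H (crd u) (crd v) (crd w) \<le> 0
      \<and> (H (crd u) (crd v) (crd w) = 0 \<longrightarrow> (\<exists>d. splits (crd u) d \<and> (\<forall>i<a. rowsum d i = crd v i) \<and> (\<forall>j<b. colsum d j = crd w j)))}"
  have genQ: "triple_vec ` Kron CARD('a) CARD('b) \<subseteq> Q"
  proof
    fix s :: "(real ^ 'c::{finite,linorder}) \<times> (real ^ 'a::{finite,linorder}) \<times> (real ^ 'b::{finite,linorder})"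
    assume "s \<in> triple_vec ` Kron CARD('a) CARD('b)"
    then obtain p q r where k: "(p, q, r) \<in> Kron a b" "s = triple_vec (p, q, r)" using cards by auto
    note K = KronD[OF k(1)]
    note kw = kronecker_nonzero_weight[OF K(8-10) K(5,6,7)]
    have cp: "crd (partition_vec p :: real ^ 'c::{finite,linorder}) = (\<lambda>k. real (rowlen p k))" 
      and cq: "crd (partition_vec q :: real ^ 'a::{finite,linorder}) = (\<lambda>k. real (rowlen q k))" 
      and cr: "crd (partition_vec r :: real ^ 'b::{finite,linorder}) = (\<lambda>k. real (rowlen r k))"
      using K(4-6) cards by (auto simp: crd_partition_vec)
    have "\<exists>d. splits (\<lambda>k. real (rowlen p k)) d \<and> (\<forall>i<a. rowsum d i = real (rowlen q i)) \<and> (\<forall>j<b. colsum d j = real (rowlen r j))"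
      if eq: "margin_weight q r = top_weight p"
    proof -
      obtain d :: "nat \<Rightarrow> nat" where d: "splits (\<lambda>k. int (rowlen p k)) (\<lambda>k. int (d k))" "\<forall>i<a. rowsum (\<lambda>k. int (d k)) i = int (rowlen q i)"
          "\<forall>j<b. colsum (\<lambda>k. int (d k)) j = int (rowlen r j)"
        using kw(3)[OF eq] by blast
      have "splits (\<lambda>k. real_of_int (int (rowlen p k))) (\<lambda>k. real_of_int (int (d k)))"
        using d(1) by (rule splits_of_int)
      thus ?thesis using d(2,3) by (intro exI[of _ "\<lambda>k. real (d k)"]) (simp add: rowsum_real colsum_real rowsum_int colsum_int)
    qed
    thus "s \<in> Q"
      using kw(2) rowlen_antimono[OF K(1)] by (simp add: k(2) triple_vec_def Q_def cp cq cr Htriple)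
  qed
  have QC: "?C \<subseteq> Q"
    unfolding PKron_def
  proof (rule hull_minimal[OF genQ])
    have Hadd: "H (\<lambda>k. l k + l' k) (\<lambda>i. m i + n i) (\<lambda>j. m' j + n' j) = H l m m' + H l' n n'" for l l' m n m' n'
      by (simp add: H_def distrib_right sum.distrib)
    have Hsc: "H (\<lambda>k. c * l k) (\<lambda>i. c * m i) (\<lambda>j. c * m' j) = c * H l m m'" for c l m m'
      by (simp add: H_def algebra_simps sum_distrib_left)
    show "convex_cone Q"
      unfolding convex_cone_iff
    proof (intro conjI ballI allI impI)
      have "H (\<lambda>k. 0) (\<lambda>i. 0) (\<lambda>j. 0) = 0" by (simp add: H_def)
      moreover have "splits (\<lambda>k. 0 :: real) (\<lambda>k. 0)" by (simp add: splits_def)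
      ultimately show "0 \<in> Q"
        by (auto simp: Q_def zero_prod_def crd_zero[abs_def] rowsum_def colsum_def intro!: exI[of _ "\<lambda>k. 0"])
    next
      fix s s' assume s: "s \<in> Q" "s' \<in> Q"
      obtain u v w u' v' w' where e: "s = (u, v, w)" "s' = (u', v', w')" by (cases s; cases s')
      let ?H = "H (crd u) (crd v) (crd w)" and ?H' = "H (crd u') (crd v') (crd w')"
      have le: "?H \<le> 0" "?H' \<le> 0" using s by (auto simp: Q_def e)
      have "\<exists>d. splits (\<lambda>k. crd u k + crd u' k) d \<and> (\<forall>i<a. rowsum d i = crd v i + crd v' i) \<and> (\<forall>j<b. colsum d j = crd w j + crd w' j)"
        if "?H + ?H' = 0"
      proof -
        have z: "?H = 0" "?H' = 0" using le that by linarith+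
        obtain d where d: "splits (crd u) d" "\<forall>i<a. rowsum d i = crd v i" "\<forall>j<b. colsum d j = crd w j" using s(1) z(1) by (auto simp: Q_def e)
        obtain d' where d': "splits (crd u') d'" "\<forall>i<a. rowsum d' i = crd v' i" "\<forall>j<b. colsum d' j = crd w' j" using s(2) z(2) by (auto simp: Q_def e)
        have "splits (\<lambda>k. crd u k + crd u' k) (\<lambda>k. d k + d' k)" using d(1) d'(1) unfolding splits_def by (smt (verit))
        thus ?thesis using d d' by (intro exI[of _ "\<lambda>k. d k + d' k"]) (simp add: rowsum_lin)
      qed
      thus "s + s' \<in> Q"
        using s le by (simp add: Q_def e crd_add[abs_def] Hadd add_mono)
    next
      fix s and c :: real assume s: "s \<in> Q" and c: "0 \<le> c"
      obtain u v w where e: "s = (u, v, w)" by (cases s)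
      let ?H = "H (crd u) (crd v) (crd w)"
      have le: "?H \<le> 0" using s by (auto simp: Q_def e)
      have "\<exists>d. splits (\<lambda>k. c * crd u k) d \<and> (\<forall>i<a. rowsum d i = c * crd v i) \<and> (\<forall>j<b. colsum d j = c * crd w j)"
        if "c * ?H = 0"
      proof (cases "c = 0")
        case True
        thus ?thesis by (intro exI[of _ "\<lambda>k. 0"]) (simp add: splits_def rowsum_def colsum_def)
      next
        case False
        hence "?H = 0" using that by simp
        then obtain d where d: "splits (crd u) d" "\<forall>i<a. rowsum d i = crd v i" "\<forall>j<b. colsum d j = crd w j" using s by (auto simp: Q_def e)
        have "splits (\<lambda>k. c * crd u k) (\<lambda>k. c * d k)"
          using d(1) c by (auto simp: splits_def mult_left_mono simp flip: distrib_left)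
        thus ?thesis using d by (intro exI[of _ "\<lambda>k. c * d k"]) (simp add: rowsum_lin)
      qed
      thus "c *\<^sub>R s \<in> Q"
        using s c le by (simp add: Q_def e crd_scale[abs_def] Hsc mult_left_mono mult_nonneg_nonpos)
    qed
  qed
  have "F \<inter> weight_lattice \<subseteq> triple_vec ` SKron CARD('a) CARD('b)"
  proof
    fix s assume s: "s \<in> F \<inter> weight_lattice"
    obtain u v w where uvw: "s = (u, v, w)" by (cases s)
    have Q: "(u, v, w) \<in> Q" and H0: "H (crd u) (crd v) (crd w) = 0" using s QC uvw by (auto simp: F_def h)
    then obtain d where d: "splits (crd u) d" "\<forall>i<a. rowsum d i = crd v i" "\<forall>j<b. colsum d j = crd w j" by (auto simp: Q_def)
    have "crd u k \<in> \<int>" "crd v k \<in> \<int>" "crd w k \<in> \<int>" for k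
      using s by (auto intro!: crd_Ints simp: weight_lattice_def uvw)
    then obtain L M M' where LM: "\<And>k. crd u k = real_of_int (L k)" "\<And>k. crd v k = real_of_int (M k)" "\<And>k. crd w k = real_of_int (M' k)"
      using int_function[of "crd u"] int_function[of "crd v"] int_function[of "crd w"] by metis
    have sums: "(\<Sum>k<?N. crd u k) = (\<Sum>i<a. crd v i)" "(\<Sum>i<a. crd v i) = (\<Sum>j<b. crd w j)"
      using s by (auto simp: weight_lattice_def uvw sum_crd cards)
    have "real_of_int (\<Sum>i<a. M i) = real_of_int (\<Sum>k<?N. L k)" using sums(1) by (simp add: LM)
    hence 1: "(\<Sum>i<a. M i) = (\<Sum>k<?N. L k)" by (simp only: of_int_eq_iff)
    have "real_of_int (\<Sum>j<b. M' j) = real_of_int (\<Sum>k<?N. L k)" using sums by (simp add: LM)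
    hence 2: "(\<Sum>j<b. M' j) = (\<Sum>k<?N. L k)" by (simp only: of_int_eq_iff)
    have "real_of_int ((\<Sum>i<a. M i * x i) + (\<Sum>j<b. M' j * y j)) = real_of_int (\<Sum>k<?N. L k * z (\<kappa> k))"
      using H0 by (simp add: H_def LM)
    hence 3: "(\<Sum>i<a. M i * x i) + (\<Sum>j<b. M' j * y j) = (\<Sum>k<?N. L k * z (\<kappa> k))" by (simp only: of_int_eq_iff)
    obtain D where D: "balanced (\<lambda>k. D k - L k)" "\<And>i. i < a \<Longrightarrow> rowsum D i = M i" "\<And>j. j < b \<Longrightarrow> colsum D j = M' j"
      using lift_margins[OF 1 2 3] by blast
    have dD: "d k = real_of_int (D k)" if k: "k < ?N" for k
    proof -
      have "d k - real_of_int (D k) = 0"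
      proof (rule unique[of "\<lambda>k. d k - real_of_int (D k)", OF _ _ _ k])
        show "balanced (\<lambda>k. d k - real_of_int (D k))"
          unfolding balanced_def
        proof (intro conjI allI impI)
          fix k assume k: "k < ?N" "\<not> P k" "\<forall>k'. k = Suc k' \<longrightarrow> \<not> P k'"
          have "D k = L k" using D(1) k by (auto simp: balanced_def)
          moreover have "d k = crd u k" using d(1) k by (auto simp: splits_def)
          ultimately show "d k - real_of_int (D k) = 0" by (simp add: LM)
        next
          fix k assume k: "P k"
          have "(D k - L k) + (D (Suc k) - L (Suc k)) = 0" using D(1) k by (auto simp: balanced_def)
          hence "real_of_int ((D k - L k) + (D (Suc k) - L (Suc k))) = 0" by simp
          moreover have "d k + d (Suc k) = crd u k + crd u (Suc k)" using d(1) k by (auto simp: splits_def)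
          ultimately show "d k - real_of_int (D k) + (d (Suc k) - real_of_int (D (Suc k))) = 0" by (simp add: LM)
        qed
      qed (use d D in \<open>simp_all add: rowsum_lin rowsum_of_int colsum_of_int LM\<close>)
      thus ?thesis by simp
    qed
    have anti: "\<And>i j. i \<le> j \<Longrightarrow> crd u j \<le> crd u i" and nn: "\<And>k. 0 \<le> crd u k" using Q by (auto simp: Q_def)
    define l where "l k = nat (L k)" for k
    define e where "e k = nat (D k)" for k
    have l: "L k = int (l k)" for k using nn[of k] by (simp add: l_def LM)
    have e: "D k = int (e k)" if "k < ?N" for k
      using splits_nonneg[OF d(1) anti nn that] dD[OF that] by (simp add: e_def)
    have "splits (\<lambda>k. real_of_int (L k)) (\<lambda>k. real_of_int (D k))"
      using d(1) splits_cong[of "crd u" "\<lambda>k. real_of_int (L k)" d "\<lambda>k. real_of_int (D k)"] dD LM(1) by simp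
    hence "splits L D" by (rule splits_of_int_iff[THEN iffD1])
    hence spl: "splits (\<lambda>k. int (l k)) (\<lambda>k. int (e k))"
      using splits_cong[of L "\<lambda>k. int (l k)" D "\<lambda>k. int (e k)"] l e by simp
    have "s = V (\<lambda>k. real (l k)) (\<lambda>i. real (rowsum e i)) (\<lambda>j. real (colsum e j))"
    proof -
      have r1: "crd v i = real (rowsum e i)" if "i < a" for i
      proof -
        have "rowsum D i = int (rowsum e i)" using rowsum_cong[of D "\<lambda>k. int (e k)" i] e by (simp add: rowsum_int)
        thus ?thesis using D(2)[OF that] by (simp add: LM)
      qed
      have r2: "crd w j = real (colsum e j)" if "j < b" for j
      proof -
        have "colsum D j = int (colsum e j)" using colsum_cong[of D "\<lambda>k. int (e k)" j] e by (simp add: colsum_int)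
        thus ?thesis using D(3)[OF that] by (simp add: LM)
      qed
      have "vec_of (crd u) = (vec_of (\<lambda>k. real (l k)) :: real ^ 'c::{finite,linorder})"
        by (rule vec_of_cong) (simp add: LM l)
      moreover have "vec_of (crd v) = (vec_of (\<lambda>i. real (rowsum e i)) :: real ^ 'a::{finite,linorder})"
        by (rule vec_of_cong) (simp add: r1 cards)
      moreover have "vec_of (crd w) = (vec_of (\<lambda>j. real (colsum e j)) :: real ^ 'b::{finite,linorder})"
        by (rule vec_of_cong) (simp add: r2 cards)
      ultimately show ?thesis by (simp add: uvw V_def vec_of_crd)
    qed
    moreover have "V (\<lambda>k. real (l k)) (\<lambda>i. real (rowsum e i)) (\<lambda>j. real (colsum e j)) \<in> triple_vec ` SKron a b"
    proof (rule stable[OF _ _ spl])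
      show "l j \<le> l i" if "i \<le> j" for i j using anti[OF that] by (simp add: LM l)
      show "l k = 0" if "?N \<le> k" for k using crd_out[of k u] that cards by (simp add: LM l)
    qed
    ultimately show "s \<in> triple_vec ` SKron CARD('a) CARD('b)" using cards by simp
  qed
  moreover have "F facet_of ?C"
  proof (rule facet_of_cone[OF PKron_def F_def])
    show "h \<bullet> s \<le> 0" if "s \<in> triple_vec ` Kron CARD('a) CARD('b)" for s
    proof -
      have "s \<in> Q" using that genQ by blast
      thus ?thesis by (cases s) (auto simp: h Q_def)
    qed
    let ?p = "[2::nat]" and ?q = "[Suc 0, Suc 0]"
    have p0: "?p \<in> partitions_of 2" "?q \<in> partitions_of 2" by (auto simp: partitions_of_def is_partition_def)
    have "kronecker ?p ?q ?q \<noteq> 0" by (rule kronecker_trivial_left[OF p0]) simp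
    moreover have "1 \<le> a * b" using two by (metis One_nat_def Suc_leI mult_pos_pos order_less_le_trans pos2)
    ultimately have K0: "(?p, ?q, ?q) \<in> Kron a b" using two by (simp add: Kron_def is_partition_def)
    show "triple_vec (?p, ?q, ?q) \<in> ?C" by (rule Kron_in_PKron) (use K0 cards in simp)
    define H0 where "H0 = margin_weight ?q ?q - top_weight ?p"
    have H0neg: "H0 < 0"
    proof -
      have pt: "rowlen ?q k = (if k < 2 then 1 else 0)" for k by (auto simp: rowlen_def less_Suc_eq numeral_2_eq_2)
      have s2: "(\<Sum>i<m. int (rowlen ?q i) * f i) = f 0 + f 1" if m: "2 \<le> m" for m and f :: "nat \<Rightarrow> int"
      proof -
        have "(\<Sum>i<m. int (rowlen ?q i) * f i) = (\<Sum>i<2. int (rowlen ?q i) * f i)"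
          by (rule sum.mono_neutral_right) (use m in \<open>auto simp: pt\<close>)
        thus ?thesis by (simp add: pt numeral_2_eq_2)
      qed
      have w1: "top_weight ?p = 2 * z (\<kappa> 0)"
      proof -
        have "top_weight ?p = (\<Sum>k\<in>{0}. int (rowlen ?p k) * z (\<kappa> k))"
          unfolding top_weight_def by (rule sum.mono_neutral_right) (use \<open>1 \<le> a * b\<close> in \<open>auto simp: rowlen_def\<close>)
        thus ?thesis by (simp add: rowlen_def)
      qed
      have i0: "idx (0, 0) < ?N" "\<kappa> (idx (0, 0)) = (0, 0)" using idx(1,2)[of 0 0] two by auto
      have "z (\<kappa> (idx (0, 0))) \<le> z (\<kappa> 0)" using kap_anti i0(1) by blast
      hence "x 0 + y 0 \<le> z (\<kappa> 0)" by (simp add: i0(2) wt_def)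
      moreover have "x 1 < x 0" "y 1 < y 0" using x_anti y_anti two by auto
      ultimately show ?thesis
        by (simp add: H0_def w1 margin_weight_def s2[OF two(1)] s2[OF two(2)])
    qed
    show "h \<bullet> triple_vec (?p, ?q, ?q) < 0"
      using H0neg by (simp add: triple hV Htriple H0_def)
    fix s :: "(real ^ 'c::{finite,linorder}) \<times> (real ^ 'a::{finite,linorder}) \<times> (real ^ 'b::{finite,linorder})"
    assume "s \<in> triple_vec ` Kron CARD('a) CARD('b)"
    then obtain p q r where k: "(p, q, r) \<in> Kron a b" "s = triple_vec (p, q, r)" using cards by auto
    note K = KronD[OF k(1)]
    note K0' = KronD[OF K0]
    define G where "G = margin_weight q r - top_weight p"
    define L where "L k = H0 * int (rowlen p k) - G * int (rowlen ?p k)" for k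
    define M where "M k = H0 * int (rowlen q k) - G * int (rowlen ?q k)" for k
    define M' where "M' k = H0 * int (rowlen r k) - G * int (rowlen ?q k)" for k
    have tot: "(\<Sum>i<m. H0 * int (rowlen p' i) - G * int (rowlen q' i)) = H0 * int (sum_list p') - G * int (sum_list q')"
      if "length p' \<le> m" "length q' \<le> m" for p' q' m
      unfolding sum_rowlen[OF that(1), symmetric] sum_rowlen[OF that(2), symmetric]
      by (simp add: sum_subtractf sum_distrib_left)
    have n: "sum_list q = sum_list p" "sum_list r = sum_list p" using partitions_ofD(2)[OF K(9)] partitions_ofD(2)[OF K(10)] by auto
    have 1: "(\<Sum>i<a. M i) = (\<Sum>k<?N. L k)" and 2: "(\<Sum>j<b. M' j) = (\<Sum>k<?N. L k)"
      unfolding M_def M'_def L_def tot[OF K(4) K0'(4)] tot[OF K(5) K0'(5)] tot[OF K(6) K0'(6)] n by simp_all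
    have 3: "(\<Sum>i<a. M i * x i) + (\<Sum>j<b. M' j * y j) = (\<Sum>k<?N. L k * z (\<kappa> k))"
    proof -
      have "(\<Sum>i<a. M i * x i) + (\<Sum>j<b. M' j * y j) = H0 * margin_weight q r - G * margin_weight ?q ?q"
        by (simp add: M_def M'_def margin_weight_def left_diff_distrib sum_subtractf sum_distrib_left right_diff_distrib distrib_left mult.assoc)
      also have "\<dots> = H0 * top_weight p - G * top_weight ?p" by (simp add: H0_def G_def algebra_simps)
      also have "\<dots> = (\<Sum>k<?N. L k * z (\<kappa> k))"
        by (simp add: L_def top_weight_def left_diff_distrib sum_subtractf sum_distrib_left mult.assoc)
      finally show ?thesis .
    qed
    obtain D where D: "balanced (\<lambda>k. D k - L k)" "\<And>i. i < a \<Longrightarrow> rowsum D i = M i" "\<And>j. j < b \<Longrightarrow> colsum D j = M' j"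
      using lift_margins[OF 1 2 3] by blast
    have Lout: "L k = 0" if "?N \<le> k" for k
    proof -
      have "1 \<le> k" "length p \<le> k" using that \<open>1 \<le> a * b\<close> K(4) by linarith+
      thus ?thesis by (simp add: L_def rowlen_def)
    qed
    define T where "T = 2 * (\<Sum>k<?N. \<bar>L k\<bar> + \<bar>D k\<bar>) + 1"
    define l where "l = (\<lambda>k. nat (L k + T * steep k))"
    define d where "d = (\<lambda>k. nat (D k + T * steep_split k))"
    have ld: "\<And>k. int (l k) = L k + T * steep k" "\<And>k. k < ?N \<Longrightarrow> int (d k) = D k + T * steep_split k"
      "\<And>i j. i \<le> j \<Longrightarrow> l j \<le> l i" "\<And>k. ?N \<le> k \<Longrightarrow> l k = 0" "splits (\<lambda>k. int (l k)) (\<lambda>k. int (d k))"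
      by (rule stable_shift[where L = L and D = D and K = T and l = l and d = d];
          (rule D(1) T_def l_def d_def | erule Lout | assumption))+
    define T0 where "T0 = 2 * (\<Sum>k<?N. \<bar>0::int\<bar> + \<bar>0::int\<bar>) + 1"
    define l0 where "l0 = (\<lambda>k. nat (0 + T0 * steep k))"
    define d0 where "d0 = (\<lambda>k. nat (0 + T0 * steep_split k))"
    have b0: "balanced (\<lambda>k. (0::int) - 0)" by (simp add: balanced_def)
    have ld0: "\<And>k. int (l0 k) = 0 + T0 * steep k" "\<And>k. k < ?N \<Longrightarrow> int (d0 k) = 0 + T0 * steep_split k"
      "\<And>i j. i \<le> j \<Longrightarrow> l0 j \<le> l0 i" "\<And>k. ?N \<le> k \<Longrightarrow> l0 k = 0" "splits (\<lambda>k. int (l0 k)) (\<lambda>k. int (d0 k))"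
      by (rule stable_shift[where L = "\<lambda>_. 0" and D = "\<lambda>_. 0" and K = T0 and l = l0 and d = d0];
          (rule b0 refl T0_def l0_def d0_def | assumption))+
    have T01: "T0 = 1" by (simp add: T0_def)
    let ?v = "V (\<lambda>k. real (l k)) (\<lambda>i. real (rowsum d i)) (\<lambda>j. real (colsum d j))"
    let ?w = "V (\<lambda>k. real (l0 k)) (\<lambda>i. real (rowsum d0 i)) (\<lambda>j. real (colsum d0 j))"
    have vF: "?v \<in> F" by (rule inF[OF ld(3,4,5)])
    have v0F: "?w \<in> F" by (rule inF[OF ld0(3,4,5)])
    have eqL: "real_of_int (L k) = real (l k) - real_of_int T * real (l0 k)" for k
    proof -
      have "int (l k) = L k + T * int (l0 k)" using ld(1)[of k] ld0(1)[of k] T01 by simp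
      hence "real_of_int (int (l k)) = real_of_int (L k + T * int (l0 k))" by (rule arg_cong)
      thus ?thesis by simp
    qed
    have eqD: "int (d k) = D k + T * int (d0 k)" if "k < ?N" for k
      using ld(2)[OF that] ld0(2)[OF that] T01 by simp
    have eqM: "real_of_int (M i) = real (rowsum d i) - real_of_int T * real (rowsum d0 i)" if "i < a" for i
    proof -
      have "int (rowsum d i) = rowsum D i + T * int (rowsum d0 i)"
        using rowsum_cong[of "\<lambda>k. int (d k)" "\<lambda>k. D k + T * int (d0 k)" i, OF eqD]
        by (simp only: rowsum_lin rowsum_int)
      hence "real_of_int (int (rowsum d i)) = real_of_int (M i + T * int (rowsum d0 i))" using D(2)[OF that] by simp
      thus ?thesis by simp
    qed
    have eqM': "real_of_int (M' i) = real (colsum d i) - real_of_int T * real (colsum d0 i)" if "i < b" for i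
    proof -
      have "int (colsum d i) = colsum D i + T * int (colsum d0 i)"
        using colsum_cong[of "\<lambda>k. int (d k)" "\<lambda>k. D k + T * int (d0 k)" i, OF eqD]
        by (simp only: rowsum_lin colsum_int)
      hence "real_of_int (int (colsum d i)) = real_of_int (M' i + T * int (colsum d0 i))" using D(3)[OF that] by simp
      thus ?thesis by simp
    qed
    have H0r: "real_of_int H0 \<noteq> 0" using H0neg by simp
    have solve_eq: "f = (g + real_of_int G * t) / real_of_int H0" if "real_of_int H0 * f - real_of_int G * t = g" for f g t :: real
      using that H0r by (simp add: field_simps)
    have vL: "real (rowlen p k) = (real (l k) - real_of_int T * real (l0 k) + real_of_int G * real (rowlen ?p k)) / real_of_int H0" for k
      by (rule solve_eq) (use eqL[of k] in \<open>simp add: L_def\<close>)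
    have vM: "real (rowlen q k) = (real (rowsum d k) - real_of_int T * real (rowsum d0 k) + real_of_int G * real (rowlen ?q k)) / real_of_int H0" if "k < a" for k
      by (rule solve_eq) (use eqM[OF that] in \<open>simp add: M_def\<close>)
    have vM': "real (rowlen r k) = (real (colsum d k) - real_of_int T * real (colsum d0 k) + real_of_int G * real (rowlen ?q k)) / real_of_int H0" if "k < b" for k
      by (rule solve_eq) (use eqM'[OF that] in \<open>simp add: M'_def\<close>)
    have "s = (1 / real_of_int H0) *\<^sub>R ((?v - real_of_int T *\<^sub>R ?w) + real_of_int G *\<^sub>R triple_vec (?p, ?q, ?q))"
      unfolding k(2) triple V_def
      using vL vM vM' by (auto simp: vec_of_lin cards intro!: vec_of_cong)
    moreover have "\<dots> \<in> span (insert (triple_vec (?p, ?q, ?q)) F)"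
      using vF v0F by (intro span_scale span_add span_diff span_base insertI1 insertI2)
    ultimately show "s \<in> span (insert (triple_vec (?p, ?q, ?q)) F)" by simp
  qed
  ultimately show ?thesis using facet_stableI by blast
qed

end


section \<open>The staircase configuration\<close>

context pair_config
begin

lemma cell_pair:
  assumes \<delta>: "balanced \<delta>" and c: "i < a" "j < b" "i' < a" "j' < b" "(i, j) \<noteq> (i', j')" "z (i, j) = z (i', j')"
  shows "\<delta> (idx (i, j)) + \<delta> (idx (i', j')) = 0"
proof -
  have gen: "\<delta> k + \<delta> k' = 0" if "k < a * b" "k' < a * b" "z (\<kappa> k) = z (\<kappa> k')" "k < k'" for k k'
  proof -
    have "k' = Suc k \<and> P k" using z_eq_cases[OF that(1-3)] that(4) by auto
    thus ?thesis using \<delta> by (auto simp: balanced_def)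
  qed
  let ?k = "idx (i, j)" and ?k' = "idx (i', j')"
  have k: "?k < a * b" "?k' < a * b" "z (\<kappa> ?k) = z (\<kappa> ?k')" "?k \<noteq> ?k'"
    using c idx(1)[OF c(1,2)] idx(1)[OF c(3,4)] idx(2)[OF c(1,2)] idx(2)[OF c(3,4)] by (simp, simp, simp, metis)
  show ?thesis
    using gen[OF k(1-3)] gen[OF k(2,1) k(3)[symmetric]] k(4) by (metis add.commute linorder_neqE_nat)
qed

lemma cell_single:
  assumes \<delta>: "balanced \<delta>" and c: "i < a" "j < b"
    and alone: "\<And>i' j'. i' < a \<Longrightarrow> j' < b \<Longrightarrow> z (i', j') = z (i, j) \<Longrightarrow> (i', j') = (i, j)"
  shows "\<delta> (idx (i, j)) = 0"
proof -
  let ?k = "idx (i, j)"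
  have k: "?k < a * b" "\<kappa> ?k = (i, j)" using c idx by auto
  have other: "k' = ?k" if k': "k' < a * b" "z (\<kappa> k') = z (\<kappa> ?k)" for k'
  proof -
    have "\<kappa> k' = (i, j)" using alone[of "fst (\<kappa> k')" "snd (\<kappa> k')"] k' kap_range[OF k'(1)] k(2) by simp
    thus ?thesis using kap_inj[OF k'(1) k(1)] k(2) by simp
  qed
  have "\<not> P ?k" using other[of "Suc ?k"] by (auto simp: tie_def)
  moreover have "\<forall>k'. ?k = Suc k' \<longrightarrow> \<not> P k'"
  proof (intro allI impI notI)
    fix k' assume "?k = Suc k'" "P k'"
    thus False using other[of k'] by (auto simp: tie_def)
  qed
  ultimately show ?thesis using \<delta> k(1) by (auto simp: balanced_def)
qed

text \<open>
  A criterion in terms of cells instead of positions in the list \<open>\<kappa>\<close>.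
\<close>

lemma balancedI:
  assumes pair: "\<And>c c'. c \<in> {..<a} \<times> {..<b} \<Longrightarrow> c' \<in> {..<a} \<times> {..<b} \<Longrightarrow> c \<noteq> c' \<Longrightarrow> z c = z c' \<Longrightarrow> f c + f c' = 0"
    and single: "\<And>c. c \<in> {..<a} \<times> {..<b} \<Longrightarrow> (\<And>c'. c' \<in> {..<a} \<times> {..<b} \<Longrightarrow> z c' = z c \<Longrightarrow> c' = c) \<Longrightarrow> f c = 0"
  shows "balanced (\<lambda>k. f (\<kappa> k))"
  unfolding balanced_def
proof (intro conjI allI impI)
  have rng: "\<kappa> k \<in> {..<a} \<times> {..<b}" if "k < a * b" for k using bij_betwE[OF kap_bij] that by blast
  fix k assume k: "k < a * b" "\<not> P k" "\<forall>k'. k = Suc k' \<longrightarrow> \<not> P k'"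
  show "f (\<kappa> k) = 0"
  proof (rule single[OF rng[OF k(1)]])
    fix c' assume c': "c' \<in> {..<a} \<times> {..<b}" "z c' = z (\<kappa> k)"
    then obtain k' where k': "k' < a * b" "c' = \<kappa> k'" using bij_betw_imp_surj_on[OF kap_bij] by (metis imageE lessThan_iff)
    consider "k \<le> k'" | "k' \<le> k" by linarith
    hence "k' = k"
    proof cases
      case 1
      thus ?thesis using z_eq_cases[OF k(1) k'(1) _ 1] c' k'(2) k(2) by auto
    next
      case 2
      thus ?thesis using z_eq_cases[OF k'(1) k(1) _ 2] c' k'(2) k(3) by auto
    qed
    thus "c' = \<kappa> k" using k'(2) by simp
  qed
next
  fix k assume k: "P k"
  have kN: "k < a * b" "Suc k < a * b" using P_less[OF k] by auto
  show "f (\<kappa> k) + f (\<kappa> (Suc k)) = 0"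
  proof (rule pair)
    show "\<kappa> k \<in> {..<a} \<times> {..<b}" "\<kappa> (Suc k) \<in> {..<a} \<times> {..<b}" using bij_betwE[OF kap_bij] kN by blast+
    show "\<kappa> k \<noteq> \<kappa> (Suc k)" using kap_inj[OF kN] by simp
    show "z (\<kappa> k) = z (\<kappa> (Suc k))" using k by (simp add: tie_def)
  qed
qed

end

text \<open>
  The negated column weights \<open>0, 1, a, 2 a - 1, \<dots>\<close>. The step \<open>1\<close> ties column \<open>0\<close> to column \<open>1\<close>
  along a whole diagonal; the steps \<open>a - 1\<close> tie just the last cell of each later column to the
  first cell of the next one.
\<close>

definition stair :: "nat \<Rightarrow> nat \<Rightarrow> nat"
  where "stair a j = (if j = 0 then 0 else 1 + (j - 1) * (a - 1))"

definition linked :: "nat \<Rightarrow> nat \<times> nat \<Rightarrow> nat \<times> nat \<Rightarrow> bool"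
  where "linked a c c' \<longleftrightarrow> (snd c = 0 \<and> snd c' = 1 \<and> fst c = Suc (fst c'))
    \<or> (1 \<le> snd c \<and> snd c' = Suc (snd c) \<and> fst c = a - 1 \<and> fst c' = 0)"

lemma same_level:
  assumes a: "2 \<le> a" and i: "i < a" "i' < a" and j: "j < j'"
  shows "i + stair a j = i' + stair a j' \<longleftrightarrow> linked a (i, j) (i', j')"
proof (cases "j = 0")
  case True
  show ?thesis
  proof (cases "j' = 1")
    case False
    hence "1 \<le> j' - 1" using j True by simp
    hence "1 * (a - 1) \<le> (j' - 1) * (a - 1)" by (rule mult_le_mono1)
    moreover have "stair a j' = 1 + (j' - 1) * (a - 1)" using j by (simp add: stair_def)
    ultimately have "a \<le> stair a j'" using a by linarith
    thus ?thesis using i True False by (simp add: stair_def linked_def)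
  qed (simp add: True stair_def linked_def)
next
  case False
  obtain k where k: "j' = j + Suc k" using j less_iff_Suc_add by auto
  obtain m where "j = Suc m" using False by (cases j) auto
  hence "stair a j' = stair a j + Suc k * (a - 1)"
    by (simp add: stair_def k add_mult_distrib)
  hence eq: "i + stair a j = i' + stair a j' \<longleftrightarrow> i = i' + Suc k * (a - 1)" by linarith
  show ?thesis
  proof (cases "k = 0")
    case True
    thus ?thesis using eq False k i by (auto simp: linked_def)
  next
    case k0: False
    have "2 * (a - 1) \<le> Suc k * (a - 1)" by (rule mult_le_mono1) (use k0 in simp)
    hence "a \<le> Suc k * (a - 1)" using a by linarith
    thus ?thesis using eq i k k0 False by (simp add: linked_def)
  qed
qed

lemma stair_strict: "2 \<le> a \<Longrightarrow> i < j \<Longrightarrow> stair a i < stair a j"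
proof -
  assume a: "2 \<le> a" and ij: "i < j"
  show ?thesis
  proof (cases "i = 0")
    case False
    hence "(i - 1) * (a - 1) < (j - 1) * (a - 1)" using a ij by (intro mult_strict_right_mono) auto
    thus ?thesis using False ij by (simp add: stair_def)
  qed (use ij in \<open>simp add: stair_def\<close>)
qed

locale staircase =
  fixes a b :: nat and \<kappa> :: "nat \<Rightarrow> nat \<times> nat"
  assumes two: "2 \<le> a" "2 \<le> b"
    and bij: "bij_betw \<kappa> {..<a * b} ({..<a} \<times> {..<b})"
    and anti: "\<forall>i j. i \<le> j \<longrightarrow> j < a * b \<longrightarrow> wt (\<lambda>i. - int i) (\<lambda>j. - int (stair a j)) (\<kappa> j) \<le> wt (\<lambda>i. - int i) (\<lambda>j. - int (stair a j)) (\<kappa> i)"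
begin

abbreviation "zs \<equiv> wt (\<lambda>i. - int i) (\<lambda>j. - int (stair a j))"

lemma zz_eq: "zs c = zs c' \<longleftrightarrow> fst c + stair a (snd c) = fst c' + stair a (snd c')"
  by (auto simp: wt_def)

lemma partner:
  assumes "c \<in> {..<a} \<times> {..<b}" "c' \<in> {..<a} \<times> {..<b}"
  shows "zs c = zs c' \<longleftrightarrow> c = c' \<or> linked a c c' \<or> linked a c' c"
proof -
  obtain i j i' j' where e: "c = (i, j)" "c' = (i', j')" by (cases c; cases c')
  have r: "i < a" "i' < a" using assms by (auto simp: e)
  consider "j = j'" | "j < j'" | "j' < j" by linarith
  thus ?thesis
  proof cases
    case 1
    thus ?thesis by (auto simp: zz_eq e linked_def)
  next
    case 2
    have "\<not> linked a (i', j') (i, j)" using 2 by (auto simp: linked_def)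
    thus ?thesis using same_level[OF two(1) r 2] 2 by (simp add: zz_eq e)
  next
    case 3
    have "\<not> linked a (i, j) (i', j')" using 3 by (auto simp: linked_def)
    thus ?thesis using same_level[OF two(1) r(2,1) 3] 3 by (auto simp: zz_eq e)
  qed
qed

lemma linked_irrefl: "\<not> linked a c c"
  using two by (simp add: linked_def)

sublocale pair_config a b "\<lambda>i. - int i" "\<lambda>j. - int (stair a j)" \<kappa>
proof unfold_locales
  show "bij_betw \<kappa> {..<a * b} ({..<a} \<times> {..<b})" by (rule bij)
  show "\<forall>i j. i \<le> j \<longrightarrow> j < a * b \<longrightarrow> zs (\<kappa> j) \<le> zs (\<kappa> i)" by (rule anti)
  fix k assume k: "Suc (Suc k) < a * b"
  have le: "zs (\<kappa> (Suc (Suc k))) \<le> zs (\<kappa> (Suc k))" "zs (\<kappa> (Suc k)) \<le> zs (\<kappa> k)" using anti k by auto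
  have rng: "\<kappa> i \<in> {..<a} \<times> {..<b}" if "i < a * b" for i using bij_betwE[OF bij] that by blast
  show "zs (\<kappa> (Suc (Suc k))) < zs (\<kappa> k)"
  proof (rule ccontr)
    assume "\<not> ?thesis"
    hence e: "zs (\<kappa> (Suc (Suc k))) = zs (\<kappa> (Suc k))" "zs (\<kappa> (Suc k)) = zs (\<kappa> k)" "zs (\<kappa> (Suc (Suc k))) = zs (\<kappa> k)" using le by linarith+
    have inj: "\<kappa> i = \<kappa> j \<longleftrightarrow> i = j" if "i < a * b" "j < a * b" for i j
      using bij_betw_imp_inj_on[OF bij] that by (auto dest: inj_onD)
    define c0 where "c0 = \<kappa> k"
    define c1 where "c1 = \<kappa> (Suc k)"
    define c2 where "c2 = \<kappa> (Suc (Suc k))"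
    have r: "c0 \<in> {..<a} \<times> {..<b}" "c1 \<in> {..<a} \<times> {..<b}" "c2 \<in> {..<a} \<times> {..<b}"
      using rng k by (simp_all add: c0_def c1_def c2_def)
    have d: "c0 \<noteq> c1" "c1 \<noteq> c2" "c0 \<noteq> c2" using inj k by (simp_all add: c0_def c1_def c2_def)
    have l: "linked a c0 c1 \<or> linked a c1 c0" "linked a c1 c2 \<or> linked a c2 c1" "linked a c0 c2 \<or> linked a c2 c0"
      using partner r d e by (metis c0_def c1_def c2_def)+
    show False
      using l d two by (cases c0; cases c1; cases c2) (auto simp: linked_def)
  qed
next
  show "\<forall>i j. i < j \<longrightarrow> j < a \<longrightarrow> - int j < - int i" by simp
  show "\<forall>i j. i < j \<longrightarrow> j < b \<longrightarrow> - int (stair a j) < - int (stair a i)" using stair_strict[OF two(1)] by simp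
qed

lemma linked_zero:
  fixes \<delta> :: "nat \<Rightarrow> 'r::comm_ring_1"
  assumes \<delta>: "balanced \<delta>"
  shows "Suc i < a \<Longrightarrow> \<delta> (idx (Suc i, 0)) + \<delta> (idx (i, 1)) = 0"
    and "1 \<le> j \<Longrightarrow> Suc j < b \<Longrightarrow> \<delta> (idx (a - 1, j)) + \<delta> (idx (0, Suc j)) = 0"
    and "i < a \<Longrightarrow> j < b \<Longrightarrow> (\<And>c. c \<in> {..<a} \<times> {..<b} \<Longrightarrow> \<not> linked a (i, j) c \<and> \<not> linked a c (i, j)) \<Longrightarrow> \<delta> (idx (i, j)) = 0"
proof -
  show "\<delta> (idx (Suc i, 0)) + \<delta> (idx (i, 1)) = 0" if "Suc i < a"
  proof (rule cell_pair[OF \<delta>])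
    show "zs (Suc i, 0) = zs (i, 1)" by (simp add: wt_def stair_def)
  qed (use that two in auto)
  show "\<delta> (idx (a - 1, j)) + \<delta> (idx (0, Suc j)) = 0" if "1 \<le> j" "Suc j < b"
  proof (rule cell_pair[OF \<delta>])
    have "linked a (a - 1, j) (0, Suc j)" using that by (simp add: linked_def)
    thus "zs (a - 1, j) = zs (0, Suc j)" using partner[of "(a - 1, j)" "(0, Suc j)"] that two by simp
  qed (use that two in auto)
  show "\<delta> (idx (i, j)) = 0" if "i < a" "j < b" "\<And>c. c \<in> {..<a} \<times> {..<b} \<Longrightarrow> \<not> linked a (i, j) c \<and> \<not> linked a c (i, j)"
  proof (rule cell_single[OF \<delta> that(1,2)])
    fix i' j' assume "i' < a" "j' < b" "zs (i', j') = zs (i, j)"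
    thus "(i', j') = (i, j)" using partner[of "(i', j')" "(i, j)"] that by auto
  qed
qed

lemma two_term_sum:
  fixes f :: "nat \<Rightarrow> 'r::comm_monoid_add"
  assumes "\<And>i. 0 < i \<Longrightarrow> i < a - 1 \<Longrightarrow> f i = 0"
  shows "(\<Sum>i<a. f i) = f 0 + f (a - 1)"
proof -
  have "(\<Sum>i<a. f i) = (\<Sum>i\<in>{0, a - 1}. f i)"
  proof (rule sum.mono_neutral_right)
    show "\<forall>i\<in>{..<a} - {0, a - 1}. f i = 0"
    proof
      fix i assume "i \<in> {..<a} - {0, a - 1}"
      thus "f i = 0" by (intro assms) auto
    qed
  qed (use two in auto)
  thus ?thesis using two by simp
qed

lemma first_two:
  fixes f :: "nat \<Rightarrow> 'r::comm_monoid_add"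
  shows "(\<Sum>j<b. f j) = f 0 + (f 1 + (\<Sum>j\<in>{2..<b}. f j))"
proof -
  have "{..<b} = insert 0 (insert 1 {2..<b})" using two by auto
  thus ?thesis by simp
qed

text \<open>
  The ties form a chain that can be solved step by step. Beyond column \<open>1\<close> only the top and the
  bottom cell of a column are tied, the top one to the bottom of the previous column; going from
  the last column to the left, the column sums clear all of them. The row sums then clear the
  columns \<open>0\<close> and \<open>1\<close> from the bottom row upwards.
\<close>

lemma staircase_unique:
  fixes \<delta> :: "nat \<Rightarrow> 'r::comm_ring_1"
  assumes \<delta>: "balanced \<delta>" and rows: "\<And>i. i < a \<Longrightarrow> rowsum \<delta> i = 0" and cols: "\<And>j. j < b \<Longrightarrow> colsum \<delta> j = 0"
    and k: "k < a * b"
  shows "\<delta> k = 0"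
proof -
  define e where "e i j = \<delta> (idx (i, j))" for i j
  note A = linked_zero(1)[OF \<delta>, folded e_def] and B = linked_zero(2)[OF \<delta>, folded e_def]
    and S = linked_zero(3)[OF \<delta>, folded e_def]
  have row: "(\<Sum>j<b. e i j) = 0" if "i < a" for i using rows[OF that] rowsum_idx[OF that, of \<delta>] by (simp add: e_def)
  have colm: "(\<Sum>i<a. e i j) = 0" if "j < b" for j using cols[OF that] colsum_idx[OF that, of \<delta>] by (simp add: e_def)
  have mid: "e i j = 0" if "0 < i" "i < a - 1" "2 \<le> j" "j < b" for i j
    by (rule S) (use that in \<open>auto simp: linked_def\<close>)
  have last: "e (a - 1) (b - 1) = 0"
    by (rule S) (use two in \<open>auto simp: linked_def\<close>)
  have bottom: "e (a - 1) (b - 1 - k) = 0" if "Suc k < b" for k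
    using that
  proof (induction k)
    case (Suc k)
    define j where "j = b - 1 - Suc k"
    have j: "1 \<le> j" "Suc j < b" "Suc j = b - 1 - k" using Suc.prems by (auto simp: j_def)
    have "e (a - 1) (Suc j) = 0" using Suc j(3) by simp
    moreover have "(\<Sum>i<a. e i (Suc j)) = e 0 (Suc j) + e (a - 1) (Suc j)"
      by (rule two_term_sum) (use mid j in auto)
    ultimately have "e 0 (Suc j) = 0" using colm[OF j(2)] by simp
    thus ?case using B[OF j(1,2)] by (simp add: j_def)
  qed (use last in simp)
  have bot: "e (a - 1) j = 0" if "1 \<le> j" "j < b" for j
    using bottom[of "b - 1 - j"] that by simp
  have top: "e 0 j = 0" if "2 \<le> j" "j < b" for j
  proof -
    define j' where "j' = j - 1"
    have "j = Suc j'" "1 \<le> j'" using that(1) by (auto simp: j'_def)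
    thus ?thesis using B[of j'] bot[of j'] that(2) by simp
  qed
  have far: "e i j = 0" if ij: "i < a" "2 \<le> j" "j < b" for i j
  proof -
    consider "i = 0" | "i = a - 1" | "0 < i" "i < a - 1" using ij(1) by linarith
    thus ?thesis using top[of j] bot[of j] mid[of i j] ij by cases auto
  qed
  have rsum: "e i 0 + e i 1 = 0" if "i < a" for i
    using row[OF that] first_two[of "e i"] far[OF that] by simp
  have first: "e (a - 1 - k) 0 = 0" if "Suc k < a" for k
    using that
  proof (induction k)
    case 0
    thus ?case using rsum[of "a - 1"] bot[of 1] two by simp
  next
    case (Suc k)
    define i where "i = a - 1 - Suc k"
    have i: "1 \<le> i" "Suc i < a" "Suc i = a - 1 - k" using Suc.prems by (auto simp: i_def)
    have "e (Suc i) 0 = 0" using Suc i(3) by simp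
    hence "e i 1 = 0" using A[OF i(2)] by simp
    thus ?case using rsum[of i] i by (simp add: i_def)
  qed
  have left: "e i 0 = 0" if "i < a" for i
  proof (cases "i = 0")
    case True
    show ?thesis unfolding True by (rule S) (use two in \<open>auto simp: linked_def\<close>)
  next
    case False
    thus ?thesis using first[of "a - 1 - i"] that by simp
  qed
  have "e i j = 0" if "i < a" "j < b" for i j
  proof -
    consider "j = 0" | "j = 1" | "2 \<le> j" by linarith
    thus ?thesis using left[OF that(1)] rsum[OF that(1)] far[OF that(1) _ that(2)] by cases auto
  qed
  moreover have "\<delta> k = e (fst (\<kappa> k)) (snd (\<kappa> k))" using idx(3)[OF k] by (simp add: e_def)
  ultimately show ?thesis using kap_range[OF k] by simp
qed

text \<open>
  The same elimination, carried out with right-hand sides: \<open>\<tau> j\<close> is the amount carried across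
  the tie between the columns \<open>j\<close> and \<open>j + 1\<close>, and \<open>\<sigma> i\<close> the amount carried by the tie of the
  cell \<open>(i, 0)\<close>. The margins of the columns \<open>0\<close> and \<open>1\<close> come out right because the totals and
  the weights agree.
\<close>

lemma staircase_solve:
  fixes m m' :: "nat \<Rightarrow> int"
  assumes m: "(\<Sum>i<a. m i) = 0" and m': "(\<Sum>j<b. m' j) = 0"
    and w: "(\<Sum>i<a. m i * - int i) + (\<Sum>j<b. m' j * - int (stair a j)) = 0"
  shows "\<exists>\<delta> :: nat \<Rightarrow> int. balanced \<delta> \<and> (\<forall>i<a. rowsum \<delta> i = m i) \<and> (\<forall>j<b. colsum \<delta> j = m' j)"
proof -
  define \<tau> where "\<tau> j = - (\<Sum>l\<in>{Suc j..<b}. m' l)" for j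
  define T where "T = (\<Sum>j\<in>{1..<b}. \<tau> j)"
  define \<sigma> where "\<sigma> i = (\<Sum>i'\<in>{i..<a}. m i') - T" for i
  define D where "D c = (if snd c = 0 then (if 1 \<le> fst c then \<sigma> (fst c) else 0)
      else if snd c = 1 \<and> fst c < a - 1 then - \<sigma> (Suc (fst c))
      else if fst c = a - 1 then \<tau> (snd c) else if fst c = 0 then - \<tau> (snd c - 1) else 0)" for c :: "nat \<times> nat"
  have lk: "D c + D c' = 0" if "linked a c c'" "c \<in> {..<a} \<times> {..<b}" "c' \<in> {..<a} \<times> {..<b}" for c c'
    using that(1) unfolding linked_def
  proof (elim disjE conjE)
    assume "snd c = 0" "snd c' = 1" "fst c = Suc (fst c')"
    moreover have "fst c < a" using that(2) by auto
    ultimately show ?thesis by (simp add: D_def)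
  next
    assume "1 \<le> snd c" "snd c' = Suc (snd c)" "fst c = a - 1" "fst c' = 0"
    thus ?thesis using two by (simp add: D_def)
  qed
  have \<tau>b: "\<tau> (b - 1) = 0" using two by (simp add: \<tau>_def)
  have bal: "balanced (\<lambda>k. D (\<kappa> k))"
  proof (rule balancedI)
    fix c c' assume c: "c \<in> {..<a} \<times> {..<b}" "c' \<in> {..<a} \<times> {..<b}" "c \<noteq> c'" "zs c = zs c'"
    hence "linked a c c' \<or> linked a c' c" using partner by blast
    thus "D c + D c' = 0" using lk[of c c'] lk[of c' c] c by (auto simp: add.commute)
  next
    fix c assume c: "c \<in> {..<a} \<times> {..<b}" and alone: "\<And>c'. c' \<in> {..<a} \<times> {..<b} \<Longrightarrow> zs c' = zs c \<Longrightarrow> c' = c"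
    obtain i j where ij: "c = (i, j)" "i < a" "j < b" using c by auto
    have no: "\<not> linked a c c'" "\<not> linked a c' c" if "c' \<in> {..<a} \<times> {..<b}" for c'
      using alone[OF that] partner[OF that c] linked_irrefl[of c] by blast+
    consider "j = 0" | "j = 1" "i < a - 1" | "i = a - 1" "1 \<le> j" | "j \<noteq> 0" "\<not> (j = 1 \<and> i < a - 1)" "i \<noteq> a - 1" "i = 0"
      | "j \<noteq> 0" "\<not> (j = 1 \<and> i < a - 1)" "i \<noteq> a - 1" "i \<noteq> 0" by linarith
    thus "D c = 0"
    proof cases
      case 1
      have "\<not> 1 \<le> i"
      proof
        assume "1 \<le> i"
        then obtain i' where "i = Suc i'" by (cases i) auto
        thus False using no(1)[of "(i', 1)"] 1 ij two by (auto simp: linked_def)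
      qed
      thus ?thesis using 1 by (simp add: D_def ij)
    next
      case 2
      hence "Suc i < a" by linarith
      thus ?thesis using no(2)[of "(Suc i, 0)"] 2 ij two by (auto simp: linked_def)
    next
      case 3
      have "\<not> Suc j < b" using no(1)[of "(0, Suc j)"] 3 ij two by (auto simp: linked_def)
      hence "j = b - 1" using ij by simp
      thus ?thesis using 3 \<tau>b by (simp add: D_def ij)
    next
      case 4
      hence "1 \<le> j - 1" "j = Suc (j - 1)" "j - 1 < b" using two ij by linarith+
      thus ?thesis using no(2)[of "(a - 1, j - 1)"] 4 ij two by (simp add: linked_def)
    next
      case 5
      moreover have "j \<noteq> 1" using 5 ij(2) by linarith
      ultimately show ?thesis by (simp add: D_def ij)
    qed
  qed
  let ?\<delta> = "\<lambda>k. D (\<kappa> k)"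
  have row: "rowsum ?\<delta> i = (\<Sum>j<b. D (i, j))" if "i < a" for i
    using rowsum_idx[OF that, of ?\<delta>] idx(1)[OF that] by simp
  have colm: "colsum ?\<delta> j = (\<Sum>i<a. D (i, j))" if "j < b" for j
    using colsum_idx[OF that, of ?\<delta>] idx(1)[OF _ that] by simp
  have Tsplit: "T = \<tau> 1 + (\<Sum>j\<in>{2..<b}. \<tau> j)"
  proof -
    have "{1..<b} = insert 1 {2..<b}" using two by auto
    thus ?thesis by (simp add: T_def)
  qed
  have Tshift: "(\<Sum>j\<in>{2..<b}. \<tau> (j - 1)) = T"
  proof -
    have "(\<Sum>j\<in>{2..<b}. \<tau> (j - 1)) = (\<Sum>j\<in>{1..<b - 1}. \<tau> j)"
      by (rule sum.reindex_bij_witness[of _ Suc "\<lambda>j. j - 1"]) auto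
    moreover have "T = (\<Sum>j\<in>{1..<b - 1}. \<tau> j) + \<tau> (b - 1)"
    proof -
      have "{1..<b} = insert (b - 1) {1..<b - 1}" using two by auto
      thus ?thesis by (simp add: T_def)
    qed
    ultimately show ?thesis using \<tau>b by simp
  qed
  have \<sigma>step: "\<sigma> i = m i + \<sigma> (Suc i)" if "i < a" for i
    using that by (simp add: \<sigma>_def sum.atLeast_Suc_lessThan)
  have rows: "rowsum ?\<delta> i = m i" if i: "i < a" for i
  proof -
    have f2: "rowsum ?\<delta> i = D (i, 0) + (D (i, 1) + (\<Sum>j\<in>{2..<b}. D (i, j)))"
      unfolding row[OF i] by (rule first_two)
    consider "i = 0" | "0 < i" "i < a - 1" | "i = a - 1" using i by linarith
    thus ?thesis
    proof cases
      case 1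
      have "(\<Sum>j\<in>{2..<b}. D (0, j)) = (\<Sum>j\<in>{2..<b}. - \<tau> (j - 1))"
        by (rule sum.cong) (use two in \<open>auto simp: D_def\<close>)
      hence "rowsum ?\<delta> i = - \<sigma> 1 - T" using f2 1 two Tshift by (simp add: D_def sum_negf)
      also have "\<dots> = m 0"
      proof -
        have "(\<Sum>i<a. m i) = \<sigma> 0 + T" by (simp add: \<sigma>_def atLeast0LessThan)
        thus ?thesis using m \<sigma>step[of 0] two by simp
      qed
      finally show ?thesis using 1 by simp
    next
      case 2
      have "(\<Sum>j\<in>{2..<b}. D (i, j)) = 0" by (rule sum.neutral) (use 2 in \<open>auto simp: D_def\<close>)
      thus ?thesis using f2 2 \<sigma>step[OF i] by (simp add: D_def)
    next
      case 3
      have "(\<Sum>j\<in>{2..<b}. D (i, j)) = (\<Sum>j\<in>{2..<b}. \<tau> j)" by (rule sum.cong) (use 3 in \<open>auto simp: D_def\<close>)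
      hence "rowsum ?\<delta> i = \<sigma> i + T" using f2 3 two Tsplit by (simp add: D_def)
      thus ?thesis using \<sigma>step[OF i] 3 two by (simp add: \<sigma>_def)
    qed
  qed
  have cols2: "colsum ?\<delta> j = m' j" if j: "2 \<le> j" "j < b" for j
  proof -
    have "colsum ?\<delta> j = D (0, j) + D (a - 1, j)"
      unfolding colm[OF j(2)] by (rule two_term_sum) (use j in \<open>auto simp: D_def\<close>)
    also have "\<dots> = \<tau> j - \<tau> (j - 1)" using j two by (auto simp: D_def)
    also have "\<dots> = m' j"
      using j by (simp add: \<tau>_def sum.atLeast_Suc_lessThan)
    finally show ?thesis .
  qed
  \<comment> \<open>The errors in the columns \<open>0\<close> and \<open>1\<close>, weighted in two independent ways, sum to zero.\<close>
  define E where "E j = colsum ?\<delta> j - m' j" for j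
  have E2: "(\<Sum>j\<in>{2..<b}. E j * f j) = 0" for f :: "nat \<Rightarrow> int"
    by (rule sum.neutral) (simp add: E_def cols2)
  have "(\<Sum>j<b. colsum ?\<delta> j) = 0" using margin_totals(2)[of ?\<delta>] balanced_sum(2)[OF bal] by simp
  hence "(\<Sum>j<b. E j * 1) = 0" using m' by (simp add: E_def sum_subtractf)
  hence E01: "E 0 + E 1 = 0" using first_two[of "\<lambda>j. E j * 1"] E2[of "\<lambda>_. 1"] by simp
  have "(\<Sum>i<a. rowsum ?\<delta> i * - int i) + (\<Sum>j<b. colsum ?\<delta> j * - int (stair a j)) = 0"
    using sum_margins[of ?\<delta>] balanced_sum(1)[OF bal] by simp
  moreover have "(\<Sum>i<a. rowsum ?\<delta> i * - int i) = (\<Sum>i<a. m i * - int i)"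
    by (rule sum.cong) (simp_all add: rows)
  ultimately have "(\<Sum>j<b. colsum ?\<delta> j * - int (stair a j)) = (\<Sum>j<b. m' j * - int (stair a j))" using w by linarith
  hence "(\<Sum>j<b. E j * - int (stair a j)) = 0"
    by (simp add: E_def left_diff_distrib sum_subtractf sum_negf)
  hence "E 1 = 0" using first_two[of "\<lambda>j. E j * - int (stair a j)"] E2[of "\<lambda>j. - int (stair a j)"] by (simp add: stair_def)
  hence E: "E j = 0" if "j < b" for j
  proof -
    consider "j = 0" | "j = 1" | "2 \<le> j" by linarith
    thus ?thesis using E01 \<open>E 1 = 0\<close> cols2[OF _ that] by cases (auto simp: E_def)
  qed
  show ?thesis
    by (rule exI[of _ ?\<delta>]) (use bal rows E in \<open>auto simp: E_def\<close>)
qed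

sublocale facet_config a b "\<lambda>i. - int i" "\<lambda>j. - int (stair a j)" \<kappa>
  by unfold_locales (use staircase_unique staircase_solve two in blast)+

end

lemma single_row_config:
  "rigid_config 1 b (\<lambda>_. 0) (\<lambda>j. - int j) (\<lambda>k. (0, k))"
proof -
  have p: "pair_config 1 b (\<lambda>_. 0) (\<lambda>j. - int j) (\<lambda>k. (0, k))"
  proof unfold_locales
    show "bij_betw (\<lambda>k. (0::nat, k)) {..<1 * b} ({..<1} \<times> {..<b})"
      by (rule bij_betwI[where g = snd]) auto
  qed (auto simp: wt_def)
  interpret pair_config 1 b "\<lambda>_. 0" "\<lambda>j. - int j" "\<lambda>k. (0, k)" by (rule p)
  show ?thesis by unfold_locales (unfold balanced_def, auto simp: tie_def wt_def)
qed

lemma single_column_config: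
  "rigid_config a 1 (\<lambda>i. - int i) (\<lambda>_. 0) (\<lambda>k. (k, 0))"
proof -
  have p: "pair_config a 1 (\<lambda>i. - int i) (\<lambda>_. 0) (\<lambda>k. (k, 0))"
  proof unfold_locales
    show "bij_betw (\<lambda>k. (k, 0::nat)) {..<a * 1} ({..<a} \<times> {..<1})"
      by (rule bij_betwI[where g = fst]) auto
  qed (auto simp: wt_def)
  interpret pair_config a 1 "\<lambda>i. - int i" "\<lambda>_. 0" "\<lambda>k. (k, 0)" by (rule p)
  show ?thesis by unfold_locales (unfold balanced_def, auto simp: tie_def wt_def)
qed

section \<open>Existence of stable facets\<close>

lemma rowlen_single: "length q \<le> 1 \<Longrightarrow> rowlen q 0 = sum_list q"
  by (cases q) (auto simp: rowlen_def)

theorem corollary1: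
  assumes "CARD('c::{finite,linorder}) = CARD('a::{finite,linorder}) * CARD('b::{finite,linorder})"
  shows "\<exists>F :: ((real ^ 'c::{finite,linorder}) \<times> (real ^ 'a::{finite,linorder}) \<times> (real ^ 'b::{finite,linorder})) set.
           F facet_of PKron \<and> stable_face F"
proof -
  define a where "a = CARD('a)"
  define b where "b = CARD('b)"
  have cards: "CARD('c) = a * b" "CARD('a) = a" "CARD('b) = b" using assms by (simp_all add: a_def b_def)
  have pos: "0 < a" "0 < b" by (simp_all add: a_def b_def)
  consider "a = 1" | "b = 1" | "2 \<le> a" "2 \<le> b" using pos by linarith
  thus ?thesis
  proof cases
    case 1
    interpret rigid_config 1 b "\<lambda>_. 0" "\<lambda>j. - int j" "\<lambda>k. (0, k)" by (rule single_row_config)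
    show ?thesis
    proof (rule tie_free_facet)
      show "\<not> tie (1 * b) (wt (\<lambda>_. 0) (\<lambda>j. - int j)) (\<lambda>k. (0, k)) k" for k by (simp add: tie_def wt_def)
      fix p q r assume "(p, q, r) \<in> Kron 1 b"
      note K = KronD[OF this]
      have "p = r" using kronecker_trivial_middle[OF K(8-10) K(7)] K(5) by simp
      moreover have "sum_list q = sum_list p" using partitions_ofD(2)[OF K(9)] .
      moreover have single: "{k. k < 1 * b \<and> k = j} = {j}" if "j < b" for j using that by auto
      ultimately show "(\<forall>i<1. rowlen q i = rowsum (rowlen p) i) \<and> (\<forall>j<b. rowlen r j = colsum (rowlen p) j)"
        unfolding rowsum_def colsum_def using rowlen_single[of q] K(4,5) sum_rowlen[of p b] single by (auto simp: lessThan_def)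
    qed (use cards 1 in auto)
  next
    case 2
    interpret rigid_config a 1 "\<lambda>i. - int i" "\<lambda>_. 0" "\<lambda>k. (k, 0)" by (rule single_column_config)
    show ?thesis
    proof (rule tie_free_facet)
      show "\<not> tie (a * 1) (wt (\<lambda>i. - int i) (\<lambda>_. 0)) (\<lambda>k. (k, 0)) k" for k by (simp add: tie_def wt_def)
      fix p q r assume "(p, q, r) \<in> Kron a 1"
      note K = KronD[OF this]
      have "p = q" using kronecker_trivial_right[OF K(8-10) K(7)] K(6) by simp
      moreover have "sum_list r = sum_list p" using partitions_ofD(2)[OF K(10)] .
      ultimately show "(\<forall>i<a. rowlen q i = rowsum (rowlen p) i) \<and> (\<forall>j<1. rowlen r j = colsum (rowlen p) j)"
        unfolding rowsum_def colsum_def using rowlen_single[of r] K(4,6) sum_rowlen[of p a] by (auto simp: lessThan_def cong: conj_cong)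
    qed (use cards 2 in auto)
  next
    case 3
    have "card ({..<a} \<times> {..<b}) = a * b" by (simp add: card_cartesian_product)
    then obtain \<kappa> where "bij_betw \<kappa> {..<a * b} ({..<a} \<times> {..<b})"
        "\<forall>i j. i \<le> j \<longrightarrow> j < a * b \<longrightarrow> wt (\<lambda>i. - int i) (\<lambda>j. - int (stair a j)) (\<kappa> j) \<le> wt (\<lambda>i. - int i) (\<lambda>j. - int (stair a j)) (\<kappa> i)"
      using antitone_enumeration[of "{..<a} \<times> {..<b}" "wt (\<lambda>i. - int i) (\<lambda>j. - int (stair a j))"] by auto
    then interpret staircase a b \<kappa> using 3 by unfold_locales
    show ?thesis by (rule tied_facet[OF cards])
  qed
qed


end
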